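(* Let $\alpha\in\mathcal{B}$ and $\tau>0$, and let $\mathcal{M}_\varepsilon(\alpha)$ be the self-adjoint positive Maxwell operator described below. Then: (1) $\sigma_{ess}(\mathcal{M}_\varepsilon(\alpha))=[|\alpha|^2,+\infty)$; (2) for every $\tau>0$ and every $\alpha\ne0$, $\mu_1(\tau)<|\alpha|^2$, i.e. $\mathcal{M}_\varepsilon(\alpha)$ has a discrete eigenvalue below $|\alpha|^2$.
   Context: Lattice $\Lambda\subset\mathbb{R}^2$ with fundamental cell $Y$ of area 1, reciprocal lattice $\Lambda^*$, Brillouin zone $\mathcal{B}=\{\alpha:|\alpha|\le|\alpha-q|\ \forall q\in\Lambda^*\}$, $Y_\infty=Y\times\mathbb{R}$, $Y_h=Y\times[-h,h]$. A field is $\alpha$-quasi-periodic if $f(x+(\gamma,0))=e^{i\alpha\cdot\gamma}f(x)$ for $\gamma\in\Lambda$. Let $D\subset Y_h$ be a bounded open set with smooth boundary, and $\varepsilon=1+\tau\chi_D$ on $Y_\infty$ (extended quasi-periodically), $\tau>0$. Let $\mathbf{L}^2_\alpha(Y_\infty)$ be the space of $\alpha$-quasi-periodic fields that are square integrable on $Y_\infty$. Let $\mathbf{H}_\alpha(\varepsilon;\mathrm{div}0,Y_\infty)=\{f\in\mathbf{L}^2_\alpha(Y_\infty):\mathrm{div}(\varepsilon f)=0\}$ be the Hilbert space with inner product $(f,g)_{\varepsilon,Y_\infty}=\int_{Y_\infty}\varepsilon\bar f\cdot g$. The Maxwell operator $\mathcal{M}_\varepsilon(\alpha)E=\varepsilon^{-1}\nabla\times\nabla\times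 E$ acts on this space with domain $$\{E\in\mathbf{L}^2_\alpha(Y_\infty):\nabla\times E,\ \nabla\times\nabla\times E\in\mathbf{L}^2_\alpha(Y_\infty),\ \mathrm{div}(\varepsilon E)=0\};$$ it is self-adjoint and nonnegative. Set $$\mu_1(\tau)=\inf\Big\{\frac{(\nabla\times\varphi,\nabla\times\varphi)_{Y_\infty}}{(\varepsilon\varphi,\varphi)_{Y_\infty}}:\ 0\ne\varphi\in\mathrm{dom}(\mathcal{M}_\varepsilon(\alpha))\Big\},$$ where $(f,g)_U=\int_U\bar f\cdot g$. *)

theory Defs
  imports "HOL-Analysis.Analysis"
begin

text \<open>Points of R^3 are written as pairs (x', x3) with x' in R^2 (horizontal)
  and x3 in R (vertical). Fields are maps R^3 -> C^3.\<close>

type_synonym pt = "(real^2) \<times> real"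
type_synonym field = "pt \<Rightarrow> complex^3"

definition lat :: "real^2 \<Rightarrow> real^2 \<Rightarrow> (real^2) set" where
  "lat a1 a2 = {of_int m *\<^sub>R a1 + of_int n *\<^sub>R a2 | m n. True}"

definition rlat :: "real^2 \<Rightarrow> real^2 \<Rightarrow> (real^2) set" where
  "rlat a1 a2 = {q. \<forall>\<gamma>\<in>lat a1 a2. \<exists>k::int. q \<bullet> \<gamma> = 2 * pi * of_int k}"

definition cell :: "real^2 \<Rightarrow> real^2 \<Rightarrow> (real^2) set" where
  "cell a1 a2 = {s *\<^sub>R a1 + t *\<^sub>R a2 | s t. 0 \<le> s \<and> s < 1 \<and> 0 \<le> t \<and> t < 1}"

definition brillouin :: "real^2 \<Rightarrow> real^2 \<Rightarrow> (real^2) set" where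
  "brillouin a1 a2 = {\<alpha>. \<forall>q\<in>rlat a1 a2. norm \<alpha> \<le> norm (\<alpha> - q)}"

definition Yinf :: "real^2 \<Rightarrow> real^2 \<Rightarrow> pt set" where
  "Yinf a1 a2 = cell a1 a2 \<times> UNIV"

definition Yh :: "real^2 \<Rightarrow> real^2 \<Rightarrow> real \<Rightarrow> pt set" where
  "Yh a1 a2 h = cell a1 a2 \<times> {-h..h}"

definition dir :: "3 \<Rightarrow> pt" where
  "dir i = (if i = 1 then (axis 1 1, 0) else if i = 2 then (axis 2 1, 0) else (0, 1))"

definition pd :: "3 \<Rightarrow> (pt \<Rightarrow> real) \<Rightarrow> pt \<Rightarrow> real" where
  "pd i f x = frechet_derivative f (at x) (dir i)"

coinductive smooth_fun :: "(pt \<Rightarrow> real) \<Rightarrow> bool" where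
  "(\<forall>x. f differentiable (at x)) \<Longrightarrow> (\<forall>i. smooth_fun (pd i f)) \<Longrightarrow> smooth_fun f"

definition test_fun :: "(pt \<Rightarrow> real) \<Rightarrow> bool" where
  "test_fun \<phi> \<longleftrightarrow> smooth_fun \<phi> \<and> bounded {x. \<phi> x \<noteq> 0}"

definition smooth_boundary :: "pt set \<Rightarrow> bool" where
  "smooth_boundary D \<longleftrightarrow> (\<exists>\<rho>. smooth_fun \<rho> \<and> D = {x. \<rho> x < 0} \<and>
      (\<forall>x. \<rho> x = 0 \<longrightarrow> (\<exists>i. pd i \<rho> x \<noteq> 0)))"

definition eps :: "real^2 \<Rightarrow> real^2 \<Rightarrow> real \<Rightarrow> pt set \<Rightarrow> pt \<Rightarrow> real" where
  "eps a1 a2 \<tau> D p = 1 + \<tau> * (if \<exists>\<gamma>\<in>lat a1 a2. p - (\<gamma>, 0) \<in> D then 1 else 0)"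

definition L2q :: "real^2 \<Rightarrow> real^2 \<Rightarrow> real^2 \<Rightarrow> field \<Rightarrow> bool" where
  "L2q a1 a2 \<alpha> f \<longleftrightarrow> f \<in> borel_measurable lebesgue \<and>
     (\<forall>p. \<forall>\<gamma>\<in>lat a1 a2. f (p + (\<gamma>, 0)) = cis (\<alpha> \<bullet> \<gamma>) *s f p) \<and>
     integrable lebesgue (\<lambda>p. indicator (Yinf a1 a2) p * (norm (f p))\<^sup>2)"

definition nxt :: "3 \<Rightarrow> 3" where
  "nxt i = (if i = 1 then 2 else if i = 2 then 3 else 1)"

text \<open>g is the distributional curl of f:
  (curl f)_i = d_j f_k - d_k f_j with (i,j,k) cyclic.\<close>
definition is_curl :: "field \<Rightarrow> field \<Rightarrow> bool" where
  "is_curl f g \<longleftrightarrow> (\<forall>\<phi>. test_fun \<phi> \<longrightarrow> (\<forall>i.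
     integral\<^sup>L lebesgue (\<lambda>p. g p $ i * complex_of_real (\<phi> p)) =
     integral\<^sup>L lebesgue (\<lambda>p. f p $ nxt i * complex_of_real (pd (nxt (nxt i)) \<phi> p)
                              - f p $ nxt (nxt i) * complex_of_real (pd (nxt i) \<phi> p))))"

definition div_free :: "(pt \<Rightarrow> real) \<Rightarrow> field \<Rightarrow> bool" where
  "div_free w f \<longleftrightarrow> (\<forall>\<phi>. test_fun \<phi> \<longrightarrow>
     integral\<^sup>L lebesgue (\<lambda>p. complex_of_real (w p) * (\<Sum>i\<in>UNIV. f p $ i * complex_of_real (pd i \<phi> p))) = 0)"

definition aeq :: "field \<Rightarrow> field \<Rightarrow> bool" where
  "aeq f g \<longleftrightarrow> (AE p in lebesgue. f p = g p)"

definition inH :: "real^2 \<Rightarrow> real^2 \<Rightarrow> real^2 \<Rightarrow> real \<Rightarrow> pt set \<Rightarrow> field \<Rightarrow> bool" where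
  "inH a1 a2 \<alpha> \<tau> D f \<longleftrightarrow> L2q a1 a2 \<alpha> f \<and> div_free (eps a1 a2 \<tau> D) f"

definition Hnorm :: "real^2 \<Rightarrow> real^2 \<Rightarrow> real \<Rightarrow> pt set \<Rightarrow> field \<Rightarrow> real" where
  "Hnorm a1 a2 \<tau> D f = sqrt (integral\<^sup>L lebesgue
      (\<lambda>p. indicator (Yinf a1 a2) p * eps a1 a2 \<tau> D p * (norm (f p))\<^sup>2))"

definition domM :: "real^2 \<Rightarrow> real^2 \<Rightarrow> real^2 \<Rightarrow> real \<Rightarrow> pt set \<Rightarrow> field \<Rightarrow> bool" where
  "domM a1 a2 \<alpha> \<tau> D E \<longleftrightarrow> L2q a1 a2 \<alpha> E \<and>
     (\<exists>g h. L2q a1 a2 \<alpha> g \<and> is_curl E g \<and> L2q a1 a2 \<alpha> h \<and> is_curl g h) \<and>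
     div_free (eps a1 a2 \<tau> D) E"

text \<open>Graph of M_eps(alpha): MM E F means E in the domain and
  F = eps^{-1} curl curl E (as a representative).\<close>
definition MM :: "real^2 \<Rightarrow> real^2 \<Rightarrow> real^2 \<Rightarrow> real \<Rightarrow> pt set \<Rightarrow> field \<Rightarrow> field \<Rightarrow> bool" where
  "MM a1 a2 \<alpha> \<tau> D E F \<longleftrightarrow> domM a1 a2 \<alpha> \<tau> D E \<and>
     (\<exists>g h. L2q a1 a2 \<alpha> g \<and> is_curl E g \<and> L2q a1 a2 \<alpha> h \<and> is_curl g h \<and>
        (\<forall>p. F p = complex_of_real (1 / eps a1 a2 \<tau> D p) *s h p))"

definition resolvent_set :: "real^2 \<Rightarrow> real^2 \<Rightarrow> real^2 \<Rightarrow> real \<Rightarrow> pt set \<Rightarrow> complex set" where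
  "resolvent_set a1 a2 \<alpha> \<tau> D = {z.
     (\<forall>g. inH a1 a2 \<alpha> \<tau> D g \<longrightarrow>
        (\<exists>E F. MM a1 a2 \<alpha> \<tau> D E F \<and> aeq (\<lambda>p. F p - z *s E p) g)) \<and>
     (\<forall>E1 F1 E2 F2. MM a1 a2 \<alpha> \<tau> D E1 F1 \<and> MM a1 a2 \<alpha> \<tau> D E2 F2 \<and>
        aeq (\<lambda>p. F1 p - z *s E1 p) (\<lambda>p. F2 p - z *s E2 p) \<longrightarrow> aeq E1 E2) \<and>
     (\<exists>C. \<forall>E F. MM a1 a2 \<alpha> \<tau> D E F \<longrightarrow>
        Hnorm a1 a2 \<tau> D E \<le> C * Hnorm a1 a2 \<tau> D (\<lambda>p. F p - z *s E p))}"

definition spec :: "real^2 \<Rightarrow> real^2 \<Rightarrow> real^2 \<Rightarrow> real \<Rightarrow> pt set \<Rightarrow> complex set" where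
  "spec a1 a2 \<alpha> \<tau> D = - resolvent_set a1 a2 \<alpha> \<tau> D"

definition is_eigenvalue :: "real^2 \<Rightarrow> real^2 \<Rightarrow> real^2 \<Rightarrow> real \<Rightarrow> pt set \<Rightarrow> complex \<Rightarrow> bool" where
  "is_eigenvalue a1 a2 \<alpha> \<tau> D z \<longleftrightarrow>
     (\<exists>E F. MM a1 a2 \<alpha> \<tau> D E F \<and> \<not> aeq E (\<lambda>_. 0) \<and> aeq F (\<lambda>p. z *s E p))"

definition finite_mult :: "real^2 \<Rightarrow> real^2 \<Rightarrow> real^2 \<Rightarrow> real \<Rightarrow> pt set \<Rightarrow> complex \<Rightarrow> bool" where
  "finite_mult a1 a2 \<alpha> \<tau> D z \<longleftrightarrow> (\<exists>N::nat. \<forall>Es Fs. (\<forall>k\<le>N. MM a1 a2 \<alpha> \<tau> D (Es k) (Fs k) \<and>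
        aeq (Fs k) (\<lambda>p. z *s Es k p)) \<longrightarrow>
      (\<exists>c::nat \<Rightarrow> complex. (\<exists>k\<le>N. c k \<noteq> 0) \<and> aeq (\<lambda>p. \<Sum>k\<le>N. c k *s Es k p) (\<lambda>_. 0)))"

definition disc_spec :: "real^2 \<Rightarrow> real^2 \<Rightarrow> real^2 \<Rightarrow> real \<Rightarrow> pt set \<Rightarrow> complex set" where
  "disc_spec a1 a2 \<alpha> \<tau> D = {z \<in> spec a1 a2 \<alpha> \<tau> D.
     (\<exists>e>0. ball z e \<inter> spec a1 a2 \<alpha> \<tau> D = {z}) \<and>
     is_eigenvalue a1 a2 \<alpha> \<tau> D z \<and> finite_mult a1 a2 \<alpha> \<tau> D z}"

definition ess_spec :: "real^2 \<Rightarrow> real^2 \<Rightarrow> real^2 \<Rightarrow> real \<Rightarrow> pt set \<Rightarrow> complex set" where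
  "ess_spec a1 a2 \<alpha> \<tau> D = spec a1 a2 \<alpha> \<tau> D - disc_spec a1 a2 \<alpha> \<tau> D"

definition mu1 :: "real^2 \<Rightarrow> real^2 \<Rightarrow> real^2 \<Rightarrow> real \<Rightarrow> pt set \<Rightarrow> real" where
  "mu1 a1 a2 \<alpha> \<tau> D = Inf {q. \<exists>\<phi> g. domM a1 a2 \<alpha> \<tau> D \<phi> \<and> \<not> aeq \<phi> (\<lambda>_. 0) \<and>
      L2q a1 a2 \<alpha> g \<and> is_curl \<phi> g \<and>
      q = integral\<^sup>L lebesgue (\<lambda>p. indicator (Yinf a1 a2) p * (norm (g p))\<^sup>2) /
          integral\<^sup>L lebesgue (\<lambda>p. indicator (Yinf a1 a2) p * eps a1 a2 \<tau> D p * (norm (\<phi> p))\<^sup>2)}"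

end

theory Submission
  imports Defs "HOL-Library.Function_Algebras" "HOL-Real_Asymp.Real_Asymp"
begin

text \<open>The curl is diagonalized by Fourier series on slabs of the cell. After truncation in the vertical direction,
  Parseval's identity gives the symmetry of the weak curl, the lower bound
  \<open>\<parallel>curl u\<parallel>\<^sup>2 >= |\<alpha>|\<^sup>2 \<parallel>u\<parallel>\<^sup>2\<close> for divergence-free \<open>u\<close> (by the definition of the Brillouin zone every
  wave vector has length at least \<open>|\<alpha>|\<close>), and a Rellich estimate near the inclusion. A field with
  \<open>div (\<epsilon> E) = 0\<close> differs from its divergence-free part by a curl-free field, and its weighted
  energy exceeds that of the divergence-free part only by a term living on the inclusion. So below \<open>|\<alpha>|\<^sup>2\<close> the operator
  is bounded below up to finitely many functionals, and the spectrum there consists of isolated eigenvalues of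
  finite multiplicity. Slowly modulated plane waves far from the inclusion are Weyl sequences for
  every point of \<open>[|\<alpha>|\<^sup>2, \<infinity>)\<close>. Projecting a slowly cut off wave of frequency \<open>|\<alpha>|\<^sup>2\<close> to
  \<open>div (\<epsilon> E) = 0\<close> keeps its curl and raises its weighted norm by a fixed amount, so its Rayleigh
  quotient drops below \<open>|\<alpha>|\<^sup>2\<close>; the infimum of the Rayleigh quotients is always in the spectrum.\<close>

text \<open>Fields are functions, not classes, so all inner products are only semidefinite; null
  vectors are handled by Cauchy--Schwarz instead of a quotient. The products are real parts, with
  complex scalars acting as operators, so Hilbert space theory is needed over the reals only. The
  obstacle is that the problem lives in div (\<epsilon> E) = 0, while the Fourier lower bound is
  available only in div u = 0. The bridge: \<epsilon> E is itself divergence-free, hence orthogonal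
  to the difference of \<open>E\<close> and its unweighted projection \<open>u\<close>, so the
  weighted energy of \<open>E\<close> is a pairing with \<open>u\<close>. No spectral theorem is
  invoked. Surjectivity of M - z follows from lower bounds at z and at its conjugate, combined with
  the solvability of (M + 1) E = f. The gain in the Rayleigh quotient is a duality: if
  \<open>E\<close> is the weighted projection of a divergence-free \<open>E0\<close>, testing with
  E0 / \<epsilon> gives (\<epsilon> E, E) >= 2 (E0, E0) - (E0 / \<epsilon>, E0), which exceeds (E0,
  E0) by an amount carried by the inclusion.\<close>

instantiation "fun" :: (type, real_vector) real_vector
begin

definition "r *\<^sub>R f = (\<lambda>x. r *\<^sub>R f x)"

instance
  by standard (simp_all add: fun_eq_iff scaleR_fun_def scaleR_add_right scaleR_add_left)

end

lemma scaleR_fun_apply [simp]: "(r *\<^sub>R f) x = r *\<^sub>R f x"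
  by (simp add: scaleR_fun_def)

lemma sum_fun_apply [simp]: "(\<Sum>i\<in>A. f i) x = (\<Sum>i\<in>A. f i x)"
  by (induction A rule: infinite_finite_induct) auto

abbreviation Lmeas :: "('a::euclidean_space => 'b::topological_space) set" where "Lmeas \<equiv> borel_measurable lebesgue"
abbreviation Lint :: "('a::euclidean_space => 'b::{banach, second_countable_topology}) => bool" where "Lint \<equiv> integrable lebesgue"
abbreviation Lebint :: "('a::euclidean_space => 'b::{banach, second_countable_topology}) => 'b" (binder "LI " 10)
  where "Lebint f \<equiv> integral\<^sup>L lebesgue f"

abbreviation tends :: "(nat => 'a::topological_space) => 'a => bool" (infix "~~>" 60) where "X ~~> L \<equiv> X \<longlonglongrightarrow> L"

lemmas int_cong = Bochner_Integration.integral_cong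
lemmas int_diff = Bochner_Integration.integral_diff
lemmas int_add = Bochner_Integration.integral_add
lemmas Lint_add = Bochner_Integration.integrable_add
lemmas Lint_diff = Bochner_Integration.integrable_diff
lemmas int_sum = Bochner_Integration.integral_sum
lemmas Lint_bound = Bochner_Integration.integrable_bound

section \<open>Semi-inner product spaces\<close>

text \<open>Semidefinite, because a field vanishing almost everywhere need not be the zero function.
  The carrier \<open>H\<close> is a set, so that one theory serves the whole field space, the fields
  living on a slab, and pairs of fields.\<close>

locale semi_ip =
  fixes H :: "'a::real_vector set" and ip :: "'a => 'a => real"
  assumes sub: "subspace H"
    and sym: "x \<in> H ==> y \<in> H ==> ip x y = ip y x"
    and add_left: "x \<in> H ==> y \<in> H ==> z \<in> H ==> ip (x + y) z = ip x z + ip y z"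
    and scale_left: "x \<in> H ==> y \<in> H ==> ip (c *\<^sub>R x) y = c * ip x y"
    and nonneg: "x \<in> H ==> 0 <= ip x x"
begin

definition "nm x = sqrt (ip x x)"

text \<open>The limit is asked for only up to a vector of length 0, the natural notion when limits
  are not unique.\<close>

definition "complete_in S \<longleftrightarrow> (\<forall>X. (\<forall>n::nat. X n \<in> S) &
    (\<forall>e>0. \<exists>N. \<forall>m\<ge>N. \<forall>n\<ge>N. nm (X m - X n) < e) --> (\<exists>y\<in>S. (\<lambda>n. nm (X n - y)) ~~> 0))"

lemma mem [intro, simp]:
  "x \<in> H ==> y \<in> H ==> x + y \<in> H" "x \<in> H ==> y \<in> H ==> x - y \<in> H"
  "x \<in> H ==> c *\<^sub>R x \<in> H" "0 \<in> H" "x \<in> H ==> - x \<in> H"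
  using sub by (auto simp: subspace_add subspace_diff subspace_scale subspace_0 subspace_neg)

lemma mem_sum [intro]: "(!!i. i \<in> A ==> f i \<in> H) ==> sum f A \<in> H"
  using sub by (rule subspace_sum)

lemma add_right: "x \<in> H ==> y \<in> H ==> z \<in> H ==> ip z (x + y) = ip z x + ip z y"
  by (metis add_left mem(1) sym)

lemma scale_right: "x \<in> H ==> y \<in> H ==> ip y (c *\<^sub>R x) = c * ip y x"
  by (metis scale_left mem(3) sym)

lemma diff_left: "x \<in> H ==> y \<in> H ==> z \<in> H ==> ip (x - y) z = ip x z - ip y z"
  using add_left[of x "(-1) *\<^sub>R y" z] scale_left[of y z "-1"] mem(3)[of y "-1"] by simp

lemma diff_right: "x \<in> H ==> y \<in> H ==> z \<in> H ==> ip z (x - y) = ip z x - ip z y"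
  by (metis diff_left mem(2) sym)

lemma zero_left [simp]: "x \<in> H ==> ip 0 x = 0"
  using scale_left[of x x 0] by simp

lemma zero_right [simp]: "x \<in> H ==> ip x 0 = 0"
  using scale_right[of x x 0] by simp

lemma sum_left: "finite A ==> (!!i. i \<in> A ==> f i \<in> H) ==> x \<in> H ==> ip (sum f A) x = (\<Sum>i\<in>A. ip (f i) x)"
  by (induction A rule: finite_induct) (auto simp: add_left mem_sum)

lemma sum_right: "finite A ==> (!!i. i \<in> A ==> f i \<in> H) ==> x \<in> H ==> ip x (sum f A) = (\<Sum>i\<in>A. ip x (f i))"
  by (induction A rule: finite_induct) (auto simp: add_right mem_sum)

lemmas bilin = add_left add_right diff_left diff_right scale_left scale_right

lemma nm_nonneg [simp]: "x \<in> H ==> 0 <= nm x"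
  by (simp add: nm_def nonneg)

lemma nm_sq: "x \<in> H ==> (nm x)\<^sup>2 = ip x x"
  by (simp add: nm_def nonneg)

lemma quad:
  assumes "x \<in> H" "y \<in> H"
  shows "ip (x + t *\<^sub>R y) (x + t *\<^sub>R y) = ip x x + 2 * t * ip x y + t\<^sup>2 * ip y y"
  using assms sym[of x y] by (simp add: bilin power2_eq_square algebra_simps)

text \<open>The discriminant criterion, kept free of \<open>ip\<close> because it is also applied to
  the quadratic form of M - \<mu>. The degenerate leading coefficient 0 has to be covered: a linear
  function bounded below is constant.\<close>

lemma quad_nonneg_imp:
  fixes a b c :: real
  assumes "!!t. 0 <= a + 2 * t * b + t\<^sup>2 * c" "0 <= c"
  shows "b\<^sup>2 <= a * c"
proof (cases "c = 0")
  case True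
  have "b = 0"
  proof (rule ccontr)
    assume "b ~= 0"
    then have "a + 2 * (- (a + 1) / (2 * b)) * b = - 1" by (simp add: field_simps)
    then show False using assms(1)[of "- (a + 1) / (2 * b)"] True by simp
  qed
  then show ?thesis using True by simp
next
  case False
  then have "c > 0" using assms(2) by simp
  have "0 <= a + 2 * (- b / c) * b + (- b / c)\<^sup>2 * c" by (rule assms(1))
  also have "\<dots> = a - b\<^sup>2 / c" using \<open>c > 0\<close> by (simp add: field_simps power2_eq_square)
  finally show ?thesis using \<open>c > 0\<close> by (simp add: field_simps)
qed

lemma CS: "x \<in> H ==> y \<in> H ==> (ip x y)\<^sup>2 <= ip x x * ip y y"
  by (rule quad_nonneg_imp) (use quad[of x y] nonneg[of y] nonneg[of "x + _ *\<^sub>R y"] in \<open>auto\<close>)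

lemma CS_abs: "x \<in> H ==> y \<in> H ==> \<bar>ip x y\<bar> <= nm x * nm y"
  using CS[of x y] by (simp add: nm_def flip: real_sqrt_mult) (metis real_sqrt_abs real_sqrt_le_mono)

lemma triangle: "x \<in> H ==> y \<in> H ==> nm (x + y) <= nm x + nm y"
proof -
  assume xy: "x \<in> H" "y \<in> H"
  have "(nm (x + y))\<^sup>2 <= (nm x + nm y)\<^sup>2"
  proof -
    have "(nm (x + y))\<^sup>2 = (nm x)\<^sup>2 + 2 * ip x y + (nm y)\<^sup>2"
      using quad[OF xy, of 1] nm_sq[OF xy(1)] nm_sq[OF xy(2)] nm_sq[of "x + y"] xy by simp
    then show ?thesis using CS_abs[OF xy] unfolding power2_sum by linarith
  qed
  then show ?thesis by (rule power2_le_imp_le) (use xy in simp)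
qed

lemma nm_scale: "x \<in> H ==> nm (c *\<^sub>R x) = \<bar>c\<bar> * nm x"
proof -
  assume "x \<in> H"
  then have "ip (c *\<^sub>R x) (c *\<^sub>R x) = c\<^sup>2 * ip x x" by (simp add: bilin power2_eq_square)
  then show ?thesis by (simp add: nm_def real_sqrt_mult)
qed

lemma nm_minus: "x \<in> H ==> y \<in> H ==> nm (x - y) = nm (y - x)"
  using nm_scale[of "x - y" "-1"] by simp

lemma triangle_sub: "x \<in> H ==> y \<in> H ==> nm (x - y) <= nm x + nm y"
  using triangle[of x "(-1) *\<^sub>R y"] nm_scale[of y "-1"] mem(3)[of y "-1"] by simp

lemma triangle3: "x \<in> H ==> y \<in> H ==> z \<in> H ==> nm (x - z) <= nm (x - y) + nm (y - z)"
  using triangle[of "x - y" "y - z"] by simp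

text \<open>Cauchy--Schwarz with one factor 0. This replaces working modulo null vectors: a null
  difference may be dropped from any pairing.\<close>

lemma zero_nm_imp: "x \<in> H ==> y \<in> H ==> ip x x = 0 ==> ip x y = 0"
  using CS[of x y] by simp

lemma lim_ip:
  assumes "!!n. X n \<in> H" "x \<in> H" "y \<in> H" "(\<lambda>n. nm (X n - x)) ~~> 0"
  shows "(\<lambda>n. ip (X n) y) ~~> ip x y"
proof -
  have "(\<lambda>n. nm (X n - x) * nm y) ~~> 0" using tendsto_mult_left_zero[OF assms(4)] .
  moreover have "\<bar>ip (X n) y - ip x y\<bar> <= nm (X n - x) * nm y" for n
    using CS_abs[of "X n - x" y] assms by (simp add: bilin)
  ultimately have "(\<lambda>n. ip (X n) y - ip x y) ~~> 0"
    by (rule_tac Lim_null_comparison[of _ "\<lambda>n. nm (X n - x) * nm y"]) auto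
  then show ?thesis by (simp add: LIM_zero_iff)
qed

lemma lim_nm:
  assumes "!!n. X n \<in> H" "x \<in> H" "(\<lambda>n. nm (X n - x)) ~~> 0"
  shows "(\<lambda>n. nm (X n)) ~~> nm x"
proof -
  have "\<bar>nm (X n) - nm x\<bar> <= nm (X n - x)" for n
    using triangle[of "X n - x" x] triangle_sub[of "X n" "X n - x"] assms by (auto simp: abs_le_iff)
  then have "(\<lambda>n. nm (X n) - nm x) ~~> 0"
    by (rule_tac Lim_null_comparison[of _ "\<lambda>n. nm (X n - x)"]) (auto simp: assms)
  then show ?thesis by (simp add: LIM_zero_iff)
qed

lemma lim_imp_Cauchy:
  assumes "!!n. X n \<in> H" "x \<in> H" "(\<lambda>n. nm (X n - x)) ~~> 0" "e > 0"
  shows "\<exists>N. \<forall>m\<ge>N. \<forall>n\<ge>N. nm (X m - X n) < e"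
proof -
  obtain N where N: "!!n. n >= N ==> nm (X n - x) < e/2"
    using assms(3,4) LIMSEQ_D[OF assms(3), of "e/2"] by (auto simp: assms)
  have "nm (X m - X n) < e" if "m >= N" "n >= N" for m n
    using N[OF that(1)] N[OF that(2)] triangle3[of "X m" x "X n"] nm_minus[of x "X n"] assms by auto
  then show ?thesis by blast
qed

text \<open>A minimizing sequence for the distance is Cauchy by the parallelogram law, and the first
  variation at its limit vanishes. The point \<open>y\<close> is determined only up to null vectors,
  so nothing is claimed about uniqueness.\<close>

lemma projection:
  assumes S: "subspace S" "S \<subseteq> H" "complete_in S" and x: "x \<in> H"
  shows "\<exists>y\<in>S. \<forall>s\<in>S. ip (x - y) s = 0"
proof -
  define Q where "Q v = ip v v" for v
  define d where "d = Inf ((\<lambda>s. Q (x - s)) ` S)"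
  have S0: "0 \<in> S" using S(1) by (rule subspace_0)
  have bdd: "bdd_below ((\<lambda>s. Q (x - s)) ` S)"
    by (rule bdd_belowI[of _ 0]) (use S(2) x in \<open>auto simp: Q_def intro!: nonneg\<close>)
  have dle: "d <= Q (x - s)" if "s \<in> S" for s
    unfolding d_def using bdd that by (auto intro: cInf_lower)
  have "\<exists>s\<in>S. Q (x - s) < d + 1 / Suc n" for n
  proof -
    have "\<exists>v\<in>(\<lambda>s. Q (x - s)) ` S. v < d + 1 / Suc n"
      by (rule cInf_lessD) (use S0 in \<open>auto simp: d_def\<close>)
    then show ?thesis by auto
  qed
  then obtain s where s: "!!n. s n \<in> S" "!!n. Q (x - s n) < d + 1 / Suc n" by metis
  have sH: "s n \<in> H" for n using s S by auto
  have par: "Q (s m - s n) <= 2 / Suc m + 2 / Suc n" for m n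
  proof -
    \<comment> \<open>The midpoint stays in \<open>S\<close>, so its squared distance from
      \<open>x\<close> is at least \<open>d\<close>; the parallelogram law then bounds the gap
      between \<open>s m\<close> and \<open>s n\<close>.\<close>
    have mid: "(1/2) *\<^sub>R (s m + s n) \<in> S" using s S(1) by (simp add: subspace_add subspace_scale)
    have "Q (s m - s n) = 2 * Q (x - s m) + 2 * Q (x - s n) - 4 * Q (x - (1/2) *\<^sub>R (s m + s n))"
      using sH[of m] sH[of n] x sym[of x "s m"] sym[of x "s n"] sym[of "s m" "s n"] unfolding Q_def
      by (simp add: bilin algebra_simps)
    then have "Q (s m - s n) <= 2 * (d + 1 / Suc m) + 2 * (d + 1 / Suc n) - 4 * d"
      using dle[OF mid] add_strict_mono[OF s(2)[of m] s(2)[of n]] by (smt (verit))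
    then show ?thesis by simp
  qed
  have "\<exists>N. \<forall>m\<ge>N. \<forall>n\<ge>N. nm (s m - s n) < e" if "e > 0" for e
  proof -
    have "(\<lambda>n. 4 / Suc n) ~~> 0" by real_asymp
    then have "\<forall>\<^sub>F n in sequentially. 4 / Suc n < e\<^sup>2"
      by (rule order_tendstoD(2)) (use that in simp)
    then obtain N where N: "!!n. n >= N ==> 4 / Suc n < e\<^sup>2"
      unfolding eventually_sequentially by blast
    have "nm (s m - s n) < e" if mn: "m >= N" "n >= N" for m n
    proof -
      have "(nm (s m - s n))\<^sup>2 < e\<^sup>2" using par[of m n] N[OF mn(1)] N[OF mn(2)] sH by (simp add: nm_sq Q_def)
      then show ?thesis using \<open>e > 0\<close> by (simp add: power_less_imp_less_base)
    qed
    then show ?thesis by blast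
  qed
  then obtain y where y: "y \<in> S" "(\<lambda>n. nm (s n - y)) ~~> 0"
    using S(3) s(1) unfolding complete_in_def by blast
  have yH: "y \<in> H" using y S by auto
  have "(\<lambda>n. nm (x - s n)) ~~> nm (x - y)"
    by (rule lim_nm) (use sH x yH y(2) in \<open>auto simp: nm_minus\<close>)
  then have "(\<lambda>n. (nm (x - s n))\<^sup>2) ~~> (nm (x - y))\<^sup>2" by (intro tendsto_intros)
  then have "(\<lambda>n. Q (x - s n)) ~~> Q (x - y)" using x sH yH by (simp add: nm_sq Q_def)
  moreover have "(\<lambda>n. d + 1 / Suc n) ~~> d" by real_asymp
  ultimately have dmin: "Q (x - y) <= d"
    using s(2) by (meson LIMSEQ_le less_imp_le)
  have "ip (x - y) t = 0" if t: "t \<in> S" for t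
  proof -
    have tH: "t \<in> H" using t S by auto
    \<comment> \<open>Since \<open>Q (x - y)\<close> is the minimum \<open>d\<close>, the quadratic
      in \<open>r\<close> has constant term 0, and so its linear coefficient must vanish.\<close>
    have "0 <= 0 + 2 * r * ip (x - y) t + r\<^sup>2 * ip t t" for r
    proof -
      have "d <= Q (x - (y + (- r) *\<^sub>R t))" using dle y(1) t S(1) by (meson subspace_add subspace_scale)
      also have "x - (y + (- r) *\<^sub>R t) = (x - y) + r *\<^sub>R t" by (simp add: algebra_simps)
      also have "Q \<dots> = Q (x - y) + 2 * r * ip (x - y) t + r\<^sup>2 * ip t t"
        unfolding Q_def using x yH tH by (intro quad) auto
      finally show ?thesis using dmin by simp
    qed
    then have "(ip (x - y) t)\<^sup>2 <= 0 * ip t t" using tH nonneg by (intro quad_nonneg_imp) auto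
    then show ?thesis by simp
  qed
  then show ?thesis using y(1) by blast
qed

text \<open>The approximable vectors form a complete subspace; projecting onto it reduces Parseval's
  identity to the totality of the orthonormal family.\<close>

lemma parseval:
  assumes comp: "complete_in H" and b: "!!i. i \<in> I ==> b i \<in> H"
    and on: "!!i j. i \<in> I ==> j \<in> I ==> ip (b i) (b j) = (if i = j then 1 else 0)"
    and total: "!!y. y \<in> H ==> (!!i. i \<in> I ==> ip y (b i) = 0) ==> ip y y = 0"
    and x: "x \<in> H"
  shows "((\<lambda>i. (ip x (b i))\<^sup>2) has_sum ip x x) I"
proof -
  \<comment> \<open>Pythagoras: the squared distance to a finite combination is the Bessel remainder
    plus the squared errors of the coefficients.\<close>
  have best: "ip (x - (\<Sum>i\<in>F. c i *\<^sub>R b i)) (x - (\<Sum>i\<in>F. c i *\<^sub>R b i))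
      = ip x x - (\<Sum>i\<in>F. (ip x (b i))\<^sup>2) + (\<Sum>i\<in>F. (c i - ip x (b i))\<^sup>2)"
    if F: "finite F" "F \<subseteq> I" and x: "x \<in> H" for F c x
  proof -
    let ?p = "\<Sum>i\<in>F. c i *\<^sub>R b i"
    have cb: "c i *\<^sub>R b i \<in> H" if "i \<in> F" for i using that F b by auto
    have pH: "?p \<in> H" using cb by (rule mem_sum)
    have 1: "ip x ?p = (\<Sum>i\<in>F. c i * ip x (b i))"
      using F b x cb by (simp add: sum_right scale_right subset_iff)
    have 2: "ip (b j) ?p = c j" if j: "j \<in> F" for j
    proof -
      have "ip (b j) ?p = (\<Sum>i\<in>F. c i * ip (b j) (b i))"
        using F b cb j by (simp add: sum_right scale_right subset_iff)
      also have "\<dots> = (\<Sum>i\<in>F. if j = i then c i else 0)"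
        using F(2) j on by (intro sum.cong) (auto simp: subset_iff)
      finally show ?thesis using j F by simp
    qed
    have 3: "ip ?p ?p = (\<Sum>i\<in>F. (c i)\<^sup>2)"
    proof -
      have "ip ?p ?p = (\<Sum>i\<in>F. c i * ip (b i) ?p)"
        using F b cb pH by (simp add: sum_left scale_left subset_iff)
      then show ?thesis using 2 by (simp add: power2_eq_square)
    qed
    have e0: "ip (x - ?p) (x - ?p) = ip x x - 2 * ip x ?p + ip ?p ?p"
      using x pH sym[of x ?p] by (simp add: bilin)
    have "(\<Sum>i\<in>F. (c i - ip x (b i))\<^sup>2)
        = (\<Sum>i\<in>F. (c i)\<^sup>2) + (\<Sum>i\<in>F. (ip x (b i))\<^sup>2) - 2 * (\<Sum>i\<in>F. c i * ip x (b i))"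
      by (simp add: power2_diff sum.distrib sum_subtractf sum_distrib_left mult.assoc)
    then show ?thesis unfolding e0 1 3 by simp
  qed
  have rep: "\<exists>F c. finite F & F \<subseteq> I & p = (\<Sum>i\<in>F. c i *\<^sub>R b i)" if "p \<in> span (b ` I)" for p
    using that
  proof (induction rule: span_induct_alt)
    case base
    show ?case by (rule exI[of _ "{}"]) auto
  next
    case (step r v p)
    obtain F c where F: "finite F" "F \<subseteq> I" "p = (\<Sum>i\<in>F. c i *\<^sub>R b i)" using step.IH by blast
    obtain j where j: "j \<in> I" "v = b j" using step.hyps by blast
    \<comment> \<open>The index \<open>j\<close> may already occur in \<open>F\<close>, so its
      coefficients are added up rather than appended.\<close>
    let ?k = "\<lambda>i. (if i = j then r else 0) + (if i \<in> F then c i else 0)"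
    have "(\<Sum>i\<in>insert j F. ?k i *\<^sub>R b i) = (\<Sum>i\<in>insert j F. (if i = j then r else 0) *\<^sub>R b i)
        + (\<Sum>i\<in>insert j F. (if i \<in> F then c i else 0) *\<^sub>R b i)"
      by (simp only: scaleR_add_left sum.distrib)
    also have "(\<Sum>i\<in>insert j F. (if i = j then r else 0) *\<^sub>R b i) = (\<Sum>i\<in>{j}. r *\<^sub>R b i)"
      using F(1) by (intro sum.mono_neutral_cong_right) auto
    also have "(\<Sum>i\<in>insert j F. (if i \<in> F then c i else 0) *\<^sub>R b i) = (\<Sum>i\<in>F. c i *\<^sub>R b i)"
      using F(1) by (intro sum.mono_neutral_cong_right) auto
    finally have "r *\<^sub>R v + p = (\<Sum>i\<in>insert j F. ?k i *\<^sub>R b i)" using F(3) j(2) by simp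
    then show ?case using F(1,2) j(1) by (intro exI[of _ "insert j F"] exI[of _ ?k]) auto
  qed
  define S where "S = {y \<in> H. \<forall>e>0. \<exists>p\<in>span (b ` I). nm (y - p) < e}"
  have SI: "y \<in> S" if "y \<in> H" "!!e. e > 0 ==> \<exists>p\<in>span (b ` I). nm (y - p) < e" for y
    using that by (simp add: S_def)
  have SD: "\<exists>p\<in>span (b ` I). nm (y - p) < e" if "y \<in> S" "e > 0" for y e
    using that by (simp add: S_def)
  have SH: "S \<subseteq> H" by (auto simp: S_def)
  have pH: "p \<in> H" if "p \<in> span (b ` I)" for p
  proof -
    have "span (b ` I) \<subseteq> H" by (rule span_minimal[OF _ sub]) (use b in auto)
    then show ?thesis using that by blast
  qed
  have Sbest: "\<exists>F. finite F & F \<subseteq> I & ip y y - (\<Sum>i\<in>F. (ip y (b i))\<^sup>2) < e" if "y \<in> S" "e > 0" for y e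
  proof -
    have y: "y \<in> H" using that by (simp add: S_def)
    obtain p where p: "p \<in> span (b ` I)" "nm (y - p) < sqrt e"
      using SD[OF \<open>y \<in> S\<close>, of "sqrt e"] \<open>e > 0\<close> by auto
    obtain F c where F: "finite F" "F \<subseteq> I" "p = (\<Sum>i\<in>F. c i *\<^sub>R b i)" using rep[OF p(1)] by blast
    have "ip (y - p) (y - p) < e"
      using p y pH unfolding nm_def by simp
    moreover have "0 <= (\<Sum>i\<in>F. (c i - ip y (b i))\<^sup>2)" by (simp add: sum_nonneg)
    ultimately have "ip y y - (\<Sum>i\<in>F. (ip y (b i))\<^sup>2) < e"
      using best[OF F(1,2) y, of c] unfolding F(3) by linarith
    then show ?thesis using F by blast
  qed
  have bS: "b i \<in> S" if "i \<in> I" for i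
  proof (rule SI[OF b[OF that]])
    show "\<exists>p\<in>span (b ` I). nm (b i - p) < e" if "e > 0" for e
      by (rule bexI[of _ "b i"]) (use that \<open>i \<in> I\<close> in \<open>auto simp: nm_def intro!: span_base\<close>)
  qed
  have subS: "subspace S"
  proof (rule subspaceI)
    show "0 \<in> S"
    proof (rule SI)
      show "\<exists>p\<in>span (b ` I). nm (0 - p) < e" if "e > 0" for e
        by (rule bexI[of _ 0]) (use that in \<open>auto simp: nm_def intro!: span_zero\<close>)
    qed auto
    show "y + z \<in> S" if yz: "y \<in> S" "z \<in> S" for y z
    proof (rule SI)
      show "y + z \<in> H" using yz SH by auto
      fix e :: real assume e: "e > 0"
      obtain p where p: "p \<in> span (b ` I)" "nm (y - p) < e/2" using SD[OF yz(1), of "e/2"] e by auto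
      obtain q where q: "q \<in> span (b ` I)" "nm (z - q) < e/2" using SD[OF yz(2), of "e/2"] e by auto
      have "nm ((y - p) + (z - q)) < e"
        using triangle[of "y - p" "z - q"] p q pH yz SH by fastforce
      then have "nm ((y + z) - (p + q)) < e" by (simp add: algebra_simps)
      then show "\<exists>p\<in>span (b ` I). nm (y + z - p) < e" using p q span_add by blast
    qed
    show "r *\<^sub>R y \<in> S" if y: "y \<in> S" for y r
    proof (rule SI)
      show "r *\<^sub>R y \<in> H" using y SH by auto
      fix e :: real assume e: "e > 0"
      obtain p where p: "p \<in> span (b ` I)" "nm (y - p) < e / (\<bar>r\<bar> + 1)"
        using SD[OF y, of "e / (\<bar>r\<bar> + 1)"] e by auto
      have "nm (r *\<^sub>R (y - p)) = \<bar>r\<bar> * nm (y - p)" using p y pH SH by (intro nm_scale) auto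
      also have "\<dots> <= \<bar>r\<bar> * (e / (\<bar>r\<bar> + 1))" using p(2) by (intro mult_left_mono) auto
      also have "\<dots> < e" using e by (simp add: field_simps)
      finally have "nm (r *\<^sub>R y - r *\<^sub>R p) < e" by (simp add: scaleR_diff_right)
      then show "\<exists>p\<in>span (b ` I). nm (r *\<^sub>R y - p) < e" using p span_scale by blast
    qed
  qed
  have compS: "complete_in S"
    unfolding complete_in_def
  proof (intro allI impI, elim conjE)
    fix X :: "nat => 'a"
    assume X: "\<forall>n. X n \<in> S" and C: "\<forall>e>0. \<exists>N. \<forall>m\<ge>N. \<forall>n\<ge>N. nm (X m - X n) < e"
    have XH: "X n \<in> H" for n using X SH by auto
    obtain y where y: "y \<in> H" "(\<lambda>n. nm (X n - y)) ~~> 0"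
      using comp XH C unfolding complete_in_def by blast
    have "y \<in> S"
    proof (rule SI[OF y(1)])
      fix e :: real assume e: "e > 0"
      obtain n where "\<bar>nm (X n - y) - 0\<bar> < e/2"
        using LIMSEQ_D[OF y(2), of "e/2"] e by auto
      then have n: "nm (X n - y) < e/2" by simp
      obtain p where p: "p \<in> span (b ` I)" "nm (X n - p) < e/2" using SD[of "X n" "e/2"] X e by auto
      have "nm (y - p) < e"
        using triangle3[of y "X n" p] n p pH XH[of n] y(1) nm_minus[of y "X n"] by simp
      then show "\<exists>p\<in>span (b ` I). nm (y - p) < e" using p(1) by blast
    qed
    then show "\<exists>y\<in>S. (\<lambda>n. nm (X n - y)) ~~> 0" using y by auto
  qed
  obtain y where y: "y \<in> S" "!!s. s \<in> S ==> ip (x - y) s = 0"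
    using projection[OF subS SH compS x] by blast
  have yH: "y \<in> H" using y SH by auto
  have z: "ip (x - y) (x - y) = 0" using y bS x yH by (intro total) auto
  \<comment> \<open>\<open>x - y\<close> is null but need not be 0; the approximants of
    \<open>y\<close> are used for \<open>x\<close>.\<close>
  have xS: "x \<in> S"
  proof (rule SI[OF x])
    fix e :: real assume e: "e > 0"
    obtain p where p: "p \<in> span (b ` I)" "nm (y - p) < e" using SD[OF y(1) e] by auto
    have "nm (x - y) = 0" using z by (simp add: nm_def)
    then have "nm (x - p) < e" using triangle3[of x y p] p(2) pH[OF p(1)] x yH by linarith
    then show "\<exists>p\<in>span (b ` I). nm (x - p) < e" using p(1) by blast
  qed
  have bess: "(\<Sum>i\<in>F. (ip x (b i))\<^sup>2) <= ip x x" if F: "finite F" "F \<subseteq> I" for F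
  proof -
    have "(\<Sum>i\<in>F. ip x (b i) *\<^sub>R b i) \<in> H" using F b by (auto intro!: mem_sum)
    then show ?thesis
      using best[OF F x, of "\<lambda>i. ip x (b i)"] nonneg[of "x - (\<Sum>i\<in>F. ip x (b i) *\<^sub>R b i)"] x by simp
  qed
  show ?thesis
    unfolding has_sum_def tendsto_iff eventually_finite_subsets_at_top
  proof (intro allI impI)
    fix e :: real assume "e > 0"
    obtain F where F: "finite F" "F \<subseteq> I" "ip x x - (\<Sum>i\<in>F. (ip x (b i))\<^sup>2) < e"
      using Sbest[OF xS \<open>e > 0\<close>] by blast
    have "dist (\<Sum>i\<in>G. (ip x (b i))\<^sup>2) (ip x x) < e" if G: "finite G" "F \<subseteq> G" "G \<subseteq> I" for G
    proof -
      have "(\<Sum>i\<in>F. (ip x (b i))\<^sup>2) <= (\<Sum>i\<in>G. (ip x (b i))\<^sup>2)" using G by (intro sum_mono2) auto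
      then show ?thesis using bess[OF G(1,3)] F(3) by (simp add: dist_real_def)
    qed
    then show "\<exists>X. finite X & X \<subseteq> I & (\<forall>Y. finite Y & X \<subseteq> Y & Y \<subseteq> I --> dist (\<Sum>i\<in>Y. (ip x (b i))\<^sup>2) (ip x x) < e)"
      using F by blast
  qed
qed

end

section \<open>Smooth functions with bounded support\<close>

lemma pd_eq: "(f has_derivative f') (at x) ==> pd i f x = f' (dir i)"
  by (simp add: pd_def frechet_derivative_at[symmetric])

lemma pd_const [simp]: "pd i (\<lambda>p. c) x = 0"
  by (rule pd_eq[of _ "\<lambda>_. 0", simplified]) simp

lemma pd_add: "f differentiable at x ==> g differentiable at x ==> pd i (\<lambda>p. f p + g p) x = pd i f x + pd i g x"
proof -
  assume "f differentiable at x" "g differentiable at x"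
  then have "((\<lambda>p. f p + g p) has_derivative (\<lambda>h. frechet_derivative f (at x) h + frechet_derivative g (at x) h)) (at x)"
    by (intro has_derivative_add) (simp_all add: frechet_derivative_works)
  from pd_eq[OF this] show ?thesis by (simp add: pd_def)
qed

lemma pd_mult:
  assumes "f differentiable at x" "g differentiable at x"
  shows "pd i (\<lambda>p. f p * g p) x = pd i f x * g x + f x * pd i g x"
proof -
  have "((\<lambda>p. f p * g p) has_derivative (\<lambda>h. f x * frechet_derivative g (at x) h + frechet_derivative f (at x) h * g x)) (at x)"
    by (intro has_derivative_mult) (use assms frechet_derivative_works in blast)+
  from pd_eq[OF this] show ?thesis by (simp add: pd_def)
qed

lemma has_derivative_comp_inner:
  assumes "(u has_real_derivative d) (at (v \<bullet> x + c))"
  shows "((\<lambda>p. u (v \<bullet> p + c)) has_derivative (\<lambda>h. d * (v \<bullet> h))) (at x)"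
proof -
  have "((\<lambda>p. v \<bullet> p + c) has_derivative (\<lambda>h. v \<bullet> h)) (at x)"
    by (auto intro!: derivative_eq_intros)
  from has_derivative_compose[OF this has_field_derivative_imp_has_derivative[OF assms]]
  show ?thesis by simp
qed

lemma pd_comp: "(u has_real_derivative d) (at (v \<bullet> x + c)) ==> pd i (\<lambda>p. u (v \<bullet> p + c)) x = d * (v \<bullet> dir i)"
  by (rule pd_eq[OF has_derivative_comp_inner])

section \<open>Flat exponentials and syntactic classes of smooth functions\<close>

definition gb :: "nat => real => real" where
  "gb n t = (if t > 0 then exp (- 1 / t) / t ^ n else 0)"

text \<open>With s = 1/t the limit from the right is that of s^n / exp s at infinity.\<close>

lemma gb_lim: "((\<lambda>t. gb n t) \<longlongrightarrow> 0) (at 0)"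
proof -
  have "((\<lambda>t. gb n t) \<longlongrightarrow> 0) (at_left 0)"
    by (rule tendsto_eventually) (auto simp: gb_def eventually_at_filter)
  moreover have "((\<lambda>t. gb n t) \<longlongrightarrow> 0) (at_right 0)"
  proof -
    have "((\<lambda>x::real. x ^ n / exp x) \<longlongrightarrow> 0) at_top" by (rule tendsto_power_div_exp_0)
    then have "((\<lambda>t::real. (inverse t) ^ n / exp (inverse t)) \<longlongrightarrow> 0) (at_right 0)"
      by (rule filterlim_compose) (rule filterlim_inverse_at_top_right)
    moreover have "\<forall>\<^sub>F t in at_right 0. (inverse t) ^ n / exp (inverse t) = gb n t"
    proof (rule eventually_mono[OF eventually_at_right_less[of 0]])
      fix t :: real assume "0 < t"
      have "exp (- 1 / t) = inverse (exp (inverse t))" by (simp add: exp_minus[symmetric] divide_inverse)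
      then show "(inverse t) ^ n / exp (inverse t) = gb n t"
        using \<open>0 < t\<close> by (simp add: gb_def divide_inverse power_inverse mult.commute)
    qed
    ultimately show ?thesis by (rule Lim_transform_eventually)
  qed
  ultimately show ?thesis by (simp add: filterlim_at_split)
qed

text \<open>The whole family over \<open>n\<close> is needed because differentiation leads from one
  member to a combination of two others; up to linear combinations the family is closed under
  derivatives.\<close>

lemma gb_deriv: "(gb n has_real_derivative (gb (n + 2) t - n * gb (Suc n) t)) (at t)"
proof -
  show ?thesis
  proof (cases t "0::real" rule: linorder_cases)
    case less
    have "(gb n has_real_derivative 0) (at t)"
      by (rule has_field_derivative_transform_within_open[of "\<lambda>_. 0" 0 t "{..<0}"])
         (use less in \<open>auto simp: gb_def\<close>)
    then show ?thesis using less by (simp add: gb_def)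
  next
    case 2: greater
    have i: "(inverse has_real_derivative - (inverse t)\<^sup>2) (at t)"
      using 2 by (auto intro!: derivative_eq_intros simp: power2_eq_square)
    have "((\<lambda>t. exp (- inverse t) * inverse t ^ n) has_real_derivative
        (exp (- inverse t) * (inverse t)\<^sup>2) * inverse t ^ n
        + (real n * (inverse t) ^ (n - 1) * (- (inverse t)\<^sup>2)) * exp (- inverse t)) (at t)"
      using DERIV_mult[OF DERIV_fun_exp[OF DERIV_minus[OF i]] DERIV_power[OF i, of n]]
      by (simp add: mult.commute mult.left_commute)
    moreover have "(exp (- inverse t) * (inverse t)\<^sup>2) * inverse t ^ n
        + (real n * (inverse t) ^ (n - 1) * (- (inverse t)\<^sup>2)) * exp (- inverse t)
        = gb (n + 2) t - n * gb (Suc n) t"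
      using 2 by (cases n) (simp_all add: gb_def divide_inverse power_inverse power2_eq_square algebra_simps)
    ultimately have "((\<lambda>t. exp (- 1 / t) / t ^ n) has_real_derivative (gb (n + 2) t - n * gb (Suc n) t)) (at t)"
      by (simp add: divide_inverse power_inverse)
    then show ?thesis
      by (rule has_field_derivative_transform_within_open[of _ _ _ "{0<..}"]) (use 2 in \<open>auto simp: gb_def\<close>)
  next
    case 3: equal
    \<comment> \<open>The difference quotient of \<open>gb n\<close> at 0 is
      \<open>gb (Suc n)\<close> itself, so differentiability there is the limit of the next
      member.\<close>
    have "(\<lambda>h. (gb n (0 + h) - gb n 0) / h) = gb (Suc n)" by (auto simp: gb_def fun_eq_iff)
    then have "(gb n has_real_derivative 0) (at 0)" using gb_lim[of "Suc n"] by (simp add: DERIV_def)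
    then show ?thesis using 3 by (simp add: gb_def)
  qed
qed

text \<open>A syntactic class made to be closed under differentiation. The rule
  \<open>sm1_anti\<close> admits antiderivatives, which is how the smooth step, an integral of a
  bump, gets in.\<close>

inductive sm1 :: "(real => real) => bool" where
  sm1_const: "sm1 (\<lambda>_. c)"
| sm1_id: "sm1 (\<lambda>x. x)"
| sm1_sin: "sm1 sin"
| sm1_cos: "sm1 cos"
| sm1_gb: "sm1 (gb n)"
| sm1_add: "sm1 u ==> sm1 v ==> sm1 (\<lambda>x. u x + v x)"
| sm1_mult: "sm1 u ==> sm1 v ==> sm1 (\<lambda>x. u x * v x)"
| sm1_affine: "sm1 u ==> sm1 (\<lambda>x. u (a * x + b))"
| sm1_anti: "sm1 u ==> (!!x. (w has_real_derivative u x) (at x)) ==> sm1 w"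

lemma sm1_deriv: "sm1 u ==> \<exists>u'. sm1 u' & (\<forall>x. (u has_real_derivative u' x) (at x))"
proof (induction rule: sm1.induct)
  case (sm1_const c)
  show ?case by (intro exI[of _ "\<lambda>_. 0"]) (auto intro: sm1.intros)
next
  case sm1_id
  show ?case by (intro exI[of _ "\<lambda>_. 1"]) (auto intro: sm1.intros)
next
  case sm1_sin
  show ?case by (intro exI[of _ cos]) (auto intro: sm1.intros)
next
  case sm1_cos
  have "sm1 (\<lambda>x. (-1) * sin x)" by (rule sm1.sm1_mult[OF sm1.sm1_const sm1.sm1_sin])
  then show ?case by (intro exI[of _ "\<lambda>x. (-1) * sin x"]) (auto intro!: derivative_eq_intros)
next
  case (sm1_gb n)
  have "sm1 (\<lambda>x. gb (n + 2) x + (- real n) * gb (Suc n) x)"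
    by (intro sm1.intros)
  then show ?case using gb_deriv[of n] by (intro exI[of _ "\<lambda>x. gb (n + 2) x + (- real n) * gb (Suc n) x"]) auto
next
  case (sm1_add u v)
  then obtain u' v' where "sm1 u'" "sm1 v'" "\<forall>x. (u has_real_derivative u' x) (at x)" "\<forall>x. (v has_real_derivative v' x) (at x)"
    by blast
  then have "sm1 (\<lambda>x. u' x + v' x)" "\<forall>x. ((\<lambda>x. u x + v x) has_real_derivative u' x + v' x) (at x)"
    by (auto intro: sm1.sm1_add DERIV_add)
  then show ?case by (intro exI[of _ "\<lambda>x. u' x + v' x"] conjI)
next
  case (sm1_mult u v)
  then obtain u' v' where uv: "sm1 u'" "sm1 v'" "\<forall>x. (u has_real_derivative u' x) (at x)" "\<forall>x. (v has_real_derivative v' x) (at x)"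
    by blast
  have "sm1 (\<lambda>x. u' x * v x + v' x * u x)"
    by (intro sm1.sm1_add sm1.sm1_mult uv sm1_mult.hyps)
  moreover have "\<forall>x. ((\<lambda>x. u x * v x) has_real_derivative (u' x * v x + v' x * u x)) (at x)"
    using uv by (auto intro!: DERIV_mult)
  ultimately show ?case by (intro exI[of _ "\<lambda>x. u' x * v x + v' x * u x"] conjI)
next
  case (sm1_affine u a b)
  then obtain u' where u: "sm1 u'" "!!x. (u has_real_derivative u' x) (at x)" by blast
  have "sm1 (\<lambda>x. a * u' (a * x + b))"
    by (intro sm1.sm1_mult[OF sm1.sm1_const] sm1.sm1_affine u)
  moreover have "((\<lambda>x. u (a * x + b)) has_real_derivative a * u' (a * x + b)) (at x)" for x
  proof -
    have "((\<lambda>x. a * x + b) has_real_derivative a) (at x)" by (auto intro!: derivative_eq_intros)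
    from DERIV_chain2[OF u(2) this] show ?thesis by (simp add: mult.commute)
  qed
  ultimately show ?case by (intro exI[of _ "\<lambda>x. a * u' (a * x + b)"] conjI allI)
next
  case (sm1_anti u w)
  then show ?case by blast
qed

text \<open>Generated by ridge functions. The cutoffs and real waves used below have this shape, and
  closure under \<open>pd\<close> yields their smoothness by coinduction.\<close>

inductive smA :: "(pt => real) => bool" where
  smA_comp: "sm1 u ==> smA (\<lambda>p. u (v \<bullet> p + c))"
| smA_add: "smA f ==> smA g ==> smA (\<lambda>p. f p + g p)"
| smA_mult: "smA f ==> smA g ==> smA (\<lambda>p. f p * g p)"

lemma smA_const: "smA (\<lambda>p. c)"
  using smA_comp[OF sm1_const[of c]] .

lemma smA_pd: "smA f ==> (\<forall>x. f differentiable at x) & (\<forall>i. smA (pd i f))"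
proof (induction rule: smA.induct)
  case (smA_comp u v c)
  obtain u' where u': "sm1 u'" "!!x. (u has_real_derivative u' x) (at x)" using sm1_deriv[OF smA_comp] by blast
  have "pd i (\<lambda>p. u (v \<bullet> p + c)) = (\<lambda>p. u' (v \<bullet> p + c) * (v \<bullet> dir i))" for i
    by (rule ext) (rule pd_comp[OF u'(2)])
  moreover have "smA (\<lambda>p. u' (v \<bullet> p + c) * (v \<bullet> dir i))" for i
    by (intro smA.smA_mult smA.smA_comp u' smA_const)
  moreover have "(\<lambda>p. u (v \<bullet> p + c)) differentiable at x" for x
    using has_derivative_comp_inner[OF u'(2)] unfolding differentiable_def by blast
  ultimately show ?case by simp
next
  case (smA_add f g)
  have "pd i (\<lambda>p. f p + g p) = (\<lambda>p. pd i f p + pd i g p)" for i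
    using smA_add by (intro ext pd_add) auto
  then show ?case using smA_add by (auto intro: smA.intros)
next
  case (smA_mult f g)
  have "pd i (\<lambda>p. f p * g p) = (\<lambda>p. pd i f p * g p + f p * pd i g p)" for i
    using smA_mult by (intro ext pd_mult) auto
  moreover have "smA (\<lambda>p. pd i f p * g p + f p * pd i g p)" for i
    using smA_mult by (intro smA.intros) auto
  ultimately show ?case using smA_mult by auto
qed

lemma smA_smooth: "smA f ==> smooth_fun f"
  by (coinduction arbitrary: f) (use smA_pd in blast)

section \<open>Stability of smooth functions and test functions\<close>

lemma smooth_diff: "smooth_fun f ==> f differentiable at x"
  using smooth_fun.cases by blast

lemma smooth_pd: "smooth_fun f ==> smooth_fun (pd i f)"
  by (erule smooth_fun.cases) auto

lemma smooth_cont: "smooth_fun f ==> continuous_on UNIV f"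
  by (auto intro!: continuous_at_imp_continuous_on differentiable_imp_continuous_within smooth_diff)

lemma pd_shift:
  assumes "f differentiable at (x - c)"
  shows "pd i (\<lambda>p. f (p - c)) x = pd i f (x - c)"
proof -
  have "(f has_derivative frechet_derivative f (at (x - c))) (at (x - c))"
    using assms frechet_derivative_works by blast
  moreover have "((\<lambda>p. p - c) has_derivative (\<lambda>h. h)) (at x)" by (auto intro!: derivative_eq_intros)
  ultimately have "((\<lambda>p. f (p - c)) has_derivative frechet_derivative f (at (x - c))) (at x)"
    using has_derivative_compose by fastforce
  from pd_eq[OF this] show ?thesis by (simp add: pd_def)
qed

lemma smooth_shift: "smooth_fun f ==> smooth_fun (\<lambda>p. f (p - c))"
proof (coinduction arbitrary: f)
  case smooth_fun
  have "(\<lambda>p. f (p - c)) differentiable at x" for x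
    using smooth_diff[OF smooth_fun, of "x - c"]
    by (intro differentiable_chain_at[of "\<lambda>p. p - c" x f, unfolded o_def]) (auto intro!: derivative_intros)
  moreover have "pd i (\<lambda>p. f (p - c)) = (\<lambda>p. pd i f (p - c))" for i
    by (rule ext) (rule pd_shift[OF smooth_diff[OF smooth_fun]])
  ultimately show ?case using smooth_pd[OF smooth_fun] by blast
qed

lemma test_shift: "test_fun f ==> test_fun (\<lambda>p. f (p - c))"
proof -
  assume f: "test_fun f"
  have "{p. f (p - c) ~= 0} = (\<lambda>x. c + x) ` {x. f x ~= 0}"
  proof (intro subset_antisym subsetI)
    fix x assume "x \<in> {p. f (p - c) ~= 0}"
    then show "x \<in> (\<lambda>x. c + x) ` {x. f x ~= 0}"
      by (intro image_eqI[of _ _ "x - c"]) simp_all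
  qed (auto simp: image_iff)
  then show ?thesis using f by (simp add: test_fun_def smooth_shift bounded_translation)
qed

lemma pd_zero_open:
  assumes "open S" "x \<in> S" "!!y. y \<in> S ==> f y = 0"
  shows "pd i f x = 0"
proof -
  have "(f has_derivative (\<lambda>_. 0)) (at x)"
    by (rule has_derivative_transform_within_open[of "\<lambda>_. 0" _ _ _ S]) (use assms in auto)
  from pd_eq[OF this] show ?thesis by simp
qed

text \<open>On the open complement of the closed support the function is constantly 0, hence so is
  its derivative.\<close>

lemma pd_supp: "{x. pd i f x ~= 0} \<subseteq> closure {x. f x ~= 0}"
proof
  fix x assume "x \<in> {x. pd i f x ~= 0}"
  then show "x \<in> closure {x. f x ~= 0}"
    using pd_zero_open[of "- closure {x. f x ~= 0}" x f i] closure_subset by force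
qed

lemma test_pd: "test_fun f ==> test_fun (pd i f)"
  using pd_supp[of i f] by (auto simp: test_fun_def smooth_pd intro: bounded_subset bounded_closure)

lemma test_bounded:
  assumes "test_fun f"
  shows "\<exists>M. \<forall>x. \<bar>f x\<bar> <= M"
proof -
  let ?K = "closure {x. f x ~= 0}"
  have "compact (f ` ?K)"
    using assms by (intro compact_continuous_image continuous_on_subset[OF smooth_cont])
      (auto simp: test_fun_def compact_eq_bounded_closed)
  then have "bounded (f ` ?K)" by (rule compact_imp_bounded)
  then obtain M where M: "!!x. x \<in> ?K ==> \<bar>f x\<bar> <= M"
    unfolding bounded_iff by (metis imageI real_norm_def)
  have "\<bar>f x\<bar> <= max M 0" for x
    using M[of x] closure_subset[of "{x. f x ~= 0}"] by (cases "f x = 0") (auto simp: le_max_iff_disj)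
  then show ?thesis by blast
qed

lemma test_cont: "test_fun f ==> continuous_on UNIV f"
  by (simp add: test_fun_def smooth_cont)

lemma cont_lebesgue: "continuous_on UNIV f ==> f \<in> Lmeas"
  by (intro measurable_completion) (simp add: borel_measurable_continuous_onI)

lemma test_meas: "test_fun f ==> f \<in> Lmeas"
  by (intro cont_lebesgue test_cont)

lemma smooth_along:
  assumes "smooth_fun f"
  shows "((\<lambda>t. f (p + t *\<^sub>R dir i)) has_real_derivative pd i f p) (at 0)"
proof -
  have "(f has_derivative frechet_derivative f (at p)) (at (p + 0 *\<^sub>R dir i))"
    using smooth_diff[OF assms] by (simp only: frechet_derivative_works scaleR_zero_left add_0_right)
  moreover have "((\<lambda>t. p + t *\<^sub>R dir i) has_derivative (\<lambda>t. t *\<^sub>R dir i)) (at 0)"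
    by (auto intro!: derivative_eq_intros)
  ultimately have "((\<lambda>t. f (p + t *\<^sub>R dir i)) has_derivative (\<lambda>t. frechet_derivative f (at p) (t *\<^sub>R dir i))) (at 0)"
    by (rule has_derivative_compose[rotated])
  moreover have "frechet_derivative f (at p) (t *\<^sub>R dir i) = t * pd i f p" for t
    using linear_frechet_derivative[OF smooth_diff[OF assms]] by (simp add: pd_def linear_scale)
  ultimately show ?thesis
    by (simp add: has_field_derivative_def mult.commute[of _ "pd i f p"])
qed

subsection \<open>A smooth step\<close>

text \<open>A normalized antiderivative of the bump \<open>gb 0 t * gb 0 (1 - t)\<close>, which is
  positive exactly on the open unit interval.\<close>

lemma ex_step:
  "\<exists>B. sm1 B & (\<forall>t\<le>0. B t = 0) & (\<forall>t\<ge>1. B t = 1) & (\<forall>t. 0 <= B t & B t <= (1::real))"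
proof -
  define b where "b t = gb 0 t * gb 0 ((-1) * t + 1)" for t
  have sb: "sm1 b"
    using sm1_mult[OF sm1_gb[of 0] sm1_affine[OF sm1_gb[of 0], of "-1" 1]] by (simp only: b_def[abs_def])
  have b0: "0 <= b t" for t by (simp add: b_def gb_def)
  have bpos: "0 < b t" if "0 < t" "t < 1" for t using that by (simp add: b_def gb_def)
  have bz: "b t = 0" if "t <= 0 \<or> t >= 1" for t using that by (auto simp: b_def gb_def)
  obtain b' where "!!x. (b has_real_derivative b' x) (at x)" using sm1_deriv[OF sb] by blast
  then have cb: "isCont b x" for x using DERIV_isCont by blast
  obtain F where F: "!!x. (F has_vector_derivative b x) (at x)"
    using einterval_antiderivative[of "-\<infinity>" "\<infinity>" b] cb by auto
  have F': "(F has_real_derivative b x) (at x)" for x using F has_real_derivative_iff_has_vector_derivative by blast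
  have mono: "F x <= F y" if "x <= y" for x y
    by (rule DERIV_nonneg_imp_nondecreasing[OF that]) (use F' b0 in blast)
  have c1: "F t = F 0" if "t <= 0" for t
  proof (cases "t = 0")
    case False
    then have "t < 0" using that by simp
    from MVT2[OF this, of F b] F' obtain z where "t < z" "z < 0" "F 0 - F t = (0 - t) * b z" by blast
    then show ?thesis using bz[of z] by simp
  qed simp
  have c2: "F t = F 1" if "1 <= t" for t
  proof (cases "t = 1")
    case False
    then have "1 < t" using that by simp
    from MVT2[OF this, of F b] F' obtain z where "1 < z" "z < t" "F t - F 1 = (t - 1) * b z" by blast
    then show ?thesis using bz[of z] by simp
  qed simp
  obtain z where z: "0 < z" "z < 1" "F 1 - F 0 = (1 - 0) * b z" using MVT2[OF zero_less_one, of F b] F' by blast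
  then have d: "F 1 - F 0 > 0" using bpos by simp
  define B where "B t = (F t + (- F 0)) * (1 / (F 1 - F 0))" for t
  have "sm1 F" using sm1_anti[OF sb F'] .
  from sm1_mult[OF sm1_add[OF this sm1_const[of "- F 0"]] sm1_const[of "1 / (F 1 - F 0)"]]
  have "sm1 B" by (simp add: B_def[abs_def])
  moreover have "0 <= B t & B t <= 1" for t
  proof -
    have "F 0 <= F t" "F t <= F 1"
      using mono[of 0 t] mono[of t 1] c1[of t] c2[of t] mono[of 0 1] by (cases "t <= 0"; cases "t >= 1"; simp)+
    then show ?thesis using d by (simp add: B_def field_simps)
  qed
  moreover have "B t = 0" if "t <= 0" for t using c1[OF that] by (simp add: B_def)
  moreover have "B t = 1" if "1 <= t" for t using c2[OF that] d by (simp add: B_def)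
  ultimately show ?thesis by (intro exI[of _ B] conjI allI impI) auto
qed

definition stp :: "real => real" where
  "stp = (SOME B. sm1 B & (\<forall>t\<le>0. B t = 0) & (\<forall>t\<ge>1. B t = 1) & (\<forall>t. 0 <= B t & B t <= (1::real)))"

lemma stp: "sm1 stp" "t <= 0 ==> stp t = 0" "t >= 1 ==> stp t = 1" "0 <= stp t" "stp t <= 1"
  using someI_ex[OF ex_step] unfolding stp_def by blast+

definition zt :: "real => real" where "zt t = stp (2 + t) * stp (2 - t)"

lemma zt: "sm1 zt" "\<bar>t\<bar> >= 2 ==> zt t = 0" "\<bar>t\<bar> <= 1 ==> zt t = 1" "0 <= zt t" "zt t <= 1"
proof -
  have "sm1 (\<lambda>t. stp (1 * t + 2) * stp ((-1) * t + 2))"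
    by (rule sm1_mult[OF sm1_affine[OF stp(1), of 1 2] sm1_affine[OF stp(1), of "-1" 2]])
  moreover have "(\<lambda>t. stp (1 * t + 2) * stp ((-1) * t + 2)) = zt"
    by (auto simp: zt_def fun_eq_iff add.commute)
  ultimately show "sm1 zt" by simp
qed (auto simp: zt_def stp abs_if mult_le_one split: if_splits)

text \<open>Beyond |t| = 2 the cutoff is locally constant, so its derivatives vanish there; being
  continuous and supported in [-2,2], they are bounded. The common bound \<open>M\<close> controls
  the errors of the vertical cutoffs later on.\<close>

lemma ex_zt_derivs:
  "\<exists>z1 z2 M. (\<forall>t. (zt has_real_derivative z1 t) (at t)) & (\<forall>t. (z1 has_real_derivative z2 t) (at t)) &
     (\<forall>t. \<bar>z1 t\<bar> <= M & \<bar>z2 t\<bar> <= M) & (\<forall>t. \<bar>t\<bar> > 2 --> z1 t = 0 & z2 t = 0) & sm1 z1 & sm1 z2"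
proof -
  obtain z1 where z1: "sm1 z1" "!!t. (zt has_real_derivative z1 t) (at t)" using sm1_deriv[OF zt(1)] by blast
  obtain z2 where z2: "sm1 z2" "!!t. (z1 has_real_derivative z2 t) (at t)" using sm1_deriv[OF z1(1)] by blast
  obtain z3 where z3: "!!t. (z2 has_real_derivative z3 t) (at t)" using sm1_deriv[OF z2(1)] by blast
  have op: "open {t::real. \<bar>t\<bar> > 2}" by (intro open_Collect_less continuous_intros)
  have zero: "g' t = 0" if "\<bar>t\<bar> > 2" "!!t. \<bar>t\<bar> > 2 ==> g t = 0" "(g has_real_derivative g' t) (at t)" for g g' :: "real => real" and t
  proof -
    have "(g has_real_derivative 0) (at t)"
      by (rule has_field_derivative_transform_within_open[of "\<lambda>_. 0" _ _ "{t. \<bar>t\<bar> > 2}"]) (use op that in auto)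
    then show ?thesis using that(3) DERIV_unique by blast
  qed
  have a: "z1 t = 0" if "\<bar>t\<bar> > 2" for t
    by (rule zero[of t zt z1]) (use that zt(2) z1(2) in auto)
  have b: "z2 t = 0" if "\<bar>t\<bar> > 2" for t
    by (rule zero[of t z1 z2]) (use that a z2(2) in auto)
  have bd: "\<exists>M. \<forall>t. \<bar>g t\<bar> <= M" if "!!t. isCont g t" "!!t. \<bar>t\<bar> > 2 ==> g t = 0" for g :: "real => real"
  proof -
    have "compact (g ` {-2..2})"
      using that(1) by (intro compact_continuous_image continuous_at_imp_continuous_on) auto
    then have "bounded (g ` {-2..2})" by (rule compact_imp_bounded)
    then obtain M where M: "!!t. t \<in> {-2..2} ==> \<bar>g t\<bar> <= M"
      unfolding bounded_iff by (metis imageI real_norm_def)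
    have "\<bar>g t\<bar> <= max M 0" for t using M[of t] that(2)[of t] by (cases "\<bar>t\<bar> > 2") (auto simp: abs_if split: if_splits)
    then show ?thesis by blast
  qed
  obtain M1 where M1: "!!t. \<bar>z1 t\<bar> <= M1" using bd[of z1] a z2(2) DERIV_isCont by blast
  obtain M2 where M2: "!!t. \<bar>z2 t\<bar> <= M2" using bd[of z2] b z3 DERIV_isCont by blast
  have "\<bar>z1 t\<bar> <= max M1 M2 & \<bar>z2 t\<bar> <= max M1 M2" for t using M1[of t] M2[of t] by auto
  then show ?thesis using z1 z2 a b by blast
qed

section \<open>Translation invariance and integration by parts\<close>

lemma lebesgue_shift_measurable: "(\<lambda>x. c + x) \<in> lebesgue \<rightarrow>\<^sub>M (lebesgue :: 'a::euclidean_space measure)"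
  using lebesgue_affine_measurable[of "\<lambda>_. 1" c] by (simp add: euclidean_representation)

lemma lebesgue_distr_shift: "distr lebesgue lebesgue (\<lambda>x. c + x) = (lebesgue :: 'a::euclidean_space measure)"
  using lebesgue_affine_euclidean[of "\<lambda>_. 1" c] by (simp add: euclidean_representation density_1)

lemma meas_shift:
  fixes f :: "'a::euclidean_space => 'b::topological_space"
  assumes "f \<in> Lmeas"
  shows "(\<lambda>x. f (x + c)) \<in> Lmeas" "(\<lambda>x. f (x - c)) \<in> Lmeas"
  using measurable_compose[OF lebesgue_shift_measurable assms, of c] measurable_compose[OF lebesgue_shift_measurable assms, of "- c"]
  by (simp_all add: add.commute)

lemma integrable_shift:
  fixes f :: "'a::euclidean_space => 'b::{banach, second_countable_topology}"
  shows "Lint f ==> Lint (\<lambda>x. f (x + c))"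
  using integrable_distr[OF lebesgue_shift_measurable, of c f] unfolding lebesgue_distr_shift
  by (simp add: add.commute)

lemma integral_shift:
  fixes f :: "'a::euclidean_space => 'b::{banach, second_countable_topology}"
  assumes "f \<in> Lmeas"
  shows "(LI x. f (x + c)) = (LI x. f x)"
  using integral_distr[OF lebesgue_shift_measurable assms, of c] unfolding lebesgue_distr_shift
  by (simp add: add.commute)

lemma integrable_bounded_support:
  fixes f :: "'a::euclidean_space => 'b::{banach, second_countable_topology}"
  assumes "f \<in> Lmeas" "!!x. norm (f x) <= M" "bounded {x. f x ~= 0}"
  shows "Lint f"
proof -
  obtain a b where ab: "{x. f x ~= 0} \<subseteq> cbox a b" using assms(3) bounded_subset_cbox_symmetric by blast
  have "0 <= M" using assms(2) norm_ge_zero order_trans by blast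
  then have "norm (f x) <= norm (indicator (cbox a b) x * M)" for x
    using ab assms(2)[of x] by (cases "f x = 0") (auto simp: indicator_def)
  moreover have "Lint (\<lambda>x. indicator (cbox a b) x * M)"
    by (intro integrable_mult_left) (auto intro!: integrable_real_indicator simp: emeasure_lborel_cbox_eq)
  ultimately show ?thesis
    by (rule_tac Lint_bound[OF _ assms(1)]) (assumption | rule always_eventually allI)+
qed

text \<open>Both sides are limits of integrals of difference quotients, matched by translation invariance.\<close>

lemma integration_by_parts:
  fixes f g df dg :: "'a::euclidean_space => real"
  assumes meas: "f \<in> Lmeas" "df \<in> Lmeas"
      "g \<in> Lmeas" "dg \<in> Lmeas"
    and bd: "!!p. \<bar>f p\<bar> <= M" "!!p. \<bar>df p\<bar> <= M" "!!p. \<bar>g p\<bar> <= M" "!!p. \<bar>dg p\<bar> <= M"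
    and supp: "bounded {p. g p ~= 0}"
    and f: "!!p. ((\<lambda>t. f (p + t *\<^sub>R e)) has_real_derivative df p) (at 0)"
    and g: "!!p. ((\<lambda>t. g (p + t *\<^sub>R e)) has_real_derivative dg p) (at 0)"
  shows "(LI p. df p * g p) = - (LI p. f p * dg p)"
proof -
  define t where "t n = 1 / real (Suc n)" for n
  have t: "0 < t n" "t n <= 1" for n by (auto simp: t_def)
  have t0: "t ~~> 0" unfolding t_def by real_asymp
  have along: "((\<lambda>s. h (p + s *\<^sub>R e)) has_real_derivative dh (p + s *\<^sub>R e)) (at s)"
    if h: "!!p. ((\<lambda>t. h (p + t *\<^sub>R e)) has_real_derivative dh p) (at 0)" for h dh p s
  proof -
    have "((\<lambda>u. h ((p + s *\<^sub>R e) + u *\<^sub>R e)) has_real_derivative dh (p + s *\<^sub>R e)) (at (s - s))"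
      using h by simp
    then have "((\<lambda>x. h ((p + s *\<^sub>R e) + (x - s) *\<^sub>R e)) has_real_derivative dh (p + s *\<^sub>R e) * 1) (at s)"
      by (rule DERIV_chain2) (auto intro!: derivative_eq_intros)
    then show ?thesis by (simp add: algebra_simps)
  qed
  have mvt: "\<bar>h (p + s *\<^sub>R e) - h p\<bar> <= M * \<bar>s\<bar>"
    if h: "!!p. ((\<lambda>t. h (p + t *\<^sub>R e)) has_real_derivative dh p) (at 0)" and dh: "!!p. \<bar>dh p\<bar> <= M" for h dh p s
  proof -
    have "\<bar>h (p + s *\<^sub>R e) - h (p + 0 *\<^sub>R e)\<bar> <= M * \<bar>s - 0\<bar>"
      using field_differentiable_bound[of UNIV "\<lambda>s. h (p + s *\<^sub>R e)" "\<lambda>s. dh (p + s *\<^sub>R e)" M s 0] along[OF h] dh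
      by (simp add: real_norm_def)
    then show ?thesis by simp
  qed
  have lim: "(\<lambda>n. (h (p + (c * t n) *\<^sub>R e) - h p) / (c * t n)) ~~> dh p"
    if h: "!!p. ((\<lambda>t. h (p + t *\<^sub>R e)) has_real_derivative dh p) (at 0)" and "c ~= 0" for h dh p c
  proof -
    have "((\<lambda>s. (h (p + s *\<^sub>R e) - h p) / s) \<longlongrightarrow> dh p) (at 0)" using h[of p] by (simp add: DERIV_def)
    moreover have "filterlim (\<lambda>n. c * t n) (at 0) sequentially"
      unfolding filterlim_at using t0 t \<open>c ~= 0\<close> by (auto intro!: tendsto_eq_intros simp: less_imp_neq[symmetric])
    ultimately show ?thesis by (rule filterlim_compose)
  qed
  have M0: "0 <= M" using bd(1)[of 0] by linarith
  obtain R where R: "!!p. g p ~= 0 ==> norm p <= R" using supp by (auto simp: bounded_iff)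
  \<comment> \<open>The radius is enlarged by \<open>norm e\<close> because the step sizes are at
    most 1: the ball then contains the supports of all translates of \<open>g\<close> that
    occur.\<close>
  define B where "B = cball (0::'a) (R + norm e)"
  have Bint: "Lint (\<lambda>p. indicator B p * M\<^sup>2)"
    by (intro integrable_mult_left) (use emeasure_bounded_finite[OF bounded_cball, of 0 "R + norm e"] in \<open>auto intro!: integrable_real_indicator simp: B_def\<close>)
  have B1: "p \<in> B" if "g p ~= 0" for p using R[OF that] by (simp add: B_def add_increasing2)
  have B2: "p \<in> B" if "g (p + (- t n) *\<^sub>R e) ~= 0" for p n
  proof -
    have "norm p <= norm (p + (- t n) *\<^sub>R e) + norm (t n *\<^sub>R e)"
      using norm_triangle_ineq[of "p + (- t n) *\<^sub>R e" "t n *\<^sub>R e"] by simp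
    also have "\<dots> <= R + norm e" using R[OF that] t[of n] by (intro add_mono) (auto intro: mult_left_le_one_le)
    finally show ?thesis by (simp add: B_def)
  qed
  have 1: "(\<lambda>n. LI p. (f (p + t n *\<^sub>R e) - f p) / t n * g p) ~~> (LI p. df p * g p)"
  proof (rule integral_dominated_convergence[where w="\<lambda>p. indicator B p * M\<^sup>2"])
    show "AE p in lebesgue. (\<lambda>n. (f (p + t n *\<^sub>R e) - f p) / t n * g p) ~~> df p * g p"
      using lim[OF f, of 1] by (intro always_eventually allI tendsto_intros) simp
    show "AE p in lebesgue. norm ((f (p + t n *\<^sub>R e) - f p) / t n * g p) <= indicator B p * M\<^sup>2" for n
    proof (intro always_eventually allI)
      fix p
      show "norm ((f (p + t n *\<^sub>R e) - f p) / t n * g p) <= indicator B p * M\<^sup>2"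
      proof (cases "g p = 0")
        case False
        have "\<bar>f (p + t n *\<^sub>R e) - f p\<bar> / t n <= M" using mvt[OF f bd(2), of p "t n"] t[of n] by (simp add: field_simps)
        then have "\<bar>f (p + t n *\<^sub>R e) - f p\<bar> / t n * \<bar>g p\<bar> <= M * M" using bd(3)[of p] M0 by (intro mult_mono) auto
        then show ?thesis using B1[OF False] t[of n] by (simp add: abs_mult power2_eq_square)
      qed simp
    qed
    show "(\<lambda>p. (f (p + t n *\<^sub>R e) - f p) / t n * g p) \<in> Lmeas" for n
      by (intro borel_measurable_times borel_measurable_divide borel_measurable_diff borel_measurable_const
          meas meas_shift(1)[OF meas(1)])
  qed (rule Bint borel_measurable_times meas)+
  have 2: "(\<lambda>n. LI p. f p * ((g (p + (- t n) *\<^sub>R e) - g p) / (- t n))) ~~> (LI p. f p * dg p)"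
  proof (rule integral_dominated_convergence[where w="\<lambda>p. indicator B p * M\<^sup>2"])
    show "AE p in lebesgue. (\<lambda>n. f p * ((g (p + (- t n) *\<^sub>R e) - g p) / (- t n))) ~~> f p * dg p"
      using lim[OF g, of "-1"] by (intro always_eventually allI tendsto_intros) simp
    show "AE p in lebesgue. norm (f p * ((g (p + (- t n) *\<^sub>R e) - g p) / (- t n))) <= indicator B p * M\<^sup>2" for n
    proof (intro always_eventually allI)
      fix p
      have a: "\<bar>g (p + (- t n) *\<^sub>R e) - g p\<bar> / t n <= M" using mvt[OF g bd(4), of p "- t n"] t[of n] by (simp add: field_simps)
      have b: "\<bar>f p\<bar> * (\<bar>g (p + (- t n) *\<^sub>R e) - g p\<bar> / t n) <= M * M" using bd(1)[of p] M0 a t[of n] by (intro mult_mono) auto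
      show "norm (f p * ((g (p + (- t n) *\<^sub>R e) - g p) / (- t n))) <= indicator B p * M\<^sup>2"
      proof (cases "p \<in> B")
        case True
        then show ?thesis using b t[of n] by (simp add: abs_mult power2_eq_square)
      next
        case False
        then have "g p = 0" "g (p + (- t n) *\<^sub>R e) = 0" using B1 B2 by blast+
        then show ?thesis using False by simp
      qed
    qed
    show "(\<lambda>p. f p * ((g (p + (- t n) *\<^sub>R e) - g p) / (- t n))) \<in> Lmeas" for n
      by (intro borel_measurable_times borel_measurable_divide borel_measurable_diff borel_measurable_const
          meas meas_shift(1)[OF meas(3)])
  qed (rule Bint borel_measurable_times meas)+
  have int: "Lint (\<lambda>p. a p * b (p + c))"
    if "a \<in> Lmeas" "b \<in> Lmeas" "!!p. \<bar>a p\<bar> <= M" "!!p. \<bar>b p\<bar> <= M"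
      "bounded {p. a p ~= 0} \<or> bounded {p. b (p + c) ~= 0}" for a b :: "'a => real" and c
  proof (rule integrable_bounded_support[of _ "M * M"])
    show "(\<lambda>p. a p * b (p + c)) \<in> Lmeas"
      by (rule borel_measurable_times[OF that(1) meas_shift(1)[OF that(2)]])
    show "norm (a p * b (p + c)) <= M * M" for p
      using mult_mono[OF that(3,4)] M0 by (simp add: abs_mult)
    show "bounded {p. a p * b (p + c) ~= 0}" using that(5) by (auto elim: bounded_subset)
  qed
  have bsh: "bounded {p. g (p + c) ~= 0}" for c
  proof -
    have "{p. g (p + c) ~= 0} \<subseteq> cball 0 (R + norm c)"
    proof
      fix p assume "p \<in> {p. g (p + c) ~= 0}"
      then have "norm (p + c) <= R" using R by simp
      then show "p \<in> cball 0 (R + norm c)" using norm_triangle_ineq4[of "p + c" c] by simp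
    qed
    then show ?thesis using bounded_cball bounded_subset by blast
  qed
  \<comment> \<open>Summation by parts for differences: translating the mixed product by minus the
    step turns the forward difference of \<open>f\<close> into the backward difference of
    \<open>g\<close>.\<close>
  have eq: "(LI p. (f (p + t n *\<^sub>R e) - f p) / t n * g p)
      = - (LI p. f p * ((g (p + (- t n) *\<^sub>R e) - g p) / (- t n)))" for n
  proof -
    have i1: "Lint (\<lambda>p. g p * f (p + t n *\<^sub>R e))" using meas bd supp by (intro int) auto
    have i2: "Lint (\<lambda>p. f p * g (p + (- t n) *\<^sub>R e))"
      using meas bd bsh[of "(- t n) *\<^sub>R e"] by (intro int) auto
    have i3: "Lint (\<lambda>p. f p * g p)"
      using int[of f g 0] meas bd supp by simp
    have "(LI p. g (p + (- t n) *\<^sub>R e) * f ((p + (- t n) *\<^sub>R e) + t n *\<^sub>R e)) = (LI p. g p * f (p + t n *\<^sub>R e))"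
      by (rule integral_shift[of "\<lambda>p. g p * f (p + t n *\<^sub>R e)"])
         (rule borel_measurable_times[OF meas(3) meas_shift(1)[OF meas(1)]])
    then have e: "(LI p. g p * f (p + t n *\<^sub>R e)) = (LI p. f p * g (p + (- t n) *\<^sub>R e))"
      by (simp add: mult.commute)
    have "(LI p. (f (p + t n *\<^sub>R e) - f p) / t n * g p)
        = (LI p. (1 / t n) * (g p * f (p + t n *\<^sub>R e) - f p * g p))"
      by (rule int_cong) (auto simp: field_simps)
    also have "\<dots> = (1 / t n) * ((LI p. g p * f (p + t n *\<^sub>R e)) - (LI p. f p * g p))"
      using i1 i3 by (simp add: int_diff)
    also have "\<dots> = (1 / t n) * ((LI p. f p * g (p + (- t n) *\<^sub>R e)) - (LI p. f p * g p))"
      by (simp only: e)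
    also have "\<dots> = (LI p. (1 / t n) * (f p * g (p + (- t n) *\<^sub>R e) - f p * g p))"
      using i2 i3 by (simp add: int_diff del: scaleR_minus_left)
    also have "\<dots> = (LI p. - (f p * ((g (p + (- t n) *\<^sub>R e) - g p) / (- t n))))"
      by (rule int_cong) (auto simp: field_simps)
    finally show ?thesis by simp
  qed
  have "(\<lambda>n. LI p. (f (p + t n *\<^sub>R e) - f p) / t n * g p) ~~> - (LI p. f p * dg p)"
    unfolding eq by (intro tendsto_intros 2)
  with 1 show ?thesis using LIMSEQ_unique by blast
qed

lemma test_ibp:
  assumes "test_fun f" "test_fun g"
  shows "(LI p. pd i f p * g p) = - (LI p. f p * pd i g p)"
proof -
  obtain M1 M2 M3 M4 where M: "!!p. \<bar>f p\<bar> <= M1" "!!p. \<bar>pd i f p\<bar> <= M2" "!!p. \<bar>g p\<bar> <= M3" "!!p. \<bar>pd i g p\<bar> <= M4"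
    using test_bounded assms test_pd by metis
  define M where "M = max (max M1 M2) (max M3 M4)"
  have "\<bar>f p\<bar> <= M" "\<bar>pd i f p\<bar> <= M" "\<bar>g p\<bar> <= M" "\<bar>pd i g p\<bar> <= M" for p
    using M[of p] by (auto simp: M_def)
  then show ?thesis
    using assms by (intro integration_by_parts[where e="dir i" and M=M])
      (auto intro!: test_meas test_pd smooth_along simp: test_fun_def)
qed

text \<open>Replaces the symmetry of second derivatives: the derivative in direction \<open>k\<close> is moved across as
  a difference quotient, which commutes with the derivative in direction \<open>j\<close>.\<close>

lemma test_ibp_diff:
  assumes f: "test_fun f" and g: "test_fun g"
  shows "(LI p. pd j f p * pd k g p) = (LI p. pd k f p * pd j g p)"
proof -
  define t where "t n = 1 / real (Suc n)" for n
  have t: "0 < t n" for n by (auto simp: t_def)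
  have t0: "t ~~> 0" unfolding t_def by real_asymp
  have ts: "test_fun (\<lambda>p. h (p + c))" if "test_fun h" for h c using test_shift[OF that, of "- c"] by simp
  have pds: "pd i (\<lambda>p. h (p + c)) = (\<lambda>p. pd i h (p + c))" if "test_fun h" for h c i
    using pd_shift[of h _ "- c" i] that by (auto simp: fun_eq_iff test_fun_def smooth_diff)
  have ii: "Lint (\<lambda>p. a p * b p)" if ab: "test_fun a" "test_fun b" for a b
  proof -
    obtain M1 M2 where M: "!!p. \<bar>a p\<bar> <= M1" "!!p. \<bar>b p\<bar> <= M2" using ab test_bounded by metis
    show ?thesis
    proof (rule integrable_bounded_support[of _ "M1 * M2"])
      show "norm (a p * b p) <= M1 * M2" for p using mult_mono[OF M(1)[of p] M(2)[of p]] M(1)[of p] by (auto simp: abs_mult)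
      show "bounded {p. a p * b p ~= 0}" using ab(1) by (auto simp: test_fun_def elim: bounded_subset)
    qed (intro borel_measurable_times test_meas ab)
  qed
  define dq where "dq h n p = (h (p + t n *\<^sub>R dir k) - h p) / t n" for h :: "pt => real" and n p
  have dqlim: "(\<lambda>n. LI p. a p * dq b n p) ~~> (LI p. a p * pd k b p)"
    if ab: "test_fun a" "test_fun b" for a b
  proof -
    have "(\<lambda>n. LI p. a p * dq b n p) = (\<lambda>n. LI p. (a p * b (p + t n *\<^sub>R dir k) - a p * b p) / t n)"
      by (simp add: dq_def field_simps)
    obtain M1 M2 where M: "!!p. \<bar>a p\<bar> <= M1" "!!p. \<bar>pd k b p\<bar> <= M2" using ab test_bounded test_pd by metis
    have Mn: "0 <= M1" "0 <= M2" using M[of 0] by linarith+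
    have sm: "smooth_fun b" using ab by (simp add: test_fun_def)
    show ?thesis
    proof (rule integral_dominated_convergence[where w="\<lambda>p. \<bar>a p\<bar> * M2"])
      show "AE p in lebesgue. (\<lambda>n. a p * dq b n p) ~~> a p * pd k b p"
      proof (intro always_eventually allI tendsto_intros)
        fix p
        have "((\<lambda>s. (b (p + s *\<^sub>R dir k) - b p) / s) \<longlongrightarrow> pd k b p) (at 0)" using smooth_along[OF sm, of p k] by (simp add: DERIV_def)
        moreover have "filterlim t (at 0) sequentially"
          unfolding filterlim_at using t0 t by (auto simp: less_imp_neq[symmetric])
        ultimately show "(\<lambda>n. dq b n p) ~~> pd k b p" unfolding dq_def by (rule filterlim_compose)
      qed
      show "AE p in lebesgue. norm (a p * dq b n p) <= \<bar>a p\<bar> * M2" for n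
      proof (intro always_eventually allI)
        fix p
        have "((\<lambda>s. b (p + s *\<^sub>R dir k)) has_real_derivative pd k b (p + s *\<^sub>R dir k)) (at s)" for s
        proof -
          have "((\<lambda>u. b ((p + s *\<^sub>R dir k) + u *\<^sub>R dir k)) has_real_derivative pd k b (p + s *\<^sub>R dir k)) (at (s - s))"
            using smooth_along[OF sm] by simp
          then have "((\<lambda>x. b ((p + s *\<^sub>R dir k) + (x - s) *\<^sub>R dir k)) has_real_derivative pd k b (p + s *\<^sub>R dir k) * 1) (at s)"
            by (rule DERIV_chain2) (auto intro!: derivative_eq_intros)
          then show ?thesis by (simp add: algebra_simps)
        qed
        then have "\<bar>b (p + t n *\<^sub>R dir k) - b (p + 0 *\<^sub>R dir k)\<bar> <= M2 * \<bar>t n - 0\<bar>"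
          using field_differentiable_bound[of UNIV "\<lambda>s. b (p + s *\<^sub>R dir k)" "\<lambda>s. pd k b (p + s *\<^sub>R dir k)" M2 "t n" 0] M(2)
          by (simp add: real_norm_def)
        then have "\<bar>dq b n p\<bar> <= M2" using t[of n] by (simp add: dq_def field_simps)
        then show "norm (a p * dq b n p) <= \<bar>a p\<bar> * M2" by (simp add: abs_mult mult_left_mono)
      qed
      have "Lint a"
        using ab(1) M(1) by (intro integrable_bounded_support[of _ M1] test_meas) (auto simp: test_fun_def)
      then show "Lint (\<lambda>p. \<bar>a p\<bar> * M2)" by (intro integrable_mult_left integrable_abs)
      show "(\<lambda>p. a p * dq b n p) \<in> Lmeas" for n
        unfolding dq_def by (intro borel_measurable_times borel_measurable_divide borel_measurable_diff
            borel_measurable_const test_meas ab meas_shift(1)[OF test_meas[OF ab(2)]])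
    qed (rule borel_measurable_times test_meas test_pd ab)+
  qed
  have A: "(LI p. pd j f p * dq g n p) = - (LI p. f p * dq (pd j g) n p)" for n
  proof -
    have "(LI p. pd j f p * dq g n p)
        = (LI p. (1 / t n) * (pd j f p * g (p + t n *\<^sub>R dir k) - pd j f p * g p))"
      by (rule int_cong) (auto simp: dq_def field_simps)
    also have "\<dots> = (1 / t n) * ((LI p. pd j f p * g (p + t n *\<^sub>R dir k)) - (LI p. pd j f p * g p))"
      by (subst integral_mult_right_zero, subst int_diff) (auto intro!: ii test_pd ts f g)
    also have "\<dots> = (1 / t n) * (- (LI p. f p * pd j g (p + t n *\<^sub>R dir k)) + (LI p. f p * pd j g p))"
      using test_ibp[OF f ts[OF g], of j "t n *\<^sub>R dir k"] test_ibp[OF f g, of j] by (simp add: pds[OF g])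
    also have "\<dots> = - ((1 / t n) * ((LI p. f p * pd j g (p + t n *\<^sub>R dir k)) - (LI p. f p * pd j g p)))"
      by (simp add: algebra_simps)
    also have "\<dots> = - (LI p. (1 / t n) * (f p * pd j g (p + t n *\<^sub>R dir k) - f p * pd j g p))"
      by (subst integral_mult_right_zero, subst int_diff) (auto intro!: ii test_pd ts f g)
    also have "(LI p. (1 / t n) * (f p * pd j g (p + t n *\<^sub>R dir k) - f p * pd j g p)) = (LI p. f p * dq (pd j g) n p)"
      by (rule int_cong) (auto simp: dq_def field_simps)
    finally show ?thesis .
  qed
  have l1: "(\<lambda>n. LI p. pd j f p * dq g n p) ~~> (LI p. pd j f p * pd k g p)"
    by (rule dqlim[OF test_pd[OF f] g])
  have l2: "(\<lambda>n. LI p. pd j f p * dq g n p) ~~> - (LI p. f p * pd k (pd j g) p)"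
    unfolding A by (intro tendsto_intros dqlim f test_pd g)
  have "(LI p. pd j f p * pd k g p) = - (LI p. f p * pd k (pd j g) p)"
    using LIMSEQ_unique[OF l1 l2] .
  then show ?thesis using test_ibp[OF f test_pd[OF g], of k j] by simp
qed

section \<open>Complex vector algebra\<close>

lemma norm_vsmult: "norm (c *s (v :: complex^3)) = norm c * norm v"
  by (simp add: norm_vec_def norm_mult L2_set_right_distrib)

lemma bb_vsmult: "bounded_bilinear ((*s) :: complex => complex^3 => complex^3)"
proof
  show "\<exists>K. \<forall>a b. norm (a *s (b :: complex^3)) <= norm a * norm b * K" by (rule exI[of _ 1]) (simp add: norm_vsmult)
qed (auto simp: vec_eq_iff algebra_simps)

lemma meas_vsmult:
  "c \<in> borel_measurable M ==> v \<in> borel_measurable M ==> (\<lambda>p. c p *s (v p :: complex^3)) \<in> borel_measurable M"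
proof -
  assume a: "c \<in> borel_measurable M" "v \<in> borel_measurable M"
  interpret bounded_bilinear "(*s) :: complex => complex^3 => complex^3" by (rule bb_vsmult)
  have "continuous_on UNIV (\<lambda>x :: complex \<times> (complex^3). fst x *s snd x)"
    by (intro continuous_on continuous_on_fst continuous_on_snd continuous_on_id)
  from borel_measurable_continuous_Pair[OF a, of "\<lambda>x y. x *s y"] this
  show ?thesis by (simp add: case_prod_beta)
qed

lemma inner_vsmult_left: "(c *s v) \<bullet> (w :: complex^3) = v \<bullet> (cnj c *s w)"
  by (simp add: inner_vec_def inner_complex_def sum_3 algebra_simps)

definition crs :: "complex^3 => complex^3 => complex^3" where
  "crs a b = (\<chi> i. a $ nxt i * b $ nxt (nxt i) - a $ nxt (nxt i) * b $ nxt i)"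

text \<open>Bilinear, without conjugation: with a wave vector as first argument it is, up to the
  factor i, the symbol of the divergence, as \<open>crs\<close> is that of the curl.\<close>

definition dot3 :: "complex^3 => complex^3 => complex" where
  "dot3 a b = (\<Sum>i\<in>UNIV. a $ i * b $ i)"

definition rvec :: "complex^3 => bool" where "rvec k \<longleftrightarrow> (\<forall>i. Im (k $ i) = 0)"

lemma nxt_simps [simp]: "nxt 1 = 2" "nxt 2 = 3" "nxt 3 = 1"
  by (auto simp: nxt_def)

lemma crs_simps [simp]: "crs a b $ 1 = a $ 2 * b $ 3 - a $ 3 * b $ 2" "crs a b $ 2 = a $ 3 * b $ 1 - a $ 1 * b $ 3"
  "crs a b $ 3 = a $ 1 * b $ 2 - a $ 2 * b $ 1"
  by (simp_all add: crs_def)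

lemma vec3_eq: "(v :: complex^3) = w \<longleftrightarrow> v $ 1 = w $ 1 & v $ 2 = w $ 2 & v $ 3 = w $ 3"
  by (simp add: vec_eq_iff forall_3)

lemma inner3: "(v :: complex^3) \<bullet> w = Re (v$1) * Re (w$1) + Im (v$1) * Im (w$1) + Re (v$2) * Re (w$2) + Im (v$2) * Im (w$2)
   + Re (v$3) * Re (w$3) + Im (v$3) * Im (w$3)"
  by (simp add: inner_vec_def inner_complex_def sum_3)

lemma norm3_sq: "(norm (v :: complex^3))\<^sup>2 = (Re (v$1))\<^sup>2 + (Im (v$1))\<^sup>2 + (Re (v$2))\<^sup>2 + (Im (v$2))\<^sup>2 + (Re (v$3))\<^sup>2 + (Im (v$3))\<^sup>2"
  unfolding power2_norm_eq_inner inner3 by (simp add: power2_eq_square)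

lemma lagrange_identity:
  fixes k1 k2 k3 x1 x2 x3 :: real
  shows "(k2 * x3 - k3 * x2)\<^sup>2 + (k3 * x1 - k1 * x3)\<^sup>2 + (k1 * x2 - k2 * x1)\<^sup>2 + (k1 * x1 + k2 * x2 + k3 * x3)\<^sup>2
    = (k1\<^sup>2 + k2\<^sup>2 + k3\<^sup>2) * (x1\<^sup>2 + x2\<^sup>2 + x3\<^sup>2)"
  by algebra

text \<open>Lagrange's identity for the real and the imaginary part of \<open>a\<close> separately,
  which works because \<open>k\<close> is real. It shows that curl and divergence of one mode
  together control the full gradient.\<close>

lemma crs_dot_norm:
  assumes "rvec k"
  shows "(norm (crs k a))\<^sup>2 + (norm (dot3 k a))\<^sup>2 = (norm k)\<^sup>2 * (norm a)\<^sup>2"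
proof -
  have im: "Im (k $ i) = 0" for i using assms by (simp add: rvec_def)
  have "(norm (crs k a))\<^sup>2 + (norm (dot3 k a))\<^sup>2
    = ((Re (k$2) * Re (a$3) - Re (k$3) * Re (a$2))\<^sup>2 + (Re (k$3) * Re (a$1) - Re (k$1) * Re (a$3))\<^sup>2
        + (Re (k$1) * Re (a$2) - Re (k$2) * Re (a$1))\<^sup>2 + (Re (k$1) * Re (a$1) + Re (k$2) * Re (a$2) + Re (k$3) * Re (a$3))\<^sup>2)
    + ((Re (k$2) * Im (a$3) - Re (k$3) * Im (a$2))\<^sup>2 + (Re (k$3) * Im (a$1) - Re (k$1) * Im (a$3))\<^sup>2
        + (Re (k$1) * Im (a$2) - Re (k$2) * Im (a$1))\<^sup>2 + (Re (k$1) * Im (a$1) + Re (k$2) * Im (a$2) + Re (k$3) * Im (a$3))\<^sup>2)"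
    unfolding norm3_sq cmod_power2 dot3_def sum_3 by (simp add: im)
  also have "\<dots> = (norm k)\<^sup>2 * (norm a)\<^sup>2"
    unfolding lagrange_identity norm3_sq by (simp add: im) (simp add: distrib_left)
  finally show ?thesis .
qed

lemma norm_crs_le:
  assumes "rvec k"
  shows "norm (crs k a) <= norm k * norm a"
proof (rule power2_le_imp_le)
  show "(norm (crs k a))\<^sup>2 <= (norm k * norm a)\<^sup>2"
    unfolding power_mult_distrib using crs_dot_norm[OF assms, of a] zero_le_power2[of "norm (dot3 k a)"] by linarith
qed simp

lemma crs_real_inner: "rvec k ==> crs k a \<bullet> b = - (a \<bullet> crs k b)"
  by (simp add: inner3 rvec_def algebra_simps)

text \<open>The factor i turns the antisymmetric map a -> k x a into a symmetric one: this is the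
  symmetry of the curl on a single mode.\<close>

lemma crs_imag_inner: "rvec k ==> (\<i> *s crs k a) \<bullet> b = a \<bullet> (\<i> *s crs k b)"
  by (simp add: inner3 rvec_def algebra_simps)

section \<open>Lattice geometry and unfolding\<close>

locale qp =
  fixes a1 a2 \<alpha> :: "real^2"
  assumes det1: "\<bar>a1 $ 1 * a2 $ 2 - a1 $ 2 * a2 $ 1\<bar> = 1"
begin

definition "dt = a1 $ 1 * a2 $ 2 - a1 $ 2 * a2 $ 1"
text \<open>The dual basis of \<open>a1\<close>, \<open>a2\<close>. The factor \<open>dt\<close>
  stands where one divides by the determinant, since its square is 1.\<close>

definition w1 :: "real^2" where "w1 = vector [a2 $ 2 * dt, - a2 $ 1 * dt]"
definition w2 :: "real^2" where "w2 = vector [- a1 $ 2 * dt, a1 $ 1 * dt]"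
definition gm :: "int \<times> int => pt" where "gm k = (of_int (fst k) *\<^sub>R a1 + of_int (snd k) *\<^sub>R a2, 0)"
definition ph :: "int \<times> int => complex" where "ph k = cis (\<alpha> \<bullet> fst (gm k))"
definition "Y = Yinf a1 a2"
text \<open>Growing finite squares of lattice indices. Lattice sums are cut down to one of them, so
  that no convergence question arises.\<close>

definition Sq :: "nat => (int \<times> int) set" where "Sq N = {- int N..int N} \<times> {- int N..int N}"

lemma dt2: "dt * dt = 1"
  using det1 by (metis dt_def abs_mult_self_eq mult_1)

lemma dual [simp]: "w1 \<bullet> a1 = 1" "w1 \<bullet> a2 = 0" "w2 \<bullet> a1 = 0" "w2 \<bullet> a2 = 1"
proof -
  have "w1 \<bullet> a1 = dt * dt" "w2 \<bullet> a2 = dt * dt"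
    unfolding dt_def w1_def w2_def by (simp_all add: inner_vec_def sum_2 algebra_simps dt_def)
  then show "w1 \<bullet> a1 = 1" "w2 \<bullet> a2 = 1" by (simp_all add: dt2)
qed (simp_all add: w1_def w2_def inner_vec_def sum_2 algebra_simps)

lemma coord: "x = (w1 \<bullet> x) *\<^sub>R a1 + (w2 \<bullet> x) *\<^sub>R a2"
proof -
  have "((w1 \<bullet> x) *\<^sub>R a1 + (w2 \<bullet> x) *\<^sub>R a2) $ i = dt * (a1 $ 1 * a2 $ 2 - a1 $ 2 * a2 $ 1) * x $ i" for i
    using exhaust_2[of i] by (auto simp: w1_def w2_def inner_vec_def sum_2 algebra_simps)
  then have "((w1 \<bullet> x) *\<^sub>R a1 + (w2 \<bullet> x) *\<^sub>R a2) $ i = x $ i" for i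
    unfolding dt_def[symmetric] dt2 by simp
  then show ?thesis unfolding vec_eq_iff by simp
qed

lemma cell_eq: "cell a1 a2 = {x. 0 <= w1 \<bullet> x & w1 \<bullet> x < 1 & 0 <= w2 \<bullet> x & w2 \<bullet> x < 1}"
proof (intro subset_antisym subsetI)
  fix x assume "x \<in> {x. 0 <= w1 \<bullet> x & w1 \<bullet> x < 1 & 0 <= w2 \<bullet> x & w2 \<bullet> x < 1}"
  then show "x \<in> cell a1 a2" using coord[of x] unfolding cell_def by blast
qed (auto simp: cell_def inner_add_right)

lemma Y_iff: "p \<in> Y \<longleftrightarrow> 0 <= w1 \<bullet> fst p & w1 \<bullet> fst p < 1 & 0 <= w2 \<bullet> fst p & w2 \<bullet> fst p < 1"
  by (cases p) (simp add: Y_def Yinf_def cell_eq)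

lemma gm_coord [simp]: "w1 \<bullet> fst (p + gm k) = w1 \<bullet> fst p + of_int (fst k)" "w2 \<bullet> fst (p + gm k) = w2 \<bullet> fst p + of_int (snd k)"
  "w1 \<bullet> fst (p - gm k) = w1 \<bullet> fst p - of_int (fst k)" "w2 \<bullet> fst (p - gm k) = w2 \<bullet> fst p - of_int (snd k)"
  "snd (p + gm k) = snd p" "snd (p - gm k) = snd p"
  by (simp_all add: gm_def inner_add_right inner_diff_right)

lemma gm_add: "gm (k + l) = gm k + gm l"
  by (simp add: gm_def scaleR_add_left)

lemma gm_minus: "gm (- k) = - gm k"
  by (simp add: gm_def)

lemma gm_diff: "gm (k - l) = gm k - gm l"
  by (simp add: gm_def scaleR_diff_left)

lemma ph_minus: "ph (- k) = cnj (ph k)"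
  by (simp add: ph_def gm_minus cis_cnj)

lemma ph_add: "ph (k + l) = ph k * ph l"
  by (simp add: ph_def gm_add inner_add_right cis_mult)

lemma ph_norm [simp]: "norm (ph k) = 1"
  by (simp add: ph_def)

lemma lat_eq: "lat a1 a2 = range (\<lambda>k. fst (gm k))"
proof (intro subset_antisym subsetI)
  fix x assume "x \<in> lat a1 a2"
  then obtain m n where "x = of_int m *\<^sub>R a1 + of_int n *\<^sub>R a2" by (auto simp: lat_def)
  then show "x \<in> range (\<lambda>k. fst (gm k))" by (intro image_eqI[of _ _ "(m, n)"]) (auto simp: gm_def)
qed (auto simp: lat_def gm_def)

text \<open>The cell is half-open in both dual coordinates, so the pair of integer parts is the only
  index that works.\<close>

lemma Y_shift_iff: "p - gm k \<in> Y \<longleftrightarrow> k = (\<lfloor>w1 \<bullet> fst p\<rfloor>, \<lfloor>w2 \<bullet> fst p\<rfloor>)"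
  unfolding Y_iff gm_coord by (cases k) (auto simp: floor_eq_iff; linarith)

lemma Y_meas: "Y \<in> sets borel"
proof -
  have "Y = {p. 0 <= w1 \<bullet> fst p} \<inter> {p. w1 \<bullet> fst p < 1} \<inter> {p. 0 <= w2 \<bullet> fst p} \<inter> {p. w2 \<bullet> fst p < 1}"
    by (auto simp: Y_iff)
  moreover have "closed {p::pt. 0 <= v \<bullet> fst p}" "open {p::pt. v \<bullet> fst p < 1}" for v
    by (intro closed_Collect_le open_Collect_less continuous_intros)+
  ultimately show ?thesis by auto
qed

lemma Y_sets [measurable]: "Y \<in> sets lebesgue"
  using Y_meas by simp

lemma indY_meas [measurable]: "(indicator Y :: pt => real) \<in> Lmeas"
  by (intro borel_measurable_indicator Y_sets)

lemma bounded_coords: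
  fixes B :: "pt set"
  assumes "bounded B"
  obtains N where "!!p. p \<in> B ==> \<bar>w1 \<bullet> fst p\<bar> <= real N & \<bar>w2 \<bullet> fst p\<bar> <= real N"
proof -
  obtain R where R: "!!p. p \<in> B ==> norm p <= R" using assms by (auto simp: bounded_iff)
  obtain N :: nat where N: "norm w1 * \<bar>R\<bar> <= real N" "norm w2 * \<bar>R\<bar> <= real N"
    using real_arch_simple[of "max (norm w1 * \<bar>R\<bar>) (norm w2 * \<bar>R\<bar>)"] by auto
  have "\<bar>w \<bullet> fst p\<bar> <= norm w * \<bar>R\<bar>" if "p \<in> B" for p w
  proof -
    have "norm (fst p) <= \<bar>R\<bar>" using R[OF that] norm_fst_le[of "fst p" "snd p"] by simp
    then show ?thesis using Cauchy_Schwarz_ineq2[of w "fst p"] by (meson mult_left_mono norm_ge_zero order_trans)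
  qed
  then show ?thesis using that[of N] N by (meson order_trans)
qed

lemma floor_Sq: "\<bar>x\<bar> <= real N ==> \<bar>y\<bar> <= real N ==> (\<lfloor>x\<rfloor>, \<lfloor>y\<rfloor>) \<in> Sq N"
  by (auto simp: Sq_def le_floor_iff floor_le_iff abs_le_iff)

lemma finite_Sq [simp]: "finite (Sq N)"
  by (simp add: Sq_def)

lemma Sq_minus: "uminus ` Sq N = Sq N"
proof -
  have "k \<in> uminus ` Sq N" if "k \<in> Sq N" for k
    using that by (intro image_eqI[of _ _ "- k"]) (auto simp: Sq_def)
  then show ?thesis by (auto simp: Sq_def)
qed

text \<open>Exactly one translate of the cell contains \<open>p\<close>, so one summand survives;
  the bound on the dual coordinates puts its index into \<open>Sq N\<close>.\<close>

lemma decomp: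
  fixes f :: "pt => 'b::real_vector"
  assumes "!!p. f p ~= 0 ==> \<bar>w1 \<bullet> fst p\<bar> <= real N & \<bar>w2 \<bullet> fst p\<bar> <= real N"
  shows "f p = (\<Sum>k\<in>Sq N. indicator Y (p - gm k) *\<^sub>R f p)"
proof (cases "f p = 0")
  case False
  let ?k = "(\<lfloor>w1 \<bullet> fst p\<rfloor>, \<lfloor>w2 \<bullet> fst p\<rfloor>)"
  have k: "?k \<in> Sq N" using assms[OF False] floor_Sq by blast
  have "(\<Sum>k\<in>Sq N. indicator Y (p - gm k) *\<^sub>R f p) = (\<Sum>k\<in>{?k}. indicator Y (p - gm k) *\<^sub>R f p)"
    using k by (intro sum.mono_neutral_right) (auto simp: indicator_def Y_shift_iff)
  then show ?thesis by (simp add: indicator_def Y_shift_iff)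
qed simp

lemma ind_integrable:
  fixes f :: "pt => 'b::{banach, second_countable_topology}"
  shows "Lint f ==> Lint (\<lambda>p. indicator Y p *\<^sub>R f p)"
  using integrable_mult_indicator[OF Y_sets] .

text \<open>The pieces of \<open>f\<close> on the translates of the cell are moved back to the cell
  one by one. Only the horizontal extent of \<open>f\<close> has to be bounded, which keeps the sum
  finite.\<close>

lemma unfold_integral:
  fixes f :: "pt => 'b::{banach, second_countable_topology}"
  assumes "Lint f"
    and "!!p. f p ~= 0 ==> \<bar>w1 \<bullet> fst p\<bar> <= real N & \<bar>w2 \<bullet> fst p\<bar> <= real N"
  shows "(LI p. f p) = (LI p. indicator Y p *\<^sub>R (\<Sum>k\<in>Sq N. f (p + gm k)))"
proof -
  have i: "Lint (\<lambda>p. indicator Y p *\<^sub>R f (p + gm k))" for k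
    by (rule ind_integrable[OF integrable_shift[OF assms(1)]])
  have i': "Lint (\<lambda>p. indicator Y (p - gm k) *\<^sub>R f p)" for k
    using integrable_shift[OF i[of k], of "- gm k"] by simp
  have "(LI p. f p) = (LI p. (\<Sum>k\<in>Sq N. indicator Y (p - gm k) *\<^sub>R f p))"
    by (rule int_cong) (use decomp[OF assms(2)] in auto)
  also have "\<dots> = (\<Sum>k\<in>Sq N. LI p. indicator Y (p - gm k) *\<^sub>R f p)"
    by (rule int_sum) (rule i')
  also have "\<dots> = (\<Sum>k\<in>Sq N. LI p. indicator Y p *\<^sub>R f (p + gm k))"
  proof (rule sum.cong[OF refl])
    fix k
    have "(LI p. indicator Y ((p + gm k) - gm k) *\<^sub>R f (p + gm k)) = (LI p. indicator Y (p - gm k) *\<^sub>R f p)"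
      by (rule integral_shift[of "\<lambda>p. indicator Y (p - gm k) *\<^sub>R f p"]) (rule borel_measurable_integrable[OF i'])
    then show "(LI p. indicator Y (p - gm k) *\<^sub>R f p) = (LI p. indicator Y p *\<^sub>R f (p + gm k))" by simp
  qed
  also have "\<dots> = (LI p. (\<Sum>k\<in>Sq N. indicator Y p *\<^sub>R f (p + gm k)))"
    by (rule int_sum[symmetric]) (rule i)
  finally show ?thesis by (simp add: scaleR_sum_right)
qed

section \<open>The space of quasi-periodic fields\<close>

definition L2 :: "field set" where "L2 = {f. L2q a1 a2 \<alpha> f}"

lemma meas_ind_normsq: "f \<in> Lmeas ==> (\<lambda>p. indicator Y p * (norm (f p :: complex^3))\<^sup>2) \<in> Lmeas"
  by (intro borel_measurable_times indY_meas) measurable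

text \<open>Periodicity is what lets multiplication preserve quasi-periodicity. No sign is imposed,
  because derivatives of cutoffs serve as weights too.\<close>

definition wt :: "(pt => real) => bool" where
  "wt w \<longleftrightarrow> w \<in> Lmeas & (\<forall>p k. w (p + gm k) = w p) & (\<exists>M. \<forall>p. \<bar>w p\<bar> <= M)"

text \<open>The inner product of \<open>complex^3\<close> is real valued, so this is the real part
  of the Hermitian product over the cell; its imaginary part is recovered by pairing with a multiple
  of i.\<close>

definition ip :: "(pt => real) => field => field => real" where
  "ip w f g = (LI p. indicator Y p * w p * (f p \<bullet> g p))"

abbreviation "ip1 \<equiv> ip (\<lambda>p. 1)"

lemma L2D: "f \<in> L2 ==> f \<in> Lmeas" "f \<in> L2 ==> f (p + gm k) = ph k *s f p"
  "f \<in> L2 ==> Lint (\<lambda>p. indicator Y p * (norm (f p))\<^sup>2)"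
proof -
  assume f: "f \<in> L2"
  show "f \<in> Lmeas" "Lint (\<lambda>p. indicator Y p * (norm (f p))\<^sup>2)"
    using f by (auto simp: L2_def L2q_def Y_def)
  have "fst (gm k) \<in> lat a1 a2" by (simp add: lat_eq)
  then have "f (p + (fst (gm k), 0)) = ph k *s f p" using f unfolding L2_def L2q_def ph_def by blast
  moreover have "(fst (gm k), 0) = gm k" by (simp add: gm_def)
  ultimately show "f (p + gm k) = ph k *s f p" by simp
qed

lemma L2I:
  assumes "f \<in> Lmeas" "!!p k. f (p + gm k) = ph k *s f p"
    "Lint (\<lambda>p. indicator Y p * (norm (f p))\<^sup>2)"
  shows "f \<in> L2"
proof -
  have "f (p + (\<gamma>, 0)) = cis (\<alpha> \<bullet> \<gamma>) *s f p" if g: "\<gamma> \<in> lat a1 a2" for p \<gamma>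
  proof -
    obtain k where k: "\<gamma> = fst (gm k)" using g by (auto simp: lat_eq)
    then have e: "gm k = (\<gamma>, 0)" by (simp add: gm_def)
    show ?thesis using assms(2)[of p k] unfolding ph_def e by simp
  qed
  then show ?thesis using assms(1,3) unfolding L2_def L2q_def Y_def by blast
qed

lemma norm_shift: "f \<in> L2 ==> norm (f (p + gm k)) = norm (f p)"
  by (simp add: L2D(2) norm_vsmult)

lemma wtD: "wt w ==> w \<in> Lmeas" "wt w ==> w (p + gm k) = w p" "wt w ==> \<exists>M\<ge>0. \<forall>p. \<bar>w p\<bar> <= M"
  unfolding wt_def by (blast, blast) (metis abs_ge_zero order_trans)

lemma wt_const [simp]: "wt (\<lambda>p. c)"
  by (auto simp: wt_def)

lemma L2_bound:
  assumes g: "g \<in> Lmeas" "!!p k. g (p + gm k) = ph k *s g p"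
    and f: "f \<in> L2" and bd: "!!p. norm (g p) <= M * norm (f p)"
  shows "g \<in> L2"
proof (rule L2I[OF g])
  have "Lint (\<lambda>p. M\<^sup>2 * (indicator Y p * (norm (f p))\<^sup>2))"
    by (intro integrable_mult_right L2D f)
  then show "Lint (\<lambda>p. indicator Y p * (norm (g p))\<^sup>2)"
  proof (rule Lint_bound)
    show "AE p in lebesgue. norm (indicator Y p * (norm (g p))\<^sup>2) <= norm (M\<^sup>2 * (indicator Y p * (norm (f p))\<^sup>2))"
    proof (intro always_eventually allI)
      fix p
      have "(norm (g p))\<^sup>2 <= (M * norm (f p))\<^sup>2" using bd by (intro power_mono) auto
      then show "norm (indicator Y p * (norm (g p))\<^sup>2) <= norm (M\<^sup>2 * (indicator Y p * (norm (f p))\<^sup>2))"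
        by (simp add: indicator_def power_mult_distrib)
    qed
  qed (rule meas_ind_normsq[OF g(1)])
qed

lemma L2_wt: "f \<in> L2 ==> wt w ==> (\<lambda>p. w p *\<^sub>R f p) \<in> L2"
proof -
  assume f: "f \<in> L2" and w: "wt w"
  obtain M where "!!p. \<bar>w p\<bar> <= M" using wtD(3)[OF w] by blast
  then show ?thesis
    using f w by (intro L2_bound[OF _ _ f, of _ M] borel_measurable_scaleR)
      (auto simp: L2D wtD vec_eq_iff intro!: mult_right_mono)
qed

lemma L2_smult: "f \<in> L2 ==> (\<lambda>p. c *s f p) \<in> L2"
  by (rule L2_bound[of _ f "norm c"])
    (auto simp: L2D norm_vsmult mult_ac vec_eq_iff intro!: meas_vsmult borel_measurable_const)

lemma L2_add: "f \<in> L2 ==> g \<in> L2 ==> (\<lambda>p. f p + g p) \<in> L2"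
proof -
  assume f: "f \<in> L2" and g: "g \<in> L2"
  show ?thesis
  proof (rule L2I)
    show m: "(\<lambda>p. f p + g p) \<in> Lmeas" using f g by (intro borel_measurable_add L2D)
    show "f (p + gm k) + g (p + gm k) = ph k *s (f p + g p)" for p k
      using L2D(2)[OF f] L2D(2)[OF g] by (simp add: vector_add_ldistrib)
    have "Lint (\<lambda>p. 2 * (indicator Y p * (norm (f p))\<^sup>2) + 2 * (indicator Y p * (norm (g p))\<^sup>2))"
      by (intro Lint_add integrable_mult_right L2D f g)
    then show "Lint (\<lambda>p. indicator Y p * (norm (f p + g p))\<^sup>2)"
    proof (rule Lint_bound)
      show "AE p in lebesgue. norm (indicator Y p * (norm (f p + g p))\<^sup>2) <= norm (2 * (indicator Y p * (norm (f p))\<^sup>2) + 2 * (indicator Y p * (norm (g p))\<^sup>2))"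
      proof (intro always_eventually allI)
        fix p
        have "(norm (f p + g p))\<^sup>2 <= (norm (f p) + norm (g p))\<^sup>2" by (intro power_mono norm_triangle_ineq) auto
        also have "\<dots> <= 2 * (norm (f p))\<^sup>2 + 2 * (norm (g p))\<^sup>2"
          using sum_squares_bound[of "norm (f p)" "norm (g p)"] by (simp add: power2_sum)
        finally show "norm (indicator Y p * (norm (f p + g p))\<^sup>2) <= norm (2 * (indicator Y p * (norm (f p))\<^sup>2) + 2 * (indicator Y p * (norm (g p))\<^sup>2))"
          by (simp add: indicator_def)
      qed
    qed (rule meas_ind_normsq[OF m])
  qed
qed

lemma L2_scaleR: "f \<in> L2 ==> (\<lambda>p. r *\<^sub>R f p) \<in> L2"
  using L2_wt[of f "\<lambda>_. r"] by simp

lemma L2_sub: "subspace L2"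
proof (rule subspaceI)
  have "(\<lambda>p. 0) \<in> L2" by (rule L2I) auto
  then show "0 \<in> L2" by (simp add: zero_fun_def)
  show "f + g \<in> L2" if "f \<in> L2" "g \<in> L2" for f g using L2_add[OF that] by (simp add: plus_fun_def)
  show "c *\<^sub>R f \<in> L2" if "f \<in> L2" for c f using L2_scaleR[OF that] by (simp add: scaleR_fun_def)
qed

lemma ip_integrable:
  assumes f: "f \<in> L2" and g: "g \<in> L2" and w: "wt w"
  shows "Lint (\<lambda>p. indicator Y p * w p * (f p \<bullet> g p))"
proof -
  obtain M where M: "M >= 0" "!!p. \<bar>w p\<bar> <= M" using wtD(3)[OF w] by blast
  have "Lint (\<lambda>p. M * (indicator Y p * (norm (f p))\<^sup>2 + indicator Y p * (norm (g p))\<^sup>2))"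
    by (intro Lint_add integrable_mult_right L2D f g)
  then show ?thesis
  proof (rule Lint_bound)
    show "AE p in lebesgue. norm (indicator Y p * w p * (f p \<bullet> g p)) <= norm (M * (indicator Y p * (norm (f p))\<^sup>2 + indicator Y p * (norm (g p))\<^sup>2))"
    proof (intro always_eventually allI)
      fix p
      have "\<bar>f p \<bullet> g p\<bar> <= norm (f p) * norm (g p)" by (rule Cauchy_Schwarz_ineq2)
      also have "\<dots> <= (norm (f p))\<^sup>2 + (norm (g p))\<^sup>2"
        using sum_squares_bound[of "norm (f p)" "norm (g p)"] zero_le_power2[of "norm (f p)"] zero_le_power2[of "norm (g p)"] by linarith
      finally have "\<bar>w p\<bar> * \<bar>f p \<bullet> g p\<bar> <= M * ((norm (f p))\<^sup>2 + (norm (g p))\<^sup>2)"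
        using M by (intro mult_mono) auto
      then show "norm (indicator Y p * w p * (f p \<bullet> g p)) <= norm (M * (indicator Y p * (norm (f p))\<^sup>2 + indicator Y p * (norm (g p))\<^sup>2))"
        using M(1) by (simp add: indicator_def abs_mult)
    qed
  qed (intro borel_measurable_times indY_meas borel_measurable_inner L2D wtD f g w)
qed

lemma semi_ip_L2:
  assumes w: "wt w" "!!p. 0 <= w p"
  shows "semi_ip L2 (ip w)"
proof
  show "subspace L2" by (rule L2_sub)
  show "ip w f g = ip w g f" for f g by (simp add: ip_def inner_commute)
  show "ip w (f + g) h = ip w f h + ip w g h" if "f \<in> L2" "g \<in> L2" "h \<in> L2" for f g h
  proof -
    have "ip w (f + g) h = (LI p. indicator Y p * w p * (f p \<bullet> h p) + indicator Y p * w p * (g p \<bullet> h p))"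
      unfolding ip_def by (rule int_cong) (auto simp: inner_add_left algebra_simps)
    also have "\<dots> = ip w f h + ip w g h"
      unfolding ip_def by (rule int_add) (intro ip_integrable that w)+
    finally show ?thesis .
  qed
  show "ip w (c *\<^sub>R f) h = c * ip w f h" if "f \<in> L2" "h \<in> L2" for f h c
  proof -
    have "ip w (c *\<^sub>R f) h = (LI p. c * (indicator Y p * w p * (f p \<bullet> h p)))"
      unfolding ip_def by (rule int_cong) auto
    then show ?thesis unfolding ip_def by simp
  qed
  show "0 <= ip w f f" if "f \<in> L2" for f
    unfolding ip_def using w by (intro integral_nonneg_AE always_eventually allI mult_nonneg_nonneg) auto
qed

section \<open>Completeness of the space of quasi-periodic fields\<close>

sublocale L: semi_ip L2 ip1
  by (rule semi_ip_L2) auto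

text \<open>A sequence with geometrically decreasing gaps converges almost everywhere on the cell; the pointwise
  limit inherits quasi-periodicity at every point.\<close>

lemma fast_limit:
  assumes X: "!!n. X n \<in> L2" and fast: "!!n. ip1 (X (Suc n) - X n) (X (Suc n) - X n) <= (1/4)^n"
  obtains x where "x \<in> Lmeas" "!!p k. x (p + gm k) = ph k *s x p"
    "AE p in lebesgue. p \<in> Y --> (\<lambda>n. X n p) ~~> x p"
proof -
  \<comment> \<open>Weighted by 2^n the integrals of \<open>d n\<close> are still summable, since
    2^n / 4^n = 2^-n. Where the weighted sum is finite, the gaps decay like 2^(-n/2).\<close>
  define d where "d n p = indicator Y p * (norm (X (Suc n) p - X n p))\<^sup>2" for n p
  have dm: "d n \<in> Lmeas" for n
    unfolding d_def by (intro meas_ind_normsq borel_measurable_diff L2D X)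
  have d0: "0 <= d n p" for n p by (simp add: d_def)
  have di: "Lint (d n)" and de: "(LI p. d n p) <= (1/4)^n" for n
  proof -
    have "X (Suc n) - X n \<in> L2" using X by auto
    from ip_integrable[OF this this wt_const[of 1]] show "Lint (d n)"
      by (simp add: d_def[abs_def] power2_norm_eq_inner)
    show "(LI p. d n p) <= (1/4)^n"
      using fast[of n] by (simp add: d_def ip_def power2_norm_eq_inner)
  qed
  have "(\<integral>\<^sup>+p. (\<Sum>n. ennreal (2 ^ n * d n p)) \<partial>lebesgue) = (\<Sum>n. \<integral>\<^sup>+p. ennreal (2 ^ n * d n p) \<partial>lebesgue)"
    using dm by (intro nn_integral_suminf) measurable
  also have "\<dots> <= (\<Sum>n. ennreal ((1/2) ^ n))"
  proof (intro suminf_le allI)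
    fix n
    have "(\<integral>\<^sup>+p. ennreal (2 ^ n * d n p) \<partial>lebesgue) = ennreal (LI p. 2 ^ n * d n p)"
      using di d0 by (intro nn_integral_eq_integral) auto
    also have "(LI p. 2 ^ n * d n p) = 2 ^ n * (LI p. d n p)" by simp
    also have "\<dots> <= 2 ^ n * (1/4)^n" using de by (intro mult_left_mono) auto
    also have "\<dots> = (1/2)^n" by (simp flip: power_mult_distrib)
    finally show "(\<integral>\<^sup>+p. ennreal (2 ^ n * d n p) \<partial>lebesgue) <= ennreal ((1/2) ^ n)" by (simp add: ennreal_leI)
  qed auto
  also have "\<dots> = ennreal (\<Sum>n. (1/2) ^ n)" by (intro suminf_ennreal2) (auto intro: summable_geometric)
  finally have "(\<integral>\<^sup>+p. (\<Sum>n. ennreal (2 ^ n * d n p)) \<partial>lebesgue) ~= \<infinity>"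
    by (metis ennreal_neq_top infinity_ennreal_def neq_top_trans)
  then have fin: "AE p in lebesgue. (\<Sum>n. ennreal (2 ^ n * d n p)) ~= \<infinity>"
    by (rule nn_integral_noteq_infinite[rotated]) (use dm in measurable)
  have conv: "convergent (\<lambda>n. X n p)" if p: "p \<in> Y" and s: "(\<Sum>n. ennreal (2 ^ n * d n p)) ~= \<infinity>" for p
  proof -
    define C where "C = enn2real (\<Sum>n. ennreal (2 ^ n * d n p))"
    have C: "(\<Sum>n. ennreal (2 ^ n * d n p)) = ennreal C" "0 <= C"
      using s by (simp_all add: C_def top.not_eq_extremum)
    have le: "norm (X (Suc n) p - X n p) <= sqrt C * (sqrt (1/2)) ^ n" for n
    proof -
      have "ennreal (2 ^ n * d n p) <= (\<Sum>n. ennreal (2 ^ n * d n p))"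
        using sum_le_suminf[of "\<lambda>n. ennreal (2 ^ n * d n p)" "{n}"] by simp
      then have "2 ^ n * d n p <= C" using C by (simp add: ennreal_le_iff)
      then have "(norm (X (Suc n) p - X n p))\<^sup>2 <= C * (1/2)^n" using p by (simp add: d_def power_divide field_simps)
      then have "norm (X (Suc n) p - X n p) <= sqrt (C * (1/2)^n)" by (rule real_le_rsqrt)
      then show ?thesis by (simp add: real_sqrt_mult real_sqrt_power)
    qed
    have "summable (\<lambda>n. sqrt C * (sqrt (1/2)) ^ n)"
      by (intro summable_mult summable_geometric) (simp add: real_sqrt_divide)
    then have "summable (\<lambda>n. X (Suc n) p - X n p)"
      by (rule summable_comparison_test'[where N=0]) (use le in auto)
    then have "convergent (\<lambda>n. \<Sum>i<n. X (Suc i) p - X i p)" by (simp add: summable_iff_convergent)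
    then have "convergent (\<lambda>n. X n p - X 0 p)" unfolding sum_lessThan_telescope[of "\<lambda>i. X i p"] .
    then have "convergent (\<lambda>n. (X n p - X 0 p) + X 0 p)" by (intro convergent_add convergent_const)
    then show ?thesis by simp
  qed
  \<comment> \<open>The value 0 is taken where the sequence diverges. That set is invariant under
    lattice translations, so quasi-periodicity has no exceptional points.\<close>
  define x where "x p = (if convergent (\<lambda>n. X n p) then lim (\<lambda>n. X n p) else 0)" for p
  have Xm: "X n \<in> Lmeas" for n using X L2D by blast
  have "(\<lambda>p. lim (\<lambda>n. X n p)) \<in> Lmeas" by (intro borel_measurable_lim_metric Xm)
  moreover have "{p \<in> space lebesgue. convergent (\<lambda>n. X n p)} \<in> sets lebesgue"
    using sets_Collect_Cauchy[of X lebesgue, OF Xm] by (simp add: Cauchy_convergent_iff)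
  ultimately have xm: "x \<in> Lmeas"
    unfolding x_def by (intro measurable_If borel_measurable_const)
  have xq: "x (p + gm k) = ph k *s x p" for p k
  proof -
    interpret bounded_bilinear "(*s) :: complex => complex^3 => complex^3" by (rule bb_vsmult)
    have tr: "(\<lambda>n. c *s Z n) ~~> c *s z" if "Z ~~> z" for c z and Z :: "nat => complex^3"
      using tendsto[OF tendsto_const that] .
    have e: "(\<lambda>n. X n (p + gm k)) = (\<lambda>n. ph k *s X n p)" using L2D(2)[OF X] by simp
    have pn: "cnj (ph k) * ph k = 1" using complex_mult_cnj[of "ph k"] by (simp add: ph_def cis_cnj cis_mult)
    show ?thesis
    proof (cases "convergent (\<lambda>n. X n p)")
      case True
      then have l: "(\<lambda>n. X n p) ~~> lim (\<lambda>n. X n p)" by (simp add: convergent_LIMSEQ_iff)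
      have l2: "(\<lambda>n. X n (p + gm k)) ~~> ph k *s lim (\<lambda>n. X n p)" unfolding e by (rule tr[OF l])
      then show ?thesis using True limI[OF l2] unfolding x_def by (auto simp: convergent_def)
    next
      case False
      have "~ convergent (\<lambda>n. X n (p + gm k))"
      proof
        assume "convergent (\<lambda>n. X n (p + gm k))"
        then obtain l where "(\<lambda>n. X n (p + gm k)) ~~> l" by (auto simp: convergent_def)
        from tr[OF this, of "cnj (ph k)"] have "(\<lambda>n. X n p) ~~> cnj (ph k) *s l"
          by (simp add: L2D(2)[OF X] vector_smult_assoc pn)
        then show False using False by (auto simp: convergent_def)
      qed
      then show ?thesis using False by (simp add: x_def)
    qed
  qed
  have "AE p in lebesgue. p \<in> Y --> (\<lambda>n. X n p) ~~> x p"
    using fin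
  proof eventually_elim
    case (elim p)
    then show ?case using conv[of p] by (auto simp: x_def convergent_LIMSEQ_iff)
  qed
  then show ?thesis using that xm xq by blast
qed

text \<open>Fatou's lemma for the squared norms gives integrability of the limit and the bound at
  the same time.\<close>

lemma Fatou_L2:
  assumes X: "!!n. X n \<in> L2" and x: "x \<in> Lmeas" "!!p k. x (p + gm k) = ph k *s x p"
    "AE p in lebesgue. p \<in> Y --> (\<lambda>n. X n p) ~~> x p"
    and le: "!!n. ip1 (X n) (X n) <= C"
  shows "x \<in> L2" "ip1 x x <= C"
proof -
  have C0: "0 <= C" using le[of 0] L.nonneg[OF X[of 0]] by linarith
  have nn: "(\<integral>\<^sup>+p. ennreal (indicator Y p * (norm (x p))\<^sup>2) \<partial>lebesgue) <= ennreal C"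
  proof -
    have "(\<integral>\<^sup>+p. ennreal (indicator Y p * (norm (x p))\<^sup>2) \<partial>lebesgue)
      = (\<integral>\<^sup>+p. liminf (\<lambda>n. ennreal (indicator Y p * (norm (X n p))\<^sup>2)) \<partial>lebesgue)"
    proof (rule nn_integral_cong_AE)
      show "AE p in lebesgue. ennreal (indicator Y p * (norm (x p))\<^sup>2) = liminf (\<lambda>n. ennreal (indicator Y p * (norm (X n p))\<^sup>2))"
        using x(3)
      proof eventually_elim
        case (elim p)
        have "(\<lambda>n. ennreal (indicator Y p * (norm (X n p))\<^sup>2)) ~~> ennreal (indicator Y p * (norm (x p))\<^sup>2)"
          using elim by (cases "p \<in> Y") (auto intro!: tendsto_intros)
        from lim_imp_Liminf[OF sequentially_bot this] show ?case by simp
      qed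
    qed
    also have "\<dots> <= liminf (\<lambda>n. \<integral>\<^sup>+p. ennreal (indicator Y p * (norm (X n p))\<^sup>2) \<partial>lebesgue)"
      by (intro nn_integral_liminf measurable_compose[OF _ measurable_ennreal] meas_ind_normsq L2D X)
    also have "\<dots> <= liminf (\<lambda>n::nat. ennreal C)"
    proof (intro Liminf_mono always_eventually allI)
      fix n
      have "(\<integral>\<^sup>+p. ennreal (indicator Y p * (norm (X n p))\<^sup>2) \<partial>lebesgue) = ennreal (LI p. indicator Y p * (norm (X n p))\<^sup>2)"
        using L2D(3)[OF X] by (intro nn_integral_eq_integral) auto
      also have "(LI p. indicator Y p * (norm (X n p))\<^sup>2) = ip1 (X n) (X n)"
        by (simp add: ip_def power2_norm_eq_inner)
      finally show "(\<integral>\<^sup>+p. ennreal (indicator Y p * (norm (X n p))\<^sup>2) \<partial>lebesgue) <= ennreal C"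
        using le[of n] by (simp add: ennreal_leI)
    qed
    also have "\<dots> = ennreal C" by (simp add: Liminf_const)
    finally show ?thesis .
  qed
  have m: "(\<lambda>p. indicator Y p * (norm (x p))\<^sup>2) \<in> Lmeas"
    by (intro meas_ind_normsq x)
  have i: "Lint (\<lambda>p. indicator Y p * (norm (x p))\<^sup>2)"
    using nn by (intro integrableI_nonneg m) (auto simp: less_top[symmetric] top_unique elim: order_le_less_trans)
  show "x \<in> L2" by (rule L2I[OF x(1,2) i])
  have "ennreal (ip1 x x) = (\<integral>\<^sup>+p. ennreal (indicator Y p * (norm (x p))\<^sup>2) \<partial>lebesgue)"
    using i by (subst nn_integral_eq_integral) (auto simp: ip_def power2_norm_eq_inner)
  then have "ennreal (ip1 x x) <= ennreal C" using nn by (simp only:)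
  then show "ip1 x x <= C" using C0 ennreal_le_iff by blast
qed

lemma L2_complete: "L.complete_in L2"
  unfolding L.complete_in_def
proof (intro allI impI, elim conjE)
  fix X :: "nat => field"
  assume X: "\<forall>n. X n \<in> L2" and C: "\<forall>e>0. \<exists>N. \<forall>m\<ge>N. \<forall>n\<ge>N. L.nm (X m - X n) < e"
  have "\<exists>N. \<forall>m\<ge>N. \<forall>n\<ge>N. L.nm (X m - X n) < (1/2)^k" for k using C by simp
  then obtain N where N: "!!k m n. m >= N k ==> n >= N k ==> L.nm (X m - X n) < (1/2)^k" by metis
  \<comment> \<open>Partial sums of \<open>N\<close> make the chosen indices monotone while keeping
    them above \<open>N k\<close>.\<close>
  define r where "r k = (\<Sum>j\<le>k. N j)" for k
  have rN: "N k <= r k" for k unfolding r_def by (rule member_le_sum) auto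
  have rmono: "r k <= r l" if "k <= l" for k l unfolding r_def using that by (intro sum_mono2) auto
  define Z where "Z k = X (r k)" for k
  have ZL: "Z k \<in> L2" for k using X by (simp add: Z_def)
  have Zd: "L.nm (Z l - Z k) < (1/2)^k" if "k <= l" for k l
    unfolding Z_def using rN[of k] rmono[OF that] by (intro N) auto
  have "ip1 (Z (Suc k) - Z k) (Z (Suc k) - Z k) <= (1/4)^k" for k
  proof -
    have "(L.nm (Z (Suc k) - Z k))\<^sup>2 <= ((1/2)^k)\<^sup>2"
      using Zd[of k "Suc k"] ZL by (intro power_mono) auto
    also have "((1/2)^k)\<^sup>2 = ((1/4)^k :: real)"
      by (simp add: power2_eq_square flip: power_mult_distrib)
    finally show ?thesis using ZL by (simp add: L.nm_sq)
  qed
  then have Zf: "!!k. ip1 (Z (Suc k) - Z k) (Z (Suc k) - Z k) <= (1/4)^k" .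
  obtain x where x: "x \<in> Lmeas" "!!p k. x (p + gm k) = ph k *s x p"
    "AE p in lebesgue. p \<in> Y --> (\<lambda>n. Z n p) ~~> x p"
    by (rule fast_limit[OF ZL Zf]; rule that)
  \<comment> \<open>Fatou applied to the tail \<open>Z (n + k) - Z k\<close>: the bound on the gaps
    passes to the distance between \<open>Z k\<close> and the limit.\<close>
  have dif: "x - Z k \<in> L2 & ip1 (x - Z k) (x - Z k) <= ((1/2)^k)\<^sup>2" for k
  proof -
    have a: "(\<lambda>n. Z (n + k) - Z k) n \<in> L2" for n using ZL by auto
    have b: "x - Z k \<in> Lmeas"
      unfolding fun_diff_def using x(1) L2D(1)[OF ZL] by (intro borel_measurable_diff)
    have c: "(x - Z k) (p + gm j) = ph j *s (x - Z k) p" for p j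
      using x(2) L2D(2)[OF ZL] by (simp add: vector_sub_rdistrib vec.scale_right_diff_distrib)
    have d: "AE p in lebesgue. p \<in> Y --> (\<lambda>n. (Z (n + k) - Z k) p) ~~> (x - Z k) p"
      using x(3)
    proof eventually_elim
      case (elim p)
      show ?case
      proof
        assume "p \<in> Y"
        then have "(\<lambda>n. Z (n + k) p) ~~> x p" using elim LIMSEQ_ignore_initial_segment by blast
        then show "(\<lambda>n. (Z (n + k) - Z k) p) ~~> (x - Z k) p" by (auto intro!: tendsto_intros)
      qed
    qed
    have e: "ip1 (Z (n + k) - Z k) (Z (n + k) - Z k) <= ((1/2)^k)\<^sup>2" for n
    proof -
      have "(L.nm (Z (n + k) - Z k))\<^sup>2 <= ((1/2)^k)\<^sup>2"
        using Zd[of k "n + k"] ZL by (intro power_mono) auto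
      then show ?thesis using ZL by (simp add: L.nm_sq)
    qed
    show ?thesis using Fatou_L2[OF a b c d e] by blast
  qed
  have xL: "x \<in> L2" using L.mem(1)[OF conjunct1[OF dif[of 0]] ZL[of 0]] by simp
  have zx: "L.nm (Z k - x) <= (1/2)^k" for k
  proof -
    have "(L.nm (x - Z k))\<^sup>2 <= ((1/2)^k)\<^sup>2" using dif[of k] by (simp add: L.nm_sq)
    then have "L.nm (x - Z k) <= (1/2)^k" by (rule power2_le_imp_le) simp
    then show ?thesis using L.nm_minus[OF xL ZL] by simp
  qed
  have "(\<lambda>n. L.nm (X n - x)) ~~> 0"
  proof (rule LIMSEQ_I)
    fix e :: real assume e: "e > 0"
    obtain k where k: "(1/2)^k < e/2" using real_arch_pow_inv[of "e/2" "1/2"] e by auto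
    have "norm (L.nm (X n - x) - 0) < e" if n: "n >= r k" for n
    proof -
      have "L.nm (X n - x) <= L.nm (X n - Z k) + L.nm (Z k - x)" using X ZL xL by (intro L.triangle3) auto
      moreover have "L.nm (X n - Z k) < (1/2)^k" unfolding Z_def using n rN[of k] by (intro N) auto
      moreover have "X n - x \<in> L2" using X xL by auto
      ultimately show ?thesis using zx[of k] k by simp
    qed
    then show "\<exists>no. \<forall>n\<ge>no. norm (L.nm (X n - x) - 0) < e" by blast
  qed
  then show "\<exists>y\<in>L2. (\<lambda>n. L.nm (X n - y)) ~~> 0" using xL by blast
qed

end

section \<open>Linear maps on complex vectors and fields of bounded support\<close>

lemma bounded_linear_crs_left: "bounded_linear (\<lambda>v. crs v a)"
proof -
  have "linear (\<lambda>v. crs v a)"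
    by (rule linearI) (auto simp: crs_def vec_eq_iff algebra_simps)
  then show ?thesis by (simp add: linear_conv_bounded_linear)
qed

lemma bounded_linear_crs_right: "bounded_linear (\<lambda>a. crs v a)"
proof -
  have "linear (\<lambda>a. crs v a)"
    by (rule linearI) (auto simp: crs_def vec_eq_iff algebra_simps)
  then show ?thesis by (simp add: linear_conv_bounded_linear)
qed

lemma crs_scale: "crs v (c *s a) = c *s crs v a" "crs (c *s v) a = c *s crs v a"
  "crs v (r *\<^sub>R a) = r *\<^sub>R crs v a" "crs (r *\<^sub>R v) a = r *\<^sub>R crs v a"
  by (auto simp: crs_def vec_eq_iff algebra_simps)

lemma bounded_linear_vsmult: "bounded_linear (\<lambda>a :: complex^3. c *s a)"
  using bounded_bilinear.bounded_linear_right[OF bb_vsmult] .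

lemma bounded_linear_nth: "bounded_linear (\<lambda>v :: complex^3. v $ i)"
  by (rule bounded_linear_vec_nth)

lemma meas_vec:
  fixes f :: "'a => complex^3"
  assumes "!!i. (\<lambda>p. f p $ i) \<in> borel_measurable M"
  shows "f \<in> borel_measurable M"
proof -
  have "(\<lambda>p. f p \<bullet> b) \<in> borel_measurable M" if "b \<in> Basis" for b
  proof -
    from that obtain i and u :: complex where b: "b = axis i u" unfolding Basis_vec_def by blast
    have "(\<lambda>p. f p $ i \<bullet> u) \<in> borel_measurable M"
      by (intro borel_measurable_inner assms borel_measurable_const)
    then show ?thesis by (simp add: b inner_axis)
  qed
  then show ?thesis using borel_measurable_euclidean_space by blast
qed

lemma meas_nth:
  assumes "f \<in> borel_measurable M"
  shows "(\<lambda>p. (f p :: complex^3) $ i) \<in> borel_measurable M"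
proof -
  have "continuous_on UNIV (\<lambda>v :: complex^3. v $ i)" by (intro continuous_intros)
  then have "(\<lambda>v :: complex^3. v $ i) \<in> borel_measurable borel" by (rule borel_measurable_continuous_onI)
  from measurable_compose[OF assms this] show ?thesis .
qed

lemma meas_crs:
  "f \<in> borel_measurable M ==> g \<in> borel_measurable M ==> (\<lambda>p. crs (f p) (g p)) \<in> borel_measurable M"
  by (rule meas_vec) (simp add: crs_def, intro borel_measurable_diff borel_measurable_times meas_nth)

definition gr :: "(pt => real) => field" where "gr \<phi> p = (\<chi> i. of_real (pd i \<phi> p))"

lemma rvec_gr [simp]: "rvec (gr \<phi> p)"
  by (simp add: rvec_def gr_def)

lemma gr_nth [simp]: "gr \<phi> p $ i = of_real (pd i \<phi> p)"
  by (simp add: gr_def)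

definition cmp :: "field => bool" where
  "cmp \<psi> \<longleftrightarrow> \<psi> \<in> Lmeas & bounded {p. \<psi> p ~= 0} & (\<exists>M. \<forall>p. norm (\<psi> p) <= M)"

lemma cmpD: "cmp \<psi> ==> \<psi> \<in> Lmeas" "cmp \<psi> ==> bounded {p. \<psi> p ~= 0}"
  "cmp \<psi> ==> \<exists>M\<ge>0. \<forall>p. norm (\<psi> p) <= M"
  unfolding cmp_def by (blast, blast) (metis norm_ge_zero order_trans)

lemma cmp_gr: assumes "test_fun \<phi>" shows "cmp (gr \<phi>)"
proof -
  have "(\<lambda>p. gr \<phi> p $ i) \<in> Lmeas" for i
    by (simp, intro measurable_compose[OF test_meas[OF test_pd[OF assms]]] borel_measurable_continuous_onI continuous_intros)
  then have m: "gr \<phi> \<in> Lmeas" by (rule meas_vec)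
  obtain M where M: "!!i p. \<bar>pd i \<phi> p\<bar> <= M i" using test_bounded[OF test_pd[OF assms]] by metis
  have "norm (gr \<phi> p) <= (\<Sum>i\<in>UNIV. M i)" for p
  proof -
    have "norm (gr \<phi> p) <= (\<Sum>i\<in>UNIV. norm (gr \<phi> p $ i))" unfolding norm_vec_def by (rule L2_set_le_sum) auto
    also have "\<dots> <= (\<Sum>i\<in>UNIV. M i)" using M by (intro sum_mono) simp
    finally show ?thesis .
  qed
  moreover have "bounded {p. gr \<phi> p ~= 0}"
  proof (rule bounded_subset)
    show "bounded (\<Union>i. {p. pd i \<phi> p ~= 0})"
      using test_pd[OF assms] by (intro bounded_UN) (auto simp: test_fun_def)
    show "{p. gr \<phi> p ~= 0} \<subseteq> (\<Union>i. {p. pd i \<phi> p ~= 0})" by (auto simp: vec_eq_iff)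
  qed
  ultimately show ?thesis using m unfolding cmp_def by blast
qed

lemma cmp_map:
  assumes c: "cmp \<psi>" and m: "T \<in> Lmeas" and le: "!!p. norm (T p) <= K * norm (\<psi> p)"
  shows "cmp T"
proof -
  obtain M where M: "0 <= M" "!!p. norm (\<psi> p) <= M" using cmpD(3)[OF c] by blast
  have "norm (T p) <= \<bar>K\<bar> * M" for p
  proof -
    have "norm (T p) <= \<bar>K\<bar> * norm (\<psi> p)"
      using le[of p] abs_ge_self[of K] mult_right_mono[of K "\<bar>K\<bar>" "norm (\<psi> p)"] by simp
    also have "\<dots> <= \<bar>K\<bar> * M" using M by (intro mult_left_mono) auto
    finally show ?thesis .
  qed
  moreover have "{p. T p ~= 0} \<subseteq> {p. \<psi> p ~= 0}"
  proof
    fix p assume "p \<in> {p. T p ~= 0}"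
    then have "norm (T p) > 0" by simp
    then have "norm (\<psi> p) ~= 0" using le[of p] by auto
    then show "p \<in> {p. \<psi> p ~= 0}" by simp
  qed
  ultimately show ?thesis using m cmpD(2)[OF c] bounded_subset unfolding cmp_def by blast
qed

lemma cmp_vsmult: "cmp \<psi> ==> cmp (\<lambda>p. c *s \<psi> p)"
  by (rule cmp_map[of \<psi> _ "norm c", OF _ meas_vsmult[OF borel_measurable_const cmpD(1)]]) (simp_all add: norm_vsmult)

lemma cmp_crs_gr:
  assumes "test_fun \<phi>"
  shows "cmp (\<lambda>p. crs (gr \<phi> p) a)"
proof (rule cmp_map[OF cmp_gr, of _ _ "norm a"])
  show "norm (crs (gr \<phi> p) a) <= norm a * norm (gr \<phi> p)" for p
    by (subst mult.commute) (rule norm_crs_le[OF rvec_gr])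
qed (rule assms meas_crs[OF cmpD(1)[OF cmp_gr[OF assms]] borel_measurable_const])+

lemma cmp_test: assumes "test_fun \<phi>" shows "cmp (\<lambda>p. \<phi> p *\<^sub>R a)"
proof -
  obtain M where M: "!!p. \<bar>\<phi> p\<bar> <= M" using test_bounded[OF assms] by blast
  have "bounded {p. \<phi> p *\<^sub>R a ~= 0}" using assms by (auto simp: test_fun_def elim: bounded_subset)
  moreover have "(\<lambda>p. \<phi> p *\<^sub>R a) \<in> Lmeas"
    by (intro borel_measurable_scaleR test_meas assms borel_measurable_const)
  moreover have "\<forall>p. norm (\<phi> p *\<^sub>R a) <= M * norm a" using M by (auto intro: mult_right_mono)
  ultimately show ?thesis unfolding cmp_def by blast
qed

context qp
begin

section \<open>Periodization of test fields\<close>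

text \<open>Finitely many translates of the cell cover \<open>B\<close>, and the norm of a
  quasi-periodic field is periodic, so integrability on the cell is enough.\<close>

lemma L2_loc_sq:
  assumes f: "f \<in> L2" and B: "bounded B" "B \<in> sets lebesgue"
  shows "Lint (\<lambda>p. indicator B p * (norm (f p))\<^sup>2)"
proof -
  obtain N where N: "!!p. p \<in> B ==> \<bar>w1 \<bullet> fst p\<bar> <= real N & \<bar>w2 \<bullet> fst p\<bar> <= real N"
    using bounded_coords[OF B(1)] by blast
  have "Lint (\<lambda>p. indicator Y (p - gm k) * (norm (f p))\<^sup>2)" for k
  proof -
    have "Lint (\<lambda>p. indicator Y (p + - gm k) * (norm (f (p + - gm k)))\<^sup>2)"
      by (rule integrable_shift[OF L2D(3)[OF f]])
    then show ?thesis using norm_shift[OF f, of _ "- k"] by (simp add: gm_minus)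
  qed
  then have "Lint (\<lambda>p. \<Sum>k\<in>Sq N. indicator Y (p - gm k) * (norm (f p))\<^sup>2)"
    by (intro Bochner_Integration.integrable_sum)
  then show ?thesis
  proof (rule Lint_bound)
    show "AE p in lebesgue. norm (indicator B p * (norm (f p))\<^sup>2) <= norm (\<Sum>k\<in>Sq N. indicator Y (p - gm k) * (norm (f p))\<^sup>2)"
    proof (intro always_eventually allI)
      fix p
      have "indicator B p * (norm (f p))\<^sup>2 = (\<Sum>k\<in>Sq N. indicator Y (p - gm k) *\<^sub>R (indicator B p * (norm (f p))\<^sup>2))"
        by (rule decomp) (use N in \<open>auto simp: indicator_def split: if_splits\<close>)
      also have "\<dots> <= (\<Sum>k\<in>Sq N. indicator Y (p - gm k) * (norm (f p))\<^sup>2)"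
        by (intro sum_mono) (simp add: indicator_def)
      finally have "indicator B p * (norm (f p))\<^sup>2 <= (\<Sum>k\<in>Sq N. indicator Y (p - gm k) * (norm (f p))\<^sup>2)" .
      moreover have "0 <= (\<Sum>k\<in>Sq N. indicator Y (p - gm k) * (norm (f p))\<^sup>2)" by (simp add: sum_nonneg)
      ultimately show "norm (indicator B p * (norm (f p))\<^sup>2) <= norm (\<Sum>k\<in>Sq N. indicator Y (p - gm k) * (norm (f p))\<^sup>2)"
        by (simp add: abs_mult)
    qed
    show "(\<lambda>p. indicator B p * (norm (f p))\<^sup>2) \<in> Lmeas"
      using L2D(1)[OF f] B(2) by measurable
  qed
qed

lemma L2_dom:
  fixes T :: "pt => 'b::{banach, second_countable_topology}"
  assumes f: "f \<in> L2" and m: "T \<in> Lmeas" and le: "!!p. norm (T p) <= M * norm (f p)"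
    and bd: "bounded {p. T p ~= 0}"
  shows "Lint T"
proof -
  obtain R where R: "!!p. T p ~= 0 ==> norm p <= R" using bd by (auto simp: bounded_iff)
  let ?B = "cball (0::pt) R"
  have i1: "Lint (\<lambda>p. indicator ?B p * (norm (f p))\<^sup>2)" by (rule L2_loc_sq[OF f]) auto
  have i2: "Lint (\<lambda>p. indicator ?B p :: real)"
    using emeasure_bounded_finite[OF bounded_cball, of "0::pt" R] by (intro integrable_real_indicator) auto
  have "Lint (\<lambda>p. \<bar>M\<bar> * (indicator ?B p + indicator ?B p * (norm (f p))\<^sup>2))"
    by (intro integrable_mult_right Lint_add i1 i2)
  then show ?thesis
  proof (rule Lint_bound[OF _ m])
    show "AE p in lebesgue. norm (T p) <= norm (\<bar>M\<bar> * (indicator ?B p + indicator ?B p * (norm (f p))\<^sup>2))"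
    proof (intro always_eventually allI)
      fix p
      show "norm (T p) <= norm (\<bar>M\<bar> * (indicator ?B p + indicator ?B p * (norm (f p))\<^sup>2))"
      proof (cases "T p = 0")
        case False
        then have "p \<in> ?B" using R by simp
        have "norm (T p) <= \<bar>M\<bar> * norm (f p)"
          using le[of p] abs_ge_self[of M] mult_right_mono[of M "\<bar>M\<bar>" "norm (f p)"] by simp
        \<comment> \<open>The first power is traded for the square, which is integrable on the
          bounded support.\<close>
        also have "norm (f p) <= 1 + (norm (f p))\<^sup>2"
          using sum_squares_bound[of 1 "norm (f p)"] zero_le_power2[of "norm (f p)"] norm_ge_zero[of "f p"] by (simp only: mult_1_right one_power2)
        then have "\<bar>M\<bar> * norm (f p) <= \<bar>M\<bar> * (1 + (norm (f p))\<^sup>2)" by (intro mult_left_mono) auto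
        finally show ?thesis using \<open>p \<in> ?B\<close> by (simp add: indicator_def abs_mult)
      qed simp
    qed
  qed
qed

text \<open>Quasi-periodization of a field on the whole space. Summing over the indices with a
  nonzero term makes the formula independent of any bound on the support; for fields of bounded
  support the sum is finite at each point.\<close>

definition per :: "field => field" where
  "per \<psi> p = (\<Sum>k | \<psi> (p - gm k) ~= 0. ph k *s \<psi> (p - gm k))"

lemma per_sum:
  assumes "finite F" "!!k. k \<notin> F ==> \<psi> (p - gm k) = 0"
  shows "per \<psi> p = (\<Sum>k\<in>F. ph k *s \<psi> (p - gm k))"
  unfolding per_def using assms by (intro sum.mono_neutral_left) auto

lemma per_Sq:
  assumes N: "\<forall>p. \<psi> p ~= 0 --> \<bar>w1 \<bullet> fst p\<bar> <= real N & \<bar>w2 \<bullet> fst p\<bar> <= real N"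
    and p: "\<bar>w1 \<bullet> fst p\<bar> <= real R" "\<bar>w2 \<bullet> fst p\<bar> <= real R" and M: "N + R <= M"
  shows "per \<psi> p = (\<Sum>k\<in>Sq M. ph k *s \<psi> (p - gm k))"
proof (rule per_sum)
  fix k assume k: "k \<notin> Sq M"
  show "\<psi> (p - gm k) = 0"
  proof (rule ccontr)
    assume "\<psi> (p - gm k) ~= 0"
    from N[rule_format, OF this] have "\<bar>real_of_int (fst k)\<bar> <= real (N + R)" "\<bar>real_of_int (snd k)\<bar> <= real (N + R)"
      using p unfolding gm_coord by linarith+
    then have "\<bar>fst k\<bar> <= int (N + R)" "\<bar>snd k\<bar> <= int (N + R)" by linarith+
    then show False using k M by (cases k) (auto simp: Sq_def)
  qed
qed simp

text \<open>For points of the cell the coordinates lie in [0,1), so the index square of the support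
  of \<psi> already suffices, without the enlargement that general points need.\<close>

lemma per_Y:
  assumes N: "\<forall>p. \<psi> p ~= 0 --> \<bar>w1 \<bullet> fst p\<bar> <= real N & \<bar>w2 \<bullet> fst p\<bar> <= real N"
    and p: "p \<in> Y"
  shows "per \<psi> p = (\<Sum>k\<in>Sq N. ph k *s \<psi> (p - gm k))"
proof (rule per_sum)
  fix k assume k: "k \<notin> Sq N"
  show "\<psi> (p - gm k) = 0"
  proof (rule ccontr)
    assume "\<psi> (p - gm k) ~= 0"
    from N[rule_format, OF this] have "real_of_int (fst k) < real N + 1" "real_of_int (fst k) >= - real N"
       "real_of_int (snd k) < real N + 1" "real_of_int (snd k) >= - real N"
      using p unfolding gm_coord Y_iff by linarith+
    then have "fst k <= int N" "fst k >= - int N" "snd k <= int N" "snd k >= - int N" by linarith+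
    then show False using k by (cases k) (auto simp: Sq_def)
  qed
qed simp

lemma cmp_coords:
  assumes "cmp \<psi>"
  obtains N where "\<forall>p. \<psi> p ~= 0 --> \<bar>w1 \<bullet> fst p\<bar> <= real N & \<bar>w2 \<bullet> fst p\<bar> <= real N"
  by (rule bounded_coords[OF cmpD(2)[OF assms]]) (use that in blast)

lemma per_quasi:
  assumes c: "cmp \<psi>" shows "per \<psi> (p + gm l) = ph l *s per \<psi> p"
proof -
  let ?A = "{k. \<psi> (p - gm k) ~= 0}"
  have "{k. \<psi> (p + gm l - gm k) ~= 0} = (\<lambda>k. k + l) ` ?A"
  proof (intro subset_antisym subsetI)
    fix k assume "k \<in> {k. \<psi> (p + gm l - gm k) ~= 0}"
    then show "k \<in> (\<lambda>k. k + l) ` ?A" by (intro image_eqI[of _ _ "k - l"]) (auto simp: gm_diff algebra_simps)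
  qed (auto simp: gm_add)
  then have "per \<psi> (p + gm l) = (\<Sum>k\<in>?A. ph (k + l) *s \<psi> (p + gm l - gm (k + l)))"
    unfolding per_def by (simp add: sum.reindex inj_on_def)
  also have "\<dots> = (\<Sum>k\<in>?A. ph l *s (ph k *s \<psi> (p - gm k)))"
    by (intro sum.cong refl) (simp add: gm_add ph_add vector_smult_assoc mult.commute)
  also have "\<dots> = ph l *s per \<psi> p" by (simp add: per_def vec.scale_sum_right)
  finally show ?thesis .
qed

lemma per_meas:
  assumes c: "cmp \<psi>" shows "per \<psi> \<in> Lmeas"
proof (rule borel_measurable_LIMSEQ_metric)
  obtain N where N: "\<forall>p. \<psi> p ~= 0 --> \<bar>w1 \<bullet> fst p\<bar> <= real N & \<bar>w2 \<bullet> fst p\<bar> <= real N"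
    using cmp_coords[OF c] by blast
  show "(\<lambda>p. \<Sum>k\<in>Sq n. ph k *s \<psi> (p - gm k)) \<in> Lmeas" for n
    by (intro borel_measurable_sum meas_vsmult borel_measurable_const meas_shift(2)[OF cmpD(1)[OF c]])
  show "(\<lambda>n. \<Sum>k\<in>Sq n. ph k *s \<psi> (p - gm k)) ~~> per \<psi> p" for p
  proof (rule tendsto_eventually)
    obtain R :: nat where R: "\<bar>w1 \<bullet> fst p\<bar> <= real R" "\<bar>w2 \<bullet> fst p\<bar> <= real R"
      using real_arch_simple[of "max \<bar>w1 \<bullet> fst p\<bar> \<bar>w2 \<bullet> fst p\<bar>"] by auto
    show "\<forall>\<^sub>F n in sequentially. (\<Sum>k\<in>Sq n. ph k *s \<psi> (p - gm k)) = per \<psi> p"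
      using eventually_ge_at_top[of "N + R"] by eventually_elim (use per_Sq[OF N R] in simp)
  qed
qed

lemma per_L2:
  assumes c: "cmp \<psi>" shows "per \<psi> \<in> L2"
proof (rule L2I[OF per_meas[OF c] per_quasi[OF c]])
  obtain N where N: "\<forall>p. \<psi> p ~= 0 --> \<bar>w1 \<bullet> fst p\<bar> <= real N & \<bar>w2 \<bullet> fst p\<bar> <= real N"
    using cmp_coords[OF c] by blast
  obtain M where M: "0 <= M" "!!p. norm (\<psi> p) <= M" using cmpD(3)[OF c] by blast
  obtain R where R: "!!p. \<psi> p ~= 0 ==> norm p <= R" using cmpD(2)[OF c] by (auto simp: bounded_iff)
  let ?K = "real (card (Sq N)) * M"
  show "Lint (\<lambda>p. indicator Y p * (norm (per \<psi> p))\<^sup>2)"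
  proof (rule integrable_bounded_support[of _ "?K\<^sup>2"])
    show "norm (indicator Y p * (norm (per \<psi> p))\<^sup>2) <= ?K\<^sup>2" for p
    proof (cases "p \<in> Y")
      case True
      have "norm (per \<psi> p) <= (\<Sum>k\<in>Sq N. norm (ph k *s \<psi> (p - gm k)))"
        by (subst per_Y[OF N True]) (simp_all add: norm_sum)
      also have "\<dots> <= (\<Sum>k\<in>Sq N. M)" using M by (intro sum_mono) (simp add: norm_vsmult)
      finally have "norm (per \<psi> p) <= ?K" by simp
      then show ?thesis by (simp add: indicator_def power_mono)
    qed simp
    show "bounded {p. indicator Y p * (norm (per \<psi> p))\<^sup>2 ~= 0}"
      unfolding bounded_iff
    proof (intro exI ballI)
      fix p assume "p \<in> {p. indicator Y p * (norm (per \<psi> p))\<^sup>2 ~= 0}"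
      then have p: "p \<in> Y" "per \<psi> p ~= 0" by (auto simp: indicator_def split: if_splits)
      then obtain k where "k \<in> Sq N" "ph k *s \<psi> (p - gm k) ~= 0"
        using per_Y[OF N p(1)] sum.neutral[of "Sq N" "\<lambda>k. ph k *s \<psi> (p - gm k)"] by metis
      then have k: "\<psi> (p - gm k) ~= 0" by auto
      have "\<bar>snd p\<bar> <= R"
      proof -
        have "norm (snd (p - gm k)) <= norm (p - gm k)" by (metis norm_snd_le prod.collapse)
        then show ?thesis using R[OF k] unfolding gm_coord(6) by simp
      qed
      moreover have "norm (fst p) <= norm a1 + norm a2"
      proof -
        have "norm (fst p) <= norm ((w1 \<bullet> fst p) *\<^sub>R a1) + norm ((w2 \<bullet> fst p) *\<^sub>R a2)"
          using coord[of "fst p"] norm_triangle_ineq by metis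
        also have "\<dots> <= norm a1 + norm a2" using p(1) by (intro add_mono) (auto simp: Y_iff intro!: mult_left_le_one_le)
        finally show ?thesis .
      qed
      ultimately show "norm p <= (norm a1 + norm a2) + R"
        using norm_Pair_le[of "fst p" "snd p"] by simp
    qed
  qed (rule meas_ind_normsq[OF per_meas[OF c]])
qed

text \<open>Unfolding the integral over the lattice puts phases on \<open>f\<close>; moved to the
  other factor they are conjugated, which the reflection of the index square undoes. Hence testing
  on the whole space is an inner product over the cell.\<close>

lemma per_pair:
  assumes f: "f \<in> L2" and c: "cmp \<psi>"
  shows "(LI p. f p \<bullet> \<psi> p) = ip1 f (per \<psi>)"
proof -
  obtain N where N: "\<forall>p. \<psi> p ~= 0 --> \<bar>w1 \<bullet> fst p\<bar> <= real N & \<bar>w2 \<bullet> fst p\<bar> <= real N"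
    using cmp_coords[OF c] by blast
  obtain M where M: "0 <= M" "!!p. norm (\<psi> p) <= M" using cmpD(3)[OF c] by blast
  have "Lint (\<lambda>p. f p \<bullet> \<psi> p)"
  proof (rule L2_dom[OF f, of _ M])
    show "norm (f p \<bullet> \<psi> p) <= M * norm (f p)" for p
      using Cauchy_Schwarz_ineq2[of "f p" "\<psi> p"] mult_left_mono[OF M(2)[of p], of "norm (f p)"] by (simp add: mult.commute)
    show "bounded {p. f p \<bullet> \<psi> p ~= 0}" by (rule bounded_subset[OF cmpD(2)[OF c]]) auto
  qed (intro borel_measurable_inner L2D f cmpD c)
  then have "(LI p. f p \<bullet> \<psi> p) = (LI p. indicator Y p *\<^sub>R (\<Sum>k\<in>Sq N. f (p + gm k) \<bullet> \<psi> (p + gm k)))"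
  proof (rule unfold_integral)
    show "\<bar>w1 \<bullet> fst p\<bar> <= real N & \<bar>w2 \<bullet> fst p\<bar> <= real N" if "f p \<bullet> \<psi> p ~= 0" for p
      by (rule N[rule_format]) (use that in auto)
  qed
  also have "\<dots> = (LI p. indicator Y p * 1 * (f p \<bullet> per \<psi> p))"
  proof (rule int_cong[OF refl])
    fix p
    show "indicator Y p *\<^sub>R (\<Sum>k\<in>Sq N. f (p + gm k) \<bullet> \<psi> (p + gm k)) = indicator Y p * 1 * (f p \<bullet> per \<psi> p)"
    proof (cases "p \<in> Y")
      case True
      have "(\<Sum>k\<in>Sq N. f (p + gm k) \<bullet> \<psi> (p + gm k)) = (\<Sum>k\<in>uminus ` Sq N. f (p + gm k) \<bullet> \<psi> (p + gm k))"
        by (simp add: Sq_minus)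
      also have "\<dots> = (\<Sum>k\<in>Sq N. f (p + gm (- k)) \<bullet> \<psi> (p + gm (- k)))"
        by (subst sum.reindex) (auto simp: inj_on_def)
      also have "\<dots> = (\<Sum>k\<in>Sq N. (ph (- k) *s f p) \<bullet> \<psi> (p + gm (- k)))"
        by (simp only: L2D(2)[OF f])
      also have "\<dots> = (\<Sum>k\<in>Sq N. f p \<bullet> (ph k *s \<psi> (p - gm k)))"
        by (intro sum.cong refl) (simp add: ph_minus inner_vsmult_left gm_minus)
      also have "\<dots> = f p \<bullet> per \<psi> p" by (subst per_Y[OF N True]) (simp_all add: inner_sum_right)
      finally show ?thesis by simp
    qed simp
  qed
  finally show ?thesis by (simp add: ip_def)
qed

text \<open>Only finitely many translates of \<psi> meet the support of \<psi>'. The formula is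
  given for all large \<open>M\<close> so that two such expansions can be compared over a common
  index set.\<close>

lemma per_pairing:
  assumes c: "cmp \<psi>" and c': "cmp \<psi>'"
  shows "\<exists>M0. \<forall>M\<ge>M0. (LI p. per \<psi> p \<bullet> \<psi>' p) = (\<Sum>k\<in>Sq M. LI p. (ph k *s \<psi> (p - gm k)) \<bullet> \<psi>' p)"
proof -
  obtain N where N: "\<forall>p. \<psi> p ~= 0 --> \<bar>w1 \<bullet> fst p\<bar> <= real N & \<bar>w2 \<bullet> fst p\<bar> <= real N"
    using cmp_coords[OF c] by blast
  obtain R where R: "\<forall>p. \<psi>' p ~= 0 --> \<bar>w1 \<bullet> fst p\<bar> <= real R & \<bar>w2 \<bullet> fst p\<bar> <= real R"
    using cmp_coords[OF c'] by blast
  obtain M1 where M1: "0 <= M1" "!!p. norm (\<psi> p) <= M1" using cmpD(3)[OF c] by blast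
  obtain M2 where M2: "0 <= M2" "!!p. norm (\<psi>' p) <= M2" using cmpD(3)[OF c'] by blast
  have int: "Lint (\<lambda>p. (ph k *s \<psi> (p - gm k)) \<bullet> \<psi>' p)" for k
  proof (rule integrable_bounded_support[of _ "M1 * M2"])
    show "(\<lambda>p. (ph k *s \<psi> (p - gm k)) \<bullet> \<psi>' p) \<in> Lmeas"
      by (intro borel_measurable_inner meas_vsmult borel_measurable_const meas_shift(2)[OF cmpD(1)[OF c]] cmpD(1)[OF c'])
    show "norm ((ph k *s \<psi> (p - gm k)) \<bullet> \<psi>' p) <= M1 * M2" for p
    proof -
      have "norm ((ph k *s \<psi> (p - gm k)) \<bullet> \<psi>' p) <= norm (ph k *s \<psi> (p - gm k)) * norm (\<psi>' p)"
        using Cauchy_Schwarz_ineq2 by simp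
      also have "\<dots> <= M1 * M2" using M1 M2 by (intro mult_mono) (auto simp: norm_vsmult)
      finally show ?thesis .
    qed
    show "bounded {p. (ph k *s \<psi> (p - gm k)) \<bullet> \<psi>' p ~= 0}" by (rule bounded_subset[OF cmpD(2)[OF c']]) auto
  qed
  have "(LI p. per \<psi> p \<bullet> \<psi>' p) = (\<Sum>k\<in>Sq M. LI p. (ph k *s \<psi> (p - gm k)) \<bullet> \<psi>' p)"
    if M: "M >= N + R" for M
  proof -
    have "(LI p. per \<psi> p \<bullet> \<psi>' p) = (LI p. (\<Sum>k\<in>Sq M. (ph k *s \<psi> (p - gm k)) \<bullet> \<psi>' p))"
    proof (rule int_cong[OF refl])
      fix p
      show "per \<psi> p \<bullet> \<psi>' p = (\<Sum>k\<in>Sq M. (ph k *s \<psi> (p - gm k)) \<bullet> \<psi>' p)"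
      proof (cases "\<psi>' p = 0")
        case False
        then show ?thesis using per_Sq[OF N conjunct1[OF R[rule_format, OF False]] conjunct2[OF R[rule_format, OF False]] M] by (simp add: inner_sum_left)
      qed simp
    qed
    also have "\<dots> = (\<Sum>k\<in>Sq M. LI p. (ph k *s \<psi> (p - gm k)) \<bullet> \<psi>' p)"
      by (rule int_sum[OF int])
    finally show ?thesis .
  qed
  then show ?thesis by blast
qed

end

context semi_ip
begin

text \<open>Orthogonality conditions are continuous in the norm and survive limits. The solenoidal
  spaces are instances, with \<open>T\<close> the periodized gradients.\<close>

lemma orth_complete:
  assumes comp: "complete_in H" and T: "T \<subseteq> H"
  shows "subspace {x \<in> H. \<forall>t\<in>T. ip x t = 0}" "complete_in {x \<in> H. \<forall>t\<in>T. ip x t = 0}"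
proof -
  have TH: "t \<in> H" if "t \<in> T" for t using T that by blast
  show "subspace {x \<in> H. \<forall>t\<in>T. ip x t = 0}"
  proof (rule subspaceI)
    show "0 \<in> {x \<in> H. \<forall>t\<in>T. ip x t = 0}" using TH by simp
    show "x + y \<in> {x \<in> H. \<forall>t\<in>T. ip x t = 0}" if "x \<in> {x \<in> H. \<forall>t\<in>T. ip x t = 0}" "y \<in> {x \<in> H. \<forall>t\<in>T. ip x t = 0}" for x y
      using that TH by (simp add: add_left)
    show "c *\<^sub>R x \<in> {x \<in> H. \<forall>t\<in>T. ip x t = 0}" if "x \<in> {x \<in> H. \<forall>t\<in>T. ip x t = 0}" for c x
      using that TH by (simp add: scale_left)
  qed
  show "complete_in {x \<in> H. \<forall>t\<in>T. ip x t = 0}"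
    unfolding complete_in_def
  proof (intro allI impI, elim conjE)
    fix X :: "nat => 'a"
    assume X: "\<forall>n. X n \<in> {x \<in> H. \<forall>t\<in>T. ip x t = 0}" and C: "\<forall>e>0. \<exists>N. \<forall>m\<ge>N. \<forall>n\<ge>N. nm (X m - X n) < e"
    have XH: "X n \<in> H" for n using X by simp
    obtain y where y: "y \<in> H" "(\<lambda>n. nm (X n - y)) ~~> 0"
      using comp XH C unfolding complete_in_def by blast
    have "ip y t = 0" if t: "t \<in> T" for t
    proof -
      have "(\<lambda>n. ip (X n) t) ~~> ip y t" by (rule lim_ip[OF XH y(1) TH[OF t] y(2)])
      moreover have "(\<lambda>n. ip (X n) t) = (\<lambda>n. 0)" using X t by simp
      ultimately show ?thesis by (simp add: LIMSEQ_const_iff)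
    qed
    then show "\<exists>y\<in>{x \<in> H. \<forall>t\<in>T. ip x t = 0}. (\<lambda>n. nm (X n - y)) ~~> 0" using y by (intro bexI[of _ y]) simp_all
  qed
qed

end

lemma crs_zero [simp]: "crs 0 v = 0"
  by (simp add: crs_def vec_eq_iff)

lemma dot3_zero [simp]: "dot3 v 0 = 0"
  by (simp add: dot3_def)

lemma vsmult_scaleR: "c *s (r *\<^sub>R v) = r *\<^sub>R (c *s (v :: complex^3))"
  by (simp add: vec_eq_iff)

context qp
begin

section \<open>Weak curl and divergence as orthogonality relations\<close>

lemma int_test:
  assumes f: "f \<in> L2" and t: "test_fun \<phi>"
  shows "Lint (\<lambda>p. \<phi> p *\<^sub>R f p)" "Lint (\<lambda>p. crs (gr \<phi> p) (f p))"
proof -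
  obtain M where M: "!!p. \<bar>\<phi> p\<bar> <= M" using test_bounded[OF t] by blast
  obtain K where K: "!!p. norm (gr \<phi> p) <= K" using cmpD(3)[OF cmp_gr[OF t]] by blast
  show "Lint (\<lambda>p. \<phi> p *\<^sub>R f p)"
  proof (rule L2_dom[OF f, of _ M])
    show "norm (\<phi> p *\<^sub>R f p) <= M * norm (f p)" for p using M[of p] by (simp add: mult_right_mono)
    show "bounded {p. \<phi> p *\<^sub>R f p ~= 0}" using t by (auto simp: test_fun_def elim: bounded_subset)
  qed (intro borel_measurable_scaleR test_meas t L2D f)
  show "Lint (\<lambda>p. crs (gr \<phi> p) (f p))"
  proof (rule L2_dom[OF f, of _ K])
    show "norm (crs (gr \<phi> p) (f p)) <= K * norm (f p)" for p
      using norm_crs_le[OF rvec_gr, of \<phi> p "f p"] mult_right_mono[OF K[of p], of "norm (f p)"] by simp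
    have "{p. crs (gr \<phi> p) (f p) ~= 0} \<subseteq> {p. gr \<phi> p ~= 0}" by auto
    then show "bounded {p. crs (gr \<phi> p) (f p) ~= 0}" using bounded_subset cmpD(2)[OF cmp_gr[OF t]] by blast
  qed (intro meas_crs cmpD cmp_gr t L2D f)
qed

lemma curl_vec:
  assumes f: "f \<in> L2" and g: "g \<in> L2"
  shows "is_curl f g \<longleftrightarrow> (\<forall>\<phi>. test_fun \<phi> --> (LI p. \<phi> p *\<^sub>R g p) = - (LI p. crs (gr \<phi> p) (f p)))"
proof -
  have a: "(LI p. g p $ i * complex_of_real (\<phi> p)) = (LI p. \<phi> p *\<^sub>R g p) $ i" if t: "test_fun \<phi>" for \<phi> i
    using integral_bounded_linear[OF bounded_linear_nth int_test(1)[OF g t], of i]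
    by (simp add: scaleR_conv_of_real[where 'a=complex] mult.commute)
  have b: "(LI p. f p $ nxt i * complex_of_real (pd (nxt (nxt i)) \<phi> p)
                              - f p $ nxt (nxt i) * complex_of_real (pd (nxt i) \<phi> p)) = (- (LI p. crs (gr \<phi> p) (f p))) $ i"
    if t: "test_fun \<phi>" for \<phi> i
  proof -
    have "(LI p. f p $ nxt i * complex_of_real (pd (nxt (nxt i)) \<phi> p)
        - f p $ nxt (nxt i) * complex_of_real (pd (nxt i) \<phi> p)) = (LI p. - (crs (gr \<phi> p) (f p) $ i))"
      by (rule int_cong) (auto simp: crs_def mult.commute)
    also have "\<dots> = - (LI p. crs (gr \<phi> p) (f p) $ i)" by (rule Bochner_Integration.integral_minus)
    also have "(LI p. crs (gr \<phi> p) (f p) $ i) = (LI p. crs (gr \<phi> p) (f p)) $ i"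
      by (rule integral_bounded_linear[OF bounded_linear_nth int_test(2)[OF f t]])
    finally show ?thesis by simp
  qed
  show ?thesis by (simp only: is_curl_def a b vec_eq_iff cong: imp_cong)
qed

lemma test_pair:
  assumes f: "f \<in> L2" and t: "test_fun \<phi>"
  shows "ip1 f (per (\<lambda>p. \<phi> p *\<^sub>R a)) = (LI p. \<phi> p *\<^sub>R f p) \<bullet> a"
    "ip1 f (per (\<lambda>p. crs (gr \<phi> p) a)) = - ((LI p. crs (gr \<phi> p) (f p)) \<bullet> a)"
proof -
  have "ip1 f (per (\<lambda>p. \<phi> p *\<^sub>R a)) = (LI p. (\<phi> p *\<^sub>R f p) \<bullet> a)"
    unfolding per_pair[OF f cmp_test[OF t], symmetric] by simp
  also have "\<dots> = (LI p. \<phi> p *\<^sub>R f p) \<bullet> a"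
    by (rule integral_inner_left) (use int_test(1)[OF f t] in auto)
  finally show "ip1 f (per (\<lambda>p. \<phi> p *\<^sub>R a)) = (LI p. \<phi> p *\<^sub>R f p) \<bullet> a" .
  have "ip1 f (per (\<lambda>p. crs (gr \<phi> p) a)) = (LI p. - (crs (gr \<phi> p) (f p) \<bullet> a))"
    unfolding per_pair[OF f cmp_crs_gr[OF t], symmetric]
    by (rule int_cong) (simp_all add: crs_real_inner)
  also have "\<dots> = - (LI p. crs (gr \<phi> p) (f p) \<bullet> a)" by (rule Bochner_Integration.integral_minus)
  also have "(LI p. crs (gr \<phi> p) (f p) \<bullet> a) = (LI p. crs (gr \<phi> p) (f p)) \<bullet> a"
    by (rule integral_inner_left) (use int_test(2)[OF f t] in auto)
  finally show "ip1 f (per (\<lambda>p. crs (gr \<phi> p) a)) = - ((LI p. crs (gr \<phi> p) (f p)) \<bullet> a)" .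
qed

text \<open>Translates the distributional definition, tested on the whole space, into relations
  between inner products over the cell. Linearity and closedness of the curl become statements about
  continuous functionals.\<close>

lemma curl_ip:
  assumes f: "f \<in> L2" and g: "g \<in> L2"
  shows "is_curl f g \<longleftrightarrow> (\<forall>\<phi> a. test_fun \<phi> -->
    ip1 g (per (\<lambda>p. \<phi> p *\<^sub>R a)) = ip1 f (per (\<lambda>p. crs (gr \<phi> p) a)))"
proof -
  have "v = - w \<longleftrightarrow> (\<forall>a. v \<bullet> a = - (w \<bullet> a))" for v w :: "complex^3"
    using vector_eq_rdot[of v "- w"] by simp
  then show ?thesis unfolding curl_vec[OF f g] using test_pair[OF g] test_pair[OF f] by auto
qed

lemma ip_weight: "ip1 (\<lambda>p. w p *\<^sub>R f p) g = ip w f g"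
  by (simp add: ip_def mult.assoc)

text \<open>The inner product sees only real parts. A complex number vanishes iff the real parts of
  all its complex multiples do, hence the extra constant \<open>c\<close>.\<close>

lemma div_ip:
  assumes f: "f \<in> L2" and w: "wt w"
  shows "div_free w f \<longleftrightarrow> (\<forall>\<phi> c. test_fun \<phi> --> ip w f (per (\<lambda>p. c *s gr \<phi> p)) = 0)"
proof -
  define Z where "Z \<phi> = (LI p. complex_of_real (w p) * (\<Sum>i\<in>UNIV. f p $ i * complex_of_real (pd i \<phi> p)))" for \<phi>
  have eq: "ip w f (per (\<lambda>p. c *s gr \<phi> p)) = Re (cnj c * Z \<phi>)" if t: "test_fun \<phi>" for \<phi> c
  proof -
    have wf: "(\<lambda>p. w p *\<^sub>R f p) \<in> L2" by (rule L2_wt[OF f w])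
    have int: "Lint (\<lambda>p. dot3 (w p *\<^sub>R f p) (gr \<phi> p))"
    proof -
      obtain K where K: "!!p. norm (gr \<phi> p) <= K" using cmpD(3)[OF cmp_gr[OF t]] by blast
      show ?thesis
      proof (rule L2_dom[OF wf, of _ "3 * K"])
        show "norm (dot3 (w p *\<^sub>R f p) (gr \<phi> p)) <= 3 * K * norm (w p *\<^sub>R f p)" for p
        proof -
          have "norm (dot3 (w p *\<^sub>R f p) (gr \<phi> p)) <= (\<Sum>i\<in>UNIV. norm ((w p *\<^sub>R f p) $ i * gr \<phi> p $ i))"
            unfolding dot3_def by (rule norm_sum)
          also have "\<dots> <= (\<Sum>i\<in>(UNIV::3 set). norm (w p *\<^sub>R f p) * K)"
            unfolding norm_mult by (intro sum_mono mult_mono Finite_Cartesian_Product.norm_nth_le order_trans[OF Finite_Cartesian_Product.norm_nth_le K]) auto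
          finally show ?thesis by (simp add: mult_ac)
        qed
        show "(\<lambda>p. dot3 (w p *\<^sub>R f p) (gr \<phi> p)) \<in> Lmeas"
          unfolding dot3_def by (intro borel_measurable_sum borel_measurable_times meas_nth L2D(1)[OF wf] cmpD(1)[OF cmp_gr[OF t]])
        show "bounded {p. dot3 (w p *\<^sub>R f p) (gr \<phi> p) ~= 0}"
          by (rule bounded_subset[OF cmpD(2)[OF cmp_gr[OF t]]]) auto
      qed
    qed
    have "ip w f (per (\<lambda>p. c *s gr \<phi> p)) = ip1 (\<lambda>p. w p *\<^sub>R f p) (per (\<lambda>p. c *s gr \<phi> p))"
      by (simp add: ip_weight)
    also have "\<dots> = (LI p. (w p *\<^sub>R f p) \<bullet> (c *s gr \<phi> p))"
      by (rule per_pair[OF wf cmp_vsmult[OF cmp_gr[OF t]], symmetric])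
    also have "\<dots> = (LI p. Re (cnj c * dot3 (w p *\<^sub>R f p) (gr \<phi> p)))"
      by (rule int_cong) (simp_all add: inner3 dot3_def sum_3 algebra_simps)
    also have "\<dots> = Re (cnj c * (LI p. dot3 (w p *\<^sub>R f p) (gr \<phi> p)))"
      by (rule integral_bounded_linear[OF _ int])
        (intro bounded_linear_compose[OF bounded_linear_Re] bounded_linear_mult_right)
    also have "(LI p. dot3 (w p *\<^sub>R f p) (gr \<phi> p)) = Z \<phi>"
      unfolding Z_def dot3_def by (rule int_cong) (simp_all add: sum_distrib_left scaleR_conv_of_real[where 'a=complex] mult.assoc)
    finally show ?thesis .
  qed
  have zero: "z = 0 \<longleftrightarrow> (\<forall>c. Re (cnj c * z) = 0)" for z :: complex
  proof
    assume "\<forall>c. Re (cnj c * z) = 0"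
    then have "Re (cnj z * z) = 0" by blast
    then show "z = 0" by (simp add: complex_eq_iff sum_squares_eq_zero_iff)
  qed simp
  have "div_free w f \<longleftrightarrow> (\<forall>\<phi>. test_fun \<phi> --> Z \<phi> = 0)" by (simp add: div_free_def Z_def)
  also have "\<dots> \<longleftrightarrow> (\<forall>\<phi>. test_fun \<phi> --> (\<forall>c. Re (cnj c * Z \<phi>) = 0))" using zero by simp
  finally show ?thesis using eq by simp
qed

section \<open>Weighted inner products\<close>

definition gw :: "(pt => real) => bool" where "gw w \<longleftrightarrow> wt w & (\<exists>m>0. \<forall>p. m <= w p)"

lemma gwD: "gw w ==> wt w" "gw w ==> 0 <= w p" "gw w ==> \<exists>m>0. \<forall>p. m <= w p" "gw w ==> 0 < w p"
proof -
  show "gw w ==> wt w" "gw w ==> \<exists>m>0. \<forall>p. m <= w p" by (simp_all add: gw_def)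
  show "0 < w p" if "gw w" using that unfolding gw_def by (meson less_le_trans)
  then show "0 <= w p" if "gw w" using that by (simp add: less_imp_le)
qed

lemma gw_1 [simp]: "gw (\<lambda>p. 1)"
  by (auto simp: gw_def intro: exI[of _ 1])

lemma gw_semi: "gw w ==> semi_ip L2 (ip w)"
  by (intro semi_ip_L2 gwD)

lemma ip_mono:
  assumes f: "f \<in> L2" and w: "wt w" "wt w'" and le: "!!p. w p <= w' p"
  shows "ip w f f <= ip w' f f"
  unfolding ip_def
  by (intro integral_mono ip_integrable f w) (auto simp: le intro!: mult_right_mono mult_left_mono)

lemma ip_const_weight: "ip (\<lambda>p. c) f g = c * ip1 f g"
proof -
  have "ip (\<lambda>p. c) f g = (LI p. c * (indicator Y p * 1 * (f p \<bullet> g p)))"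
    unfolding ip_def by (rule int_cong) auto
  then show ?thesis by (simp add: ip_def)
qed

text \<open>The weight lies between positive constants \<open>m\<close> and \<open>M\<close>, so the
  weighted and the unweighted norm are equivalent and completeness carries over.\<close>

lemma complete_gw:
  assumes w: "gw w"
  shows "semi_ip.complete_in (ip w) L2"
proof -
  interpret W: semi_ip L2 "ip w" by (rule gw_semi[OF w])
  obtain m where m: "m > 0" "!!p. m <= w p" using gwD(3)[OF w] by blast
  obtain M where M: "M >= 0" "!!p. \<bar>w p\<bar> <= M" using wtD(3)[OF gwD(1)[OF w]] by blast
  have le1: "L.nm f <= W.nm f / sqrt m" if "f \<in> L2" for f
  proof -
    have "m * ip1 f f <= ip w f f"
      using ip_mono[OF that wt_const gwD(1)[OF w], of m] m(2) by (simp add: ip_const_weight[of m])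
    then have "sqrt (m * ip1 f f) <= W.nm f" unfolding W.nm_def by simp
    then show ?thesis using m(1) by (simp add: L.nm_def real_sqrt_mult field_simps)
  qed
  have le2: "W.nm f <= sqrt M * L.nm f" if "f \<in> L2" for f
  proof -
    have "w p <= M" for p using M(2)[of p] by linarith
    then have "ip w f f <= M * ip1 f f"
      using ip_mono[OF that gwD(1)[OF w] wt_const, of M] by (simp add: ip_const_weight[of M])
    then show ?thesis unfolding W.nm_def L.nm_def real_sqrt_mult[symmetric] by simp
  qed
  show ?thesis
    unfolding W.complete_in_def
  proof (intro allI impI, elim conjE)
    fix X :: "nat => field"
    assume X: "\<forall>n. X n \<in> L2" and C: "\<forall>e>0. \<exists>N. \<forall>m\<ge>N. \<forall>n\<ge>N. W.nm (X m - X n) < e"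
    have "\<exists>N. \<forall>m\<ge>N. \<forall>n\<ge>N. L.nm (X m - X n) < e" if "e > 0" for e
    proof -
      obtain N where N: "!!i j. i >= N ==> j >= N ==> W.nm (X i - X j) < e * sqrt m"
        using C[rule_format, of "e * sqrt m"] \<open>e > 0\<close> m(1) by auto
      have "L.nm (X i - X j) < e" if "i >= N" "j >= N" for i j
      proof -
        have "L.nm (X i - X j) <= W.nm (X i - X j) / sqrt m" using X by (intro le1) auto
        also have "\<dots> < e" using N[OF that] m(1) by (simp add: field_simps)
        finally show ?thesis .
      qed
      then show ?thesis by blast
    qed
    then obtain x where x: "x \<in> L2" "(\<lambda>n. L.nm (X n - x)) ~~> 0"
      using L2_complete X unfolding L.complete_in_def by blast
    have "(\<lambda>n. sqrt M * L.nm (X n - x)) ~~> 0" using tendsto_mult_right_zero[OF x(2)] .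
    then have "(\<lambda>n. W.nm (X n - x)) ~~> 0"
      by (rule Lim_null_comparison[rotated]) (use le2 X x in auto)
    then show "\<exists>y\<in>L2. (\<lambda>n. W.nm (X n - y)) ~~> 0" using x by blast
  qed
qed

section \<open>Weighted solenoidal spaces and the weak curl\<close>

definition Hs :: "(pt => real) => field set" where "Hs w = {f \<in> L2. div_free w f}"

abbreviation "Hs1 \<equiv> Hs (\<lambda>p. 1)"

lemma Hs_L2: "f \<in> Hs w ==> f \<in> L2"
  by (simp add: Hs_def)

lemma Hs_orth:
  assumes w: "gw w"
  shows "Hs w = {f \<in> L2. \<forall>s\<in>{per (\<lambda>p. c *s gr \<phi> p) | c \<phi>. test_fun \<phi>}. ip w f s = 0}"
  unfolding Hs_def using div_ip[OF _ gwD(1)[OF w]] by blast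

lemma Hs_complete:
  assumes w: "gw w"
  shows "subspace (Hs w)" "semi_ip.complete_in (ip w) (Hs w)"
proof -
  interpret W: semi_ip L2 "ip w" by (rule gw_semi[OF w])
  have "{per (\<lambda>p. c *s gr \<phi> p) | c \<phi>. test_fun \<phi>} \<subseteq> L2" by (auto intro!: per_L2 cmp_vsmult cmp_gr)
  from W.orth_complete[OF complete_gw[OF w] this]
  show "subspace (Hs w)" "W.complete_in (Hs w)" unfolding Hs_orth[OF w] .
qed

text \<open>The Helmholtz projection. With weight 1 it leads to fields accessible to Fourier
  analysis; with the weight \<epsilon> it produces elements of the constrained space.\<close>

lemma Hs_projection:
  assumes w: "gw w" and x: "x \<in> L2"
  shows "\<exists>y\<in>Hs w. \<forall>s\<in>Hs w. ip w (x - y) s = 0"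
proof -
  interpret W: semi_ip L2 "ip w" by (rule gw_semi[OF w])
  show ?thesis by (rule W.projection[OF Hs_complete(1)[OF w] _ Hs_complete(2)[OF w] x]) (auto simp: Hs_L2)
qed

text \<open>The field grad \<phi> x a is the curl of \<phi> a. With the constants taken out, the
  pairing is the integral of grad \<psi> x grad \<phi>, which vanishes by the exchange of
  derivatives in \<open>test_ibp_diff\<close>.\<close>

lemma grad_cross_orth:
  assumes s: "test_fun \<phi>" and t: "test_fun \<psi>"
  shows "(LI p. crs (gr \<phi> p) a \<bullet> (c *s gr \<psi> p)) = 0"
proof -
  obtain K where K: "K >= 0" "!!p. norm (gr \<phi> p) <= K" using cmpD(3)[OF cmp_gr[OF s]] by blast
  obtain K' where K': "K' >= 0" "!!p. norm (gr \<psi> p) <= K'" using cmpD(3)[OF cmp_gr[OF t]] by blast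
  have int: "Lint (\<lambda>p. crs (gr \<psi> p) (gr \<phi> p))"
  proof (rule integrable_bounded_support[of _ "K' * K"])
    show "norm (crs (gr \<psi> p) (gr \<phi> p)) <= K' * K" for p
    proof -
      have "norm (crs (gr \<psi> p) (gr \<phi> p)) <= norm (gr \<psi> p) * norm (gr \<phi> p)" by (rule norm_crs_le) simp
      also have "\<dots> <= K' * K" using K K' by (intro mult_mono) auto
      finally show ?thesis .
    qed
    show "bounded {p. crs (gr \<psi> p) (gr \<phi> p) ~= 0}"
      by (rule bounded_subset[OF cmpD(2)[OF cmp_gr[OF t]]]) auto
  qed (intro meas_crs cmpD cmp_gr s t)
  have ii: "Lint (\<lambda>p. complex_of_real (pd j a p * pd k b p))"
    if ab: "test_fun a" "test_fun b" for a b j k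
  proof -
    obtain M1 M2 where M: "!!p. \<bar>pd j a p\<bar> <= M1" "!!p. \<bar>pd k b p\<bar> <= M2"
      using test_bounded[OF test_pd[OF ab(1)]] test_bounded[OF test_pd[OF ab(2)]] by metis
    have "Lint (\<lambda>p. pd j a p * pd k b p)"
    proof (rule integrable_bounded_support[of _ "M1 * M2"])
      show "norm (pd j a p * pd k b p) <= M1 * M2" for p
        using mult_mono[OF M(1)[of p] M(2)[of p]] M(1)[of p] by (auto simp: abs_mult)
      show "bounded {p. pd j a p * pd k b p ~= 0}"
        using test_pd[OF ab(1), of j] by (auto simp: test_fun_def elim: bounded_subset)
    qed (intro borel_measurable_times test_meas test_pd ab)
    then show ?thesis by (rule integrable_of_real)
  qed
  have "(LI p. crs (gr \<psi> p) (gr \<phi> p)) $ i = 0" for i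
  proof -
    have "(LI p. crs (gr \<psi> p) (gr \<phi> p)) $ i = (LI p. crs (gr \<psi> p) (gr \<phi> p) $ i)"
      by (rule integral_bounded_linear[OF bounded_linear_nth int, symmetric])
    also have "\<dots> = (LI p. complex_of_real (pd (nxt i) \<psi> p * pd (nxt (nxt i)) \<phi> p) - complex_of_real (pd (nxt (nxt i)) \<psi> p * pd (nxt i) \<phi> p))"
      by (simp add: crs_def)
    also have "\<dots> = 0"
      by (subst int_diff[OF ii ii])
        (use s t in \<open>auto simp: test_ibp_diff[OF t s, of "nxt i"] simp del: of_real_mult\<close>)
    finally show ?thesis .
  qed
  then have z: "(LI p. crs (gr \<psi> p) (gr \<phi> p)) = 0" by (simp add: vec_eq_iff)
  have "(LI p. crs (gr \<phi> p) a \<bullet> (c *s gr \<psi> p)) = (LI p. a \<bullet> (c *s crs (gr \<psi> p) (gr \<phi> p)))"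
    by (rule int_cong) (simp_all add: inner3 algebra_simps)
  also have "\<dots> = a \<bullet> (c *s (LI p. crs (gr \<psi> p) (gr \<phi> p)))"
    by (rule integral_bounded_linear[OF _ int])
      (intro bounded_linear_compose[OF bounded_linear_inner_right] bounded_linear_vsmult)
  finally show ?thesis by (simp add: z)
qed

lemma shift_fields:
  assumes "test_fun \<phi>"
  shows "crs (gr \<phi> (p - gm k)) a = crs (gr (\<lambda>p. \<phi> (p - gm k)) p) a"
  using assms pd_shift[of \<phi> p "gm k"] by (simp add: gr_def test_fun_def smooth_diff)

text \<open>Curls of periodized test fields are divergence-free because each translate is orthogonal
  to every gradient. The phases are harmless: they are absorbed into the constant vector.\<close>

lemma per_curl_Hs:
  assumes s: "test_fun \<phi>"
  shows "per (\<lambda>p. crs (gr \<phi> p) a) \<in> Hs1"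
proof -
  have L: "per (\<lambda>p. crs (gr \<phi> p) a) \<in> L2" by (intro per_L2 cmp_crs_gr s)
  have "ip1 (per (\<lambda>p. crs (gr \<phi> p) a)) (per (\<lambda>p. c *s gr \<psi> p)) = 0" if t: "test_fun \<psi>" for \<psi> c
  proof -
    have c: "cmp (\<lambda>p. c *s gr \<psi> p)" by (intro cmp_vsmult cmp_gr t)
    obtain M where M: "(LI p. per (\<lambda>p. crs (gr \<phi> p) a) p \<bullet> (c *s gr \<psi> p))
       = (\<Sum>k\<in>Sq M. LI p. (ph k *s crs (gr \<phi> (p - gm k)) a) \<bullet> (c *s gr \<psi> p))"
      using per_pairing[OF cmp_crs_gr[OF s] c] by blast
    have "(LI p. (ph k *s crs (gr \<phi> (p - gm k)) a) \<bullet> (c *s gr \<psi> p)) = 0" for k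
      using grad_cross_orth[OF test_shift[OF s] t, of "gm k" "ph k *s a" c]
      by (simp only: shift_fields[OF s] crs_scale)
    then show ?thesis using M per_pair[OF L c] by simp
  qed
  then show ?thesis using L unfolding Hs_def by (simp add: div_ip)
qed

text \<open>Curl commutes with periodization: both pairings expand into the same finite family of
  translates, and on each of them the identity is integration by parts.\<close>

lemma per_curl:
  assumes s: "test_fun \<phi>"
  shows "is_curl (per (\<lambda>p. \<phi> p *\<^sub>R a)) (per (\<lambda>p. crs (gr \<phi> p) a))"
proof -
  have L1: "per (\<lambda>p. \<phi> p *\<^sub>R a) \<in> L2" by (intro per_L2 cmp_test s)
  have L2: "per (\<lambda>p. crs (gr \<phi> p) a) \<in> L2" by (intro per_L2 cmp_crs_gr s)
  have "ip1 (per (\<lambda>p. crs (gr \<phi> p) a)) (per (\<lambda>p. \<psi> p *\<^sub>R b)) = ip1 (per (\<lambda>p. \<phi> p *\<^sub>R a)) (per (\<lambda>p. crs (gr \<psi> p) b))"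
    if t: "test_fun \<psi>" for \<psi> b
  proof -
    obtain M1 where M1: "!!M. M >= M1 ==> (LI p. per (\<lambda>p. crs (gr \<phi> p) a) p \<bullet> (\<psi> p *\<^sub>R b))
       = (\<Sum>k\<in>Sq M. LI p. (ph k *s crs (gr \<phi> (p - gm k)) a) \<bullet> (\<psi> p *\<^sub>R b))"
      using per_pairing[OF cmp_crs_gr[OF s] cmp_test[OF t]] by blast
    obtain M2 where M2: "!!M. M >= M2 ==> (LI p. per (\<lambda>p. \<phi> p *\<^sub>R a) p \<bullet> crs (gr \<psi> p) b)
       = (\<Sum>k\<in>Sq M. LI p. (ph k *s (\<phi> (p - gm k) *\<^sub>R a)) \<bullet> crs (gr \<psi> p) b)"
      using per_pairing[OF cmp_test[OF s] cmp_crs_gr[OF t]] by blast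
    have "(LI p. (ph k *s crs (gr \<phi> (p - gm k)) a) \<bullet> (\<psi> p *\<^sub>R b))
        = (LI p. (ph k *s (\<phi> (p - gm k) *\<^sub>R a)) \<bullet> crs (gr \<psi> p) b)" for k
    proof -
      define \<phi>' where "\<phi>' p = \<phi> (p - gm k)" for p
      define a' where "a' = ph k *s a"
      have s': "test_fun \<phi>'" using test_shift[OF s] by (simp add: \<phi>'_def[abs_def])
      have gi: "Lint (\<lambda>p. u p *\<^sub>R gr v p)" if u: "test_fun u" and v: "test_fun v" for u v
      proof -
        obtain Mu where Mu: "!!p. \<bar>u p\<bar> <= Mu" using test_bounded[OF u] by blast
        obtain K where K: "K >= 0" "!!p. norm (gr v p) <= K" using cmpD(3)[OF cmp_gr[OF v]] by blast
        show ?thesis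
        proof (rule integrable_bounded_support[of _ "Mu * K"])
          show "norm (u p *\<^sub>R gr v p) <= Mu * K" for p using mult_mono[OF Mu[of p] K(2)[of p]] Mu[of p] by auto
          show "bounded {p. u p *\<^sub>R gr v p ~= 0}" by (rule bounded_subset[OF cmpD(2)[OF cmp_gr[OF v]]]) auto
        qed (intro borel_measurable_scaleR test_meas u cmpD cmp_gr v)
      qed
      have nth: "(LI p. u p *\<^sub>R gr v p) $ i = complex_of_real (LI p. u p * pd i v p)"
        if u: "test_fun u" and v: "test_fun v" for u v i
      proof -
        have "(LI p. u p *\<^sub>R gr v p) $ i = (LI p. (u p *\<^sub>R gr v p) $ i)"
          by (rule integral_bounded_linear[OF bounded_linear_nth gi[OF u v], symmetric])
        also have "\<dots> = (LI p. complex_of_real (u p * pd i v p))" by (simp add: scaleR_conv_of_real[where 'a=complex])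
        finally show ?thesis by (simp only: integral_complex_of_real)
      qed
      have key: "(LI p. \<psi> p *\<^sub>R gr \<phi>' p) = - (LI p. \<phi>' p *\<^sub>R gr \<psi> p)"
      proof -
        have "(LI p. \<psi> p * pd i \<phi>' p) = - (LI p. \<phi>' p * pd i \<psi> p)" for i
          using test_ibp[OF s' t, of i] by (simp add: mult.commute)
        then show ?thesis by (simp add: vec_eq_iff nth s' t)
      qed
      have "(LI p. (ph k *s crs (gr \<phi> (p - gm k)) a) \<bullet> (\<psi> p *\<^sub>R b)) = (LI p. crs (\<psi> p *\<^sub>R gr \<phi>' p) a' \<bullet> b)"
        by (rule int_cong) (simp_all add: shift_fields[OF s] crs_scale a'_def \<phi>'_def[abs_def] vsmult_scaleR)
      also have "\<dots> = crs (LI p. \<psi> p *\<^sub>R gr \<phi>' p) a' \<bullet> b"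
        by (rule integral_bounded_linear[OF _ gi[OF t s']])
          (intro bounded_linear_compose[OF bounded_linear_inner_left] bounded_linear_crs_left)
      also have "\<dots> = - (crs (LI p. \<phi>' p *\<^sub>R gr \<psi> p) a' \<bullet> b)"
        unfolding key by (simp add: crs_def inner_vec_def sum_3 algebra_simps)
      also have "\<dots> = - (LI p. crs (\<phi>' p *\<^sub>R gr \<psi> p) a' \<bullet> b)"
        by (subst integral_bounded_linear[OF _ gi[OF s' t], of "\<lambda>v. crs v a' \<bullet> b"])
          (auto intro!: bounded_linear_compose[OF bounded_linear_inner_left bounded_linear_crs_left])
      also have "\<dots> = (LI p. - (crs (\<phi>' p *\<^sub>R gr \<psi> p) a' \<bullet> b))" by simp
      also have "\<dots> = (LI p. (ph k *s (\<phi> (p - gm k) *\<^sub>R a)) \<bullet> crs (gr \<psi> p) b)"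
      proof (rule int_cong[OF refl])
        fix p
        have "ph k *s (\<phi> (p - gm k) *\<^sub>R a) = \<phi>' p *\<^sub>R a'" by (simp add: \<phi>'_def a'_def vec_eq_iff)
        then show "- (crs (\<phi>' p *\<^sub>R gr \<psi> p) a' \<bullet> b) = (ph k *s (\<phi> (p - gm k) *\<^sub>R a)) \<bullet> crs (gr \<psi> p) b"
          by (simp add: crs_scale crs_real_inner)
      qed
      finally show ?thesis .
    qed
    then have "(LI p. per (\<lambda>p. crs (gr \<phi> p) a) p \<bullet> (\<psi> p *\<^sub>R b)) = (LI p. per (\<lambda>p. \<phi> p *\<^sub>R a) p \<bullet> crs (gr \<psi> p) b)"
      using M1[of "max M1 M2"] M2[of "max M1 M2"] by simp
    then show ?thesis using per_pair[OF L2 cmp_test[OF t]] per_pair[OF L1 cmp_crs_gr[OF t]] by simp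
  qed
  then show ?thesis using curl_ip[OF L1 L2] by blast
qed

text \<open>The curls of periodized test fields all lie in \<open>Hs1\<close>; a field orthogonal to
  \<open>Hs1\<close> therefore pairs to 0 with each of them, which is what a vanishing weak curl
  means.\<close>

lemma orth_curl_free:
  assumes v: "v \<in> L2" and o: "!!s. s \<in> Hs1 ==> ip1 v s = 0"
  shows "is_curl v 0"
proof -
  have "ip1 0 (per (\<lambda>p. \<phi> p *\<^sub>R a)) = ip1 v (per (\<lambda>p. crs (gr \<phi> p) a))" if t: "test_fun \<phi>" for \<phi> a
    using o[OF per_curl_Hs[OF t]] per_L2[OF cmp_test[OF t]] by simp
  then show ?thesis using curl_ip[OF v L.mem(4)] by blast
qed

lemma curl_closed:
  assumes X: "!!n. X n \<in> L2" "!!n. Z n \<in> L2" "!!n. is_curl (X n) (Z n)" and x: "x \<in> L2" "z \<in> L2"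
    and lim: "(\<lambda>n. L.nm (X n - x)) ~~> 0" "(\<lambda>n. L.nm (Z n - z)) ~~> 0"
  shows "is_curl x z"
proof -
  have "ip1 z (per (\<lambda>p. \<phi> p *\<^sub>R a)) = ip1 x (per (\<lambda>p. crs (gr \<phi> p) a))" if t: "test_fun \<phi>" for \<phi> a
  proof -
    have 1: "(\<lambda>n. ip1 (Z n) (per (\<lambda>p. \<phi> p *\<^sub>R a))) ~~> ip1 z (per (\<lambda>p. \<phi> p *\<^sub>R a))"
      using X x lim t by (intro L.lim_ip per_L2 cmp_test)
    have 2: "(\<lambda>n. ip1 (X n) (per (\<lambda>p. crs (gr \<phi> p) a))) ~~> ip1 x (per (\<lambda>p. crs (gr \<phi> p) a))"
      using X x lim t by (intro L.lim_ip per_L2 cmp_crs_gr)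
    have "ip1 (Z n) (per (\<lambda>p. \<phi> p *\<^sub>R a)) = ip1 (X n) (per (\<lambda>p. crs (gr \<phi> p) a))" for n
      using curl_ip[OF X(1,2)] X(3) t by blast
    then show ?thesis using LIMSEQ_unique[OF 1] 2 by simp
  qed
  then show ?thesis using curl_ip[OF x] by blast
qed

lemma curl_add:
  assumes "f \<in> L2" "g \<in> L2" "f' \<in> L2" "g' \<in> L2" "is_curl f g" "is_curl f' g'"
  shows "is_curl (f + f') (g + g')"
  using assms curl_ip[of "f + f'" "g + g'"] curl_ip[of f g] curl_ip[of f' g']
  by (simp add: L.bilin per_L2 cmp_test cmp_crs_gr)

lemma curl_diff:
  assumes "f \<in> L2" "g \<in> L2" "f' \<in> L2" "g' \<in> L2" "is_curl f g" "is_curl f' g'"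
  shows "is_curl (f - f') (g - g')"
  using assms curl_ip[of "f - f'" "g - g'"] curl_ip[of f g] curl_ip[of f' g']
  by (simp add: L.bilin per_L2 cmp_test cmp_crs_gr)

lemma curl_vsmult:
  assumes f: "f \<in> L2" and g: "g \<in> L2" and c: "is_curl f g"
  shows "is_curl (\<lambda>p. c *s f p) (\<lambda>p. c *s g p)"
proof -
  have "(LI p. \<phi> p *\<^sub>R (c *s g p)) = - (LI p. crs (gr \<phi> p) (c *s f p))" if t: "test_fun \<phi>" for \<phi>
  proof -
    have "(LI p. \<phi> p *\<^sub>R (c *s g p)) = (LI p. c *s (\<phi> p *\<^sub>R g p))"
      by (rule int_cong) (simp_all add: vec_eq_iff)
    also have "\<dots> = c *s (LI p. \<phi> p *\<^sub>R g p)"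
      by (rule integral_bounded_linear[OF bounded_linear_vsmult int_test(1)[OF g t]])
    also have "\<dots> = - (c *s (LI p. crs (gr \<phi> p) (f p)))"
      using c t unfolding curl_vec[OF f g] by (simp add: vec_eq_iff)
    also have "c *s (LI p. crs (gr \<phi> p) (f p)) = (LI p. c *s crs (gr \<phi> p) (f p))"
      by (rule integral_bounded_linear[OF bounded_linear_vsmult int_test(2)[OF f t], symmetric])
    finally show ?thesis by (simp add: crs_scale)
  qed
  then show ?thesis using curl_vec[OF L2_smult[OF f] L2_smult[OF g]] by blast
qed

end

section \<open>Fourier series on a slab of the cell\<close>

type_synonym mode = "int \<times> int \<times> int"

lemma cis_2pi_int: "cis (2 * pi * of_int n) = 1"
  by (metis cis_multiple_2pi Ints_of_int)

context qp
begin

definition Q :: "mode => real^2" where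
  "Q m = (2 * pi * of_int (fst m)) *\<^sub>R w1 + (2 * pi * of_int (fst (snd m))) *\<^sub>R w2"

text \<open>Bloch exponential with horizontal wave vector \<alpha> + \<open>Q m\<close> and a
  vertical frequency in (pi / L) Z, hence with vertical period 2 L, the height of the slab.\<close>

definition em :: "real => mode => pt => complex" where
  "em L m p = cis ((\<alpha> + Q m) \<bullet> fst p + pi * of_int (snd (snd m)) / L * snd p)"

definition kv :: "real => mode => complex^3" where
  "kv L m = vector [complex_of_real ((\<alpha> + Q m) $ 1), complex_of_real ((\<alpha> + Q m) $ 2), complex_of_real (pi * of_int (snd (snd m)) / L)]"

text \<open>Half-open, so that points of the slab over the cell are separated by the exponentials of
  their coordinates.\<close>

definition sl :: "real => pt => real" where "sl L p = indicator {-L..<L} (snd p)"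

definition bas :: "real => mode => complex^3 => field" where
  "bas L m a = (\<lambda>p. sl L p *\<^sub>R (em L m p *s a))"

text \<open>Not normalized, so Parseval's identity carries the factor \<open>vol L\<close>.\<close>

definition cf :: "real => mode => field => complex^3" where
  "cf L m f = (LI p. indicator Y p *\<^sub>R (cnj (em L m p) *s f p))"

definition LL :: "real => field set" where
  "LL L = {f \<in> L2. \<forall>p. sl L p = 0 --> f p = 0}"

text \<open>Volume of the slab over the cell. Its positivity and its doubling with \<open>L\<close>
  are what the arguments use.\<close>

definition vol :: "real => real" where "vol L = (LI p. indicator Y p * sl L p)"

lemma Q_gm: "Q m \<bullet> fst (gm k) = 2 * pi * of_int (fst m * fst k + fst (snd m) * snd k)"
  by (simp add: Q_def gm_def inner_add_left inner_add_right algebra_simps)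

lemma snd_gm [simp]: "snd (gm k) = 0"
  by (simp add: gm_def)

lemma em_norm [simp]: "norm (em L m p) = 1"
  by (simp add: em_def)

lemma em_shift: "em L m (p + gm k) = ph k * em L m p"
proof -
  have "(\<alpha> + Q m) \<bullet> fst (p + gm k) + pi * of_int (snd (snd m)) / L * snd (p + gm k)
     = \<alpha> \<bullet> fst (gm k) + ((\<alpha> + Q m) \<bullet> fst p + pi * of_int (snd (snd m)) / L * snd p) + 2 * pi * of_int (fst m * fst k + fst (snd m) * snd k)"
    using Q_gm[of m k] unfolding gm_coord(5) by (simp add: inner_add_left inner_add_right)
  moreover have "cis (a + b + 2 * pi * of_int i) = cis a * cis b" for a b and i :: int
    by (simp only: cis_mult[symmetric] cis_2pi_int mult_1_right)
  ultimately show ?thesis unfolding em_def ph_def by (simp only:)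
qed

lemma em_cont: "continuous_on UNIV (em L m)"
  unfolding em_def cis_conv_exp by (intro continuous_intros)

lemma em_meas: "em L m \<in> Lmeas"
  by (rule cont_lebesgue[OF em_cont])

lemma cnj_em_meas: "(\<lambda>p. cnj (em L m p)) \<in> Lmeas"
  using em_cont by (intro cont_lebesgue continuous_on_cnj)

lemma slab_set_meas: "S \<in> sets borel ==> (\<lambda>p::pt. indicator S (snd p) :: real) \<in> Lmeas"
proof (intro measurable_completion)
  assume S: "S \<in> sets borel"
  have "(snd :: pt => real) \<in> borel_measurable borel" by (intro borel_measurable_continuous_onI continuous_intros)
  from measurable_compose[OF this borel_measurable_indicator[OF S]]
  show "(\<lambda>p::pt. indicator S (snd p) :: real) \<in> borel_measurable lborel" by simp
qed

lemma sl_meas: "sl L \<in> Lmeas"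
  unfolding sl_def[abs_def] by (rule slab_set_meas) simp

lemma sl_wt: "wt (sl L)"
  unfolding wt_def by (intro conjI sl_meas allI exI[of _ 1]) (auto simp: sl_def indicator_def)

lemma sl_simps [simp]: "0 <= sl L p" "sl L p <= 1" "sl L p * sl L p = sl L p"
  by (auto simp: sl_def indicator_def)

lemma sl_01: "sl L p = 0 \<or> sl L p = 1"
  by (auto simp: sl_def indicator_def)

lemma Y_slab_bounded: "bounded {p \<in> Y. \<bar>snd p\<bar> <= R}"
  unfolding bounded_iff
proof (intro exI ballI)
  fix p assume "p \<in> {p \<in> Y. \<bar>snd p\<bar> <= R}"
  then have p: "p \<in> Y" "\<bar>snd p\<bar> <= R" by auto
  have "norm (fst p) <= norm ((w1 \<bullet> fst p) *\<^sub>R a1) + norm ((w2 \<bullet> fst p) *\<^sub>R a2)"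
    using coord[of "fst p"] norm_triangle_ineq by metis
  also have "\<dots> <= norm a1 + norm a2" using p(1) by (intro add_mono) (auto simp: Y_iff intro!: mult_left_le_one_le)
  finally show "norm p <= (norm a1 + norm a2) + R"
    using norm_Pair_le[of "fst p" "snd p"] p(2) by simp
qed

lemma cell_integrable:
  fixes G :: "pt => 'b::{banach, second_countable_topology}"
  assumes m: "G \<in> Lmeas" and b: "!!p. norm (G p) <= M" and s: "!!p. G p ~= 0 ==> \<bar>snd p\<bar> <= R"
  shows "Lint (\<lambda>p. indicator Y p *\<^sub>R G p)"
proof (rule integrable_bounded_support[of _ M])
  show "(\<lambda>p. indicator Y p *\<^sub>R G p) \<in> Lmeas" by (intro borel_measurable_scaleR indY_meas m)
  have "0 <= M" using b norm_ge_zero order_trans by blast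
  then show "norm (indicator Y p *\<^sub>R G p) <= M" for p using b[of p] by (simp add: indicator_def)
  show "bounded {p. indicator Y p *\<^sub>R G p ~= 0}"
    by (rule bounded_subset[OF Y_slab_bounded[of R]]) (use s in \<open>auto simp: indicator_def split: if_splits\<close>)
qed

lemma LL_L2: "f \<in> LL L ==> f \<in> L2"
  by (simp add: LL_def)

lemma LL_I: "f \<in> L2 ==> (\<lambda>p. sl L p *\<^sub>R f p) \<in> LL L"
  unfolding LL_def using L2_wt[OF _ sl_wt] by auto

lemma LL_sl: "f \<in> LL L ==> sl L p *\<^sub>R f p = f p"
  using sl_01[of L p] by (cases p) (auto simp: LL_def)

lemma LL_subspace: "subspace (LL L)"
  by (rule subspaceI) (auto simp: LL_def)

lemma bas_LL: "bas L m a \<in> LL L"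
proof -
  have "(\<lambda>p. sl L p *\<^sub>R (em L m p *s a)) \<in> L2"
  proof (rule L2I)
    show ms: "(\<lambda>p. sl L p *\<^sub>R (em L m p *s a)) \<in> Lmeas"
      by (intro borel_measurable_scaleR sl_meas meas_vsmult em_meas borel_measurable_const)
    show "sl L (p + gm k) *\<^sub>R (em L m (p + gm k) *s a) = ph k *s (sl L p *\<^sub>R (em L m p *s a))" for p k
      using wtD(2)[OF sl_wt, of L p k] by (simp add: em_shift vsmult_scaleR vector_smult_assoc)
    have "Lint (\<lambda>p. indicator Y p *\<^sub>R ((norm (sl L p *\<^sub>R (em L m p *s a)))\<^sup>2))"
    proof (rule cell_integrable[of _ "(norm a)\<^sup>2" "\<bar>L\<bar>"])
      have "norm (sl L p *\<^sub>R (em L m p *s a)) <= norm a" for p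
        using sl_01[of L p] by (auto simp: norm_vsmult)
      then show "norm ((norm (sl L p *\<^sub>R (em L m p *s a)))\<^sup>2) <= (norm a)\<^sup>2" for p
        by (simp only: real_norm_def abs_power2 power_mono norm_ge_zero)
      show "\<bar>snd p\<bar> <= \<bar>L\<bar>" if "(norm (sl L p *\<^sub>R (em L m p *s a)))\<^sup>2 ~= 0" for p
        using that by (auto simp: sl_def indicator_def split: if_splits)
    qed (use ms in measurable)
    then show "Lint (\<lambda>p. indicator Y p * (norm (sl L p *\<^sub>R (em L m p *s a)))\<^sup>2)" by simp
  qed
  then show ?thesis by (auto simp: LL_def bas_def)
qed

lemma cf_integrable:
  assumes f: "f \<in> LL L"
  shows "Lint (\<lambda>p. indicator Y p *\<^sub>R (cnj (em L m p) *s f p))"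
proof (rule L2_dom[OF LL_L2[OF f], of _ 1])
  show "(\<lambda>p. indicator Y p *\<^sub>R (cnj (em L m p) *s f p)) \<in> Lmeas"
    by (intro borel_measurable_scaleR indY_meas meas_vsmult cnj_em_meas L2D(1)[OF LL_L2[OF f]])
  show "norm (indicator Y p *\<^sub>R (cnj (em L m p) *s f p)) <= 1 * norm (f p)" for p
    by (simp add: norm_vsmult indicator_def)
  have "\<bar>snd p\<bar> <= \<bar>L\<bar>" if "f p ~= 0" for p
  proof -
    have "sl L p ~= 0" using that f unfolding LL_def by blast
    then show ?thesis by (auto simp: sl_def indicator_def split: if_splits)
  qed
  then show "bounded {p. indicator Y p *\<^sub>R (cnj (em L m p) *s f p) ~= 0}"
    by (intro bounded_subset[OF Y_slab_bounded[of "\<bar>L\<bar>"]]) (auto simp: indicator_def split: if_splits)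
qed

lemma ip_bas:
  assumes f: "f \<in> LL L"
  shows "ip1 f (bas L m a) = cf L m f \<bullet> a"
proof -
  have "ip1 f (bas L m a) = (LI p. (indicator Y p *\<^sub>R (cnj (em L m p) *s f p)) \<bullet> a)"
    unfolding ip_def
  proof (rule int_cong[OF refl])
    fix p
    have "f p \<bullet> bas L m a p = (sl L p *\<^sub>R f p) \<bullet> (em L m p *s a)" by (simp add: bas_def)
    also have "\<dots> = (cnj (em L m p) *s f p) \<bullet> a" unfolding LL_sl[OF f] inner_vsmult_left complex_cnj_cnj ..
    finally show "indicator Y p * 1 * (f p \<bullet> bas L m a p) = (indicator Y p *\<^sub>R (cnj (em L m p) *s f p)) \<bullet> a" by simp
  qed
  also have "\<dots> = cf L m f \<bullet> a"
    unfolding cf_def by (rule integral_inner_left) (use cf_integrable[OF f] in auto)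
  finally show ?thesis .
qed

lemma cf_add: "f \<in> LL L ==> g \<in> LL L ==> cf L m (f + g) = cf L m f + cf L m g"
  unfolding cf_def
  by (subst int_add[symmetric]) (auto intro!: cf_integrable simp: scaleR_add_right vector_add_ldistrib)

lemma cf_diff: "f \<in> LL L ==> g \<in> LL L ==> cf L m (f - g) = cf L m f - cf L m g"
  unfolding cf_def
  by (subst int_diff[symmetric])
    (auto intro!: cf_integrable simp: scaleR_diff_right vec.scale_right_diff_distrib)

lemma sum_ind_Sq:
  assumes "\<bar>w1 \<bullet> fst q\<bar> <= real N" "\<bar>w2 \<bullet> fst q\<bar> <= real N"
  shows "(\<Sum>k\<in>Sq N. indicator Y (q - gm k)) = (1::real)"
  using decomp[of "\<lambda>p. if p = q then 1 else (0::real)" N q] assms by (auto split: if_splits)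

text \<open>The translated cell is again a fundamental domain. This is seen by unfolding: at each
  point the indicators of its lattice translates add up to 1.\<close>

lemma periodic_shift:
  fixes G :: "pt => complex"
  assumes m: "G \<in> Lmeas" and b: "!!p. norm (G p) <= M" and s: "!!p. G p ~= 0 ==> \<bar>snd p\<bar> <= R"
    and per: "!!p k. G (p + gm k) = G p" and y: "snd y = 0"
  shows "(LI p. indicator Y p *\<^sub>R G (p + y)) = (LI p. indicator Y p *\<^sub>R G p)"
proof -
  define f where "f p = indicator Y (p - y) *\<^sub>R G p" for p
  have i0: "Lint (\<lambda>p. indicator Y p *\<^sub>R G (p + y))"
    by (rule cell_integrable[of _ M R]) (use b s[of "_ + y"] y in \<open>auto intro!: meas_shift(1)[OF m]\<close>)
  have i: "Lint f"
    using integrable_shift[OF i0, of "- y"] by (simp add: f_def[abs_def])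
  obtain N where N: "!!p. p \<in> (\<lambda>q. q + y) ` {p \<in> Y. \<bar>snd p\<bar> <= R} ==> \<bar>w1 \<bullet> fst p\<bar> <= real N & \<bar>w2 \<bullet> fst p\<bar> <= real N"
    by (rule bounded_coords[of "(\<lambda>q. q + y) ` {p \<in> Y. \<bar>snd p\<bar> <= R}"])
      (use bounded_translation[OF Y_slab_bounded, of y] in \<open>auto simp: add.commute\<close>)
  obtain N1 :: nat where N1: "1 + \<bar>w1 \<bullet> fst y\<bar> <= real N1" "1 + \<bar>w2 \<bullet> fst y\<bar> <= real N1"
    using real_arch_simple[of "max (1 + \<bar>w1 \<bullet> fst y\<bar>) (1 + \<bar>w2 \<bullet> fst y\<bar>)"] by auto
  define K where "K = N + N1"
  have "(LI p. indicator Y p *\<^sub>R G (p + y)) = (LI p. f (p + y))" by (simp add: f_def)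
  also have "\<dots> = (LI p. f p)" using i by (intro integral_shift) auto
  also have "\<dots> = (LI p. indicator Y p *\<^sub>R (\<Sum>k\<in>Sq K. f (p + gm k)))"
  proof (rule unfold_integral[OF i])
    fix p assume "f p ~= 0"
    then have "p - y \<in> Y" "G p ~= 0" by (auto simp: f_def indicator_def split: if_splits)
    then have "p - y \<in> {p \<in> Y. \<bar>snd p\<bar> <= R}" using s y by simp
    then have "p \<in> (\<lambda>q. q + y) ` {p \<in> Y. \<bar>snd p\<bar> <= R}" by (intro image_eqI[of _ _ "p - y"]) auto
    from N[OF this] show "\<bar>w1 \<bullet> fst p\<bar> <= real K & \<bar>w2 \<bullet> fst p\<bar> <= real K" by (simp add: K_def)
  qed
  also have "\<dots> = (LI p. indicator Y p *\<^sub>R G p)"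
  proof (rule int_cong[OF refl])
    fix p
    show "indicator Y p *\<^sub>R (\<Sum>k\<in>Sq K. f (p + gm k)) = indicator Y p *\<^sub>R G p"
    proof (cases "p \<in> Y")
      case True
      have "(\<Sum>k\<in>Sq K. f (p + gm k)) = (\<Sum>k\<in>uminus ` Sq K. f (p + gm k))" by (simp add: Sq_minus)
      also have "\<dots> = (\<Sum>k\<in>Sq K. f (p + gm (- k)))" by (subst sum.reindex) (auto simp: inj_on_def)
      also have "\<dots> = (\<Sum>k\<in>Sq K. indicator Y ((p - y) - gm k) *\<^sub>R G p)"
        by (intro sum.cong refl) (simp only: f_def per, simp add: gm_minus algebra_simps)
      also have "\<dots> = (\<Sum>k\<in>Sq K. indicator Y ((p - y) - gm k)) *\<^sub>R G p" by (simp only: scaleR_sum_left)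
      also have "(\<Sum>k\<in>Sq K. indicator Y ((p - y) - gm k)) = (1::real)"
        by (rule sum_ind_Sq) (use True N1 in \<open>auto simp: Y_iff inner_diff_right K_def\<close>)
      finally show ?thesis by simp
    qed simp
  qed
  finally show ?thesis .
qed

lemma slab_integrable:
  assumes "g \<in> Lmeas" "!!p. norm (g p :: complex) <= 1" "S \<in> sets borel" "S \<subseteq> {-R..R}"
  shows "Lint (\<lambda>p. indicator Y p *\<^sub>R (indicator S (snd p) *\<^sub>R g p))"
proof (rule cell_integrable[of _ 1 R])
  show "(\<lambda>p. indicator S (snd p) *\<^sub>R g p) \<in> Lmeas"
    by (intro borel_measurable_scaleR slab_set_meas assms)
  show "norm (indicator S (snd p) *\<^sub>R g p) <= 1" for p using assms(2)[of p] by (simp add: indicator_def)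
  fix p assume "indicator S (snd p) *\<^sub>R g p ~= 0"
  then have "snd p \<in> S" by (auto simp: indicator_def split: if_splits)
  then have "snd p \<in> {-R..R}" using assms(4) by blast
  then show "\<bar>snd p\<bar> <= R" by (simp add: abs_le_iff)
qed

text \<open>No integral is evaluated. Shifting the slab by half a period of the mode changes the
  sign of the integral, while the 2 L-periodicity shows that the shift leaves it unchanged.\<close>

lemma vertical_orth:
  assumes L: "L > 0" and d: "d ~= (0::int)"
  shows "(LI p. indicator Y p *\<^sub>R (sl L p *\<^sub>R cis (pi * of_int d / L * snd p))) = 0"
proof -
  define g :: "pt => complex" where "g p = cis (pi * of_int d / L * snd p)" for p
  have gm: "g \<in> Lmeas"
    unfolding g_def[abs_def] cis_conv_exp by (intro cont_lebesgue continuous_intros)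
  have gn: "norm (g p) <= 1" for p by (simp add: g_def)
  define I where "I S = (LI p. indicator Y p *\<^sub>R (indicator S (snd p) *\<^sub>R g p))" for S
  have int: "Lint (\<lambda>p. indicator Y p *\<^sub>R (indicator {a..<b} (snd p) *\<^sub>R g p))" for a b :: real
    by (rule slab_integrable[OF gm gn, of _ "max \<bar>a\<bar> \<bar>b\<bar>"]) auto
  have add: "I {a..<c} = I {a..<b} + I {b..<c}" if "a <= b" "b <= c" for a b c :: real
    unfolding I_def
    by (subst int_add[symmetric, OF int int], rule int_cong[OF refl])
      (use that in \<open>auto simp: indicator_def\<close>)
  \<comment> \<open>Half a vertical period of the mode; it is at most \<open>L\<close> because |d|
    is at least 1.\<close>
  define t where "t = L / \<bar>real_of_int d\<bar>"
  have t: "0 < t" "t <= L" using L d by (auto simp: t_def divide_le_eq)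
  have sh: "I {a + s..<b + s} = (LI p. indicator Y p *\<^sub>R (indicator {a..<b} (snd p) *\<^sub>R g (p + (0, s))))" for a b s :: real
  proof -
    have "(LI p. indicator Y (p + (0,s)) *\<^sub>R (indicator {a + s..<b + s} (snd (p + (0,s))) *\<^sub>R g (p + (0, s)))) = I {a + s..<b + s}"
      unfolding I_def by (rule integral_shift) (use int[of "a + s" "b + s"] in auto)
    moreover have "indicator Y (p + (0,s)) = (indicator Y p :: real)" for p by (simp add: indicator_def Y_iff)
    moreover have "indicator {a + s..<b + s} (snd (p + (0,s))) = (indicator {a..<b} (snd p) :: real)" for p :: pt by (simp add: indicator_def)
    ultimately show ?thesis by simp
  qed
  have g1: "g (p + (0, t)) = - g p" for p
  proof -
    have "g (p + (0,t)) = cis (pi * of_int d / L * snd p) * cis (pi * of_int d / L * t)"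
      by (simp add: g_def cis_mult distrib_left)
    also have "pi * of_int d / L * t = (if d > 0 then pi else - pi)" using L d by (auto simp: t_def abs_if)
    finally show ?thesis by (auto simp: g_def complex_eq_iff split: if_splits)
  qed
  have g2: "g (p + (0, 2 * L)) = g p" for p
  proof -
    have "g (p + (0, 2 * L)) = cis (pi * of_int d / L * snd p) * cis (2 * pi * of_int d)"
    proof -
      have "pi * of_int d / L * (snd p + 2 * L) = pi * of_int d / L * snd p + 2 * pi * of_int d" using L by (simp add: field_simps)
      then have "g (p + (0, 2 * L)) = cis (pi * of_int d / L * snd p + 2 * pi * of_int d)" by (simp add: g_def)
      then show ?thesis by (simp only: cis_mult)
    qed
    then show ?thesis by (simp add: g_def cis_2pi_int)
  qed
  have "I {-L + t..<L + t} = - I {-L..<L}"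
    unfolding sh g1 unfolding I_def by simp
  moreover have "I {-L + 2 * L..<(-L + t) + 2 * L} = I {-L..<-L + t}"
    unfolding sh g2 unfolding I_def by simp
  moreover have "I {-L..<L} = I {-L..<-L + t} + I {-L + t..<L}" "I {-L + t..<L + t} = I {-L + t..<L} + I {L..<L + t}"
    using t by (intro add; simp)+
  ultimately have "I {-L..<L} + I {-L..<L} = 0" by (simp add: algebra_simps)
  then show ?thesis by (simp add: I_def g_def sl_def)
qed

text \<open>If the horizontal indices differ, a suitable horizontal half-period shift reverses the
  sign of the integrand without changing its integral; otherwise only the vertical frequency
  differs.\<close>

lemma em_orth:
  assumes L: "L > 0" and mn: "m ~= n"
  shows "(LI p. indicator Y p *\<^sub>R (sl L p *\<^sub>R (em L m p * cnj (em L n p)))) = 0"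
proof -
  define d where "d = m - n"
  have e: "em L m p * cnj (em L n p) = cis (Q d \<bullet> fst p + pi * of_int (snd (snd d)) / L * snd p)" for p
  proof -
    have "((\<alpha> + Q m) \<bullet> fst p + pi * of_int (snd (snd m)) / L * snd p) + - ((\<alpha> + Q n) \<bullet> fst p + pi * of_int (snd (snd n)) / L * snd p)
       = Q d \<bullet> fst p + pi * of_int (snd (snd d)) / L * snd p"
      by (simp add: Q_def d_def inner_add_left inner_diff_left algebra_simps diff_divide_distrib)
    then show ?thesis unfolding em_def cis_cnj cis_mult by (simp only:)
  qed
  show ?thesis
  proof (cases "fst d = 0 & fst (snd d) = 0")
    case True
    then have "Q d = 0" by (simp add: Q_def)
    moreover have "snd (snd d) ~= 0" using True mn by (auto simp: d_def prod_eq_iff)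
    ultimately show ?thesis using vertical_orth[OF L] by (simp add: e)
  next
    case False
    \<comment> \<open>Half a period of the difference mode along a generator whose index is
      nonzero.\<close>
    define y :: pt where "y = (if fst d ~= 0 then ((1 / (2 * of_int (fst d))) *\<^sub>R a1, 0) else ((1 / (2 * of_int (fst (snd d)))) *\<^sub>R a2, 0))"
    have y: "snd y = 0" "Q d \<bullet> fst y = pi" using False by (auto simp: y_def Q_def inner_add_left)
    define G where "G p = sl L p *\<^sub>R (em L m p * cnj (em L n p))" for p
    have 1: "(LI p. indicator Y p *\<^sub>R G (p + y)) = (LI p. indicator Y p *\<^sub>R G p)"
    proof (rule periodic_shift[of _ 1 L])
      show "G \<in> Lmeas"
        unfolding G_def[abs_def] by (intro borel_measurable_scaleR sl_meas borel_measurable_times em_meas cnj_em_meas)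
      show "norm (G p) <= 1" for p using sl_01[of L p] by (auto simp: G_def norm_mult)
      show "\<bar>snd p\<bar> <= L" if "G p ~= 0" for p using that by (auto simp: G_def sl_def indicator_def split: if_splits)
      show "G (p + gm k) = G p" for p k
      proof -
        have "cis (Q d \<bullet> fst (p + gm k) + pi * of_int (snd (snd d)) / L * snd (p + gm k))
           = cis ((Q d \<bullet> fst p + pi * of_int (snd (snd d)) / L * snd p) + 2 * pi * of_int (fst d * fst k + fst (snd d) * snd k))"
          using Q_gm[of d k] unfolding gm_coord(5) by (simp add: inner_add_right algebra_simps)
        also have "\<dots> = cis (Q d \<bullet> fst p + pi * of_int (snd (snd d)) / L * snd p)"
          unfolding cis_mult[symmetric] cis_2pi_int by simp
        finally show ?thesis using wtD(2)[OF sl_wt, of L p k] by (simp add: G_def e)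
      qed
    qed (rule y)
    have 2: "G (p + y) = - G p" for p
    proof -
      have "G (p + y) = sl L p *\<^sub>R cis ((Q d \<bullet> fst p + pi * of_int (snd (snd d)) / L * snd p) + pi)"
        using y by (simp add: G_def e sl_def inner_add_right algebra_simps)
      also have "\<dots> = - G p" unfolding cis_mult[symmetric] G_def e by simp
      finally show ?thesis .
    qed
    from 1 have "(LI p. indicator Y p *\<^sub>R G p) = 0" unfolding 2 by simp
    then show ?thesis by (simp add: G_def)
  qed
qed

lemma ip_bas_bas:
  assumes L: "L > 0"
  shows "ip1 (bas L m a) (bas L n b) = (if m = n then vol L * (a \<bullet> b) else 0)"
proof -
  define c where "c = (LI p. indicator Y p *\<^sub>R (sl L p *\<^sub>R (em L m p * cnj (em L n p))))"
  have int: "Lint (\<lambda>p. indicator Y p *\<^sub>R (sl L p *\<^sub>R (em L m p * cnj (em L n p))))"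
    unfolding sl_def by (rule slab_integrable[of _ _ L])
      (auto intro!: borel_measurable_times em_meas cnj_em_meas simp: norm_mult)
  have "ip1 (bas L m a) (bas L n b) = cf L n (bas L m a) \<bullet> b" by (rule ip_bas[OF bas_LL])
  also have "cf L n (bas L m a) = (LI p. (indicator Y p *\<^sub>R (sl L p *\<^sub>R (em L m p * cnj (em L n p)))) *s a)"
    unfolding cf_def by (rule int_cong) (auto simp: bas_def vec_eq_iff)
  also have "\<dots> = c *s a"
    unfolding c_def by (rule integral_bounded_linear[OF _ int]) (rule bounded_bilinear.bounded_linear_left[OF bb_vsmult])
  finally have eq: "ip1 (bas L m a) (bas L n b) = (c *s a) \<bullet> b" .
  show ?thesis
  proof (cases "m = n")
    case True
    have "em L n p * cnj (em L n p) = 1" for p by (simp add: em_def cis_cnj cis_mult)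
    then have "c = (LI p. complex_of_real (indicator Y p * sl L p))"
      unfolding c_def True by (simp add: scaleR_conv_of_real)
    then have "c = complex_of_real (vol L)" by (simp only: vol_def integral_complex_of_real)
    then show ?thesis using True eq by (simp add: inner3 algebra_simps)
  next
    case False
    then show ?thesis using eq em_orth[OF L False] by (simp add: c_def)
  qed
qed

text \<open>The slab over the cell contains a nonempty open box in the dual coordinates, and open
  sets are not negligible.\<close>

lemma vol_pos:
  assumes L: "L > 0"
  shows "0 < vol L"
proof (rule ccontr)
  assume "~ 0 < vol L"
  have int: "Lint (\<lambda>p. indicator Y p * sl L p)"
  proof -
    have "\<bar>snd p\<bar> <= L" if "sl L p ~= 0" for p
      using that by (auto simp: sl_def indicator_def abs_le_iff split: if_splits)
    then show ?thesis using cell_integrable[of "sl L" 1 L] sl_meas by simp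
  qed
  have "0 <= vol L" unfolding vol_def by (intro integral_nonneg_AE always_eventually allI mult_nonneg_nonneg) auto
  then have "(LI p. indicator Y p * sl L p) = 0" using \<open>~ 0 < vol L\<close> unfolding vol_def by linarith
  then have "AE p in lebesgue. indicator Y p * sl L p = 0"
    using integral_nonneg_eq_0_iff_AE[OF int] by simp
  then have z: "AE p in lebesgue. ~ (p \<in> Y & \<bar>snd p\<bar> < L)"
    by eventually_elim (auto simp: sl_def indicator_def split: if_splits)
  have op: "open {p::pt. \<bar>w1 \<bullet> fst p - 1/2\<bar> < 1/2 & \<bar>w2 \<bullet> fst p - 1/2\<bar> < 1/2 & \<bar>snd p\<bar> < L}" (is "open ?U")
    by (intro open_Collect_conj open_Collect_less continuous_intros)
  have "?U \<subseteq> {p. p \<in> Y & \<bar>snd p\<bar> < L}"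
  proof
    fix p assume "p \<in> ?U"
    then have a: "\<bar>w1 \<bullet> fst p - 1/2\<bar> < 1/2" "\<bar>w2 \<bullet> fst p - 1/2\<bar> < 1/2" "\<bar>snd p\<bar> < L"
      unfolding mem_Collect_eq by blast+
    show "p \<in> {p. p \<in> Y & \<bar>snd p\<bar> < L}"
      unfolding mem_Collect_eq Y_iff using a by (intro conjI; linarith)
  qed
  then have "AE p in lebesgue. p \<notin> ?U"
    using z by (rule_tac eventually_mono[OF z]) blast
  moreover have "?U \<in> sets lebesgue" using borel_open[OF op] by simp
  ultimately have "?U \<in> null_sets lebesgue" by (simp only: AE_iff_null_sets)
  then have "negligible ?U" by (simp only: negligible_iff_null_sets)
  then have "?U = {}" using open_not_negligible[OF op] by blast
  moreover have "((1/2) *\<^sub>R a1 + (1/2) *\<^sub>R a2, 0) \<in> ?U" using L by (simp add: inner_add_right)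
  ultimately show False by blast
qed

end

section \<open>Totality of the exponentials\<close>

type_synonym c3 = "complex \<times> complex \<times> complex"

context qp
begin

text \<open>Maps the slab over the cell injectively into a three-dimensional torus. There
  Stone--Weierstrass applies, and polynomials pull back to combinations of modes.\<close>

definition zm :: "real => pt => c3" where
  "zm L p = (cis (2 * pi * (w1 \<bullet> fst p)), cis (2 * pi * (w2 \<bullet> fst p)), cis (pi / L * snd p))"

definition E0 :: "real => mode => pt => complex" where
  "E0 L m p = cis (Q m \<bullet> fst p + pi * of_int (snd (snd m)) / L * snd p)"

inductive trig :: "real => (pt => complex) => bool" for L where
  trig_mode: "trig L (\<lambda>p. c * E0 L m p)"
| trig_add: "trig L s ==> trig L t ==> trig L (\<lambda>p. s p + t p)"

lemma E0_mult: "E0 L m p * E0 L n p = E0 L (m + n) p"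
  by (simp add: E0_def cis_mult Q_def inner_add_left algebra_simps add_divide_distrib)

lemma trig_mult_mode: "trig L t ==> trig L (\<lambda>p. c * E0 L m p * t p)"
proof (induction rule: trig.induct)
  case (trig_mode c' m')
  have "(\<lambda>p. c * E0 L m p * (c' * E0 L m' p)) = (\<lambda>p. (c * c') * E0 L (m + m') p)"
    by (rule ext) (simp add: E0_mult[symmetric])
  then show ?case using trig.trig_mode by simp
next
  case (trig_add s t)
  show ?case using trig.trig_add[OF trig_add.IH] by (simp add: distrib_left)
qed

lemma trig_mult: "trig L s ==> trig L t ==> trig L (\<lambda>p. s p * t p)"
proof (induction rule: trig.induct)
  case (trig_mode c m)
  then show ?case by (rule trig_mult_mode)
next
  case (trig_add s1 s2)
  show ?case using trig.trig_add[OF trig_add.IH(1)[OF trig_add.prems] trig_add.IH(2)[OF trig_add.prems]] by (simp add: distrib_right)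
qed

lemma trig_const: "trig L (\<lambda>p. c)"
  using trig_mode[of L c 0] by (simp add: E0_def Q_def)

lemma trig_scale: "trig L t ==> trig L (\<lambda>p. c * t p)"
  using trig_mult[OF trig_const] .

lemma cis_E0:
  "cis (2 * pi * (w1 \<bullet> fst p)) = E0 L (1,0,0) p" "cnj (cis (2 * pi * (w1 \<bullet> fst p))) = E0 L (-1,0,0) p"
  "cis (2 * pi * (w2 \<bullet> fst p)) = E0 L (0,1,0) p" "cnj (cis (2 * pi * (w2 \<bullet> fst p))) = E0 L (0,-1,0) p"
  "cis (pi / L * snd p) = E0 L (0,0,1) p" "cnj (cis (pi / L * snd p)) = E0 L (0,0,-1) p"
  by (simp_all add: E0_def Q_def cis_cnj)

lemma trig_Re_Im:
  assumes "trig L z" "trig L (\<lambda>p. cnj (z p))"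
  shows "trig L (\<lambda>p. of_real (Re (z p)))" "trig L (\<lambda>p. of_real (Im (z p)))"
proof -
  have "trig L (\<lambda>p. (1/2) * (z p + cnj (z p)))" by (intro trig_scale trig_add assms)
  then show "trig L (\<lambda>p. of_real (Re (z p)))" by (simp add: complex_add_cnj)
  have "trig L (\<lambda>p. (- \<i> / 2) * (z p + (-1) * cnj (z p)))" by (intro trig_scale trig_add assms)
  moreover have "(- \<i> / 2) * (z p + (-1) * cnj (z p)) = of_real (Im (z p))" for p
    by (simp add: complex_eq_iff)
  ultimately show "trig L (\<lambda>p. of_real (Im (z p)))" by simp
qed

lemma trig_poly:
  assumes "real_polynomial_function (P :: c3 => real)"
  shows "trig L (\<lambda>p. of_real (P (zm L p)))"
  using assms
proof (induction rule: real_polynomial_function.induct)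
  case (linear f)
  interpret bounded_linear f by (rule linear)
  \<comment> \<open>A real-linear functional of three complex numbers is given by its values at 1
    and i in each slot; thus the real and imaginary parts of the coordinates enter.\<close>
  have split: "f (x, y, z) = Re x * f (1,0,0) + Im x * f (\<i>,0,0) + Re y * f (0,1,0) + Im y * f (0,\<i>,0) + Re z * f (0,0,1) + Im z * f (0,0,\<i>)" for x y z
  proof -
    have "(x, y, z) = Re x *\<^sub>R (1,0,0) + Im x *\<^sub>R (\<i>,0,0) + Re y *\<^sub>R (0,1,0) + Im y *\<^sub>R (0,\<i>,0) + Re z *\<^sub>R (0,0,1) + Im z *\<^sub>R (0,0,\<i>)"
      by (simp add: complex_eq_iff)
    then have "f (x, y, z) = f (Re x *\<^sub>R (1,0,0) + Im x *\<^sub>R (\<i>,0,0) + Re y *\<^sub>R (0,1,0) + Im y *\<^sub>R (0,\<i>,0) + Re z *\<^sub>R (0,0,1) + Im z *\<^sub>R (0,0,\<i>))" by (rule arg_cong)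
    also have "\<dots> = Re x * f (1,0,0) + Im x * f (\<i>,0,0) + Re y * f (0,1,0) + Im y * f (0,\<i>,0) + Re z * f (0,0,1) + Im z * f (0,0,\<i>)"
      by (simp only: add scaleR real_scaleR_def)
    finally show ?thesis .
  qed
  have t: "trig L (\<lambda>p. E0 L m p)" for m using trig_mode[of L 1 m] by simp
  define x where "x p = cis (2 * pi * (w1 \<bullet> fst p))" for p :: pt
  define y where "y p = cis (2 * pi * (w2 \<bullet> fst p))" for p :: pt
  define z where "z p = cis (pi / L * snd p)" for p :: pt
  have tx: "trig L (\<lambda>p. of_real (Re (x p)))" "trig L (\<lambda>p. of_real (Im (x p)))"
  proof -
    have a: "trig L x" unfolding x_def[abs_def] cis_E0(1)[where L=L] by (rule t)
    have b: "trig L (\<lambda>p. cnj (x p))" unfolding x_def cis_E0(2)[where L=L] by (rule t)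
    show "trig L (\<lambda>p. of_real (Re (x p)))" "trig L (\<lambda>p. of_real (Im (x p)))"
      by (rule trig_Re_Im[OF a b])+
  qed
  have ty: "trig L (\<lambda>p. of_real (Re (y p)))" "trig L (\<lambda>p. of_real (Im (y p)))"
  proof -
    have a: "trig L y" unfolding y_def[abs_def] cis_E0(3)[where L=L] by (rule t)
    have b: "trig L (\<lambda>p. cnj (y p))" unfolding y_def cis_E0(4)[where L=L] by (rule t)
    show "trig L (\<lambda>p. of_real (Re (y p)))" "trig L (\<lambda>p. of_real (Im (y p)))"
      by (rule trig_Re_Im[OF a b])+
  qed
  have tz: "trig L (\<lambda>p. of_real (Re (z p)))" "trig L (\<lambda>p. of_real (Im (z p)))"
  proof -
    have a: "trig L z" unfolding z_def[abs_def] cis_E0(5)[where L=L] by (rule t)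
    have b: "trig L (\<lambda>p. cnj (z p))" unfolding z_def cis_E0(6)[where L=L] by (rule t)
    show "trig L (\<lambda>p. of_real (Re (z p)))" "trig L (\<lambda>p. of_real (Im (z p)))"
      by (rule trig_Re_Im[OF a b])+
  qed
  have t6: "trig L (\<lambda>p. of_real (Re (x p)) * of_real (f (1,0,0)) + of_real (Im (x p)) * of_real (f (\<i>,0,0))
     + of_real (Re (y p)) * of_real (f (0,1,0)) + of_real (Im (y p)) * of_real (f (0,\<i>,0))
     + of_real (Re (z p)) * of_real (f (0,0,1)) + of_real (Im (z p)) * of_real (f (0,0,\<i>)))"
    by (intro trig_add trig_mult tx ty tz trig_const)
  have zm: "zm L p = (x p, y p, z p)" for p by (simp add: zm_def x_def y_def z_def)
  show ?case
  proof -
    have "f (zm L p) = Re (x p) * f (1,0,0) + Im (x p) * f (\<i>,0,0) + Re (y p) * f (0,1,0) + Im (y p) * f (0,\<i>,0)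
        + Re (z p) * f (0,0,1) + Im (z p) * f (0,0,\<i>)" for p
      unfolding zm by (rule split)
    then show ?thesis using t6 by (simp only: of_real_add of_real_mult)
  qed
next
  case (const c)
  show ?case by (rule trig_const)
next
  case (add f g)
  show ?case using trig_add[OF add.IH] by simp
next
  case (mult f g)
  show ?case using trig_mult[OF mult.IH] by simp
qed

lemma zm_cont: "continuous_on UNIV (zm L)"
  unfolding zm_def cis_conv_exp by (intro continuous_intros)

text \<open>Removes the Bloch phase and restricts to the cell, so that the Fourier coefficients
  become integrals against periodic exponentials.\<close>

definition FF :: "field => field" where
  "FF f p = indicator Y p *\<^sub>R (cis (- (\<alpha> \<bullet> fst p)) *s f p)"

lemma FF_norm: "norm (FF f p) = indicator Y p * norm (f p)"
  by (simp add: FF_def norm_vsmult indicator_def)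

lemma FF_meas:
  assumes "f \<in> L2" shows "FF f \<in> Lmeas"
proof -
  have "(\<lambda>p::pt. cis (- (\<alpha> \<bullet> fst p))) \<in> Lmeas"
    unfolding cis_conv_exp by (intro cont_lebesgue continuous_intros)
  then show ?thesis unfolding FF_def[abs_def]
    by (intro borel_measurable_scaleR indY_meas meas_vsmult L2D(1)[OF assms])
qed

lemma LL_supp: "f \<in> LL L ==> f p ~= 0 ==> - L <= snd p & snd p < L"
proof (rule ccontr)
  assume f: "f \<in> LL L" "f p ~= 0" and "~ (- L <= snd p & snd p < L)"
  then have "sl L p = 0" by (auto simp: sl_def indicator_def)
  then show False using f unfolding LL_def by blast
qed

lemma FF_supp: "f \<in> LL L ==> FF f p ~= 0 ==> p \<in> Y & - L <= snd p & snd p < L"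
  using LL_supp[of f L p] by (auto simp: FF_def indicator_def split: if_splits)

lemma FF_times:
  assumes f: "f \<in> LL L" and c: "c \<in> Lmeas" and b: "!!p. norm (c p :: complex) <= M"
  shows "Lint (\<lambda>p. c p *s FF f p)"
proof (rule L2_dom[OF LL_L2[OF f], of _ M])
  show "(\<lambda>p. c p *s FF f p) \<in> Lmeas" by (intro meas_vsmult c FF_meas LL_L2[OF f])
  show "norm (c p *s FF f p) <= M * norm (f p)" for p
  proof -
    have M: "0 <= M" using b norm_ge_zero order_trans by blast
    have "norm (c p *s FF f p) <= M * norm (FF f p)" by (simp add: norm_vsmult mult_right_mono b)
    also have "\<dots> <= M * norm (f p)" using M by (intro mult_left_mono) (auto simp: FF_norm indicator_def)
    finally show ?thesis .
  qed
  show "bounded {p. c p *s FF f p ~= 0}"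
  proof (rule bounded_subset[OF Y_slab_bounded[of "\<bar>L\<bar>"]], rule subsetI)
    fix p assume "p \<in> {p. c p *s FF f p ~= 0}"
    then have "FF f p ~= 0" by auto
    from FF_supp[OF f this] show "p \<in> {p \<in> Y. \<bar>snd p\<bar> <= \<bar>L\<bar>}" by auto
  qed
qed

lemma trig_bounded: "trig L t ==> t \<in> Lmeas & (\<exists>M. \<forall>p. norm (t p) <= M)"
proof (induction rule: trig.induct)
  case (trig_mode c m)
  have "(\<lambda>p. c * E0 L m p) \<in> Lmeas"
    unfolding E0_def cis_conv_exp by (intro cont_lebesgue continuous_intros)
  then show ?case by (auto simp: norm_mult E0_def)
next
  case (trig_add s t)
  obtain M1 where M1: "!!p. norm (s p) <= M1" using trig_add.IH by blast
  obtain M2 where M2: "!!p. norm (t p) <= M2" using trig_add.IH by blast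
  have "norm (s p + t p) <= M1 + M2" for p using norm_triangle_mono[OF M1 M2] .
  then show ?case using trig_add.IH by (auto intro: borel_measurable_add)
qed

lemma cf_FF: "cf L m f = (LI p. E0 L (- m) p *s FF f p)"
proof -
  have "cnj (em L m p) = E0 L (- m) p * cis (- (\<alpha> \<bullet> fst p))" for p
  proof -
    have "- ((\<alpha> + Q m) \<bullet> fst p + pi * of_int (snd (snd m)) / L * snd p)
      = (Q (- m) \<bullet> fst p + pi * of_int (snd (snd (- m))) / L * snd p) + - (\<alpha> \<bullet> fst p)"
      by (simp add: Q_def inner_add_left inner_diff_left)
    then show ?thesis unfolding em_def E0_def cis_cnj cis_mult by (simp only:)
  qed
  then show ?thesis unfolding cf_def FF_def
    by (intro int_cong) (simp_all add: vsmult_scaleR vector_smult_assoc)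
qed

lemma trig_zero:
  assumes f: "f \<in> LL L" and z: "!!m. cf L m f = 0" and t: "trig L t"
  shows "(LI p. t p *s FF f p) = 0"
  using t
proof (induction rule: trig.induct)
  case (trig_mode c m)
  have "E0 L m \<in> Lmeas & (\<exists>M. \<forall>p. norm (E0 L m p) <= M)"
    using trig_bounded[OF trig.trig_mode[of L 1 m]] by simp
  then have i: "Lint (\<lambda>p. E0 L m p *s FF f p)" using FF_times[OF f] by blast
  have "(LI p. (c * E0 L m p) *s FF f p) = (LI p. c *s (E0 L m p *s FF f p))" by (simp add: vector_smult_assoc)
  also have "\<dots> = c *s (LI p. E0 L m p *s FF f p)"
    by (rule integral_bounded_linear[OF bounded_linear_vsmult i])
  also have "(LI p. E0 L m p *s FF f p) = 0" using z[of "- m"] cf_FF[of L "- m" f] by simp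
  finally show ?case by simp
next
  case (trig_add s t)
  have i: "Lint (\<lambda>p. s p *s FF f p)" "Lint (\<lambda>p. t p *s FF f p)"
    using trig_bounded[OF trig_add.hyps(1)] trig_bounded[OF trig_add.hyps(2)] FF_times[OF f] by blast+
  have "(s p + t p) *s FF f p = s p *s FF f p + t p *s FF f p" for p by (simp add: vec_eq_iff distrib_right)
  then show ?case using int_add[OF i] trig_add.IH by simp
qed

text \<open>A continuous function on the torus is uniformly approximated by polynomials, whose
  pullbacks are trigonometric sums and integrate to 0 against \<open>FF f\<close>. The error is at
  most e times the integral of the norm of \<open>FF f\<close>.\<close>

lemma cont_zero:
  assumes f: "f \<in> LL L" and z: "!!m. cf L m f = 0" and g: "continuous_on UNIV (g :: c3 => real)"
  shows "(LI p. of_real (g (zm L p)) *s FF f p) = 0"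
proof -
  define K :: "c3 set" where "K = sphere 0 1 \<times> sphere 0 1 \<times> sphere 0 1"
  have K: "compact K" unfolding K_def by (intro compact_Times compact_sphere)
  have zK: "zm L p \<in> K" for p by (simp add: zm_def K_def)
  have FFi: "Lint (FF f)" using FF_times[OF f, of "\<lambda>_. 1" 1] by simp
  define A where "A = (LI p. norm (FF f p))"
  have A0: "0 <= A" by (simp add: A_def)
  obtain M where M: "!!x. x \<in> K ==> \<bar>g x\<bar> <= M"
    using compact_imp_bounded[OF compact_continuous_image[OF continuous_on_subset[OF g] K]] unfolding bounded_iff by auto
  have gm: "(\<lambda>p. g (zm L p)) \<in> Lmeas"
    by (rule cont_lebesgue) (rule continuous_on_compose2[OF g zm_cont], simp)
  have gi: "Lint (\<lambda>p. of_real (g (zm L p)) *s FF f p)"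
    by (rule FF_times[OF f, of _ M]) (use M zK gm in auto)
  have main: "norm (LI p. of_real (g (zm L p)) *s FF f p) <= e * A" if e: "e > 0" for e
  proof -
    obtain P where P: "real_polynomial_function P" "!!x. x \<in> K ==> \<bar>g x - P x\<bar> < e"
      using Stone_Weierstrass_real_polynomial_function[OF K continuous_on_subset[OF g subset_UNIV] e] by blast
    have tP: "trig L (\<lambda>p. of_real (P (zm L p)))" by (rule trig_poly[OF P(1)])
    have Pi: "Lint (\<lambda>p. of_real (P (zm L p)) *s FF f p)"
      using trig_bounded[OF tP] FF_times[OF f] by blast
    have "(LI p. of_real (g (zm L p)) *s FF f p)
       = (LI p. of_real (g (zm L p)) *s FF f p - of_real (P (zm L p)) *s FF f p)"
      using int_diff[OF gi Pi] trig_zero[OF f z tP] by simp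
    also have "norm \<dots> <= (LI p. e * norm (FF f p))"
    proof (rule Bochner_Integration.integral_norm_bound_integral)
      show "Lint (\<lambda>p. of_real (g (zm L p)) *s FF f p - of_real (P (zm L p)) *s FF f p)"
        by (rule Lint_diff[OF gi Pi])
      show "Lint (\<lambda>p. e * norm (FF f p))" by (intro integrable_mult_right integrable_norm FFi)
      fix p
      have "of_real (g (zm L p)) *s FF f p - of_real (P (zm L p)) *s FF f p = complex_of_real (g (zm L p) - P (zm L p)) *s FF f p"
        by (simp add: vec_eq_iff algebra_simps)
      then show "norm (of_real (g (zm L p)) *s FF f p - of_real (P (zm L p)) *s FF f p) <= e * norm (FF f p)"
        using P(2)[OF zK, of p] by (simp only: norm_vsmult norm_of_real) (simp add: mult_right_mono)
    qed
    also have "\<dots> = e * A" by (simp add: A_def)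
    finally show ?thesis .
  qed
  have "norm (LI p. of_real (g (zm L p)) *s FF f p) <= 0 + e" if "e > 0" for e
  proof -
    have "norm (LI p. of_real (g (zm L p)) *s FF f p) <= e / (A + 1) * A"
      using main[of "e / (A + 1)"] that A0 by simp
    also have "\<dots> <= e" using that A0 by (simp add: field_simps)
    finally show ?thesis by simp
  qed
  then have "norm (LI p. of_real (g (zm L p)) *s FF f p) <= 0" by (rule field_le_epsilon)
  then show ?thesis by simp
qed

lemma cis_inj: "cis (2 * pi * x) = cis (2 * pi * y) ==> \<bar>x - y\<bar> < 1 ==> x = y"
proof -
  assume c: "cis (2 * pi * x) = cis (2 * pi * y)" and l: "\<bar>x - y\<bar> < 1"
  have "cis (2 * pi * x - 2 * pi * y) = 1" using c by (simp flip: cis_divide)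
  then have "Re (cis (2 * pi * x - 2 * pi * y)) = 1" by simp
  then have "cos (2 * pi * x - 2 * pi * y) = 1" by simp
  then obtain n :: int where n: "2 * pi * x - 2 * pi * y = of_int n * 2 * pi" using cos_one_2pi_int by blast
  then have "2 * pi * (x - y) = 2 * pi * of_int n" by (simp add: algebra_simps)
  then have xy: "x - y = of_int n" by simp
  with l have "\<bar>n\<bar> < 1" by linarith
  then show ?thesis using xy by simp
qed

lemma zm_inj:
  assumes L: "L > 0" and p: "p \<in> Y" "- L <= snd p" "snd p < L" and q: "q \<in> Y" "- L <= snd q" "snd q < L"
    and e: "zm L p = zm L q"
  shows "p = q"
proof -
  have "cis (2 * pi * (w1 \<bullet> fst p)) = cis (2 * pi * (w1 \<bullet> fst q))" "cis (2 * pi * (w2 \<bullet> fst p)) = cis (2 * pi * (w2 \<bullet> fst q))"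
    "cis (2 * pi * (snd p / (2 * L))) = cis (2 * pi * (snd q / (2 * L)))"
    using e by (simp_all add: zm_def)
  moreover have "\<bar>w1 \<bullet> fst p - w1 \<bullet> fst q\<bar> < 1" "\<bar>w2 \<bullet> fst p - w2 \<bullet> fst q\<bar> < 1" using p q by (auto simp: Y_iff)
  moreover have "\<bar>snd p / (2 * L) - snd q / (2 * L)\<bar> < 1"
  proof -
    have "\<bar>snd p - snd q\<bar> < 2 * L" using p q by linarith
    then show ?thesis using L by (simp add: field_simps flip: diff_divide_distrib)
  qed
  ultimately have "w1 \<bullet> fst p = w1 \<bullet> fst q" "w2 \<bullet> fst p = w2 \<bullet> fst q" "snd p / (2 * L) = snd q / (2 * L)"
    using cis_inj by blast+
  then have "fst p = fst q" "snd p = snd q" using coord[of "fst p"] coord[of "fst q"] L by simp_all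
  then show ?thesis by (simp add: prod_eq_iff)
qed

text \<open>The image of \<open>A\<close> on the torus is compact, and its indicator is the
  decreasing limit of the continuous functions \<open>g n\<close>. Injectivity of
  \<open>zm L\<close> makes the pullback converge to the indicator of \<open>A\<close> and of
  nothing more.\<close>

lemma compact_zero:
  assumes L: "L > 0" and f: "f \<in> LL L" and z: "!!m. cf L m f = 0"
    and A: "compact A" "A \<subseteq> {p \<in> Y. - L <= snd p & snd p < L}"
  shows "(LI p. (indicator A p :: complex) *s FF f p) = 0"
proof (cases "A = {}")
  case False
  define C where "C = zm L ` A"
  have C: "compact C" unfolding C_def by (rule compact_continuous_image[OF continuous_on_subset[OF zm_cont] A(1)]) simp
  have Cn: "C ~= {}" using False by (simp add: C_def)
  define g where "g n x = max 0 (1 - real n * infdist x C)" for n and x :: c3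
  have gc: "continuous_on UNIV (g n)" for n unfolding g_def by (intro continuous_intros)
  have g01: "0 <= g n x" "g n x <= 1" for n x by (auto simp: g_def infdist_nonneg)
  have "(\<lambda>n. LI p. of_real (g n (zm L p)) *s FF f p) ~~> (LI p. (indicator A p :: complex) *s FF f p)"
  proof (rule integral_dominated_convergence[where w="\<lambda>p. norm (FF f p)"])
    show "(\<lambda>p. of_real (g n (zm L p)) *s FF f p) \<in> Lmeas" for n
    proof (intro meas_vsmult FF_meas LL_L2[OF f])
      show "(\<lambda>p. complex_of_real (g n (zm L p))) \<in> Lmeas"
        by (rule cont_lebesgue) (intro continuous_on_of_real continuous_on_compose2[OF gc zm_cont], simp)
    qed
    have "A \<in> sets lebesgue" using A(1) by (simp add: lmeasurable_compact fmeasurableD)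
    then show "(\<lambda>p. (indicator A p :: complex) *s FF f p) \<in> Lmeas"
      by (intro meas_vsmult FF_meas LL_L2[OF f] borel_measurable_indicator)
    show "Lint (\<lambda>p. norm (FF f p))"
      using FF_times[OF f, of "\<lambda>_. 1" 1] by simp
    show "AE p in lebesgue. norm (of_real (g n (zm L p)) *s FF f p) <= norm (FF f p)" for n
      using g01 by (intro always_eventually allI) (simp add: norm_vsmult mult_left_le_one_le)
    show "AE p in lebesgue. (\<lambda>n. of_real (g n (zm L p)) *s FF f p) ~~> (indicator A p :: complex) *s FF f p"
    proof (intro always_eventually allI)
      fix p
      show "(\<lambda>n. of_real (g n (zm L p)) *s FF f p) ~~> (indicator A p :: complex) *s FF f p"
      proof (cases "FF f p = 0")
        case False
        note sp = FF_supp[OF f False]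
        have iff: "zm L p \<in> C \<longleftrightarrow> p \<in> A"
        proof
          assume "zm L p \<in> C"
          then obtain q where q: "q \<in> A" "zm L p = zm L q" by (auto simp: C_def)
          then have "q \<in> Y" "- L <= snd q" "snd q < L" using A(2) by auto
          then have "p = q" using zm_inj[OF L _ _ _ _ _ _ q(2)] sp by blast
          then show "p \<in> A" using q by simp
        qed (simp add: C_def)
        have "\<forall>\<^sub>F n in sequentially. of_real (g n (zm L p)) *s FF f p = (indicator A p :: complex) *s FF f p"
        proof (cases "p \<in> A")
          case True
          then have "g n (zm L p) = 1" for n using iff by (simp add: g_def)
          then show ?thesis using True by simp
        next
          case False
          then have "infdist (zm L p) C > 0"
            using iff in_closed_iff_infdist_zero[OF compact_imp_closed[OF C] Cn] infdist_nonneg[of "zm L p" C] by (simp add: order_less_le)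
          then obtain N where N: "1 < real N * infdist (zm L p) C" using reals_Archimedean3 by blast
          have "g n (zm L p) = 0" if "n >= N" for n
          proof -
            have "real N * infdist (zm L p) C <= real n * infdist (zm L p) C"
              using that by (intro mult_right_mono) (auto simp: infdist_nonneg)
            then show ?thesis using N by (simp add: g_def)
          qed
          then show ?thesis using False unfolding eventually_sequentially by (intro exI[of _ N]) simp
        qed
        then show ?thesis by (rule tendsto_eventually)
      qed simp
    qed
  qed
  then show ?thesis unfolding cont_zero[OF f z gc] by (simp add: LIMSEQ_const_iff)
qed simp

text \<open>If the set where \<open>FF f \<bullet> b\<close> is positive had positive measure, inner
  regularity would give a compact subset of positive measure; the integral over it is 0 although the
  integrand is positive. The same for \<open>- b\<close> forces \<open>FF f \<bullet> b\<close> to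
  be 0 almost everywhere.\<close>

lemma total:
  assumes L: "L > 0" and f: "f \<in> LL L" and z: "!!m. cf L m f = 0"
  shows "ip1 f f = 0"
proof -
  have FFi: "Lint (FF f)" using FF_times[OF f, of "\<lambda>_. 1" 1] by simp
  have le: "AE p in lebesgue. FF f p \<bullet> b <= 0" for b
  proof -
    define S where "S = {p. FF f p \<bullet> b > 0}"
    have hm: "(\<lambda>p. FF f p \<bullet> b) \<in> Lmeas" using FF_meas[OF LL_L2[OF f]] by measurable
    have S: "S \<in> sets lebesgue"
      using borel_measurable_iff_greater[THEN iffD1, OF hm, rule_format, of 0] by (simp add: S_def)
    have Ssub: "S \<subseteq> {p \<in> Y. - L <= snd p & snd p < L}"
    proof
      fix p assume "p \<in> S"
      then have "FF f p ~= 0" by (auto simp: S_def)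
      from FF_supp[OF f this] show "p \<in> {p \<in> Y. - L <= snd p & snd p < L}" by simp
    qed
    have small: "emeasure lebesgue S <= ennreal e" if e: "e > 0" for e
    proof -
      obtain T where T: "closed T" "T \<subseteq> S" "S - T \<in> lmeasurable" "emeasure lebesgue (S - T) < ennreal e"
        using sets_lebesgue_inner_closed[OF S e] by blast
      have "bounded T" by (rule bounded_subset[OF Y_slab_bounded[of "\<bar>L\<bar>"]]) (use T Ssub in fastforce)
      then have Tc: "compact T" using T(1) by (simp add: compact_eq_bounded_closed)
      have Tm: "T \<in> sets lebesgue" using Tc by (simp add: lmeasurable_compact fmeasurableD)
      have ind: "norm (indicator T p :: complex) <= 1" for p by (simp add: indicator_def)
      have i: "Lint (\<lambda>p. (indicator T p :: complex) *s FF f p)"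
        by (rule FF_times[OF f borel_measurable_indicator[OF Tm] ind])
      have "(LI p. ((indicator T p :: complex) *s FF f p) \<bullet> b) = (LI p. (indicator T p :: complex) *s FF f p) \<bullet> b"
        by (rule integral_inner_left) (use i in auto)
      also have "\<dots> = 0" using compact_zero[OF L f z Tc] T(2) Ssub by simp
      finally have z0: "(LI p. ((indicator T p :: complex) *s FF f p) \<bullet> b) = 0" .
      have nn: "0 <= ((indicator T p :: complex) *s FF f p) \<bullet> b" for p
        using T(2) by (auto simp: indicator_def S_def intro: less_imp_le)
      have "AE p in lebesgue. ((indicator T p :: complex) *s FF f p) \<bullet> b = 0"
        using integral_nonneg_eq_0_iff_AE[of lebesgue "\<lambda>p. ((indicator T p :: complex) *s FF f p) \<bullet> b"] i nn z0 by simp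
      then have "AE p in lebesgue. p \<notin> T"
        by eventually_elim (use T(2) in \<open>auto simp: indicator_def S_def split: if_splits\<close>)
      then have "T \<in> null_sets lebesgue" using Tm by (subst AE_iff_null_sets) auto
      then have "emeasure lebesgue ((S - T) \<union> T) = emeasure lebesgue (S - T)"
        using T(3) by (intro emeasure_Un_null_set) auto
      moreover have "(S - T) \<union> T = S" using T(2) by blast
      ultimately show ?thesis using T(4) by simp
    qed
    have "emeasure lebesgue S <= 0"
    proof (rule ennreal_le_epsilon)
      fix e :: real assume "0 < e"
      then show "emeasure lebesgue S <= 0 + ennreal e" using small by simp
    qed
    then have "S \<in> null_sets lebesgue" using S by (simp add: null_sets_def)
    then have "AE p in lebesgue. p \<notin> S" by (rule AE_not_in)
    then show ?thesis by eventually_elim (auto simp: S_def)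
  qed
  have "AE p in lebesgue. FF f p \<bullet> b = 0" for b
    using le[of b] le[of "- b"] by eventually_elim simp
  then have "AE p in lebesgue. \<forall>b\<in>Basis. FF f p \<bullet> b = 0" by (intro AE_finite_allI) auto
  then have "AE p in lebesgue. FF f p = 0" by eventually_elim (simp add: euclidean_all_zero_iff)
  then have "AE p in lebesgue. indicator Y p * 1 * (f p \<bullet> f p) = 0"
  proof eventually_elim
    case (elim p)
    have "norm (FF f p) = indicator Y p * norm (f p)" by (rule FF_norm)
    then show ?case using elim by auto
  qed
  then show ?thesis unfolding ip_def by (rule integral_eq_zero_AE)
qed

section \<open>Parseval's identity on the slab\<close>

lemma LL_complete: "L.complete_in (LL L)"
  unfolding L.complete_in_def
proof (intro allI impI, elim conjE)
  fix X :: "nat => field"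
  assume X: "\<forall>n. X n \<in> LL L" and C: "\<forall>e>0. \<exists>N. \<forall>m\<ge>N. \<forall>n\<ge>N. L.nm (X m - X n) < e"
  have XL: "X n \<in> L2" for n using X LL_L2 by blast
  obtain x where x: "x \<in> L2" "(\<lambda>n. L.nm (X n - x)) ~~> 0"
    using L2_complete XL C unfolding L.complete_in_def by blast
  \<comment> \<open>A limit in \<open>L2\<close> vanishes outside the slab only up to a null set;
    truncation gives one that vanishes there at every point and is no farther from the
    sequence.\<close>
  define y where "y = (\<lambda>p. sl L p *\<^sub>R x p)"
  have y: "y \<in> LL L" unfolding y_def by (rule LL_I[OF x(1)])
  have le: "L.nm (X n - y) <= L.nm (X n - x)" for n
  proof -
    have d: "X n - x \<in> L2" using XL x by auto
    have "X n - y = (\<lambda>p. sl L p *\<^sub>R (X n - x) p)"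
      using LL_sl[of "X n" L] X by (auto simp: fun_eq_iff y_def scaleR_diff_right)
    then have "ip1 (X n - y) (X n - y) = ip (sl L) (X n - x) (X n - x)"
      unfolding ip_def by (intro int_cong) (simp_all add: mult.assoc[symmetric])
    also have "\<dots> <= ip1 (X n - x) (X n - x)" by (rule ip_mono[OF d sl_wt wt_const]) simp
    finally show ?thesis by (simp add: L.nm_def)
  qed
  have "(\<lambda>n. L.nm (X n - y)) ~~> 0"
  proof (rule Lim_null_comparison[OF _ x(2)])
    show "\<forall>\<^sub>F n in sequentially. norm (L.nm (X n - y)) <= L.nm (X n - x)"
    proof (intro always_eventually allI)
      fix n
      have "X n - y \<in> L2" using XL LL_L2[OF y] by auto
      then show "norm (L.nm (X n - y)) <= L.nm (X n - x)" using le[of n] by simp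
    qed
  qed
  then show "\<exists>y\<in>LL L. (\<lambda>n. L.nm (X n - y)) ~~> 0" using y by blast
qed

text \<open>The orthonormal family consists of the modes times the real basis directions of
  \<open>complex^3\<close>. Summing over the directions first assembles the squared norm of each
  coefficient vector.\<close>

lemma parseval_sq:
  assumes L: "L > 0" and f: "f \<in> LL L"
  shows "((\<lambda>m. (norm (cf L m f))\<^sup>2) has_sum (vol L * ip1 f f)) UNIV"
proof -
  interpret S: semi_ip "LL L" ip1
  proof
    show "subspace (LL L)" by (rule LL_subspace)
    show "ip1 x y = ip1 y x" if "x \<in> LL L" "y \<in> LL L" for x y
      using L.sym LL_L2 that by blast
    show "ip1 (x + y) z = ip1 x z + ip1 y z" if "x \<in> LL L" "y \<in> LL L" "z \<in> LL L" for x y z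
      using L.add_left LL_L2 that by blast
    show "ip1 (c *\<^sub>R x) y = c * ip1 x y" if "x \<in> LL L" "y \<in> LL L" for c x y
      using L.scale_left LL_L2 that by blast
    show "0 <= ip1 x x" if "x \<in> LL L" for x using L.nonneg LL_L2 that by blast
  qed
  have comp: "S.complete_in (LL L)"
    using LL_complete unfolding S.complete_in_def L.complete_in_def S.nm_def L.nm_def .
  define r where "r = 1 / sqrt (vol L)"
  have r: "r * r * vol L = 1" using vol_pos[OF L] by (simp add: r_def)
  define b where "b i = r *\<^sub>R bas L (fst i) (snd i)" for i :: "mode \<times> (complex^3)"
  have "((\<lambda>i. (ip1 f (b i))\<^sup>2) has_sum ip1 f f) (UNIV \<times> Basis)"
  proof (rule S.parseval[OF comp _ _ _ f])
    show "b i \<in> LL L" for i unfolding b_def by (intro S.mem bas_LL)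
    show "ip1 (b i) (b j) = (if i = j then 1 else 0)" if ij: "i \<in> UNIV \<times> Basis" "j \<in> UNIV \<times> Basis" for i j
    proof -
      have "ip1 (b i) (b j) = r * (r * ip1 (bas L (fst i) (snd i)) (bas L (fst j) (snd j)))"
        unfolding b_def by (simp add: S.scale_left S.scale_right bas_LL)
      also have "\<dots> = (if i = j then 1 else 0)"
        using ij r by (auto simp: ip_bas_bas[OF L] inner_Basis prod_eq_iff mult.assoc)
      finally show ?thesis .
    qed
    show "ip1 y y = 0" if y: "y \<in> LL L" and o: "!!i. i \<in> UNIV \<times> Basis ==> ip1 y (b i) = 0" for y
    proof (rule total[OF L y])
      fix m
      have "cf L m y \<bullet> a = 0" if "a \<in> Basis" for a
      proof -
        have "ip1 y (b (m, a)) = r * (cf L m y \<bullet> a)"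
          unfolding b_def by (subst S.scale_right) (auto simp: bas_LL y ip_bas)
        moreover have "r ~= 0" using r by auto
        ultimately show ?thesis using o[of "(m, a)"] that by simp
      qed
      then show "cf L m y = 0" using euclidean_all_zero_iff[of "cf L m y"] by blast
    qed
  qed
  then have "((\<lambda>m. r * r * (norm (cf L m f))\<^sup>2) has_sum ip1 f f) UNIV"
  proof (rule has_sum_SigmaD)
    fix m :: mode
    have "(\<Sum>a\<in>Basis. (ip1 f (b (m, a)))\<^sup>2) = (\<Sum>a\<in>Basis. r * r * (cf L m f \<bullet> a)\<^sup>2)"
    proof (intro sum.cong refl)
      fix a :: "complex^3"
      have "ip1 f (b (m, a)) = r * (cf L m f \<bullet> a)"
        unfolding b_def by (subst S.scale_right) (auto simp: bas_LL f ip_bas)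
      then show "(ip1 f (b (m, a)))\<^sup>2 = r * r * (cf L m f \<bullet> a)\<^sup>2" by (simp add: power2_eq_square)
    qed
    also have "\<dots> = r * r * (norm (cf L m f))\<^sup>2"
      unfolding sum_distrib_left[symmetric] power2_norm_eq_inner euclidean_inner[of "cf L m f" "cf L m f"] by (simp add: power2_eq_square)
    finally show "((\<lambda>a. (ip1 f (b (m, a)))\<^sup>2) has_sum r * r * (norm (cf L m f))\<^sup>2) Basis"
      using has_sum_finite[of "Basis :: (complex^3) set" "\<lambda>a. (ip1 f (b (m, a)))\<^sup>2"] by simp
  qed
  then have "((\<lambda>m. vol L * (r * r * (norm (cf L m f))\<^sup>2)) has_sum vol L * ip1 f f) UNIV"
    by (rule has_sum_cmult_right)
  moreover have "vol L * (r * r * x) = x" for x using r by (simp add: mult_ac)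
  ultimately show ?thesis by simp
qed

text \<open>Polarization of the identity for squares.\<close>

lemma parseval:
  assumes L: "L > 0" and f: "f \<in> LL L" and g: "g \<in> LL L"
  shows "((\<lambda>m. cf L m f \<bullet> cf L m g) has_sum (vol L * ip1 f g)) UNIV"
proof -
  have fg: "f + g \<in> LL L" "f - g \<in> LL L" using f g LL_subspace by (auto intro: subspace_add subspace_diff)
  have "((\<lambda>m. (1/4) * ((norm (cf L m (f + g)))\<^sup>2 + (-1) * (norm (cf L m (f - g)))\<^sup>2)) has_sum
     (1/4) * (vol L * ip1 (f + g) (f + g) + (-1) * (vol L * ip1 (f - g) (f - g)))) UNIV"
    by (intro has_sum_cmult_right has_sum_add parseval_sq L fg)
  moreover have "(1/4) * ((norm (cf L m (f + g)))\<^sup>2 + (-1) * (norm (cf L m (f - g)))\<^sup>2) = cf L m f \<bullet> cf L m g" for m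
    by (simp add: cf_add[OF f g] cf_diff[OF f g] power2_norm_eq_inner inner_add_left inner_add_right inner_diff_left inner_diff_right inner_commute)
  moreover have "(1/4) * (vol L * ip1 (f + g) (f + g) + (-1) * (vol L * ip1 (f - g) (f - g))) = vol L * ip1 f g"
    using L.sym[OF LL_L2[OF f] LL_L2[OF g]] by (simp add: L.bilin LL_L2[OF f] LL_L2[OF g] algebra_simps)
  ultimately show ?thesis by simp
qed

end

section \<open>Fourier coefficients of truncated fields\<close>

lemma sm1_bounded:
  assumes "sm1 g" and z: "!!t. \<bar>t\<bar> > R ==> g t = 0"
  shows "\<exists>M. \<forall>t. \<bar>g t\<bar> <= M"
proof -
  obtain g' where g': "!!t. (g has_real_derivative g' t) (at t)" using sm1_deriv[OF assms(1)] by blast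
  have "compact (g ` {-R..R})"
    using DERIV_isCont[OF g'] by (intro compact_continuous_image continuous_at_imp_continuous_on) auto
  then have "bounded (g ` {-R..R})" by (rule compact_imp_bounded)
  then obtain M where M: "!!t. t \<in> {-R..R} ==> \<bar>g t\<bar> <= M"
    unfolding bounded_iff by (metis imageI real_norm_def)
  have "\<bar>g t\<bar> <= max M 0" for t
  proof (cases "\<bar>t\<bar> > R")
    case False
    then have "t \<in> {-R..R}" by (simp add: abs_le_iff not_less)
    then show ?thesis using M[of t] by simp
  qed (simp add: z)
  then show ?thesis by blast
qed

lemma ex_stp1: "\<exists>s1. sm1 s1 & (\<forall>x. (stp has_real_derivative s1 x) (at x))"
  using sm1_deriv[OF stp(1)] by blast

definition stp1 :: "real => real" where "stp1 = (SOME s1. sm1 s1 & (\<forall>x. (stp has_real_derivative s1 x) (at x)))"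

lemma stp1: "sm1 stp1" "(stp has_real_derivative stp1 x) (at x)"
  using someI_ex[OF ex_stp1] unfolding stp1_def by blast+

lemma stp1_zero: "x < 0 \<or> x > 1 ==> stp1 x = 0"
proof -
  assume "x < 0 \<or> x > 1"
  then have "(stp has_real_derivative 0) (at x)"
  proof
    assume "x < 0"
    then show ?thesis by - (rule has_field_derivative_transform_within_open[of "\<lambda>_. 0" 0 x "{..<0}"], auto simp: stp)
  next
    assume "x > 1"
    then show ?thesis by - (rule has_field_derivative_transform_within_open[of "\<lambda>_. 1" 0 x "{1<..}"], auto simp: stp)
  qed
  then show ?thesis using DERIV_unique[OF stp1(2)] by blast
qed

text \<open>First derivative, second derivative and common bound are packed into a triple so that a
  single choice fixes all three consistently.\<close>

definition zd :: "(real => real) \<times> (real => real) \<times> real" where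
  "zd = (SOME z. (\<forall>t. (zt has_real_derivative fst z t) (at t)) & (\<forall>t. (fst z has_real_derivative fst (snd z) t) (at t)) &
     (\<forall>t. \<bar>fst z t\<bar> <= snd (snd z) & \<bar>fst (snd z) t\<bar> <= snd (snd z)) &
     (\<forall>t. \<bar>t\<bar> > 2 --> fst z t = 0 & fst (snd z) t = 0) & sm1 (fst z) & sm1 (fst (snd z)))"

definition "zt1 = fst zd"
definition "zt2 = fst (snd zd)"
definition "ztM = snd (snd zd)"

lemma zt_derivs:
  "(zt has_real_derivative zt1 t) (at t)" "(zt1 has_real_derivative zt2 t) (at t)"
  "\<bar>zt1 t\<bar> <= ztM" "\<bar>zt2 t\<bar> <= ztM" "\<bar>t\<bar> > 2 ==> zt1 t = 0" "\<bar>t\<bar> > 2 ==> zt2 t = 0" "sm1 zt1" "sm1 zt2"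
proof -
  have "\<exists>z. (\<forall>t. (zt has_real_derivative fst z t) (at t)) & (\<forall>t. (fst z has_real_derivative fst (snd z) t) (at t)) &
     (\<forall>t. \<bar>fst z t\<bar> <= snd (snd z) & \<bar>fst (snd z) t\<bar> <= snd (snd z)) &
     (\<forall>t. \<bar>t\<bar> > 2 --> fst z t = 0 & fst (snd z) t = 0) & sm1 (fst z) & sm1 (fst (snd z))"
    using ex_zt_derivs by auto
  from someI_ex[OF this]
  show "(zt has_real_derivative zt1 t) (at t)" "(zt1 has_real_derivative zt2 t) (at t)"
    "\<bar>zt1 t\<bar> <= ztM" "\<bar>zt2 t\<bar> <= ztM" "\<bar>t\<bar> > 2 ==> zt1 t = 0" "\<bar>t\<bar> > 2 ==> zt2 t = 0" "sm1 zt1" "sm1 zt2"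
    unfolding zd_def[symmetric] zt1_def[symmetric] zt2_def[symmetric] ztM_def[symmetric] by simp_all
qed

lemma ztM_nonneg: "0 <= ztM"
  using zt_derivs(3)[of 0] by linarith

lemma sm1_cont: "sm1 g ==> continuous_on UNIV g"
  using sm1_deriv DERIV_isCont by (blast intro: continuous_at_imp_continuous_on)

text \<open>A difference of consecutive translates of the step, so that its integer translates
  telescope to a smooth partition of unity on the line.\<close>

definition th :: "real => real" where "th x = stp (x + 1) - stp x"
definition th1 :: "real => real" where "th1 x = stp1 (x + 1) - stp1 x"

lemma th_sm1: "sm1 th" "sm1 th1"
proof -
  have a: "sm1 (\<lambda>x. u (x + 1) - u x)" if "sm1 u" for u
    using sm1_add[OF sm1_affine[OF that, of 1 1] sm1_mult[OF sm1_const[of "-1"] that]] by simp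
  show "sm1 th" "sm1 th1" unfolding th_def[abs_def] th1_def[abs_def] by (rule a[OF stp(1)], rule a[OF stp1(1)])
qed

lemma th_deriv: "(th has_real_derivative th1 x) (at x)"
proof -
  have "((\<lambda>x. stp (x + 1)) has_real_derivative stp1 (x + 1) * 1) (at x)"
    by (rule DERIV_chain2[OF stp1(2)]) (auto intro!: derivative_eq_intros)
  from DERIV_diff[OF this stp1(2)[of x]] show ?thesis by (simp add: th_def[abs_def] th1_def)
qed

lemma th_zero: "\<bar>x\<bar> > 1 ==> th x = 0" "\<bar>x\<bar> > 1 ==> th1 x = 0"
proof -
  assume "\<bar>x\<bar> > 1"
  then consider "x < -1" | "x > 1" by (auto simp: abs_if split: if_splits)
  then have "th x = 0 & th1 x = 0"
    by cases (auto simp: th_def th1_def stp stp1_zero)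
  then show "th x = 0" "th1 x = 0" by blast+
qed

lemma th_sum:
  assumes "0 <= x" "x < 1"
  shows "th (x - 1) + th x + th (x + 1) = 1" "th1 (x - 1) + th1 x + th1 (x + 1) = 0"
  using assms by (simp_all add: th_def th1_def stp stp1_zero algebra_simps)

definition cu :: "real => pt => real" where "cu R p = zt (snd p / R)"
definition cu1 :: "real => pt => real" where "cu1 R p = zt1 (snd p / R) / R"

text \<open>The bookkeeping of the product rule: real and imaginary part of the derivative of cutoff
  times conjugate exponential, recombined.\<close>

lemma mode_algebra:
  fixes A B C H k x :: real
  shows "complex_of_real (A * (C * cos x) + H * (B * cos x + C * (- sin x * k)))
      + \<i> * complex_of_real (A * (C * (- sin x)) + H * (B * (- sin x) + C * (- cos x * k)))
    = of_real A * (of_real C * cnj (cis x)) + of_real H * (of_real B * cnj (cis x))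
      - (\<i> * of_real k) * (of_real H * (of_real C * cnj (cis x)))"
  by (simp add: complex_eq_iff algebra_simps)

context qp
begin

text \<open>A smooth substitute for the indicator of the cell: the lattice translates of
  \<open>ch\<close> add up to 1.\<close>

definition ch :: "pt => real" where "ch p = th (w1 \<bullet> fst p) * th (w2 \<bullet> fst p)"

definition kp :: "real => mode => pt" where "kp L m = (\<alpha> + Q m, pi * of_int (snd (snd m)) / L)"

lemma em_kp: "em L m p = cis (kp L m \<bullet> p)"
  by (simp add: em_def kp_def inner_prod_def)

lemma dir_simps [simp]: "dir 1 = (axis 1 1, 0)" "dir 2 = (axis 2 1, 0)" "dir 3 = (0, 1)"
  by (simp_all add: dir_def)

lemma kv_kp: "kv L m $ j = of_real (kp L m \<bullet> dir j)"
  using exhaust_3[of j] by (auto simp: kv_def kp_def inner_prod_def inner_axis)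

text \<open>For a point of the cell only the nine neighbouring translates can be nonzero. Since the
  derivatives of a partition of unity add up to 0, the horizontal localization leaves no error
  term.\<close>

lemma sums_Sq1:
  assumes "p \<in> Y"
  shows "(\<Sum>k\<in>Sq 1. ch (p + gm k)) = 1" "(\<Sum>k\<in>Sq 1. pd j ch (p + gm k)) = 0"
    "pd j ch q = th1 (w1 \<bullet> fst q) * th (w2 \<bullet> fst q) * (w1 \<bullet> fst (dir j)) + th (w1 \<bullet> fst q) * th1 (w2 \<bullet> fst q) * (w2 \<bullet> fst (dir j))"
proof -
  have pdch: "pd j ch q = th1 (w1 \<bullet> fst q) * th (w2 \<bullet> fst q) * (w1 \<bullet> fst (dir j)) + th (w1 \<bullet> fst q) * th1 (w2 \<bullet> fst q) * (w2 \<bullet> fst (dir j))" for q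
  proof -
    have e: "ch = (\<lambda>p. th ((w1, 0) \<bullet> p + 0) * th ((w2, 0) \<bullet> p + 0))" by (simp add: ch_def fun_eq_iff inner_prod_def)
    have d: "(\<lambda>p. th ((w, 0) \<bullet> p + 0)) differentiable at q" for w
      using has_derivative_comp_inner[OF th_deriv] unfolding differentiable_def by blast
    show ?thesis unfolding e pd_mult[OF d d] pd_comp[OF th_deriv] by (simp add: inner_prod_def)
  qed
  then show "pd j ch q = th1 (w1 \<bullet> fst q) * th (w2 \<bullet> fst q) * (w1 \<bullet> fst (dir j)) + th (w1 \<bullet> fst q) * th1 (w2 \<bullet> fst q) * (w2 \<bullet> fst (dir j))" .
  have int3: "{-1..1::int} = {-1, 0, 1}" by auto
  have S: "(\<Sum>k\<in>Sq 1. F (of_int (fst k)) * G (of_int (snd k))) = (F (-1) + F 0 + F 1) * (G (-1) + G 0 + (G 1 :: real))" for F G :: "real => real"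
    unfolding Sq_def by (simp add: sum.cartesian_product[symmetric] int3 sum_distrib_left[symmetric] algebra_simps)
  have s: "0 <= w1 \<bullet> fst p" "w1 \<bullet> fst p < 1" "0 <= w2 \<bullet> fst p" "w2 \<bullet> fst p < 1" using assms by (auto simp: Y_iff)
  have t: "th (w \<bullet> fst p + -1) + th (w \<bullet> fst p + 0) + th (w \<bullet> fst p + 1) = 1" "th1 (w \<bullet> fst p + -1) + th1 (w \<bullet> fst p + 0) + th1 (w \<bullet> fst p + 1) = 0"
    if "0 <= w \<bullet> fst p" "w \<bullet> fst p < 1" for w
    using th_sum[OF that] by simp_all
  show "(\<Sum>k\<in>Sq 1. ch (p + gm k)) = 1"
    unfolding ch_def gm_coord using S[of "\<lambda>x. th (w1 \<bullet> fst p + x)" "\<lambda>x. th (w2 \<bullet> fst p + x)"] t(1)[OF s(1,2)] t(1)[OF s(3,4)] by simp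
  have "(\<Sum>k\<in>Sq 1. pd j ch (p + gm k)) = (\<Sum>k\<in>Sq 1. th1 (w1 \<bullet> fst p + of_int (fst k)) * th (w2 \<bullet> fst p + of_int (snd k))) * (w1 \<bullet> fst (dir j))
     + (\<Sum>k\<in>Sq 1. th (w1 \<bullet> fst p + of_int (fst k)) * th1 (w2 \<bullet> fst p + of_int (snd k))) * (w2 \<bullet> fst (dir j))"
    unfolding pdch gm_coord by (simp add: sum.distrib sum_distrib_right)
  then show "(\<Sum>k\<in>Sq 1. pd j ch (p + gm k)) = 0"
    unfolding S[of "\<lambda>x. th1 (w1 \<bullet> fst p + x)" "\<lambda>x. th (w2 \<bullet> fst p + x)"] S[of "\<lambda>x. th (w1 \<bullet> fst p + x)" "\<lambda>x. th1 (w2 \<bullet> fst p + x)"]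
    using t(2)[OF s(1,2)] t(2)[OF s(3,4)] by simp
qed

lemma Y_nonempty: "0 \<in> Y"
  by (simp add: Y_iff)

lemmas pd_ch = sums_Sq1(3)[OF Y_nonempty]

lemma ch_smA: "smA ch"
  using smA_mult[OF smA_comp[OF th_sm1(1), of "(w1, 0)" 0] smA_comp[OF th_sm1(1), of "(w2, 0)" 0]]
  by (simp add: ch_def[abs_def] inner_prod_def)

lemma ch_supp: "ch p ~= 0 ==> \<bar>w1 \<bullet> fst p\<bar> <= real 1 & \<bar>w2 \<bullet> fst p\<bar> <= real 1"
  "pd j ch p ~= 0 ==> \<bar>w1 \<bullet> fst p\<bar> <= real 1 & \<bar>w2 \<bullet> fst p\<bar> <= real 1"
  using th_zero[of "w1 \<bullet> fst p"] th_zero[of "w2 \<bullet> fst p"] by (auto simp: ch_def pd_ch not_less[symmetric])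

lemma ch_bounded: "\<exists>M. \<forall>p. \<bar>ch p\<bar> <= M" "\<exists>M. \<forall>p. \<bar>pd j ch p\<bar> <= M"
proof -
  obtain M where M: "!!t. \<bar>th t\<bar> <= M" using sm1_bounded[OF th_sm1(1), of 1] th_zero by blast
  obtain K where K: "!!t. \<bar>th1 t\<bar> <= K" using sm1_bounded[OF th_sm1(2), of 1] th_zero by blast
  have nn: "0 <= M" "0 <= K" using M[of 0] K[of 0] by linarith+
  have "\<bar>ch p\<bar> <= M * M" for p unfolding ch_def abs_mult by (intro mult_mono M) (auto simp: nn)
  then show "\<exists>M. \<forall>p. \<bar>ch p\<bar> <= M" by blast
  have "\<bar>pd j ch p\<bar> <= K * M * \<bar>w1 \<bullet> fst (dir j)\<bar> + M * K * \<bar>w2 \<bullet> fst (dir j)\<bar>" for p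
    unfolding pd_ch
    by (rule order_trans[OF abs_triangle_ineq], unfold abs_mult, intro add_mono mult_mono M K) (auto simp: nn)
  then show "\<exists>M. \<forall>p. \<bar>pd j ch p\<bar> <= M" by blast
qed

lemma slab_bounded: "bounded {p::pt. \<bar>w1 \<bullet> fst p\<bar> <= real N & \<bar>w2 \<bullet> fst p\<bar> <= real N & \<bar>snd p\<bar> <= R}"
  unfolding bounded_iff
proof (intro exI ballI)
  fix p :: pt assume "p \<in> {p. \<bar>w1 \<bullet> fst p\<bar> <= real N & \<bar>w2 \<bullet> fst p\<bar> <= real N & \<bar>snd p\<bar> <= R}"
  then have p: "\<bar>w1 \<bullet> fst p\<bar> <= real N" "\<bar>w2 \<bullet> fst p\<bar> <= real N" "\<bar>snd p\<bar> <= R" by auto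
  have "norm (fst p) <= norm ((w1 \<bullet> fst p) *\<^sub>R a1) + norm ((w2 \<bullet> fst p) *\<^sub>R a2)"
    using coord[of "fst p"] norm_triangle_ineq by metis
  also have "\<dots> <= real N * norm a1 + real N * norm a2"
    unfolding norm_scaleR using p by (intro add_mono mult_right_mono) auto
  finally show "norm p <= (real N * norm a1 + real N * norm a2) + R"
    using norm_Pair_le[of "fst p" "snd p"] p(3) by simp
qed

text \<open>Unfolding the lattice collects the translates of \<open>a\<close> in front of the
  periodic \<open>G\<close>. With \<open>c = 1\<close> it converts an integral against a test
  function into one over the cell; with \<open>c = 0\<close> it kills the terms with a derivative on
  the localizer.\<close>

lemma unfold_weight:
  fixes G :: field
  assumes f: "f \<in> L2" and G: "G \<in> Lmeas" "!!p k. G (p + gm k) = G p"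
      "!!p. norm (G p) <= M * norm (f p)" "!!p. G p ~= 0 ==> \<bar>snd p\<bar> <= R"
    and a: "a \<in> Lmeas" "!!p. \<bar>a p\<bar> <= K"
      "!!p. a p ~= 0 ==> \<bar>w1 \<bullet> fst p\<bar> <= real 1 & \<bar>w2 \<bullet> fst p\<bar> <= real 1"
    and s: "!!p. p \<in> Y ==> (\<Sum>k\<in>Sq 1. a (p + gm k)) = c"
  shows "Lint (\<lambda>p. a p *\<^sub>R G p)"
    "(LI p. a p *\<^sub>R G p) = c *\<^sub>R (LI p. indicator Y p *\<^sub>R G p)"
proof -
  have K0: "0 <= K" using a(2)[of 0] by linarith
  show i: "Lint (\<lambda>p. a p *\<^sub>R G p)"
  proof (rule L2_dom[OF f, of _ "K * M"])
    show "norm (a p *\<^sub>R G p) <= K * M * norm (f p)" for p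
    proof -
      have "norm (a p *\<^sub>R G p) <= K * norm (G p)" using a(2)[of p] by (simp add: mult_right_mono)
      also have "\<dots> <= K * (M * norm (f p))" using G(3)[of p] K0 by (rule mult_left_mono)
      finally show ?thesis by (simp add: mult.assoc)
    qed
    show "bounded {p. a p *\<^sub>R G p ~= 0}"
      by (rule bounded_subset[OF slab_bounded[of 1 R]]) (use a(3) G(4) in auto)
  qed (intro borel_measurable_scaleR a G)
  have "(LI p. a p *\<^sub>R G p) = (LI p. indicator Y p *\<^sub>R (\<Sum>k\<in>Sq 1. a (p + gm k) *\<^sub>R G (p + gm k)))"
    by (rule unfold_integral[OF i]) (use a(3) in auto)
  also have "\<dots> = (LI p. c *\<^sub>R (indicator Y p *\<^sub>R G p))"
  proof (rule int_cong[OF refl])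
    fix p
    show "indicator Y p *\<^sub>R (\<Sum>k\<in>Sq 1. a (p + gm k) *\<^sub>R G (p + gm k)) = c *\<^sub>R (indicator Y p *\<^sub>R G p)"
    proof (cases "p \<in> Y")
      case True
      then show ?thesis using s[OF True] by (simp only: G(2) scaleR_sum_left[symmetric]) simp
    qed simp
  qed
  finally show "(LI p. a p *\<^sub>R G p) = c *\<^sub>R (LI p. indicator Y p *\<^sub>R G p)"
    unfolding integral_scaleR_right .
qed

lemma cu_props:
  assumes R: "R > 0"
  shows "wt (cu R)" "wt (cu1 R)" "0 <= cu R p" "cu R p <= 1" "\<bar>cu1 R p\<bar> <= ztM / R"
    "\<bar>snd p\<bar> >= 2 * R ==> cu R p = 0" "\<bar>snd p\<bar> > 2 * R ==> cu1 R p = 0" "\<bar>snd p\<bar> <= R ==> cu R p = 1"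
proof -
  have b: "\<bar>cu1 R p\<bar> <= ztM / R" for p using zt_derivs(3)[of "snd p / R"] R by (simp add: cu1_def divide_right_mono)
  then show "\<bar>cu1 R p\<bar> <= ztM / R" .
  have c: "0 <= cu R p" "cu R p <= 1" for p by (simp_all add: cu_def zt)
  then show "0 <= cu R p" "cu R p <= 1" .
  have m: "(\<lambda>p::pt. g (snd p / R)) \<in> Lmeas" if "sm1 g" for g
    by (rule cont_lebesgue) (rule continuous_on_compose2[OF sm1_cont[OF that]], use R in \<open>auto intro!: continuous_intros\<close>)
  show "wt (cu R)" unfolding wt_def cu_def[abs_def] using c m[OF zt(1)] by (auto simp: cu_def intro!: exI[of _ 1] zt simp: abs_le_iff intro: order_trans[OF _ zero_le_one])
  have "(\<lambda>p::pt. zt1 (snd p / R) / R) \<in> Lmeas" using borel_measurable_divide[OF m[OF zt_derivs(7)] borel_measurable_const[of R]] by simp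
  moreover have "\<exists>M. \<forall>p::pt. \<bar>zt1 (snd p / R) / R\<bar> <= M" using b[unfolded cu1_def] by blast
  ultimately show "wt (cu1 R)" unfolding wt_def cu1_def[abs_def] by - (intro conjI allI, assumption, simp, assumption)
  have k: "\<bar>snd p / R\<bar> = \<bar>snd p\<bar> / R" using R by simp
  show "cu R p = 0" if "\<bar>snd p\<bar> >= 2 * R" unfolding cu_def by (rule zt(2)) (use that R k in \<open>simp add: pos_le_divide_eq\<close>)
  show "cu1 R p = 0" if "\<bar>snd p\<bar> > 2 * R" unfolding cu1_def using zt_derivs(5)[of "snd p / R"] that R k by (simp add: pos_less_divide_eq)
  show "cu R p = 1" if "\<bar>snd p\<bar> <= R" unfolding cu_def by (rule zt(3)) (use that R k in \<open>simp add: pos_divide_le_eq\<close>)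
qed

text \<open>\<open>ph1\<close> and \<open>ph2\<close> are the real and imaginary part of the
  conjugate mode cut off horizontally by \<open>ch\<close> and vertically by \<open>cu R\<close>;
  two functions because test functions are real.\<close>

definition ph1 :: "real => real => mode => pt => real" where
  "ph1 R L m p = ch p * (cu R p * cos (kp L m \<bullet> p))"

definition ph2 :: "real => real => mode => pt => real" where
  "ph2 R L m p = ch p * (cu R p * (- sin (kp L m \<bullet> p)))"

lemma cu_smA: "smA (cu R)"
  using smA_comp[OF sm1_affine[OF zt(1), of "1 / R" 0], of "(0, 1)" 0] by (simp add: cu_def[abs_def] inner_prod_def)

lemma cu_pd: assumes "R > 0" shows "pd j (cu R) p = (if j = 3 then cu1 R p else 0)"
proof -
  have "((\<lambda>x. zt (x / R)) has_real_derivative zt1 (((0::real^2, 1::real) \<bullet> p + 0) / R) * (1 / R)) (at ((0, 1) \<bullet> p + 0))"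
    by (rule DERIV_chain2[OF zt_derivs(1)]) (use assms in \<open>auto intro!: derivative_eq_intros\<close>)
  from pd_comp[OF this, of j] have "pd j (cu R) p = zt1 (snd p / R) * (1 / R) * ((0::real^2, 1::real) \<bullet> dir j)"
    by (simp add: cu_def[abs_def] inner_prod_def)
  then show ?thesis using exhaust_3[of j] by (auto simp: cu1_def inner_prod_def)
qed

lemma trig_smA: "smA (\<lambda>p. cos (k \<bullet> p))" "smA (\<lambda>p. - sin (k \<bullet> p))"
proof -
  show "smA (\<lambda>p. cos (k \<bullet> p))" using smA_comp[OF sm1_cos, of k 0] by simp
  show "smA (\<lambda>p. - sin (k \<bullet> p))" using smA_mult[OF smA_const[of "-1"] smA_comp[OF sm1_sin, of k 0]] by simp
qed

lemma ph_test:
  assumes R: "R > 0"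
  shows "test_fun (ph1 R L m)" "test_fun (ph2 R L m)"
proof -
  have "smA (ph1 R L m)" "smA (ph2 R L m)"
    unfolding ph1_def[abs_def] ph2_def[abs_def] by (intro smA_mult ch_smA cu_smA trig_smA)+
  moreover have "p \<in> {p. \<bar>w1 \<bullet> fst p\<bar> <= real 1 & \<bar>w2 \<bullet> fst p\<bar> <= real 1 & \<bar>snd p\<bar> <= 2 * R}"
    if "ch p * (cu R p * x) ~= 0" for p x
  proof -
    have "ch p ~= 0" "cu R p ~= 0" using that by auto
    then have "\<bar>snd p\<bar> <= 2 * R" using cu_props(6)[OF R, of p] by linarith
    then show ?thesis using ch_supp(1)[OF \<open>ch p ~= 0\<close>] by blast
  qed
  then have "{p. ph1 R L m p ~= 0} \<subseteq> {p. \<bar>w1 \<bullet> fst p\<bar> <= real 1 & \<bar>w2 \<bullet> fst p\<bar> <= real 1 & \<bar>snd p\<bar> <= 2 * R}"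
    "{p. ph2 R L m p ~= 0} \<subseteq> {p. \<bar>w1 \<bullet> fst p\<bar> <= real 1 & \<bar>w2 \<bullet> fst p\<bar> <= real 1 & \<bar>snd p\<bar> <= 2 * R}"
    unfolding ph1_def ph2_def by blast+
  ultimately show "test_fun (ph1 R L m)" "test_fun (ph2 R L m)"
    using smA_smooth bounded_subset[OF slab_bounded] unfolding test_fun_def by blast+
qed

lemma ph_pd:
  assumes R: "R > 0"
  shows "complex_of_real (pd j (ph1 R L m) p) + \<i> * complex_of_real (pd j (ph2 R L m) p)
    = of_real (pd j ch p) * (of_real (cu R p) * cnj (em L m p))
      + of_real (ch p) * (of_real (if j = 3 then cu1 R p else 0) * cnj (em L m p))
      - (\<i> * kv L m $ j) * (of_real (ch p) * (of_real (cu R p) * cnj (em L m p)))"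
proof -
  have d: "f differentiable at p" if "smA f" for f using smA_pd[OF that] by blast
  have c: "pd j (\<lambda>p. cos (kp L m \<bullet> p)) p = - sin (kp L m \<bullet> p) * (kp L m \<bullet> dir j)"
    using pd_comp[of cos "- sin (kp L m \<bullet> p)" "kp L m" p 0 j] by (simp add: DERIV_cos)
  have s: "pd j (\<lambda>p. - sin (kp L m \<bullet> p)) p = - cos (kp L m \<bullet> p) * (kp L m \<bullet> dir j)"
    using pd_comp[of "\<lambda>x. - sin x" "- cos (kp L m \<bullet> p)" "kp L m" p 0 j] by (simp add: DERIV_minus)
  have 1: "pd j (ph1 R L m) p = pd j ch p * (cu R p * cos (kp L m \<bullet> p))
     + ch p * ((if j = 3 then cu1 R p else 0) * cos (kp L m \<bullet> p) + cu R p * (- sin (kp L m \<bullet> p) * (kp L m \<bullet> dir j)))"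
    unfolding ph1_def[abs_def] pd_mult[OF d[OF ch_smA] d[OF smA_mult[OF cu_smA trig_smA(1)]]]
      pd_mult[OF d[OF cu_smA] d[OF trig_smA(1)]] cu_pd[OF R] c ..
  have 2: "pd j (ph2 R L m) p = pd j ch p * (cu R p * (- sin (kp L m \<bullet> p)))
     + ch p * ((if j = 3 then cu1 R p else 0) * (- sin (kp L m \<bullet> p)) + cu R p * (- cos (kp L m \<bullet> p) * (kp L m \<bullet> dir j)))"
    unfolding ph2_def[abs_def] pd_mult[OF d[OF ch_smA] d[OF smA_mult[OF cu_smA trig_smA(2)]]]
      pd_mult[OF d[OF cu_smA] d[OF trig_smA(2)]] cu_pd[OF R] s ..
  show ?thesis unfolding 1 2 em_kp kv_kp by (rule mode_algebra)
qed

text \<open>Testing with the cut-off conjugate mode yields Fourier coefficients of the truncated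
  field. A derivative falling on \<open>ch\<close> contributes nothing, one on \<open>cu R\<close>
  gives \<open>cu1 R\<close> in the vertical direction, and one on the exponential gives the factor
  -i k.\<close>

lemma mode_test:
  assumes f: "f \<in> L2" and R: "R > 0" and L: "L > 2 * R"
  shows "(LI p. ph1 R L m p *\<^sub>R f p) + \<i> *s (LI p. ph2 R L m p *\<^sub>R f p) = cf L m (\<lambda>p. cu R p *\<^sub>R f p)"
    "(LI p. pd j (ph1 R L m) p *\<^sub>R f p) + \<i> *s (LI p. pd j (ph2 R L m) p *\<^sub>R f p)
      = (if j = 3 then cf L m (\<lambda>p. cu1 R p *\<^sub>R f p) else 0) - (\<i> * kv L m $ j) *s cf L m (\<lambda>p. cu R p *\<^sub>R f p)"
proof -
  define G where "G w p = cnj (em L m p) *s (w p *\<^sub>R f p)" for w :: "pt => real" and p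
  have uw: "Lint (\<lambda>p. a p *\<^sub>R G w p)" "(LI p. a p *\<^sub>R G w p) = c *\<^sub>R cf L m (\<lambda>p. w p *\<^sub>R f p)"
    if a: "a \<in> Lmeas" "\<exists>K. \<forall>p. \<bar>a p\<bar> <= K"
      "!!p. a p ~= 0 ==> \<bar>w1 \<bullet> fst p\<bar> <= real 1 & \<bar>w2 \<bullet> fst p\<bar> <= real 1"
      "!!p. p \<in> Y ==> (\<Sum>k\<in>Sq 1. a (p + gm k)) = c" and w: "wt w" "!!p. \<bar>snd p\<bar> > 2 * R ==> w p = 0" for a w :: "pt => real" and c :: real
  proof -
    obtain K where K: "!!p. \<bar>a p\<bar> <= K" using a(2) by blast
    obtain M where M: "!!p. \<bar>w p\<bar> <= M" using wtD(3)[OF w(1)] by blast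
    have wf: "(\<lambda>p. w p *\<^sub>R f p) \<in> L2" by (rule L2_wt[OF f w(1)])
    have g1: "G w \<in> Lmeas" unfolding G_def[abs_def]
      by (rule meas_vsmult[OF cnj_em_meas L2D(1)[OF wf]])
    have g2: "G w (p + gm k) = G w p" for p k
    proof -
      have "G w (p + gm k) = (cnj (ph k) * ph k * cnj (em L m p)) *s (w p *\<^sub>R f p)"
        using L2D(2)[OF wf, of p k] by (simp add: G_def em_shift vector_smult_assoc mult_ac)
      moreover have "cnj (ph k) * ph k = 1" by (simp add: ph_def cis_cnj cis_mult)
      ultimately show ?thesis by (simp add: G_def)
    qed
    have g3: "norm (G w p) <= M * norm (f p)" for p using M[of p] by (simp add: G_def norm_vsmult mult_right_mono)
    have g4: "\<bar>snd p\<bar> <= 2 * R" if "G w p ~= 0" for p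
    proof (rule ccontr)
      assume "~ ?thesis"
      then have "w p = 0" using w(2) by simp
      then show False using that by (simp add: G_def)
    qed
    show "Lint (\<lambda>p. a p *\<^sub>R G w p)"
      using unfold_weight(1)[OF f g1 g2 g3 g4 a(1) K a(3,4)] .
    show "(LI p. a p *\<^sub>R G w p) = c *\<^sub>R cf L m (\<lambda>p. w p *\<^sub>R f p)"
      using unfold_weight(2)[OF f g1 g2 g3 g4 a(1) K a(3,4)] by (simp add: cf_def G_def)
  qed
  have chm: "ch \<in> Lmeas" "pd j ch \<in> Lmeas"
    using smooth_cont[OF smA_smooth[OF ch_smA]] smooth_cont[OF smooth_pd[OF smA_smooth[OF ch_smA]]] by (auto intro: cont_lebesgue)
  have cu0: "cu R p = 0" "cu1 R p = 0" if "\<bar>snd p\<bar> > 2 * R" for p using that cu_props(6,7)[OF R, of p] by auto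
  \<comment> \<open>The translates of \<open>ch\<close> add up to 1 and those of its derivatives to
    0: \<open>A\<close> and \<open>B\<close> give the coefficients of the two truncated fields,
    while \<open>C\<close> vanishes.\<close>
  note A = uw[OF chm(1) ch_bounded(1) ch_supp(1) sums_Sq1(1) cu_props(1)[OF R] cu0(1)]
  note B = uw[OF chm(1) ch_bounded(1) ch_supp(1) sums_Sq1(1) cu_props(2)[OF R] cu0(2)]
  note C = uw[OF chm(2) ch_bounded(2) ch_supp(2) sums_Sq1(2) cu_props(1)[OF R] cu0(1)]
  have ii: "Lint (\<lambda>p. ph1 R L m p *\<^sub>R f p)" "Lint (\<lambda>p. ph2 R L m p *\<^sub>R f p)"
    "Lint (\<lambda>p. pd j (ph1 R L m) p *\<^sub>R f p)" "Lint (\<lambda>p. pd j (ph2 R L m) p *\<^sub>R f p)"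
    by (intro int_test(1)[OF f] test_pd ph_test R)+
  have comb: "(LI p. u p *\<^sub>R f p) + \<i> *s (LI p. v p *\<^sub>R f p) = (LI p. (of_real (u p) + \<i> * of_real (v p)) *s f p)"
    if u: "Lint (\<lambda>p. u p *\<^sub>R f p)" and v: "Lint (\<lambda>p. v p *\<^sub>R f p)" for u v :: "pt => real"
  proof -
    have iv: "Lint (\<lambda>p. \<i> *s (v p *\<^sub>R f p))" by (rule integrable_bounded_linear[OF bounded_linear_vsmult v])
    have "\<i> *s (LI p. v p *\<^sub>R f p) = (LI p. \<i> *s (v p *\<^sub>R f p))"
      by (rule integral_bounded_linear[OF bounded_linear_vsmult v, symmetric])
    then have "(LI p. u p *\<^sub>R f p) + \<i> *s (LI p. v p *\<^sub>R f p) = (LI p. u p *\<^sub>R f p + \<i> *s (v p *\<^sub>R f p))"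
      using int_add[OF u iv] by simp
    also have "\<dots> = (LI p. (of_real (u p) + \<i> * of_real (v p)) *s f p)"
      by (rule int_cong) (auto simp: vec_eq_iff scaleR_conv_of_real[where 'a=complex] algebra_simps)
    finally show ?thesis .
  qed
  have p12: "of_real (ph1 R L m p) + \<i> * of_real (ph2 R L m p) = of_real (ch p) * (of_real (cu R p) * cnj (em L m p))" for p
    unfolding ph1_def ph2_def em_kp by (simp add: complex_eq_iff)
  show "(LI p. ph1 R L m p *\<^sub>R f p) + \<i> *s (LI p. ph2 R L m p *\<^sub>R f p) = cf L m (\<lambda>p. cu R p *\<^sub>R f p)"
  proof -
    have "(LI p. (of_real (ph1 R L m p) + \<i> * of_real (ph2 R L m p)) *s f p) = (LI p. ch p *\<^sub>R G (cu R) p)"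
      by (rule int_cong)
        (auto simp: p12 G_def vec_eq_iff scaleR_conv_of_real[where 'a=complex] mult_ac)
    then show ?thesis unfolding comb[OF ii(1,2)] using A(2) by simp
  qed
  show "(LI p. pd j (ph1 R L m) p *\<^sub>R f p) + \<i> *s (LI p. pd j (ph2 R L m) p *\<^sub>R f p)
      = (if j = 3 then cf L m (\<lambda>p. cu1 R p *\<^sub>R f p) else 0) - (\<i> * kv L m $ j) *s cf L m (\<lambda>p. cu R p *\<^sub>R f p)"
  proof -
    define \<beta> :: real where "\<beta> = (if j = 3 then 1 else 0)"
    define k where "k = \<i> * kv L m $ j"
    have "(LI p. (of_real (pd j (ph1 R L m) p) + \<i> * of_real (pd j (ph2 R L m) p)) *s f p)
       = (LI p. (pd j ch p *\<^sub>R G (cu R) p + \<beta> *\<^sub>R (ch p *\<^sub>R G (cu1 R) p)) - k *s (ch p *\<^sub>R G (cu R) p))"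
      by (rule int_cong)
        (auto simp: ph_pd[OF R] k_def \<beta>_def G_def vec_eq_iff scaleR_conv_of_real[where 'a=complex] algebra_simps)
    also have "\<dots> = ((LI p. pd j ch p *\<^sub>R G (cu R) p) + \<beta> *\<^sub>R (LI p. ch p *\<^sub>R G (cu1 R) p)) - k *s (LI p. ch p *\<^sub>R G (cu R) p)"
    proof (rule has_bochner_integral_integral_eq, intro has_bochner_integral_diff has_bochner_integral_add)
      show "has_bochner_integral lebesgue (\<lambda>p. pd j ch p *\<^sub>R G (cu R) p) (LI p. pd j ch p *\<^sub>R G (cu R) p)"
        by (rule has_bochner_integral_integrable[OF C(1)])
      show "has_bochner_integral lebesgue (\<lambda>p. \<beta> *\<^sub>R (ch p *\<^sub>R G (cu1 R) p)) (\<beta> *\<^sub>R (LI p. ch p *\<^sub>R G (cu1 R) p))"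
        by (rule has_bochner_integral_bounded_linear[OF bounded_linear_scaleR_right has_bochner_integral_integrable[OF B(1)]])
      show "has_bochner_integral lebesgue (\<lambda>p. k *s (ch p *\<^sub>R G (cu R) p)) (k *s (LI p. ch p *\<^sub>R G (cu R) p))"
        by (rule has_bochner_integral_bounded_linear[OF bounded_linear_vsmult has_bochner_integral_integrable[OF A(1)]])
    qed
    also have "\<dots> = \<beta> *\<^sub>R cf L m (\<lambda>p. cu1 R p *\<^sub>R f p) - k *s cf L m (\<lambda>p. cu R p *\<^sub>R f p)"
      using A(2) B(2) C(2) by simp
    finally show ?thesis unfolding comb[OF ii(3,4)] by (simp add: \<beta>_def k_def)
  qed
qed

end

section \<open>Curl and divergence of a single Fourier mode\<close>

definition ez :: "complex^3" where "ez = vector [0, 0, 1]"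
definition pz :: "complex^3 => complex^3" where "pz v = vector [0, 0, v $ 3]"

lemma ez_simps [simp]: "ez $ 1 = 0" "ez $ 2 = 0" "ez $ 3 = 1" "pz v $ 1 = 0" "pz v $ 2 = 0" "pz v $ 3 = v $ 3"
  by (simp_all add: ez_def pz_def)

lemma crs_ez: "bounded_linear (crs ez)" "crs ez (c *s v) = c *s crs ez v" "norm (crs ez v) <= norm v"
proof -
  show "bounded_linear (crs ez)" using bounded_linear_crs_right[of ez] by (simp add: eta_contract_eq)
  show "crs ez (c *s v) = c *s crs ez v" by (rule crs_scale)
  have "(norm (crs ez v))\<^sup>2 <= (norm v)\<^sup>2" unfolding norm3_sq by simp
  then show "norm (crs ez v) <= norm v" by (rule power2_le_imp_le) simp
qed

lemma pz_props: "bounded_linear pz" "pz (c *s v) = c *s pz v" "norm (pz v) <= norm v" "norm (pz v) = norm (v $ 3)"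
proof -
  have "linear pz" by (rule linearI) (auto simp: vec3_eq)
  then show "bounded_linear pz" by (simp add: linear_conv_bounded_linear)
  show "pz (c *s v) = c *s pz v" by (simp add: vec3_eq)
  have "(norm (pz v))\<^sup>2 <= (norm v)\<^sup>2" unfolding norm3_sq by simp
  then show "norm (pz v) <= norm v" by (rule power2_le_imp_le) simp
  have "(norm (pz v))\<^sup>2 = (norm (v $ 3))\<^sup>2" unfolding norm3_sq cmod_power2 by simp
  then show "norm (pz v) = norm (v $ 3)" by simp
qed

context qp
begin

lemma rvec_kv [simp]: "rvec (kv L m)"
  by (simp add: rvec_def kv_kp)

lemma kv_norm: "(norm (kv L m))\<^sup>2 = (norm (\<alpha> + Q m))\<^sup>2 + (pi * of_int (snd (snd m)) / L)\<^sup>2"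
proof -
  have "(norm (\<alpha> + Q m))\<^sup>2 = ((\<alpha> + Q m) $ 1)\<^sup>2 + ((\<alpha> + Q m) $ 2)\<^sup>2"
    unfolding power2_norm_eq_inner by (simp add: inner_vec_def sum_2 power2_eq_square)
  then show ?thesis unfolding norm3_sq by (simp add: kv_def)
qed

lemma grad_test_sum:
  assumes f: "f \<in> L2" and t: "test_fun \<phi>"
  shows "(LI p. crs (gr \<phi> p) (f p)) $ i
    = (LI p. pd (nxt i) \<phi> p *\<^sub>R f p) $ nxt (nxt i) - (LI p. pd (nxt (nxt i)) \<phi> p *\<^sub>R f p) $ nxt i"
    "(LI p. (\<Sum>i\<in>UNIV. f p $ i * complex_of_real (pd i \<phi> p))) = (\<Sum>i\<in>UNIV. (LI p. pd i \<phi> p *\<^sub>R f p) $ i)"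
proof -
  have int: "Lint (\<lambda>p. pd j \<phi> p *\<^sub>R f p)" for j by (rule int_test(1)[OF f test_pd[OF t]])
  have nth: "(LI p. pd j \<phi> p *\<^sub>R f p) $ k = (LI p. f p $ k * complex_of_real (pd j \<phi> p))"
    "Lint (\<lambda>p. f p $ k * complex_of_real (pd j \<phi> p))" for j k
    using integral_bounded_linear[OF bounded_linear_nth int, of j k] integrable_bounded_linear[OF bounded_linear_nth int, of j k]
    by (simp_all add: scaleR_conv_of_real[where 'a=complex] mult.commute)
  have "(LI p. crs (gr \<phi> p) (f p)) $ i = (LI p. crs (gr \<phi> p) (f p) $ i)"
    by (rule integral_bounded_linear[OF bounded_linear_nth int_test(2)[OF f t], symmetric])
  also have "\<dots> = (LI p. f p $ nxt (nxt i) * complex_of_real (pd (nxt i) \<phi> p) - f p $ nxt i * complex_of_real (pd (nxt (nxt i)) \<phi> p))"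
    by (simp add: crs_def mult.commute)
  also have "\<dots> = (LI p. f p $ nxt (nxt i) * complex_of_real (pd (nxt i) \<phi> p)) - (LI p. f p $ nxt i * complex_of_real (pd (nxt (nxt i)) \<phi> p))"
    by (rule int_diff[OF nth(2) nth(2)])
  finally show "(LI p. crs (gr \<phi> p) (f p)) $ i
    = (LI p. pd (nxt i) \<phi> p *\<^sub>R f p) $ nxt (nxt i) - (LI p. pd (nxt (nxt i)) \<phi> p *\<^sub>R f p) $ nxt i"
    unfolding nth(1) .
  show "(LI p. (\<Sum>i\<in>UNIV. f p $ i * complex_of_real (pd i \<phi> p))) = (\<Sum>i\<in>UNIV. (LI p. pd i \<phi> p *\<^sub>R f p) $ i)"
    unfolding nth(1) by (rule int_sum[OF nth(2)])
qed

text \<open>Coefficient form of cu curl f = curl (cu f) - grad cu x f; the gradient of the cutoff is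
  vertical, hence \<open>ez\<close>.\<close>

lemma curl_coef:
  assumes f: "f \<in> L2" and g: "g \<in> L2" and c: "is_curl f g" and R: "R > 0" and L: "L > 2 * R"
  shows "cf L m (\<lambda>p. cu R p *\<^sub>R g p) = \<i> *s crs (kv L m) (cf L m (\<lambda>p. cu R p *\<^sub>R f p)) - crs ez (cf L m (\<lambda>p. cu1 R p *\<^sub>R f p))"
proof -
  define A where "A = cf L m (\<lambda>p. cu R p *\<^sub>R f p)"
  define B where "B = cf L m (\<lambda>p. cu1 R p *\<^sub>R f p)"
  define X where "X j = (LI p. pd j (ph1 R L m) p *\<^sub>R f p) + \<i> *s (LI p. pd j (ph2 R L m) p *\<^sub>R f p)" for j
  have X: "X j = (if j = 3 then B else 0) - (\<i> * kv L m $ j) *s A" for j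
    unfolding X_def A_def B_def by (rule mode_test(2)[OF f R L])
  have cv: "(LI p. \<phi> p *\<^sub>R g p) = - (LI p. crs (gr \<phi> p) (f p))" if "test_fun \<phi>" for \<phi>
    using c that unfolding curl_vec[OF f g] by blast
  have "cf L m (\<lambda>p. cu R p *\<^sub>R g p) $ i = - (X (nxt i) $ nxt (nxt i) - X (nxt (nxt i)) $ nxt i)" for i
    unfolding mode_test(1)[OF g R L, symmetric] X_def
    by (simp add: cv[OF ph_test(1)[OF R]] cv[OF ph_test(2)[OF R]] grad_test_sum(1)[OF f ph_test(1)[OF R]] grad_test_sum(1)[OF f ph_test(2)[OF R]] algebra_simps)
  note E = this[of 1] this[of 2] this[of 3]
  show ?thesis unfolding A_def[symmetric] B_def[symmetric]
    using E by (simp add: vec3_eq X nxt_def algebra_simps)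
qed

text \<open>For div f = 0 the divergence of the truncated field is the commutator alone, the
  vertical component of \<open>cu1 R p\<close> times the field. It replaces k . A = 0, which
  truncation destroys.\<close>

lemma div_coef:
  assumes f: "f \<in> Hs1" and R: "R > 0" and L: "L > 2 * R"
  shows "cf L m (\<lambda>p. cu1 R p *\<^sub>R f p) $ 3 = \<i> * dot3 (kv L m) (cf L m (\<lambda>p. cu R p *\<^sub>R f p))"
proof -
  have fL: "f \<in> L2" and d: "div_free (\<lambda>p. 1) f" using f by (auto simp: Hs_def)
  define A where "A = cf L m (\<lambda>p. cu R p *\<^sub>R f p)"
  define B where "B = cf L m (\<lambda>p. cu1 R p *\<^sub>R f p)"
  define X where "X j = (LI p. pd j (ph1 R L m) p *\<^sub>R f p) + \<i> *s (LI p. pd j (ph2 R L m) p *\<^sub>R f p)" for j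
  have X: "X j = (if j = 3 then B else 0) - (\<i> * kv L m $ j) *s A" for j
    unfolding X_def A_def B_def by (rule mode_test(2)[OF fL R L])
  have z: "(\<Sum>i\<in>UNIV. (LI p. pd i \<phi> p *\<^sub>R f p) $ i) = 0" if "test_fun \<phi>" for \<phi>
    using d that unfolding div_free_def grad_test_sum(2)[OF fL that, symmetric] by simp
  have "(\<Sum>i\<in>UNIV. X i $ i) = 0"
    using z[OF ph_test(1)[OF R]] z[OF ph_test(2)[OF R]] by (simp add: X_def sum.distrib sum_distrib_left[symmetric])
  then show ?thesis unfolding A_def[symmetric] B_def[symmetric]
    by (simp add: sum_3 X dot3_def algebra_simps)
qed

lemma cu_LL:
  assumes f: "f \<in> L2" and R: "R > 0" and L: "L > 2 * R"
  shows "(\<lambda>p. cu R p *\<^sub>R f p) \<in> LL L" "(\<lambda>p. cu1 R p *\<^sub>R f p) \<in> LL L"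
proof -
  have s: "\<bar>snd p\<bar> > 2 * R" if "sl L p = 0" for p using that L R by (auto simp: sl_def indicator_def split: if_splits)
  show "(\<lambda>p. cu R p *\<^sub>R f p) \<in> LL L" "(\<lambda>p. cu1 R p *\<^sub>R f p) \<in> LL L"
    unfolding LL_def using L2_wt[OF f cu_props(1)[OF R]] L2_wt[OF f cu_props(2)[OF R]]
      cu_props(6)[OF R less_imp_le[OF s]] cu_props(7)[OF R s] by simp_all
qed

lemma cf_map:
  assumes T: "bounded_linear T" "!!c v. T (c *s v) = c *s T v" "!!v. norm (T v) <= norm (v :: complex^3)" and f: "f \<in> LL L"
  shows "(\<lambda>p. T (f p)) \<in> LL L" "cf L m (\<lambda>p. T (f p)) = T (cf L m f)"
proof -
  have Tm: "T \<in> borel_measurable borel"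
    by (rule borel_measurable_continuous_onI) (rule linear_continuous_on[OF T(1)])
  have "(\<lambda>p. T (f p)) \<in> L2"
  proof (rule L2_bound[OF _ _ LL_L2[OF f], of _ 1])
    show "(\<lambda>p. T (f p)) \<in> Lmeas" by (rule measurable_compose[OF L2D(1)[OF LL_L2[OF f]] Tm])
    show "T (f (p + gm k)) = ph k *s T (f p)" for p k unfolding L2D(2)[OF LL_L2[OF f]] T(2) ..
    show "norm (T (f p)) <= 1 * norm (f p)" for p using T(3) by simp
  qed
  moreover have "T (f p) = 0" if "sl L p = 0" for p
  proof -
    have "f p = 0" using f that unfolding LL_def by blast
    then show ?thesis using T(3)[of "f p"] by simp
  qed
  ultimately show "(\<lambda>p. T (f p)) \<in> LL L" by (simp add: LL_def)
  have "cf L m (\<lambda>p. T (f p)) = (LI p. T (indicator Y p *\<^sub>R (cnj (em L m p) *s f p)))"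
    unfolding cf_def by (simp add: linear_scale[OF bounded_linear.linear[OF T(1)]] T(2))
  also have "\<dots> = T (cf L m f)"
    unfolding cf_def by (rule integral_bounded_linear[OF T(1) cf_integrable[OF f]])
  finally show "cf L m (\<lambda>p. T (f p)) = T (cf L m f)" .
qed

section \<open>Estimates obtained from sums over modes\<close>

lemma nm_weight_le:
  assumes f: "f \<in> L2" and w: "wt w" "!!p. \<bar>w p\<bar> <= c" and T: "!!p. norm (g p) <= norm (w p *\<^sub>R f p)" and g: "g \<in> L2"
  shows "L.nm g <= c * L.nm f"
proof -
  have c0: "0 <= c" using w(2)[of 0] by linarith
  have "ip1 g g <= ip (\<lambda>p. c\<^sup>2) f f"
    unfolding ip_def
  proof (rule integral_mono[OF ip_integrable[OF g g wt_const] ip_integrable[OF f f wt_const]])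
    fix p
    have "norm (g p) <= c * norm (f p)" using T[of p] w(2)[of p] mult_right_mono[of "\<bar>w p\<bar>" c "norm (f p)"] by simp
    then have "(norm (g p))\<^sup>2 <= (c * norm (f p))\<^sup>2" by (intro power_mono) auto
    then show "indicator Y p * 1 * (g p \<bullet> g p) <= indicator Y p * c\<^sup>2 * (f p \<bullet> f p)"
      by (simp add: indicator_def power_mult_distrib power2_norm_eq_inner)
  qed
  also have "\<dots> = c\<^sup>2 * ip1 f f" by (rule ip_const_weight)
  finally have "sqrt (ip1 g g) <= sqrt (c\<^sup>2 * ip1 f f)" by simp
  then show ?thesis using c0 by (simp add: L.nm_def real_sqrt_mult)
qed

text \<open>By Lagrange's identity |k|^2 |A|^2 is the sum of |k x A|^2 and |k . A|^2. The first term
  is a coefficient of the truncated curl plus a commutator, the second a commutator only; Parseval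
  sums both, and each commutator costs \<open>k = ztM / R\<close> times the norm of
  \<open>u\<close>.\<close>

lemma energy:
  assumes u: "u \<in> Hs1" and g: "g \<in> L2" and c: "is_curl u g" and R: "R > 0" and L: "L > 2 * R"
  defines "k \<equiv> ztM / R"
  obtains S where "((\<lambda>m. (norm (kv L m))\<^sup>2 * (norm (cf L m (\<lambda>p. cu R p *\<^sub>R u p)))\<^sup>2) has_sum S) UNIV"
    "S <= vol L * ((L.nm g + k * L.nm u)\<^sup>2 + (k * L.nm u)\<^sup>2)"
proof -
  have uL: "u \<in> L2" using u by (rule Hs_L2)
  have L0: "L > 0" using R L by linarith
  define A where "A = (\<lambda>p. cu R p *\<^sub>R u p)"
  define B where "B = (\<lambda>p. cu1 R p *\<^sub>R u p)"
  define G where "G = (\<lambda>p. cu R p *\<^sub>R g p)"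
  have AL: "A \<in> LL L" and BL: "B \<in> LL L" and GL: "G \<in> LL L"
    unfolding A_def B_def G_def by (intro cu_LL uL g R L)+
  define EB where "EB = (\<lambda>p. crs ez (B p))"
  define PB where "PB = (\<lambda>p. pz (B p))"
  have EB: "EB \<in> LL L" "cf L m EB = crs ez (cf L m B)" for m
    unfolding EB_def by (rule cf_map[OF crs_ez BL])+
  have PB: "PB \<in> LL L" "cf L m PB = pz (cf L m B)" for m
    unfolding PB_def by (rule cf_map[OF pz_props(1-3) BL])+
  have GE: "G + EB \<in> LL L" using GL EB(1) LL_subspace by (rule_tac subspace_add)
  have k1: "cf L m (G + EB) = \<i> *s crs (kv L m) (cf L m A)" for m
    using curl_coef[OF uL g c R L, of m] unfolding cf_add[OF GL EB(1)] EB(2) by (simp add: G_def A_def B_def)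
  have k2: "norm (cf L m PB) = norm (dot3 (kv L m) (cf L m A))" for m
    using div_coef[OF u R L, of m] unfolding PB(2) pz_props(4) by (simp add: A_def B_def norm_mult)
  define S where "S = vol L * ip1 (G + EB) (G + EB) + vol L * ip1 PB PB"
  have "((\<lambda>m. (norm (cf L m (G + EB)))\<^sup>2 + (norm (cf L m PB))\<^sup>2) has_sum S) UNIV"
    unfolding S_def by (intro has_sum_add parseval_sq L0 GE PB(1))
  then have 1: "((\<lambda>m. (norm (kv L m))\<^sup>2 * (norm (cf L m (\<lambda>p. cu R p *\<^sub>R u p)))\<^sup>2) has_sum S) UNIV"
    unfolding k1 k2 norm_vsmult using crs_dot_norm[OF rvec_kv] by (simp add: A_def)
  have kk: "\<bar>cu1 R p\<bar> <= k" for p unfolding k_def by (rule cu_props(5)[OF R])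
  have k0: "0 <= k" using kk[of 0] by linarith
  have nG: "L.nm G <= 1 * L.nm g"
    by (rule nm_weight_le[OF g cu_props(1)[OF R] _ _ LL_L2[OF GL]]) (use cu_props(3,4)[OF R] in \<open>auto simp: G_def abs_le_iff intro: order_trans[OF _ zero_le_one]\<close>)
  have nE: "L.nm EB <= k * L.nm u"
    by (rule nm_weight_le[OF uL cu_props(2)[OF R] kk _ LL_L2[OF EB(1)]]) (simp add: EB_def B_def crs_ez(3)[THEN order_trans])
  have nP: "L.nm PB <= k * L.nm u"
    by (rule nm_weight_le[OF uL cu_props(2)[OF R] kk _ LL_L2[OF PB(1)]]) (simp add: PB_def B_def pz_props(3)[THEN order_trans])
  have "ip1 (G + EB) (G + EB) <= (L.nm g + k * L.nm u)\<^sup>2"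
  proof -
    have "L.nm (G + EB) <= L.nm g + k * L.nm u"
      using L.triangle[OF LL_L2[OF GL] LL_L2[OF EB(1)]] nG nE by linarith
    then have "(L.nm (G + EB))\<^sup>2 <= (L.nm g + k * L.nm u)\<^sup>2"
      using L.nm_nonneg[OF LL_L2[OF GE]] by (rule power_mono)
    then show ?thesis by (simp only: L.nm_sq[OF LL_L2[OF GE]])
  qed
  moreover have "ip1 PB PB <= (k * L.nm u)\<^sup>2"
    using power_mono[OF nP L.nm_nonneg[OF LL_L2[OF PB(1)]], of 2] by (simp only: L.nm_sq[OF LL_L2[OF PB(1)]])
  ultimately have "S <= vol L * ((L.nm g + k * L.nm u)\<^sup>2 + (k * L.nm u)\<^sup>2)"
    unfolding S_def distrib_left[symmetric] using vol_pos[OF L0] by (intro mult_left_mono add_mono) auto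
  with 1 show ?thesis by (rule that)
qed

text \<open>Dominated convergence: at every point the cutoff is eventually equal to 1.\<close>

lemma cut_limit:
  assumes f: "f \<in> L2" and g: "g \<in> L2"
  shows "(\<lambda>n. ip1 (\<lambda>p. cu (real (Suc n)) p *\<^sub>R f p) (\<lambda>p. cu (real (Suc n)) p *\<^sub>R g p)) ~~> ip1 f g"
  unfolding ip_def
proof (rule integral_dominated_convergence[where w="\<lambda>p. \<bar>indicator Y p * 1 * (f p \<bullet> g p)\<bar>"])
  have m: "(\<lambda>p. c p *\<^sub>R h p) \<in> Lmeas" if "wt c" "h \<in> L2" for c :: "pt => real" and h
    using L2D(1)[OF L2_wt[OF that(2,1)]] .
  have R: "real (Suc n) > 0" for n by simp
  show "(\<lambda>p. indicator Y p * 1 * (f p \<bullet> g p)) \<in> Lmeas"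
    by (rule borel_measurable_integrable[OF ip_integrable[OF f g wt_const]])
  show "(\<lambda>p. indicator Y p * 1 * ((cu (real (Suc n)) p *\<^sub>R f p) \<bullet> (cu (real (Suc n)) p *\<^sub>R g p))) \<in> Lmeas" for n
    by (intro borel_measurable_times indY_meas borel_measurable_const borel_measurable_inner m cu_props(1)[OF R] f g)
  show "Lint (\<lambda>p. \<bar>indicator Y p * 1 * (f p \<bullet> g p)\<bar>)"
    by (rule integrable_abs[OF ip_integrable[OF f g wt_const]])
  show "AE p in lebesgue. (\<lambda>n. indicator Y p * 1 * ((cu (real (Suc n)) p *\<^sub>R f p) \<bullet> (cu (real (Suc n)) p *\<^sub>R g p))) ~~> indicator Y p * 1 * (f p \<bullet> g p)"
  proof (rule AE_I2, rule tendsto_eventually)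
    fix p :: pt
    obtain N :: nat where N: "\<bar>snd p\<bar> <= real N" using real_arch_simple by blast
    have "cu (real (Suc n)) p = 1" if "n >= N" for n
      by (rule cu_props(8)[OF R]) (use N that in linarith)
    then show "\<forall>\<^sub>F n in sequentially. indicator Y p * 1 * ((cu (real (Suc n)) p *\<^sub>R f p) \<bullet> (cu (real (Suc n)) p *\<^sub>R g p)) = indicator Y p * 1 * (f p \<bullet> g p)"
      unfolding eventually_sequentially by (intro exI[of _ N]) simp
  qed
  show "AE p in lebesgue. norm (indicator Y p * 1 * ((cu (real (Suc n)) p *\<^sub>R f p) \<bullet> (cu (real (Suc n)) p *\<^sub>R g p))) <= \<bar>indicator Y p * 1 * (f p \<bullet> g p)\<bar>" for n
  proof (intro always_eventually allI)
    fix p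
    have "cu (real (Suc n)) p * cu (real (Suc n)) p <= 1 * 1"
      using cu_props(3,4)[OF R, of n p] by (intro mult_mono) auto
    then have "cu (real (Suc n)) p * cu (real (Suc n)) p * \<bar>f p \<bullet> g p\<bar> <= 1 * \<bar>f p \<bullet> g p\<bar>" by (intro mult_right_mono) auto
    then show "norm (indicator Y p * 1 * ((cu (real (Suc n)) p *\<^sub>R f p) \<bullet> (cu (real (Suc n)) p *\<^sub>R g p))) <= \<bar>indicator Y p * 1 * (f p \<bullet> g p)\<bar>"
      using cu_props(3)[OF R, of n p] by (simp add: abs_mult mult.assoc indicator_def)
  qed
qed

text \<open>Symmetry of the weak curl: by Parseval it holds for truncated fields up to an error of order \<open>1/R\<close>.\<close>

lemma curl_symmetric:
  assumes L: "f \<in> L2" "g \<in> L2" "F \<in> L2" "G \<in> L2" and c: "is_curl f g" "is_curl F G"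
  shows "ip1 g F = ip1 f G"
proof -
  define c0 where "c0 n = (\<lambda>h p. cu (real (Suc n)) p *\<^sub>R (h p :: complex^3))" for n
  define c1 where "c1 n = (\<lambda>h p. crs ez (cu1 (real (Suc n)) p *\<^sub>R (h p :: complex^3)))" for n
  have err: "\<bar>ip1 (c0 n g) (c0 n F) - ip1 (c0 n f) (c0 n G)\<bar> <= 2 * (ztM / real (Suc n)) * (L.nm f * L.nm F)" for n
  proof -
    define R where "R = real (Suc n)"
    \<comment> \<open>Any half-height beyond \<open>2 * R\<close> would do; the cutoff must vanish
      outside the slab.\<close>
    define K where "K = 2 * R + 1"
    have R: "R > 0" and K: "K > 2 * R" and K0: "K > 0" by (auto simp: R_def K_def)
    have c0L: "c0 n h \<in> LL K" and c1L: "c1 n h \<in> LL K" and c1cf: "cf K m (c1 n h) = crs ez (cf K m (\<lambda>p. cu1 R p *\<^sub>R h p))"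
      if h: "h \<in> L2" for h m
      unfolding c0_def c1_def R_def[symmetric]
      using cu_LL[OF h R K] cf_map[OF crs_ez cu_LL(2)[OF h R K]] by blast+
    have cc: "cf K m (c0 n b + c1 n a) = \<i> *s crs (kv K m) (cf K m (c0 n a))"
      if "a \<in> L2" "b \<in> L2" "is_curl a b" for a b m
      using curl_coef[OF that R K, of m] unfolding cf_add[OF c0L[OF that(2)] c1L[OF that(1)]] c1cf[OF that(1)]
      by (simp add: c0_def R_def)
    have s1: "((\<lambda>m. cf K m (c0 n g + c1 n f) \<bullet> cf K m (c0 n F)) has_sum vol K * ip1 (c0 n g + c1 n f) (c0 n F)) UNIV"
      by (intro parseval K0 c0L subspace_add[OF LL_subspace] c1L L)
    have s2: "((\<lambda>m. cf K m (c0 n f) \<bullet> cf K m (c0 n G + c1 n F)) has_sum vol K * ip1 (c0 n f) (c0 n G + c1 n F)) UNIV"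
      by (intro parseval K0 c0L subspace_add[OF LL_subspace] c1L L)
    have "vol K * ip1 (c0 n g + c1 n f) (c0 n F) = vol K * ip1 (c0 n f) (c0 n G + c1 n F)"
      using s1 s2 unfolding cc[OF L(1,2) c(1)] cc[OF L(3,4) c(2)] crs_imag_inner[OF rvec_kv] by (rule has_sum_unique)
    then have eq: "ip1 (c0 n g + c1 n f) (c0 n F) = ip1 (c0 n f) (c0 n G + c1 n F)"
      using vol_pos[OF K0] by simp
    have m: "c0 n h \<in> L2" "c1 n h \<in> L2" if "h \<in> L2" for h using LL_L2 c0L[OF that] c1L[OF that] by blast+
    have n0: "L.nm (c0 n h) <= 1 * L.nm h" if h: "h \<in> L2" for h
      by (rule nm_weight_le[OF h cu_props(1)[OF R] _ _ m(1)[OF h]]) (use cu_props(3,4)[OF R] in \<open>simp_all only: c0_def R_def[symmetric] abs_of_nonneg order_refl\<close>)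
    have n1: "L.nm (c1 n h) <= (ztM / R) * L.nm h" if h: "h \<in> L2" for h
      by (rule nm_weight_le[OF h cu_props(2)[OF R] cu_props(5)[OF R] _ m(2)[OF h]]) (simp add: c1_def R_def[symmetric] crs_ez(3)[THEN order_trans] del: of_nat_Suc)
    have k0: "0 <= ztM / R" using R ztM_nonneg by simp
    have kf: "0 <= ztM / R * L.nm f" using k0 L.nm_nonneg[OF L(1)] by (rule mult_nonneg_nonneg)
    have e1: "\<bar>ip1 (c1 n f) (c0 n F)\<bar> <= (ztM / R * L.nm f) * (1 * L.nm F)"
      by (rule order_trans[OF L.CS_abs[OF m(2)[OF L(1)] m(1)[OF L(3)]] mult_mono[OF n1[OF L(1)] n0[OF L(3)] kf L.nm_nonneg[OF m(1)[OF L(3)]]]])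
    have e2: "\<bar>ip1 (c0 n f) (c1 n F)\<bar> <= (1 * L.nm f) * (ztM / R * L.nm F)"
      by (rule order_trans[OF L.CS_abs[OF m(1)[OF L(1)] m(2)[OF L(3)]] mult_mono[OF n0[OF L(1)] n1[OF L(3)] _ L.nm_nonneg[OF m(2)[OF L(3)]]]])
        (simp add: L.nm_nonneg[OF L(1)])
    have "ip1 (c0 n g) (c0 n F) - ip1 (c0 n f) (c0 n G) = ip1 (c0 n f) (c1 n F) - ip1 (c1 n f) (c0 n F)"
      using eq by (simp add: L.bilin m L)
    then have "\<bar>ip1 (c0 n g) (c0 n F) - ip1 (c0 n f) (c0 n G)\<bar> <= (ztM / R * L.nm f) * (1 * L.nm F) + (1 * L.nm f) * (ztM / R * L.nm F)"
      using e1 e2 by linarith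
    also have "\<dots> = 2 * (ztM / R) * (L.nm f * L.nm F)" by simp
    finally show ?thesis unfolding R_def .
  qed
  have "(\<lambda>n. ip1 (c0 n g) (c0 n F) - ip1 (c0 n f) (c0 n G)) ~~> ip1 g F - ip1 f G"
    unfolding c0_def by (intro tendsto_diff cut_limit L)
  moreover have "(\<lambda>n. ip1 (c0 n g) (c0 n F) - ip1 (c0 n f) (c0 n G)) ~~> 0"
  proof (rule Lim_null_comparison)
    show "\<forall>\<^sub>F n in sequentially. norm (ip1 (c0 n g) (c0 n F) - ip1 (c0 n f) (c0 n G)) <= 2 * (ztM / real (Suc n)) * (L.nm f * L.nm F)"
      using err by (intro always_eventually allI) simp
    have "(\<lambda>n. 2 * (ztM * inverse (real (Suc n))) * (L.nm f * L.nm F)) ~~> 2 * (ztM * 0) * (L.nm f * L.nm F)"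
      by (intro tendsto_intros LIMSEQ_inverse_real_of_nat)
    then show "(\<lambda>n. 2 * (ztM / real (Suc n)) * (L.nm f * L.nm F)) ~~> 0" by (simp add: divide_inverse)
  qed
  ultimately show ?thesis using LIMSEQ_unique by force
qed

text \<open>The difference is a weak curl of 0, so all coefficients of its truncations vanish and
  totality makes them null.\<close>

lemma curl_unique:
  assumes f: "f \<in> L2" and g: "g \<in> L2" "g' \<in> L2" and c: "is_curl f g" "is_curl f g'"
  shows "ip1 (g - g') (g - g') = 0"
proof -
  define d where "d = g - g'"
  have d: "d \<in> L2" "is_curl 0 d" using curl_diff[OF f g(1) f g(2) c] g by (auto simp: d_def)
  have "ip1 (\<lambda>p. cu (real (Suc n)) p *\<^sub>R d p) (\<lambda>p. cu (real (Suc n)) p *\<^sub>R d p) = 0" for n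
  proof -
    define R where "R = real (Suc n)"
    have R: "R > 0" and K: "2 * R + 1 > 2 * R" and K0: "2 * R + 1 > 0" by (auto simp: R_def)
    have z: "cf K m (\<lambda>p. c p *\<^sub>R 0 p) = 0" for K m and c :: "pt => real" by (simp add: cf_def)
    have z': "cf K m (\<lambda>p. 0) = 0" for K m by (simp add: cf_def)
    have "crs v 0 = 0" for v by (simp add: crs_def vec_eq_iff)
    then have "cf (2 * R + 1) m (\<lambda>p. cu R p *\<^sub>R d p) = 0" for m
      using curl_coef[OF L.mem(4) d R K, of m] by (simp add: z z')
    from total[OF K0 cu_LL(1)[OF d(1) R K] this] show ?thesis by (simp add: R_def)
  qed
  then have "(\<lambda>n::nat. 0) ~~> ip1 d d" using cut_limit[OF d(1) d(1)] by simp
  then show ?thesis by (simp add: LIMSEQ_const_iff d_def)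
qed

text \<open>A bound on the wave vector bounds the vertical index and \<open>Q m\<close>; pairing
  \<open>Q m\<close> with \<open>a1\<close> and \<open>a2\<close> returns 2 pi times the two
  horizontal indices.\<close>

lemma finite_modes: "L > 0 ==> finite {m. norm (kv L m) <= K}"
proof -
  assume L: "L > 0"
  define N where "N = \<lceil>(\<bar>K\<bar> + norm \<alpha>) * (norm a1 + norm a2) + \<bar>K\<bar> * L\<rceil>"
  have "{m. norm (kv L m) <= K} \<subseteq> {-N..N} \<times> {-N..N} \<times> {-N..N}"
  proof
    fix m assume "m \<in> {m. norm (kv L m) <= K}"
    then have m: "norm (kv L m) <= K" by simp
    then have K0: "0 <= K" using norm_ge_zero order_trans by blast
    have sq: "(norm (kv L m))\<^sup>2 <= K\<^sup>2" using m by (intro power_mono) auto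
    have "(norm (\<alpha> + Q m))\<^sup>2 <= K\<^sup>2" using sq kv_norm[of L m] zero_le_power2[of "pi * of_int (snd (snd m)) / L"] by linarith
    then have "norm (\<alpha> + Q m) <= K" by (rule power2_le_imp_le[OF _ K0])
    then have q: "norm (Q m) <= K + norm \<alpha>" using norm_triangle_ineq4[of "\<alpha> + Q m" \<alpha>] by simp
    have "(pi * of_int (snd (snd m)) / L)\<^sup>2 <= K\<^sup>2" using sq kv_norm[of L m] zero_le_power2[of "norm (\<alpha> + Q m)"] by linarith
    then have "\<bar>pi * of_int (snd (snd m)) / L\<bar> <= K" using K0 by (simp add: abs_le_square_iff[symmetric])
    then have "pi * \<bar>of_int (snd (snd m))\<bar> <= K * L" using L by (simp add: abs_mult field_simps)
    moreover have "1 * \<bar>real_of_int (snd (snd m))\<bar> <= pi * \<bar>of_int (snd (snd m))\<bar>" using pi_ge_two by (intro mult_right_mono) auto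
    ultimately have m3: "\<bar>real_of_int (snd (snd m))\<bar> <= K * L" by simp
    have bd: "\<bar>real_of_int i\<bar> <= (K + norm \<alpha>) * norm a" if "Q m \<bullet> a = 2 * pi * of_int i" for a i
    proof -
      have "1 * \<bar>real_of_int i\<bar> <= (2 * pi) * \<bar>real_of_int i\<bar>" using pi_ge_two by (intro mult_right_mono) auto
      also have "\<dots> = \<bar>Q m \<bullet> a\<bar>" using that by (simp add: abs_mult)
      also have "\<dots> <= norm (Q m) * norm a" by (rule Cauchy_Schwarz_ineq2)
      also have "\<dots> <= (K + norm \<alpha>) * norm a" using q by (intro mult_right_mono) auto
      finally show ?thesis by simp
    qed
    have m1: "\<bar>real_of_int (fst m)\<bar> <= (K + norm \<alpha>) * norm a1" and m2: "\<bar>real_of_int (fst (snd m))\<bar> <= (K + norm \<alpha>) * norm a2"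
      by (rule bd, simp add: Q_def inner_add_left)+
    have NN: "(K + norm \<alpha>) * norm a1 + (K + norm \<alpha>) * norm a2 + K * L <= of_int N"
      unfolding N_def using K0 le_of_int_ceiling[of "(\<bar>K\<bar> + norm \<alpha>) * (norm a1 + norm a2) + \<bar>K\<bar> * L"] by (simp add: distrib_left)
    have nn: "0 <= (K + norm \<alpha>) * norm a1" "0 <= (K + norm \<alpha>) * norm a2" "0 <= K * L" using K0 L by auto
    have "\<bar>real_of_int (fst m)\<bar> <= of_int N" "\<bar>real_of_int (fst (snd m))\<bar> <= of_int N" "\<bar>real_of_int (snd (snd m))\<bar> <= of_int N"
      using m1 m2 m3 NN nn by linarith+
    then have "\<bar>fst m\<bar> <= N" "\<bar>fst (snd m)\<bar> <= N" "\<bar>snd (snd m)\<bar> <= N" by linarith+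
    then show "m \<in> {-N..N} \<times> {-N..N} \<times> {-N..N}" by (cases m) (auto simp: abs_le_iff)
  qed
  then show ?thesis by (rule finite_subset) auto
qed

text \<open>Modes with |k| > K carry at most energy / K^2, so up to a small remainder the truncated
  field is described by finitely many coefficients. This is the compactness used near the
  inclusion.\<close>

lemma rellich:
  assumes u: "u \<in> Hs1" and g: "g \<in> L2" and c: "is_curl u g" and R: "R > 0" and L: "L > 2 * R" and K: "K > 0"
  shows "vol L * ip1 (\<lambda>p. cu R p *\<^sub>R u p) (\<lambda>p. cu R p *\<^sub>R u p)
    <= (\<Sum>m\<in>{m. norm (kv L m) <= K}. (norm (cf L m (\<lambda>p. cu R p *\<^sub>R u p)))\<^sup>2)
      + vol L * ((L.nm g + ztM / R * L.nm u)\<^sup>2 + (ztM / R * L.nm u)\<^sup>2) / K\<^sup>2"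
proof -
  have L0: "L > 0" using R L by linarith
  define A where "A m = (norm (cf L m (\<lambda>p. cu R p *\<^sub>R u p)))\<^sup>2" for m
  have A0: "0 <= A m" for m by (simp add: A_def)
  obtain S where S: "((\<lambda>m. (norm (kv L m))\<^sup>2 * A m) has_sum S) UNIV"
    "S <= vol L * ((L.nm g + ztM / R * L.nm u)\<^sup>2 + (ztM / R * L.nm u)\<^sup>2)"
    unfolding A_def by (rule energy[OF u g c R L])
  define F where "F = {m. norm (kv L m) <= K}"
  have F: "finite F" unfolding F_def by (rule finite_modes[OF L0])
  have 1: "(A has_sum (vol L * ip1 (\<lambda>p. cu R p *\<^sub>R u p) (\<lambda>p. cu R p *\<^sub>R u p))) UNIV"
    unfolding A_def by (rule parseval_sq[OF L0 cu_LL(1)[OF Hs_L2[OF u] R L]])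
  have "((\<lambda>m. if m \<in> F then A m else 0) has_sum (\<Sum>m\<in>F. A m)) UNIV"
  proof -
    have "(A has_sum (\<Sum>m\<in>F. A m)) F" by (rule has_sum_finite[OF F])
    then show ?thesis by (rule has_sum_cong_neutral[THEN iffD1, rotated -1]) auto
  qed
  from has_sum_add[OF this has_sum_cmult_right[OF S(1), of "1 / K\<^sup>2"]]
  have 2: "((\<lambda>m. (if m \<in> F then A m else 0) + 1 / K\<^sup>2 * ((norm (kv L m))\<^sup>2 * A m)) has_sum ((\<Sum>m\<in>F. A m) + 1 / K\<^sup>2 * S)) UNIV" .
  have "vol L * ip1 (\<lambda>p. cu R p *\<^sub>R u p) (\<lambda>p. cu R p *\<^sub>R u p) <= (\<Sum>m\<in>F. A m) + 1 / K\<^sup>2 * S"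
  proof (rule has_sum_mono[OF 1 2])
    fix m
    show "A m <= (if m \<in> F then A m else 0) + 1 / K\<^sup>2 * ((norm (kv L m))\<^sup>2 * A m)"
    proof (cases "m \<in> F")
      case False
      then have "K\<^sup>2 <= (norm (kv L m))\<^sup>2" using K by (intro power_mono) (auto simp: F_def)
      then have "K\<^sup>2 * A m <= (norm (kv L m))\<^sup>2 * A m" using A0 by (rule mult_right_mono)
      then show ?thesis using False K by (simp add: field_simps)
    qed (simp add: A0)
  qed
  also have "1 / K\<^sup>2 * S <= 1 / K\<^sup>2 * (vol L * ((L.nm g + ztM / R * L.nm u)\<^sup>2 + (ztM / R * L.nm u)\<^sup>2))"
    using S(2) by (intro mult_left_mono) auto
  finally show ?thesis by (simp add: F_def A_def)
qed

end

section \<open>The lower bound from the Brillouin zone\<close>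

locale bz = qp +
  assumes bz: "\<alpha> \<in> brillouin a1 a2"
begin

lemma kv_lower: "norm \<alpha> <= norm (kv L m)"
proof -
  have "- Q m \<in> rlat a1 a2"
    unfolding rlat_def
  proof (intro CollectI ballI)
    fix \<gamma> assume "\<gamma> \<in> lat a1 a2"
    then obtain k where k: "\<gamma> = fst (gm k)" by (auto simp: lat_eq)
    show "\<exists>i::int. - Q m \<bullet> \<gamma> = 2 * pi * of_int i"
      by (rule exI[of _ "- (fst m * fst k + fst (snd m) * snd k)"]) (simp add: k Q_gm algebra_simps)
  qed
  then have "norm \<alpha> <= norm (\<alpha> - - Q m)" using bz unfolding brillouin_def by blast
  then have "(norm \<alpha>)\<^sup>2 <= (norm (\<alpha> + Q m))\<^sup>2" by (intro power_mono) auto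
  then have "(norm \<alpha>)\<^sup>2 <= (norm (kv L m))\<^sup>2" using kv_norm[of L m] zero_le_power2[of "pi * of_int (snd (snd m)) / L"] by linarith
  then show ?thesis by (rule power2_le_imp_le) simp
qed

text \<open>Each term of the energy sum is bounded below by |\<alpha>|^2 times its coefficient. The
  commutator errors are of order 1/R and disappear as the cutoff height tends to infinity.\<close>

lemma curl_lower_bound:
  assumes u: "u \<in> Hs1" and g: "g \<in> L2" and c: "is_curl u g"
  shows "(norm \<alpha>)\<^sup>2 * ip1 u u <= ip1 g g"
proof -
  have uL: "u \<in> L2" using u by (rule Hs_L2)
  define I where "I n = ip1 (\<lambda>p. cu (real (Suc n)) p *\<^sub>R u p) (\<lambda>p. cu (real (Suc n)) p *\<^sub>R u p)" for n
  have le: "(norm \<alpha>)\<^sup>2 * I n <= (L.nm g + ztM * inverse (real (Suc n)) * L.nm u)\<^sup>2 + (ztM * inverse (real (Suc n)) * L.nm u)\<^sup>2" for n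
  proof -
    define R where "R = real (Suc n)"
    define L where "L = 2 * R + 1"
    have R: "R > 0" and L: "L > 2 * R" and L0: "L > 0" by (auto simp: R_def L_def)
    obtain S where S: "((\<lambda>m. (norm (kv L m))\<^sup>2 * (norm (cf L m (\<lambda>p. cu R p *\<^sub>R u p)))\<^sup>2) has_sum S) UNIV"
      "S <= vol L * ((L.nm g + ztM / R * L.nm u)\<^sup>2 + (ztM / R * L.nm u)\<^sup>2)"
      by (rule energy[OF u g c R L])
    have "((\<lambda>m. (norm \<alpha>)\<^sup>2 * (norm (cf L m (\<lambda>p. cu R p *\<^sub>R u p)))\<^sup>2) has_sum (norm \<alpha>)\<^sup>2 * (vol L * I n)) UNIV"
      unfolding I_def R_def[symmetric] by (intro has_sum_cmult_right parseval_sq L0 cu_LL uL R L)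
    then have "(norm \<alpha>)\<^sup>2 * (vol L * I n) <= S"
      using S(1) by (rule has_sum_mono) (intro mult_right_mono power_mono kv_lower; simp)
    with S(2) have "vol L * ((norm \<alpha>)\<^sup>2 * I n) <= vol L * ((L.nm g + ztM / R * L.nm u)\<^sup>2 + (ztM / R * L.nm u)\<^sup>2)"
      by (simp add: mult.left_commute)
    then show ?thesis using vol_pos[OF L0] by (simp add: R_def divide_inverse)
  qed
  have "(\<lambda>n. (L.nm g + ztM * inverse (real (Suc n)) * L.nm u)\<^sup>2 + (ztM * inverse (real (Suc n)) * L.nm u)\<^sup>2)
     ~~> (L.nm g + ztM * 0 * L.nm u)\<^sup>2 + (ztM * 0 * L.nm u)\<^sup>2"
    by (intro tendsto_intros LIMSEQ_inverse_real_of_nat)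
  moreover have "(\<lambda>n. (norm \<alpha>)\<^sup>2 * I n) ~~> (norm \<alpha>)\<^sup>2 * ip1 u u"
    unfolding I_def by (intro tendsto_mult_left cut_limit uL)
  ultimately have "(norm \<alpha>)\<^sup>2 * ip1 u u <= (L.nm g + ztM * 0 * L.nm u)\<^sup>2 + (ztM * 0 * L.nm u)\<^sup>2"
    using le by (rule_tac LIMSEQ_le) auto
  then show ?thesis using L.nm_sq[OF g] by simp
qed

end

section \<open>Removing finitely many functionals from an estimate\<close>

context semi_ip
begin

text \<open>Functionals are removed one at a time: if dropping one functional destroyed the estimate, a sequence
  normalized by that functional would converge to a vector of the kernel.\<close>

lemma finite_codim_estimate:
  fixes G :: "('a \<times> 'a \<times> ('j => real)) set"
  assumes comp: "complete_in H" and G: "subspace G" "!!u v x. (u, v, x) \<in> G ==> u \<in> H & v \<in> H"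
    and cl: "!!X u. (\<forall>n. X n \<in> G) ==> u \<in> H ==> (\<lambda>n. nm (fst (X n) - u)) ~~> 0 ==>
      (\<lambda>n. nm (fst (snd (X n)))) ~~> 0 ==> nm u = 0"
    and cont: "!!u v x j. (u, v, x) \<in> G ==> \<bar>x j\<bar> <= B * nm u"
    and fin: "finite J"
    and est: "!!u v x. (u, v, x) \<in> G ==> nm u <= C * (nm v + (\<Sum>j\<in>J. \<bar>x j\<bar>))"
  shows "\<exists>c. \<forall>u v x. (u, v, x) \<in> G --> nm u <= c * nm v"
  using fin est
proof (induction J arbitrary: C rule: finite_induct)
  case empty
  then show ?case by auto
next
  case (insert j J)
  \<comment> \<open>The right-hand side of the estimate with the functional \<open>j\<close> left
    out; the step consists in bounding \<open>nm (fst t)\<close> by a multiple of it.\<close>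
  define S where "S t = nm (fst (snd t)) + (\<Sum>i\<in>J. \<bar>snd (snd t) i\<bar>)" for t :: "'a \<times> 'a \<times> ('j => real)"
  have mem1: "fst t \<in> H" "fst (snd t) \<in> H" if "t \<in> G" for t using G(2)[of "fst t" "fst (snd t)" "snd (snd t)"] that by auto
  have S0: "0 <= S t" if "t \<in> G" for t unfolding S_def using mem1[OF that] by (intro add_nonneg_nonneg sum_nonneg) auto
  have Ssc: "S (r *\<^sub>R t) = \<bar>r\<bar> * S t" if "t \<in> G" for r t
    using mem1[OF that] by (simp add: S_def nm_scale abs_mult sum_distrib_left distrib_left)
  have Sdf: "S (s - t) <= S s + S t" if "s \<in> G" "t \<in> G" for s t
  proof -
    have "(\<Sum>i\<in>J. \<bar>snd (snd s) i - snd (snd t) i\<bar>) <= (\<Sum>i\<in>J. \<bar>snd (snd s) i\<bar> + \<bar>snd (snd t) i\<bar>)"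
      by (rule sum_mono) simp
    then show ?thesis using triangle_sub[OF mem1(2)[OF that(1)] mem1(2)[OF that(2)]]
      unfolding S_def sum.distrib by simp
  qed
  have e: "nm (fst t) <= C * (S t + \<bar>snd (snd t) j\<bar>)" if "t \<in> G" for t
    using insert.prems[of "fst t" "fst (snd t)" "snd (snd t)"] that insert.hyps by (simp add: S_def algebra_simps)
  have ct: "\<bar>snd (snd t) j\<bar> <= B * nm (fst t)" if "t \<in> G" for t
    using cont[of "fst t" "fst (snd t)" "snd (snd t)" j] that by simp
  have "\<exists>C'. \<forall>t\<in>G. nm (fst t) <= C' * S t"
  proof (rule ccontr)
    assume "~ ?thesis"
    \<comment> \<open>The summand \<open>2 * \<bar>C\<bar>\<close> lets the \<open>S\<close> part of
      the old estimate be absorbed on the left; the growing \<open>real n + 1\<close> forces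
      \<open>S\<close> to be small relative to the functional \<open>j\<close>.\<close>
    then have "\<exists>t\<in>G. nm (fst t) > (2 * \<bar>C\<bar> + real n + 1) * S t" for n using not_le by blast
    then obtain t where t: "!!n. t n \<in> G" "!!n. nm (fst (t n)) > (2 * \<bar>C\<bar> + real n + 1) * S (t n)" by metis
    define a where "a n = \<bar>snd (snd (t n)) j\<bar>" for n
    have CS: "2 * (\<bar>C\<bar> * S (t n)) < nm (fst (t n))" "(real n + 1) * S (t n) < nm (fst (t n))" for n
    proof -
      have 0: "0 <= \<bar>C\<bar> * S (t n)" "0 <= (real n + 1) * S (t n)" using S0[OF t(1)[of n]] by auto
      have "(2 * \<bar>C\<bar> + real n + 1) * S (t n) = 2 * (\<bar>C\<bar> * S (t n)) + (real n + 1) * S (t n)" by (simp add: algebra_simps)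
      then show "2 * (\<bar>C\<bar> * S (t n)) < nm (fst (t n))" "(real n + 1) * S (t n) < nm (fst (t n))" using t(2)[of n] 0 by linarith+
    qed
    have ua: "nm (fst (t n)) <= 2 * \<bar>C\<bar> * a n" for n
    proof -
      have "C * (S (t n) + a n) <= \<bar>C\<bar> * (S (t n) + a n)" using S0[OF t(1)[of n]] by (intro mult_right_mono) (auto simp: a_def)
      then show ?thesis using e[OF t(1)[of n]] CS(1)[of n] unfolding a_def[symmetric] distrib_left by linarith
    qed
    have a0: "a n > 0" for n
    proof (rule ccontr)
      assume "~ a n > 0"
      then have "a n = 0" by (simp add: a_def)
      then have "nm (fst (t n)) <= 0" using ua[of n] by simp
      then show False using CS(2)[of n] S0[OF t(1)[of n]] by (smt (verit) mult_nonneg_nonneg of_nat_0_le_iff)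
    qed
    \<comment> \<open>Normalized so that the functional \<open>j\<close> equals 1. On differences of
      members it then vanishes, and the old estimate becomes a Cauchy estimate.\<close>
    define y where "y n = (1 / snd (snd (t n)) j) *\<^sub>R t n" for n
    have xj: "snd (snd (t n)) j ~= 0" for n using a0[of n] by (auto simp: a_def)
    have y: "y n \<in> G" for n unfolding y_def using G(1) t(1) by (rule subspace_scale)
    have y1: "snd (snd (y n)) j = 1" for n using xj[of n] by (simp add: y_def)
    have Sy: "S (y n) <= 2 * \<bar>C\<bar> * inverse (real (Suc n))" for n
    proof -
      have "(real n + 1) * S (t n) <= 2 * \<bar>C\<bar> * a n" using CS(2)[of n] ua[of n] by linarith
      then have "(real n + 1) * (S (t n) / a n) <= 2 * \<bar>C\<bar>" using a0[of n] by (simp add: pos_divide_le_eq)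
      moreover have "S (y n) = S (t n) / a n" unfolding y_def Ssc[OF t(1)] by (simp add: a_def)
      ultimately show ?thesis by (simp add: field_simps)
    qed
    have lim0: "(\<lambda>n. 2 * \<bar>C\<bar> * inverse (real (Suc n))) ~~> 0"
      using tendsto_mult_left[OF LIMSEQ_inverse_real_of_nat, of "2 * \<bar>C\<bar>"] by simp
    have d: "nm (fst (y m) - fst (y n)) <= C * (S (y m) + S (y n))" for m n
    proof -
      have "y m - y n \<in> G" using G(1) y y by (rule subspace_diff)
      from e[OF this] have 1: "nm (fst (y m) - fst (y n)) <= C * S (y m - y n)" by (simp add: y1)
      have "0 <= C"
      proof -
        have "nm (fst (y m)) <= C * (S (y m) + 1)" using e[OF y[of m]] y1[of m] by simp
        then have "0 <= C * (S (y m) + 1)" by (rule order_trans[OF nm_nonneg[OF mem1(1)[OF y]]])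
        then show ?thesis using S0[OF y[of m]] by (simp add: zero_le_mult_iff)
      qed
      then show ?thesis using 1 mult_left_mono[OF Sdf[OF y[of m] y[of n]], of C] by linarith
    qed
    have "\<exists>N. \<forall>m\<ge>N. \<forall>n\<ge>N. nm (fst (y m) - fst (y n)) < r" if r: "r > 0" for r
    proof -
      have "(\<lambda>n. \<bar>C\<bar> * (2 * \<bar>C\<bar> * inverse (real (Suc n)))) ~~> \<bar>C\<bar> * 0" by (rule tendsto_mult_left[OF lim0])
      then have "\<forall>\<^sub>F n in sequentially. \<bar>C\<bar> * (2 * \<bar>C\<bar> * inverse (real (Suc n))) < r / 2" by (rule order_tendstoD) (use r in simp)
      then obtain N where N: "!!n. n >= N ==> \<bar>C\<bar> * (2 * \<bar>C\<bar> * inverse (real (Suc n))) < r / 2"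
        unfolding eventually_sequentially by blast
      have "\<bar>C\<bar> * S (y n) < r / 2" if "n >= N" for n
        using mult_left_mono[OF Sy[of n], of "\<bar>C\<bar>"] N[OF that] by simp
      moreover have "C * (S (y m) + S (y n)) <= \<bar>C\<bar> * S (y m) + \<bar>C\<bar> * S (y n)" for m n
        unfolding distrib_left[symmetric] using S0[OF y[of m]] S0[OF y[of n]] by (intro mult_right_mono) auto
      ultimately show ?thesis using d by (intro exI[of _ N]) (smt (verit) field_sum_of_halves)
    qed
    moreover have "\<forall>n. fst (y n) \<in> H" using mem1(1)[OF y] by blast
    ultimately obtain u where u: "u \<in> H" "(\<lambda>n. nm (fst (y n) - u)) ~~> 0"
      using comp[unfolded complete_in_def, rule_format, of "\<lambda>n. fst (y n)"] by blast
    have "(\<lambda>n. nm (fst (snd (y n)))) ~~> 0"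
    proof (rule tendsto_sandwich[OF _ _ tendsto_const lim0])
      show "\<forall>\<^sub>F n in sequentially. 0 <= nm (fst (snd (y n)))" using mem1(2)[OF y] by simp
      have "nm (fst (snd (y n))) <= S (y n)" for n by (simp add: S_def sum_nonneg)
      then show "\<forall>\<^sub>F n in sequentially. nm (fst (snd (y n))) <= 2 * \<bar>C\<bar> * inverse (real (Suc n))"
        using Sy order_trans by (intro always_eventually allI) blast
    qed
    \<comment> \<open>The limit lies in the kernel, so \<open>nm (fst (y n))\<close> tends to 0,
      against the bound of the functional \<open>j\<close>, which is constantly 1 along the
      sequence.\<close>
    then have "nm u = 0" using cl[of y, OF _ u] y by blast
    then have "(\<lambda>n. nm (fst (y n))) ~~> 0" using lim_nm[of "\<lambda>n. fst (y n)", OF mem1(1)[OF y] u] by simp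
    then have "(\<lambda>n. B * nm (fst (y n))) ~~> B * 0" by (rule tendsto_mult_left)
    then have "\<forall>\<^sub>F n in sequentially. B * nm (fst (y n)) < 1" by (rule order_tendstoD) simp
    then obtain n where "B * nm (fst (y n)) < 1" unfolding eventually_sequentially by blast
    then show False using ct[OF y[of n]] y1[of n] by simp
  qed
  then obtain C' where "!!t. t \<in> G ==> nm (fst t) <= C' * S t" by blast
  then have "nm u <= C' * (nm v + (\<Sum>j\<in>J. \<bar>x j\<bar>))" if "(u, v, x) \<in> G" for u v x using that by (force simp: S_def)
  then show ?case by (rule insert.IH)
qed

end

text \<open>Gaussian elimination, one functional at a time: if some value at \<open>j\<close> is
  nonzero, its index \<open>p\<close> is the pivot and is eliminated from the other vectors, which
  still outnumber the remaining functionals.\<close>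

lemma dependent_functionals:
  fixes X :: "'k => 'j => real"
  assumes "finite J" "finite K" "card J < card K"
  shows "\<exists>c. (\<exists>k\<in>K. c k ~= 0) & (\<forall>j\<in>J. (\<Sum>k\<in>K. c k * X k j) = 0)"
  using assms
proof (induction J arbitrary: K X rule: finite_induct)
  case empty
  then have "K ~= {}" by auto
  then show ?case by (intro exI[of _ "\<lambda>_. 1"]) auto
next
  case (insert j J)
  show ?case
  proof (cases "\<forall>k\<in>K. X k j = 0")
    case True
    have "card J < card K" using insert.prems insert.hyps by simp
    from insert.IH[OF insert.prems(1) this, of X]
    obtain c where c: "\<exists>k\<in>K. c k ~= 0" "\<forall>j\<in>J. (\<Sum>k\<in>K. c k * X k j) = 0" by blast
    then show ?thesis using True by (intro exI[of _ c]) simp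
  next
    case False
    then obtain p where p: "p \<in> K" "X p j ~= 0" by blast
    define K' where "K' = K - {p}"
    have K': "finite K'" "card J < card K'" "K = insert p K'" "p \<notin> K'"
      using insert.prems insert.hyps p(1) by (auto simp: K'_def)
    from insert.IH[OF K'(1,2), of "\<lambda>k i. X k i - X k j / X p j * X p i"]
    obtain c where c: "\<exists>k\<in>K'. c k ~= 0" "!!i. i \<in> J ==> (\<Sum>k\<in>K'. c k * (X k i - X k j / X p j * X p i)) = 0" by blast
    define s where "s = (\<Sum>k\<in>K'. c k * X k j) / X p j"
    define c' where "c' = c(p := - s)"
    have sum: "(\<Sum>k\<in>K. c' k * X k i) = (\<Sum>k\<in>K'. c k * X k i) - s * X p i" for i
    proof -
      have "(\<Sum>k\<in>K'. c' k * X k i) = (\<Sum>k\<in>K'. c k * X k i)"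
        by (rule sum.cong) (use K'(4) in \<open>auto simp: c'_def\<close>)
      then show ?thesis unfolding K'(3) using K'(1,4) by (simp add: c'_def)
    qed
    have "(\<Sum>k\<in>K. c' k * X k j) = 0" unfolding sum s_def using p(2) by simp
    moreover have "(\<Sum>k\<in>K. c' k * X k i) = 0" if "i \<in> J" for i
    proof -
      have "(\<Sum>k\<in>K'. c k * (X k i - X k j / X p j * X p i)) = (\<Sum>k\<in>K'. c k * X k i) - s * X p i"
        by (simp add: s_def right_diff_distrib sum_subtractf sum_distrib_right sum_divide_distrib mult.assoc)
      then show ?thesis unfolding sum using c(2)[OF that] by simp
    qed
    moreover have "\<exists>k\<in>K. c' k ~= 0" using c(1) K'(3,4) by (auto simp: c'_def)
    ultimately show ?thesis by blast
  qed
qed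

section \<open>Complex scalars, weights and null fields\<close>

context qp
begin

definition cs :: "complex => field => field" where "cs z f = (\<lambda>p. z *s f p)"

lemma cs_simps: "cs z (f + g) = cs z f + cs z g" "cs z (f - g) = cs z f - cs z g" "cs z (cs w f) = cs (z * w) f"
  "cs (of_real r) f = r *\<^sub>R f" "cs (z + w) f = cs z f + cs w f" "cs (z - w) f = cs z f - cs w f" "cs z 0 = 0" "cs 1 f = f" "cs 0 f = 0"
  by (auto simp: cs_def fun_eq_iff vec_eq_iff algebra_simps scaleR_conv_of_real[where 'a=complex])

lemma cs_scaleR: "cs z (r *\<^sub>R f) = r *\<^sub>R cs z f"
  by (simp add: cs_def fun_eq_iff vsmult_scaleR)

lemma cs_L2 [simp, intro]: "f \<in> L2 ==> cs z f \<in> L2"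
  unfolding cs_def by (rule L2_smult)

lemma ip_cs: "ip w (cs z f) g = ip w f (cs (cnj z) g)"
  by (simp add: ip_def cs_def inner_vsmult_left)

lemma ip_cs_cs: "ip w (cs z f) (cs z f) = (norm z)\<^sup>2 * ip w f f"
proof -
  have n: "(z *s f p) \<bullet> (z *s f p) = (norm z)\<^sup>2 * (f p \<bullet> f p)" for p
    using norm_vsmult[of z "f p"] by (metis power2_norm_eq_inner power_mult_distrib)
  have "ip w (cs z f) (cs z f) = (LI p. (norm z)\<^sup>2 * (indicator Y p * w p * (f p \<bullet> f p)))"
    unfolding ip_def cs_def n by (rule int_cong) auto
  then show ?thesis by (simp add: ip_def)
qed

text \<open>The product is a real part, so a field is orthogonal to its multiple by i. This
  expresses that (f, f) is real in the Hermitian sense.\<close>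

lemma ip_i_self: "ip w f (cs \<i> f) = 0"
proof -
  have "f p \<bullet> (\<i> *s f p) = 0" for p by (simp add: inner3)
  then show ?thesis by (simp add: ip_def cs_def)
qed

lemma ip_cs_i: "ip w (cs z f) (cs \<i> f) = Im z * ip w f f"
proof -
  have "(z *s f p) \<bullet> (\<i> *s f p) = Im z * (f p \<bullet> f p)" for p by (simp add: inner3 algebra_simps)
  then have "ip w (cs z f) (cs \<i> f) = (LI p. Im z * (indicator Y p * w p * (f p \<bullet> f p)))"
    unfolding ip_def cs_def by (intro int_cong) auto
  then show ?thesis by (simp add: ip_def)
qed

definition wm :: "(pt => real) => field => field" where "wm w f = (\<lambda>p. w p *\<^sub>R f p)"

lemma wm_simps: "wm w (f + g) = wm w f + wm w g" "wm w (cs z f) = cs z (wm w f)" "ip1 (wm w f) g = ip w f g"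
  "wm w 0 = 0"
  by (auto simp: wm_def cs_def fun_eq_iff scaleR_add_right vsmult_scaleR ip_weight)

lemma wm_L2: "f \<in> L2 ==> wt w ==> wm w f \<in> L2"
  unfolding wm_def by (rule L2_wt)

lemma Hs_wm:
  assumes f: "f \<in> L2" and w: "wt w"
  shows "wm w f \<in> Hs1 \<longleftrightarrow> f \<in> Hs w"
  unfolding Hs_def using div_ip[OF f w] div_ip[OF wm_L2[OF f w] wt_const] f wm_L2[OF f w] by (simp add: wm_simps)

lemma Hs_cs: "f \<in> Hs w ==> wt w ==> cs z f \<in> Hs w"
proof -
  assume f: "f \<in> Hs w" and w: "wt w"
  have "(LI p. complex_of_real (w p) * (\<Sum>i\<in>UNIV. cs z f p $ i * complex_of_real (pd i \<phi> p))) = 0"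
    if t: "test_fun \<phi>" for \<phi>
  proof -
    have "(LI p. complex_of_real (w p) * (\<Sum>i\<in>UNIV. cs z f p $ i * complex_of_real (pd i \<phi> p)))
      = (LI p. z * (complex_of_real (w p) * (\<Sum>i\<in>UNIV. f p $ i * complex_of_real (pd i \<phi> p))))"
      by (rule int_cong) (simp_all add: cs_def sum_distrib_left mult_ac)
    then show ?thesis using f t by (simp add: Hs_def div_free_def)
  qed
  then show ?thesis using f cs_L2[of f z] unfolding Hs_def div_free_def by blast
qed

lemma curl_cs: "f \<in> L2 ==> g \<in> L2 ==> is_curl f g ==> is_curl (cs z f) (cs z g)"
  unfolding cs_def by (rule curl_vsmult)

lemma curl_zero: "is_curl 0 0"
  using curl_ip[OF L.mem(4) L.mem(4)] by (simp add: per_L2 cmp_test cmp_crs_gr)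

text \<open>Membership in \<open>Hs w\<close> is an orthogonality condition, and such conditions do
  not see null changes.\<close>

lemma Hs_null:
  assumes w: "gw w" and f: "f \<in> Hs w" and g: "g \<in> L2" "ip w (f - g) (f - g) = 0"
  shows "g \<in> Hs w"
proof -
  interpret W: semi_ip L2 "ip w" by (rule gw_semi[OF w])
  have fL: "f \<in> L2" using f by (rule Hs_L2)
  have "ip w g s = 0" if "ip w f s = 0" "s \<in> L2" for s
    using W.zero_nm_imp[of "f - g" s] g fL that by (simp add: W.bilin)
  then show ?thesis using f g(1) unfolding Hs_orth[OF w] by (auto intro!: per_L2 cmp_vsmult cmp_gr)
qed

text \<open>The weak form of div curl = 0. The part of \<open>u\<close> orthogonal to
  \<open>Hs1\<close> is curl-free; by symmetry of the curl its pairing with u = curl g is 0, so that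
  part is null.\<close>

lemma curl_in_Hs:
  assumes g: "g \<in> L2" and c: "is_curl g u" and u: "u \<in> L2"
  shows "u \<in> Hs1"
proof -
  obtain y where y: "y \<in> Hs1" "\<forall>s\<in>Hs1. ip1 (u - y) s = 0" using Hs_projection[OF gw_1 u] by blast
  have yL: "y \<in> L2" using y(1) by (rule Hs_L2)
  have "is_curl (u - y) 0" by (rule orth_curl_free) (use y u yL in auto)
  then have "ip1 u (u - y) = ip1 g 0" using u yL g c by (intro curl_symmetric) auto
  then have "ip1 u (u - y) = 0" using g by simp
  moreover have "ip1 (u - y) y = 0" using y by blast
  ultimately have "ip1 (y - u) (y - u) = 0" using u yL by (simp add: L.bilin L.sym[of u y])
  then show ?thesis by (rule Hs_null[OF gw_1 y(1) u])
qed

text \<open>The exceptional set is covered by countably many translates of a null set in the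
  cell.\<close>

lemma AE_cell:
  assumes "AE p in lebesgue. p \<in> Y --> f p = (0::complex^3)" and f: "!!p k. f (p + gm k) = ph k *s f p"
  shows "AE p in lebesgue. f p = 0"
proof -
  define N where "N = {p \<in> Y. f p ~= 0}"
  obtain Z where Z: "{p \<in> space lebesgue. ~ (p \<in> Y --> f p = 0)} \<subseteq> Z" "Z \<in> null_sets lebesgue"
    using assms(1) unfolding eventually_ae_filter by blast
  have "negligible Z" using Z(2) by (simp add: negligible_iff_null_sets)
  then have n: "negligible N" by (rule negligible_subset) (use Z(1) in \<open>auto simp: N_def\<close>)
  have "negligible (\<Union>k. (\<lambda>p. gm k + p) ` N)"
    by (intro negligible_countable_Union countable_image) (auto intro: negligible_translation n)
  moreover have "{p. f p ~= 0} \<subseteq> (\<Union>k. (\<lambda>p. gm k + p) ` N)"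
  proof
    fix p assume p: "p \<in> {p. f p ~= 0}"
    define k where "k = (\<lfloor>w1 \<bullet> fst p\<rfloor>, \<lfloor>w2 \<bullet> fst p\<rfloor>)"
    have "p - gm k \<in> Y" by (simp only: Y_shift_iff k_def)
    moreover have "f (p - gm k) ~= 0" using f[of "p - gm k" k] p by auto
    ultimately show "p \<in> (\<Union>k. (\<lambda>p. gm k + p) ` N)" by (intro UN_I[of k] UNIV_I image_eqI[of _ _ "p - gm k"]) (auto simp: N_def)
  qed
  ultimately have "negligible {p. f p ~= 0}" by (rule negligible_subset)
  then show ?thesis by (intro AE_I'[of "{p. f p ~= 0}"]) (auto simp: negligible_iff_null_sets)
qed

lemma aeq_iff:
  assumes f: "f \<in> L2" and g: "g \<in> L2"
  shows "aeq f g \<longleftrightarrow> ip1 (f - g) (f - g) = 0"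
proof
  assume "aeq f g"
  then have "AE p in lebesgue. indicator Y p * 1 * ((f - g) p \<bullet> (f - g) p) = 0" unfolding aeq_def by (rule eventually_mono) simp
  then show "ip1 (f - g) (f - g) = 0" unfolding ip_def by (rule integral_eq_zero_AE)
next
  assume z: "ip1 (f - g) (f - g) = 0"
  have d: "f - g \<in> L2" using f g by simp
  have "AE p in lebesgue. indicator Y p * 1 * ((f - g) p \<bullet> (f - g) p) = 0"
    using integral_nonneg_eq_0_iff_AE[OF ip_integrable[OF d d wt_const], of 1] z unfolding ip_def by simp
  then have "AE p in lebesgue. p \<in> Y --> (f - g) p = 0" by (rule eventually_mono) (auto simp: indicator_def)
  from AE_cell[OF this L2D(2)[OF d]] show "aeq f g" unfolding aeq_def by (rule eventually_mono) simp
qed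

end

section \<open>The Maxwell operator\<close>

locale mx = bz +
  fixes \<tau> h :: real and D :: "pt set"
  assumes tau: "\<tau> > 0" and D: "open D" "D ~= {}" "D \<subseteq> Yh a1 a2 h"
begin

definition "ee = eps a1 a2 \<tau> D"

abbreviation "Spec \<equiv> spec a1 a2 \<alpha> \<tau> D"
abbreviation "Resolv \<equiv> resolvent_set a1 a2 \<alpha> \<tau> D"
abbreviation "Eigen \<equiv> is_eigenvalue a1 a2 \<alpha> \<tau> D"
abbreviation "Disc \<equiv> disc_spec a1 a2 \<alpha> \<tau> D"
abbreviation "Ess \<equiv> ess_spec a1 a2 \<alpha> \<tau> D"
abbreviation "mu \<equiv> mu1 a1 a2 \<alpha> \<tau> D"
abbreviation "Mop \<equiv> MM a1 a2 \<alpha> \<tau> D"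
abbreviation "dom_M \<equiv> domM a1 a2 \<alpha> \<tau> D"

lemma ee_eq: "ee p = 1 + \<tau> * (if \<exists>l. p - gm l \<in> D then 1 else 0)"
proof -
  have "(fst (gm l), 0) = gm l" for l by (simp add: gm_def)
  then have "(\<exists>\<gamma>\<in>lat a1 a2. p - (\<gamma>, 0) \<in> D) \<longleftrightarrow> (\<exists>l. p - gm l \<in> D)" unfolding lat_eq by (simp add: bex_simps)
  then show ?thesis by (simp add: ee_def eps_def)
qed

lemma ee_bounds: "1 <= ee p" "ee p <= 1 + \<tau>" "p \<in> D ==> ee p = 1 + \<tau>" "\<bar>snd p\<bar> > h ==> ee p = 1"
proof -
  show "1 <= ee p" "ee p <= 1 + \<tau>" using tau by (auto simp: ee_eq)
  show "ee p = 1 + \<tau>" if "p \<in> D"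
  proof -
    have "gm 0 = 0" by (simp add: gm_def zero_prod_def)
    then have "p - gm 0 \<in> D" using that by simp
    then have "\<exists>l. p - gm l \<in> D" by (rule exI)
    then show ?thesis by (simp only: ee_eq if_True mult_1_right)
  qed
  show "ee p = 1" if "\<bar>snd p\<bar> > h"
  proof -
    have "\<bar>snd p\<bar> <= h" if l: "p - gm l \<in> D" for l
    proof -
      have "p - gm l \<in> cell a1 a2 \<times> {-h..h}" using l D(3) unfolding Yh_def by blast
      then have "snd p \<in> {-h..h}" unfolding mem_Times_iff by simp
      then show ?thesis by (simp add: abs_le_iff)
    qed
    then have "~ (\<exists>l. p - gm l \<in> D)" using that by (meson not_le)
    then show ?thesis by (simp only: ee_eq if_False mult_zero_right add_0_right)
  qed
qed

lemma ee_gw: "gw ee"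
proof -
  \<comment> \<open>Since \<open>D\<close> is open, so is the union of its translates, which settles
    the measurability of \<open>ee\<close>.\<close>
  define DD where "DD = (\<Union>l. (\<lambda>p. p - gm l) -` D)"
  have "open DD" unfolding DD_def by (intro open_UN ballI open_vimage D continuous_intros)
  then have "DD \<in> sets lebesgue" using borel_open by simp
  then have m: "(indicator DD :: pt => real) \<in> Lmeas" by (rule borel_measurable_indicator)
  have "ee = (\<lambda>p. 1 + \<tau> * indicator DD p)" by (auto simp: fun_eq_iff ee_eq DD_def indicator_def)
  then have em: "ee \<in> Lmeas" using m by simp
  have "(\<exists>l. p + gm k - gm l \<in> D) \<longleftrightarrow> (\<exists>l. p - gm l \<in> D)" for p k
  proof
    assume "\<exists>l. p + gm k - gm l \<in> D"
    then obtain l where "p - gm (l - k) \<in> D" by (auto simp: gm_diff algebra_simps)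
    then show "\<exists>l. p - gm l \<in> D" by blast
  next
    assume "\<exists>l. p - gm l \<in> D"
    then obtain l where "p + gm k - gm (l + k) \<in> D" by (auto simp: gm_add algebra_simps)
    then show "\<exists>l. p + gm k - gm l \<in> D" by blast
  qed
  then have "ee (p + gm k) = ee p" for p k by (simp add: ee_eq)
  moreover have "\<bar>ee p\<bar> <= 1 + \<tau>" for p using ee_bounds(1,2)[of p] by simp
  ultimately show ?thesis unfolding gw_def wt_def using em ee_bounds(1) zero_less_one by blast
qed

lemma ee_wt: "wt ee" by (rule gwD(1)[OF ee_gw])

sublocale W: semi_ip L2 "ip ee"
  by (rule gw_semi[OF ee_gw])

lemma L_le_W: "f \<in> L2 ==> ip1 f f <= ip ee f f" "f \<in> L2 ==> L.nm f <= W.nm f"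
  using ip_mono[OF _ wt_const ee_wt ee_bounds(1)] by (simp_all add: L.nm_def W.nm_def)

lemma W_le_L: "f \<in> L2 ==> ip ee f f <= (1 + \<tau>) * ip1 f f"
  using ip_mono[OF _ ee_wt wt_const ee_bounds(2)] by (simp add: ip_const_weight[of "1 + \<tau>"])

lemma W_nm_iff: "f \<in> L2 ==> W.nm f = 0 \<longleftrightarrow> ip1 f f = 0"
  using L_le_W(1)[of f] W_le_L[of f] L.nonneg[of f] by (auto simp: W.nm_def)

lemma aeq_W: "f \<in> L2 ==> g \<in> L2 ==> aeq f g \<longleftrightarrow> W.nm (f - g) = 0"
  by (simp add: aeq_iff W_nm_iff)

lemma W_nm_cs: "f \<in> L2 ==> W.nm (cs z f) = norm z * W.nm f"
  by (simp add: W.nm_def ip_cs_cs real_sqrt_mult)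

lemma Hnorm_eq: "Hnorm a1 a2 \<tau> D f = W.nm f"
  unfolding Hnorm_def W.nm_def ip_def unfolding ee_def Y_def power2_norm_eq_inner ..

lemma Hs_ee: "subspace (Hs ee)" "W.complete_in (Hs ee)"
  using Hs_complete[OF ee_gw] .

lemma inH_iff: "inH a1 a2 \<alpha> \<tau> D f \<longleftrightarrow> f \<in> Hs ee"
  by (simp add: inH_def Hs_def L2_def ee_def)

text \<open>The graph of the operator with the intermediate curl \<open>g\<close> kept as a witness
  and the factor \<epsilon> moved to the other side. In this form both conditions are statements
  about the weak curl, and the quadratic form is the product of the witnesses.\<close>

definition MO :: "field => field => field => bool" where
  "MO E g F \<longleftrightarrow> E \<in> Hs ee & g \<in> L2 & F \<in> L2 & is_curl E g & is_curl g (wm ee F)"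

lemma MOD: assumes "MO E g F" shows "E \<in> Hs ee" "E \<in> L2" "g \<in> L2" "F \<in> L2" "is_curl E g" "is_curl g (wm ee F)"
  using assms Hs_L2 by (auto simp: MO_def)

lemma ee_pos [simp]: "ee p ~= 0" "ee p > 0"
  using ee_bounds(1)[of p] by auto

lemma inv_ee_wt: "wt (\<lambda>p. 1 / ee p)"
  unfolding wt_def
proof (intro conjI allI exI[of _ 1])
  show "(\<lambda>p. 1 / ee p) \<in> Lmeas"
    by (intro borel_measurable_divide borel_measurable_const wtD(1)[OF ee_wt])
  show "1 / ee (p + gm k) = 1 / ee p" for p k using wtD(2)[OF ee_wt, of p k] by simp
  show "\<bar>1 / ee p\<bar> <= 1" for p using ee_bounds(1)[of p] by simp
qed

lemma MM_iff: "Mop E F \<longleftrightarrow> (\<exists>g. MO E g F)"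
proof
  assume "Mop E F"
  then obtain g u where gu: "g \<in> L2" "is_curl E g" "u \<in> L2" "is_curl g u" "!!p. F p = complex_of_real (1 / ee p) *s u p"
    and E: "E \<in> Hs ee" unfolding MM_def domM_def Hs_def L2_def ee_def by blast
  have Fu: "F = (\<lambda>p. (1 / ee p) *\<^sub>R u p)" using gu(5) by (auto simp: fun_eq_iff vec_eq_iff scaleR_conv_of_real[where 'a=complex])
  then have "wm ee F = u" by (auto simp: wm_def fun_eq_iff)
  moreover have "F \<in> L2" unfolding Fu by (rule L2_wt[OF gu(3) inv_ee_wt])
  ultimately show "\<exists>g. MO E g F" using gu E unfolding MO_def by blast
next
  assume "\<exists>g. MO E g F"
  then obtain g where g: "MO E g F" by blast
  have "F p = complex_of_real (1 / ee p) *s wm ee F p" for p by (simp add: wm_def vec_eq_iff scaleR_conv_of_real[where 'a=complex])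
  moreover have "wm ee F \<in> L2" by (rule wm_L2[OF MOD(4)[OF g] ee_wt])
  ultimately show "Mop E F" using MOD[OF g] unfolding MM_def domM_def Hs_def L2_def ee_def by blast
qed

lemma MO_zero: "MO 0 0 0"
  using curl_zero subspace_0[OF Hs_ee(1)] by (simp add: MO_def wm_simps)

lemma MO_add: "MO E g F ==> MO E' g' F' ==> MO (E + E') (g + g') (F + F')"
  using subspace_add[OF Hs_ee(1)] wm_L2[OF _ ee_wt] unfolding MO_def wm_simps
  by (auto intro!: curl_add simp: Hs_L2)

lemma MO_cs: assumes M: "MO E g F" shows "MO (cs z E) (cs z g) (cs z F)"
  unfolding MO_def wm_simps
  by (intro conjI Hs_cs[OF MOD(1)[OF M] ee_wt] cs_L2 curl_cs wm_L2 ee_wt MOD(2-6)[OF M])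

lemma MO_scaleR: "MO E g F ==> MO (r *\<^sub>R E) (r *\<^sub>R g) (r *\<^sub>R F)"
  using MO_cs[of E g F "of_real r"] by (simp only: cs_simps)

lemma MO_diff: "MO E g F ==> MO E' g' F' ==> MO (E - E') (g - g') (F - F')"
  using MO_add[of E g F, OF _ MO_scaleR[of E' g' F' "-1"]] by simp

lemma MO_Hs: "MO E g F ==> F \<in> Hs ee"
  using curl_in_Hs[of g "wm ee F"] Hs_wm[OF _ ee_wt, of F] MOD[of E g F] wm_L2[OF _ ee_wt, of F] by blast

lemma MO_weak:
  assumes M: "MO E g F" and E': "E' \<in> L2" "g' \<in> L2" "is_curl E' g'"
  shows "ip ee F E' = ip1 g g'"
  using curl_symmetric[OF MOD(3)[OF M] wm_L2[OF MOD(4)[OF M] ee_wt] E'(1,2) MOD(6)[OF M] E'(3)] by (simp add: wm_simps)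

lemma MO_sym:
  assumes "MO E g F" "MO E' g' F'"
  shows "ip ee F E' = ip ee E F'"
proof -
  have "ip ee F E' = ip1 g g'" by (rule MO_weak[OF assms(1)]) (use MOD[OF assms(2)] in auto)
  moreover have "ip ee F' E = ip1 g' g" by (rule MO_weak[OF assms(2)]) (use MOD[OF assms(1)] in auto)
  ultimately show ?thesis using MOD[OF assms(1)] MOD[OF assms(2)] L.sym[of g g'] W.sym[of F' E] by simp
qed

text \<open>Convergence of the witnesses is not assumed but derived: their squared differences are
  the form values of the differences, bounded by the product of the gaps of \<open>X\<close> and of
  \<open>P\<close>.\<close>

lemma MO_closed:
  assumes M: "!!n. MO (X n) (Z n) (P n)" and E: "E \<in> L2" "F \<in> L2"
    and lim: "(\<lambda>n. W.nm (X n - E)) ~~> 0" "(\<lambda>n. W.nm (P n - F)) ~~> 0"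
  shows "\<exists>g. MO E g F"
proof -
  note m = MOD[OF M]
  have LW: "(\<lambda>n. L.nm (a n)) ~~> 0" if "(\<lambda>n. W.nm (a n)) ~~> 0" "!!n. a n \<in> L2" for a :: "nat => field"
    by (rule Lim_null_comparison[OF _ that(1)]) (use L_le_W(2) that(2) in simp)
  have d: "(L.nm (Z i - Z j))\<^sup>2 <= W.nm (P i - P j) * W.nm (X i - X j)" for i j
  proof -
    have "ip ee (P i - P j) (X i - X j) = ip1 (Z i - Z j) (Z i - Z j)"
      by (rule MO_weak[OF MO_diff[OF M M] MOD(2,3,5)[OF MO_diff[OF M M]]])
    then show ?thesis using W.CS_abs[of "P i - P j" "X i - X j"] m by (simp add: L.nm_sq)
  qed
  have "\<exists>N. \<forall>i\<ge>N. \<forall>j\<ge>N. L.nm (Z i - Z j) < e" if e: "e > 0" for e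
  proof -
    obtain N1 where N1: "!!i j. i >= N1 ==> j >= N1 ==> W.nm (X i - X j) < e"
      using W.lim_imp_Cauchy[OF m(2) E(1) lim(1) e] by blast
    obtain N2 where N2: "!!i j. i >= N2 ==> j >= N2 ==> W.nm (P i - P j) < e"
      using W.lim_imp_Cauchy[OF m(4) E(2) lim(2) e] by blast
    have "L.nm (Z i - Z j) < e" if "i >= max N1 N2" "j >= max N1 N2" for i j
    proof -
      have "W.nm (P i - P j) * W.nm (X i - X j) < e * e"
        using N1[of i j] N2[of i j] that m by (intro mult_strict_mono') auto
      then have "(L.nm (Z i - Z j))\<^sup>2 < e\<^sup>2" using d[of i j] by (simp add: power2_eq_square)
      then show ?thesis by (rule power_less_imp_less_base) (use e in simp)
    qed
    then show ?thesis by blast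
  qed
  then obtain g where g: "g \<in> L2" "(\<lambda>n. L.nm (Z n - g)) ~~> 0"
    using L2_complete m(3) unfolding L.complete_in_def by blast
  have c1: "is_curl E g" by (rule curl_closed[OF m(2,3,5) E(1) g(1) LW[OF lim(1)] g(2)]) (use m E in auto)
  have wl: "L.nm (wm ee (P n) - wm ee F) <= (1 + \<tau>) * L.nm (P n - F)" for n
  proof (rule nm_weight_le[OF _ ee_wt])
    show "P n - F \<in> L2" using m E by simp
    show "\<bar>ee p\<bar> <= 1 + \<tau>" for p using ee_bounds(1,2)[of p] by simp
    show "norm ((wm ee (P n) - wm ee F) p) <= norm (ee p *\<^sub>R (P n - F) p)" for p by (simp add: wm_def scaleR_diff_right)
    show "wm ee (P n) - wm ee F \<in> L2" using m E by (simp add: wm_L2[OF _ ee_wt])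
  qed
  have "(\<lambda>n. (1 + \<tau>) * L.nm (P n - F)) ~~> 0"
    using tendsto_mult_right_zero[OF LW[OF lim(2)], of "1 + \<tau>"] m E by simp
  then have "(\<lambda>n. L.nm (wm ee (P n) - wm ee F)) ~~> 0"
    by (rule Lim_null_comparison[rotated]) (use wl m E in \<open>auto simp: wm_L2[OF _ ee_wt]\<close>)
  then have c2: "is_curl g (wm ee F)"
    by (rule curl_closed[OF m(3) wm_L2[OF m(4) ee_wt] m(6) g(1) wm_L2[OF E(2) ee_wt] g(2)])
  have "ip ee E s = 0" if s: "s \<in> L2" "!!n. ip ee (X n) s = 0" for s
    using W.lim_ip[OF m(2) E(1) s(1) lim(1)] s(2) by (simp add: LIMSEQ_const_iff)
  moreover have "ip ee (X n) (per (\<lambda>p. c *s gr \<phi> p)) = 0" if "test_fun \<phi>" for n c \<phi>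
    using m(1)[of n] that unfolding Hs_orth[OF ee_gw] by blast
  ultimately have "ip ee E (per (\<lambda>p. c *s gr \<phi> p)) = 0" if "test_fun \<phi>" for c \<phi>
    using that per_L2[OF cmp_vsmult[OF cmp_gr[OF that]]] by blast
  then have "E \<in> Hs ee" using E(1) unfolding Hs_orth[OF ee_gw] by blast
  then show ?thesis using g c1 c2 E unfolding MO_def by blast
qed

end

section \<open>Solvability and resolvent bounds\<close>

context mx
begin

text \<open>Division by \<open>ee\<close> sends \<open>Hs1\<close> into \<open>Hs ee\<close>, and
  the weight cancels in the pairing; this reduces the claim to the unweighted case.\<close>

lemma orth_ee_curl_free:
  assumes v: "v \<in> L2" and o: "!!s. s \<in> Hs ee ==> ip ee v s = 0"
  shows "is_curl v 0"
proof (rule orth_curl_free[OF v])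
  fix s assume s: "s \<in> Hs1"
  define s' where "s' = wm (\<lambda>p. 1 / ee p) s"
  have s'L: "s' \<in> L2" unfolding s'_def by (rule wm_L2[OF Hs_L2[OF s] inv_ee_wt])
  have ws: "wm ee s' = s" by (simp add: wm_def s'_def)
  then have "s' \<in> Hs ee" using Hs_wm[OF s'L ee_wt] s by simp
  then have "ip ee s' v = 0" using o[of s'] W.sym[OF s'L v] by simp
  then have "ip1 s v = 0" using wm_simps(3)[of ee s' v] unfolding ws by simp
  then show "ip1 v s = 0" using L.sym[OF Hs_L2[OF s] v] by simp
qed

text \<open>The Lax--Milgram step: the weak solution is the projection of \<open>(f, 0)\<close> onto the graph of the curl.\<close>

lemma surj1:
  assumes f: "f \<in> Hs ee"
  shows "\<exists>E g. MO E g (f - E)"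
proof -
  have fL: "f \<in> L2" using f by (rule Hs_L2)
  define ipp :: "field \<times> field => field \<times> field => real" where
    "ipp x y = ip ee (fst x) (fst y) + ip1 (snd x) (snd y)" for x y
  interpret PP: semi_ip "L2 \<times> L2" ipp
  proof
    show "subspace (L2 \<times> L2)" by (rule subspace_Times[OF L2_sub L2_sub])
    show "ipp x y = ipp y x" if "x \<in> L2 \<times> L2" "y \<in> L2 \<times> L2" for x y
      using that W.sym[of "fst x" "fst y"] L.sym[of "snd x" "snd y"] by (auto simp: ipp_def)
    show "ipp (x + y) z = ipp x z + ipp y z" if "x \<in> L2 \<times> L2" "y \<in> L2 \<times> L2" "z \<in> L2 \<times> L2" for x y z
      using that by (auto simp: ipp_def W.bilin L.bilin)
    show "ipp (c *\<^sub>R x) y = c * ipp x y" if "x \<in> L2 \<times> L2" "y \<in> L2 \<times> L2" for c x y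
      using that by (auto simp: ipp_def W.bilin L.bilin distrib_left)
    show "0 <= ipp x x" if "x \<in> L2 \<times> L2" for x
      using that by (auto simp: ipp_def W.nonneg L.nonneg)
  qed
  define S where "S = {x. fst x \<in> Hs ee & snd x \<in> L2 & is_curl (fst x) (snd x)}"
  have SL: "fst x \<in> L2" "snd x \<in> L2" if "x \<in> S" for x using that Hs_L2 by (auto simp: S_def)
  have S_sub: "subspace S"
  proof (rule subspaceI)
    show "0 \<in> S" using curl_zero subspace_0[OF Hs_ee(1)] by (simp add: S_def)
    show "x + y \<in> S" if "x \<in> S" "y \<in> S" for x y
      using that curl_add[OF SL[OF that(1)] SL[OF that(2)]] subspace_add[OF Hs_ee(1)] by (simp add: S_def)
    show "c *\<^sub>R x \<in> S" if "x \<in> S" for c x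
      using that curl_cs[OF SL[OF that], of "of_real c"] subspace_scale[OF Hs_ee(1)] by (simp add: S_def cs_simps)
  qed
  have S_le: "S \<subseteq> L2 \<times> L2" using SL by (auto simp: mem_Times_iff)
  have nmW: "W.nm (fst x) <= PP.nm x" "L.nm (snd x) <= PP.nm x" "PP.nm x <= W.nm (fst x) + L.nm (snd x)" if "x \<in> L2 \<times> L2" for x
  proof -
    have m: "fst x \<in> L2" "snd x \<in> L2" using that by (auto simp: mem_Times_iff)
    have "0 <= ip ee (fst x) (fst x)" "0 <= ip1 (snd x) (snd x)" using m by (simp_all add: W.nonneg L.nonneg)
    then show "W.nm (fst x) <= PP.nm x" "L.nm (snd x) <= PP.nm x" "PP.nm x <= W.nm (fst x) + L.nm (snd x)"
      unfolding W.nm_def L.nm_def PP.nm_def ipp_def using sqrt_add_le_add_sqrt by simp_all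
  qed
  have S_comp: "PP.complete_in S"
    unfolding PP.complete_in_def
  proof (intro allI impI, elim conjE)
    fix X :: "nat => field \<times> field"
    assume X: "\<forall>n. X n \<in> S" and C: "\<forall>e>0. \<exists>N. \<forall>m\<ge>N. \<forall>n\<ge>N. PP.nm (X m - X n) < e"
    have XS: "X n \<in> S" for n using X by blast
    have dm: "X m - X n \<in> L2 \<times> L2" for m n using subspace_diff[OF S_sub XS XS] S_le by blast
    have "\<exists>N. \<forall>m\<ge>N. \<forall>n\<ge>N. W.nm (fst (X m) - fst (X n)) < e" if "e > 0" for e
      using C[rule_format, OF that] nmW(1)[OF dm] by (simp add: fst_diff) (meson le_less_trans)
    moreover have "\<forall>n. fst (X n) \<in> Hs ee" using X by (auto simp: S_def)
    ultimately obtain E where E: "E \<in> Hs ee" "(\<lambda>n. W.nm (fst (X n) - E)) ~~> 0"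
      using Hs_ee(2)[unfolded W.complete_in_def, rule_format, of "\<lambda>n. fst (X n)"] by blast
    have "\<exists>N. \<forall>m\<ge>N. \<forall>n\<ge>N. L.nm (snd (X m) - snd (X n)) < e" if "e > 0" for e
      using C[rule_format, OF that] nmW(2)[OF dm] by (simp add: snd_diff) (meson le_less_trans)
    moreover have "\<forall>n. snd (X n) \<in> L2" using X by (auto simp: S_def)
    ultimately obtain g where g: "g \<in> L2" "(\<lambda>n. L.nm (snd (X n) - g)) ~~> 0"
      using L2_complete[unfolded L.complete_in_def, rule_format, of "\<lambda>n. snd (X n)"] by blast
    have EL: "E \<in> L2" using E(1) by (rule Hs_L2)
    have lE: "(\<lambda>n. L.nm (fst (X n) - E)) ~~> 0"
      by (rule Lim_null_comparison[OF _ E(2)]) (use SL(1)[OF XS] EL L_le_W(2) in simp)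
    have "is_curl E g"
      by (rule curl_closed[OF SL(1)[OF XS] SL(2)[OF XS] _ EL g(1) lE g(2)]) (use X in \<open>auto simp: S_def\<close>)
    then have "(E, g) \<in> S" using E g by (simp add: S_def)
    moreover have "(\<lambda>n. PP.nm (X n - (E, g))) ~~> 0"
    proof (rule Lim_null_comparison)
      have m: "X n - (E, g) \<in> L2 \<times> L2" for n using subspace_diff[OF S_sub XS \<open>(E, g) \<in> S\<close>] S_le by blast
      show "\<forall>\<^sub>F n in sequentially. norm (PP.nm (X n - (E, g))) <= W.nm (fst (X n) - E) + L.nm (snd (X n) - g)"
        using nmW(3)[OF m] PP.nm_nonneg[OF m] by (simp add: fst_diff snd_diff)
      show "(\<lambda>n. W.nm (fst (X n) - E) + L.nm (snd (X n) - g)) ~~> 0" using tendsto_add[OF E(2) g(2)] by simp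
    qed
    ultimately show "\<exists>y\<in>S. (\<lambda>n. PP.nm (X n - y)) ~~> 0" by blast
  qed
  have "(f, 0) \<in> L2 \<times> L2" using fL by simp
  from PP.projection[OF S_sub S_le S_comp this]
  obtain E g where Eg: "(E, g) \<in> S" "\<forall>s\<in>S. ipp ((f, 0) - (E, g)) s = 0" by auto
  have m: "E \<in> L2" "g \<in> L2" using SL[OF Eg(1)] by simp_all
  have EH: "E \<in> Hs ee" "is_curl E g" using Eg(1) by (simp_all add: S_def)
  have fE: "f - E \<in> Hs ee" using subspace_diff[OF Hs_ee(1) f EH(1)] .
  have weak: "ip ee (f - E) E' = ip1 g g'" if "(E', g') \<in> S" for E' g'
  proof -
    have "ipp ((f, 0) - (E, g)) (E', g') = 0" using Eg(2) that by blast
    then have "ip ee (f - E) E' + ip1 (0 - g) g' = 0" by (simp only: ipp_def diff_Pair fst_conv snd_conv)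
    moreover have "g' \<in> L2" using SL(2)[OF that] by simp
    ultimately show ?thesis using L.diff_left[OF L.mem(4) m(2), of g'] L.zero_left[of g'] by simp
  qed
  have wL: "wm ee (f - E) \<in> L2" by (rule wm_L2[OF Hs_L2[OF fE] ee_wt])
  \<comment> \<open>The equation is known only for variations in \<open>Hs ee\<close>, to which a
    periodized test field need not belong. Its weighted projection has the same curl, and the part
    removed is orthogonal to \<open>f - E\<close>.\<close>
  have "ip1 (wm ee (f - E)) (per (\<lambda>p. \<phi> p *\<^sub>R a)) = ip1 g (per (\<lambda>p. crs (gr \<phi> p) a))" if t: "test_fun \<phi>" for \<phi> a
  proof -
    define v0 where "v0 = per (\<lambda>p. \<phi> p *\<^sub>R a)"
    define c0 where "c0 = per (\<lambda>p. crs (gr \<phi> p) a)"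
    have v0: "v0 \<in> L2" "c0 \<in> L2" "is_curl v0 c0"
      unfolding v0_def c0_def using per_L2[OF cmp_test[OF t]] per_L2[OF cmp_crs_gr[OF t]] per_curl[OF t] by blast+
    obtain v where v: "v \<in> Hs ee" "\<forall>s\<in>Hs ee. ip ee (v0 - v) s = 0" using Hs_projection[OF ee_gw v0(1)] by blast
    have vL: "v \<in> L2" using v(1) by (rule Hs_L2)
    have "is_curl (v0 - v) 0"
      by (rule orth_ee_curl_free) (use v v0 vL in auto)
    from curl_diff[OF v0(1,2) _ _ v0(3) this] have "is_curl v c0" using v0 vL by simp
    then have "(v, c0) \<in> S" using v v0 by (simp add: S_def)
    from weak[OF this] have "ip ee (f - E) v = ip1 g c0" .
    moreover have "ip ee (f - E) (v0 - v) = 0"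
      using v(2) fE W.sym[of "f - E" "v0 - v"] fL m v0 vL by simp
    ultimately have "ip ee (f - E) v0 = ip1 g c0" using fL m v0 vL by (simp add: W.diff_right)
    then show ?thesis by (simp add: wm_simps v0_def c0_def)
  qed
  then have "is_curl g (wm ee (f - E))" using curl_ip[OF m(2) wL] by blast
  then show ?thesis using EH m fL unfolding MO_def by (intro exI[of _ E] exI[of _ g]) simp
qed

lemma sub_eq: "(\<lambda>p. F p - z *s E p) = F - cs z E"
  by (simp add: fun_eq_iff cs_def)

text \<open>The bound at z makes the range of M - z closed and the solution unique. A vector
  orthogonal to the range is shown to be an eigenvector for the conjugate of z up to null fields,
  and the bound there makes it null.\<close>

lemma resolvent_criterion:
  assumes b1: "!!E g F. MO E g F ==> W.nm E <= c * W.nm (F - cs z E)"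
    and b2: "!!E g F. MO E g F ==> W.nm E <= c * W.nm (F - cs (cnj z) E)"
  shows "z \<in> Resolv"
proof -
  define R where "R = {F - cs z E | E g F. MO E g F}"
  have RI: "F - cs z E \<in> R" if "MO E g F" for E g F using that unfolding R_def by blast
  have RH: "x \<in> Hs ee" if x: "x \<in> R" for x
  proof -
    obtain E g F where M: "MO E g F" "x = F - cs z E" using x unfolding R_def by blast
    show ?thesis unfolding M(2) by (rule subspace_diff[OF Hs_ee(1) MO_Hs[OF M(1)] Hs_cs[OF MOD(1)[OF M(1)] ee_wt]])
  qed
  have R_sub: "subspace R"
  proof (rule subspaceI)
    show "0 \<in> R" using RI[OF MO_zero] by (simp add: cs_simps)
    fix x y assume "x \<in> R" "y \<in> R"
    then obtain E g F E' g' F' where M: "MO E g F" "x = F - cs z E" "MO E' g' F'" "y = F' - cs z E'" unfolding R_def by blast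
    have "x + y = (F + F') - cs z (E + E')" by (simp add: M(2,4) cs_simps)
    then show "x + y \<in> R" using RI[OF MO_add[OF M(1,3)]] by simp
  next
    fix r x assume "x \<in> R"
    then obtain E g F where M: "MO E g F" "x = F - cs z E" unfolding R_def by blast
    have "r *\<^sub>R x = r *\<^sub>R F - cs z (r *\<^sub>R E)" by (simp add: M(2) cs_scaleR scaleR_diff_right)
    then show "r *\<^sub>R x \<in> R" using RI[OF MO_scaleR[OF M(1), of r]] by simp
  qed
  have R_comp: "W.complete_in R"
    unfolding W.complete_in_def
  proof (intro allI impI, elim conjE)
    fix X :: "nat => field"
    assume X: "\<forall>n. X n \<in> R" and C: "\<forall>e>0. \<exists>N. \<forall>m\<ge>N. \<forall>n\<ge>N. W.nm (X m - X n) < e"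
    have "\<forall>n. \<exists>E g F. MO E g F & X n = F - cs z E" using X unfolding R_def by blast
    then obtain E g F where M: "!!n. MO (E n) (g n) (F n)" "!!n. X n = F n - cs z (E n)" by metis
    note m = MOD[OF M(1)]
    have XH: "X n \<in> Hs ee" for n using X RH by blast
    have XL: "X n \<in> L2" for n by (rule Hs_L2[OF XH])
    obtain x where x: "x \<in> Hs ee" "(\<lambda>n. W.nm (X n - x)) ~~> 0"
      using Hs_ee(2) XH C unfolding W.complete_in_def by blast
    have xL: "x \<in> L2" using x(1) by (rule Hs_L2)
    have d: "W.nm (E i - E j) <= (\<bar>c\<bar> + 1) * W.nm (X i - X j)" for i j
    proof -
      have "(F i - F j) - cs z (E i - E j) = X i - X j" by (simp add: M(2) cs_simps)
      then have "W.nm (E i - E j) <= c * W.nm (X i - X j)" using b1[OF MO_diff[OF M(1) M(1)], of i j] by simp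
      also have "\<dots> <= (\<bar>c\<bar> + 1) * W.nm (X i - X j)" using XL by (intro mult_right_mono) auto
      finally show ?thesis .
    qed
    have "\<exists>N. \<forall>i\<ge>N. \<forall>j\<ge>N. W.nm (E i - E j) < r" if r: "r > 0" for r
    proof -
      have "r / (\<bar>c\<bar> + 1) > 0" using r by simp
      then obtain N where N: "!!i j. i >= N ==> j >= N ==> W.nm (X i - X j) < r / (\<bar>c\<bar> + 1)" using C by blast
      have "(\<bar>c\<bar> + 1) * W.nm (X i - X j) < r" if "i >= N" "j >= N" for i j
        using N[OF that] by (simp add: pos_less_divide_eq mult.commute)
      then show ?thesis using d le_less_trans by blast
    qed
    then obtain e where e: "e \<in> Hs ee" "(\<lambda>n. W.nm (E n - e)) ~~> 0"
      using Hs_ee(2) m(1) unfolding W.complete_in_def by blast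
    have eL: "e \<in> L2" using e(1) by (rule Hs_L2)
    have "(\<lambda>n. W.nm (F n - (x + cs z e))) ~~> 0"
    proof (rule Lim_null_comparison)
      have "W.nm (F n - (x + cs z e)) <= W.nm (X n - x) + norm z * W.nm (E n - e)" for n
      proof -
        have "F n - (x + cs z e) = (X n - x) + cs z (E n - e)" by (simp add: M(2) cs_simps)
        show ?thesis unfolding \<open>F n - (x + cs z e) = _\<close> using W.triangle[of "X n - x" "cs z (E n - e)"] W_nm_cs[of "E n - e" z] XL xL m(2) eL by simp
      qed
      then show "\<forall>\<^sub>F n in sequentially. norm (W.nm (F n - (x + cs z e))) <= W.nm (X n - x) + norm z * W.nm (E n - e)"
        using m xL eL by simp
      show "(\<lambda>n. W.nm (X n - x) + norm z * W.nm (E n - e)) ~~> 0"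
        using tendsto_add[OF x(2) tendsto_mult_left[OF e(2), of "norm z"]] by simp
    qed
    then obtain g where "MO e g (x + cs z e)" using MO_closed[OF M(1) eL _ e(2)] xL eL by fastforce
    from RI[OF this] have "x \<in> R" by simp
    then show "\<exists>y\<in>R. (\<lambda>n. W.nm (X n - y)) ~~> 0" using x(2) by blast
  qed
  have R_le: "R \<subseteq> L2" using RH Hs_L2 by blast
  have surj: "\<exists>E F. Mop E F & aeq (\<lambda>p. F p - z *s E p) f" if f: "f \<in> Hs ee" for f
  proof -
    have fL: "f \<in> L2" using f by (rule Hs_L2)
    obtain y where y: "y \<in> R" "\<forall>s\<in>R. ip ee (f - y) s = 0" using W.projection[OF R_sub R_le R_comp fL] by blast
    define G where "G = f - y"
    have G: "G \<in> Hs ee" unfolding G_def by (rule subspace_diff[OF Hs_ee(1) f RH[OF y(1)]])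
    have GL: "G \<in> L2" using G by (rule Hs_L2)
    \<comment> \<open>If \<open>G\<close> were in the domain with M G = cnj z G, then (M + 1) G
      would be (cnj z + 1) G. Solving this equation produces the candidate \<open>E0\<close> for
      \<open>G\<close>.\<close>
    obtain E0 g0 where M0: "MO E0 g0 (cs (cnj z + 1) G - E0)" using surj1[OF Hs_cs[OF G ee_wt]] by blast
    define F0 where "F0 = cs (cnj z + 1) G - E0"
    note M0 = M0[folded F0_def]
    note m0 = MOD[OF M0]
    have FE0: "F0 + E0 = cs (cnj z + 1) G" by (simp add: F0_def)
    \<comment> \<open>Writing M - z as (M + 1) - (z + 1) and using the symmetry of M, orthogonality
      of \<open>G\<close> to the range of M - z becomes orthogonality of \<open>G - E0\<close> to
      the range of M + 1.\<close>
    have orth: "ip ee (F + E) (G - E0) = 0" if M: "MO E g F" for E g F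
    proof -
      note m = MOD[OF M]
      have "ip ee (F - cs z E) G = 0" using y(2) RI[OF M] W.sym[of G "F - cs z E"] m GL by (auto simp: G_def)
      moreover have "F - cs z E = (F + E) - cs (z + 1) E" by (simp add: cs_simps)
      ultimately have "ip ee (F + E) G = ip ee (cs (z + 1) E) G" using m GL by (simp add: W.diff_left)
      also have "\<dots> = ip ee E (cs (cnj z + 1) G)" by (simp add: ip_cs)
      also have "\<dots> = ip ee E F0 + ip ee E E0" unfolding FE0[symmetric] using m m0 by (simp add: W.add_right)
      also have "\<dots> = ip ee (F + E) E0" using MO_sym[OF M M0] m m0 by (simp add: W.add_left)
      finally show ?thesis using m m0 GL by (simp add: W.diff_right)
    qed
    have "G - E0 \<in> Hs ee" by (rule subspace_diff[OF Hs_ee(1) G m0(1)])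
    \<comment> \<open>The range of M + 1 is all of \<open>Hs ee\<close>, so the orthogonality
      applies to \<open>G - E0\<close> itself.\<close>
    from surj1[OF this] obtain E1 g1 where M1: "MO E1 g1 ((G - E0) - E1)" by blast
    have "ip ee (G - E0) (G - E0) = 0" using orth[OF M1] by simp
    then have n: "W.nm (G - E0) = 0" by (simp add: W.nm_def)
    have "F0 - cs (cnj z) E0 = cs (cnj z + 1) (G - E0)" by (simp add: F0_def cs_simps)
    then have "W.nm (F0 - cs (cnj z) E0) = 0" using W_nm_cs[of "G - E0" "cnj z + 1"] GL m0 n by simp
    then have "W.nm E0 <= 0" using b2[OF M0] by simp
    then have "W.nm G <= 0" using W.triangle[of "G - E0" E0] n GL m0 by simp
    then have "W.nm G = 0" using W.nm_nonneg[OF GL] by (rule antisym)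
    then have "W.nm (y - f) = 0" using W.nm_minus[of y f] R_le y(1) fL by (auto simp: G_def)
    moreover obtain E g F where M: "MO E g F" "y = F - cs z E" using y(1) unfolding R_def by blast
    ultimately have "aeq (F - cs z E) f" using aeq_W[of y f] R_le y(1) fL by auto
    then show ?thesis using M(1) unfolding MM_iff sub_eq by blast
  qed
  have uniq: "aeq E1 E2" if M: "MO E1 g1 F1" "MO E2 g2 F2" and a: "aeq (F1 - cs z E1) (F2 - cs z E2)" for E1 g1 F1 E2 g2 F2
  proof -
    note m = MOD[OF M(1)] MOD[OF M(2)]
    have e: "(F1 - F2) - cs z (E1 - E2) = (F1 - cs z E1) - (F2 - cs z E2)" by (simp add: cs_simps)
    have "W.nm ((F1 - cs z E1) - (F2 - cs z E2)) = 0" using a aeq_W m by simp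
    then have "W.nm (E1 - E2) <= 0" using b1[OF MO_diff[OF M]] unfolding e by simp
    moreover have "0 <= W.nm (E1 - E2)" by (rule W.nm_nonneg) (use m in simp)
    ultimately have "W.nm (E1 - E2) = 0" by (rule antisym)
    then show ?thesis using aeq_W m by simp
  qed
  show ?thesis
    unfolding resolvent_set_def mem_Collect_eq inH_iff Hnorm_eq sub_eq
  proof (intro conjI allI impI)
    show "\<exists>E F. Mop E F & aeq (F - cs z E) g" if "g \<in> Hs ee" for g
      using surj[OF that] unfolding sub_eq .
    show "aeq E1 E2" if "Mop E1 F1 & Mop E2 F2 & aeq (F1 - cs z E1) (F2 - cs z E2)" for E1 F1 E2 F2
      using that uniq unfolding MM_iff by blast
    show "\<exists>C. \<forall>E F. Mop E F --> W.nm E <= C * W.nm (F - cs z E)"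
      using b1 unfolding MM_iff by blast
  qed
qed

text \<open>Pairing with i E annihilates the term M E, because its form value is the product of g
  with i g; what remains of F - z E is the imaginary part of z times the squared norm.\<close>

lemma nonreal_bound:
  assumes M: "MO E g F"
  shows "\<bar>Im z\<bar> * W.nm E <= W.nm (F - cs z E)"
proof -
  note m = MOD[OF M]
  have "ip ee F (cs \<i> E) = ip1 g (cs \<i> g)"
    by (rule MO_weak[OF M]) (use m curl_cs in auto)
  then have "ip ee F (cs \<i> E) = 0" by (simp add: ip_i_self)
  then have "ip ee (F - cs z E) (cs \<i> E) = - (Im z * ip ee E E)" using m by (simp add: W.diff_left ip_cs_i)
  then have "\<bar>Im z\<bar> * (W.nm E)\<^sup>2 <= W.nm (F - cs z E) * W.nm E"
    using W.CS_abs[of "F - cs z E" "cs \<i> E"] W_nm_cs[of E \<i>] m W.nonneg[OF m(2)] by (simp add: W.nm_sq abs_mult)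
  then have 1: "W.nm E * (\<bar>Im z\<bar> * W.nm E) <= W.nm E * W.nm (F - cs z E)" by (simp add: power2_eq_square mult_ac)
  show ?thesis
  proof (cases "W.nm E = 0")
    case True
    then show ?thesis using m by simp
  next
    case False
    then have "0 < W.nm E" using W.nm_nonneg[OF m(2)] by linarith
    then show ?thesis using 1 by (simp only: mult_le_cancel_left_pos)
  qed
qed

lemma nonreal_resolvent:
  assumes "Im z ~= 0"
  shows "z \<in> Resolv"
proof (rule resolvent_criterion[where c="1 / \<bar>Im z\<bar>"])
  fix E g F assume M: "MO E g F"
  show "W.nm E <= 1 / \<bar>Im z\<bar> * W.nm (F - cs z E)" "W.nm E <= 1 / \<bar>Im z\<bar> * W.nm (F - cs (cnj z) E)"
    using nonreal_bound[OF M, of z] nonreal_bound[OF M, of "cnj z"] assms by (simp_all add: field_simps)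
qed

end

section \<open>The spectrum below the threshold\<close>

context mx
begin

text \<open>The unweighted divergence-free part of \<open>E\<close>, as a relation because it is
  determined only up to null fields.\<close>

definition dec :: "field => field => bool" where
  "dec E u \<longleftrightarrow> u \<in> Hs1 & (\<forall>s\<in>Hs1. ip1 (E - u) s = 0)"

lemma dec_ex: "E \<in> L2 ==> \<exists>u. dec E u"
  using Hs_projection[OF gw_1] unfolding dec_def by blast

lemma dec_L2: "dec E u ==> u \<in> L2"
  unfolding dec_def using Hs_L2 by blast

lemma dec_curl:
  assumes d: "dec E u" and E: "E \<in> L2" "g \<in> L2" "is_curl E g"
  shows "is_curl u g"
proof -
  have u: "u \<in> L2" by (rule dec_L2[OF d])
  have "is_curl (E - u) 0" by (rule orth_curl_free) (use d E u in \<open>auto simp: dec_def\<close>)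
  from curl_diff[OF E(1,2) _ _ E(3) this] show ?thesis using E u by simp
qed

lemma dec_ip:
  assumes d: "dec E u" and E: "E \<in> L2"
  shows "ip1 E u = ip1 u u" "L.nm u <= L.nm E"
proof -
  have u: "u \<in> L2" by (rule dec_L2[OF d])
  have "ip1 (E - u) u = 0" using d by (simp add: dec_def)
  then show 1: "ip1 E u = ip1 u u" using E u by (simp add: L.diff_left)
  have "(L.nm u)\<^sup>2 <= L.nm E * L.nm u" using L.CS_abs[OF E u] 1 by (simp add: L.nm_sq[OF u])
  then have "L.nm u * L.nm u <= L.nm u * L.nm E" by (simp add: power2_eq_square mult.commute)
  then show "L.nm u <= L.nm E"
    using L.nm_nonneg[OF u] L.nm_nonneg[OF E] by (cases "L.nm u = 0") (auto simp: mult_le_cancel_left)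
qed

lemma dec_linear: "dec 0 0" "dec E u ==> E \<in> L2 ==> dec E' u' ==> E' \<in> L2 ==> dec (E + E') (u + u')"
  "dec E u ==> E \<in> L2 ==> dec (r *\<^sub>R E) (r *\<^sub>R u)"
proof -
  note H1 = Hs_complete(1)[OF gw_1]
  show "dec 0 0" using subspace_0[OF H1] by (auto simp: dec_def Hs_L2)
  assume d: "dec E u" "E \<in> L2"
  have u: "u \<in> L2" by (rule dec_L2[OF d(1)])
  have e: "r *\<^sub>R E - r *\<^sub>R u = r *\<^sub>R (E - u)" by (simp add: scaleR_diff_right)
  have "ip1 (r *\<^sub>R (E - u)) s = 0" if s: "s \<in> Hs1" for s
    using d u s Hs_L2[OF s] by (simp add: dec_def L.scale_left)
  then show "dec (r *\<^sub>R E) (r *\<^sub>R u)" using d subspace_scale[OF H1] unfolding dec_def e by blast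
  assume d': "dec E' u'" "E' \<in> L2"
  have u': "u' \<in> L2" by (rule dec_L2[OF d'(1)])
  have e': "(E + E') - (u + u') = (E - u) + (E' - u')" by simp
  have "ip1 ((E - u) + (E' - u')) s = 0" if s: "s \<in> Hs1" for s
    using d u d' u' s Hs_L2[OF s] by (simp add: dec_def L.add_left)
  then show "dec (E + E') (u + u')" using d d' subspace_add[OF H1] unfolding dec_def e' by blast
qed

text \<open>A cutoff height above the inclusion, so that the cutoff is 1 wherever \<epsilon> differs
  from 1; \<open>LR\<close> is a slab height beyond the support of that cutoff.\<close>

definition "RR = \<bar>h\<bar> + 1"
definition "LR = 2 * RR + 1"

lemma RL: "RR > 0" "LR > 2 * RR" "LR > 0" "h <= RR"
  by (auto simp: RR_def LR_def)

definition cuf :: "field => field" where "cuf u = (\<lambda>p. cu RR p *\<^sub>R u p)"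

lemma cuf_L2: "u \<in> L2 ==> cuf u \<in> L2"
  unfolding cuf_def by (rule L2_wt[OF _ cu_props(1)[OF RL(1)]])

lemma cuf_nm: "u \<in> L2 ==> L.nm (cuf u) <= L.nm u"
  using nm_weight_le[OF _ cu_props(1)[OF RL(1)] _ _ cuf_L2, of u 1 u] cu_props(3,4)[OF RL(1)] by (simp add: cuf_def)

text \<open>The field \<epsilon> E is divergence-free, hence orthogonal to \<open>E - u\<close>, so
  (\<epsilon> E, E) = (\<epsilon> E, u). Splitting \<epsilon> into 1 and \<epsilon> - 1 gives (u, u)
  plus a term in which \<open>u\<close> may be replaced by its truncation, as \<epsilon> - 1
  vanishes above height h.\<close>

lemma dec_energy:
  assumes M: "MO E g F" and d: "dec E u"
  shows "ip ee E E <= ip1 u u + \<tau> * (L.nm E * L.nm (cuf u))"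
proof -
  note m = MOD[OF M]
  have u: "u \<in> L2" by (rule dec_L2[OF d])
  have wE: "wm ee E \<in> Hs1" using Hs_wm[OF m(2) ee_wt] m(1) by blast
  then have "ip1 (E - u) (wm ee E) = 0" using d unfolding dec_def by blast
  then have "ip1 (wm ee E) (E - u) = 0" using L.sym[of "E - u" "wm ee E"] Hs_L2[OF wE] m u by simp
  then have "ip ee E (E - u) = 0" by (simp only: wm_simps)
  then have 1: "ip ee E E = ip ee E u" using m u by (simp add: W.diff_right)
  define w where "w p = ee p - 1" for p
  have wt: "wt w"
    unfolding wt_def w_def
  proof (intro conjI allI exI[of _ \<tau>])
    show "(\<lambda>p. ee p - 1) \<in> Lmeas" using wtD(1)[OF ee_wt] by simp
    show "ee (p + gm k) - 1 = ee p - 1" for p k using wtD(2)[OF ee_wt] by simp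
    show "\<bar>ee p - 1\<bar> <= \<tau>" for p using ee_bounds(1,2)[of p] by simp
  qed
  have "wm w E = wm ee E - E" by (simp add: wm_def w_def fun_eq_iff scaleR_diff_left)
  then have "ip w E u = ip ee E u - ip1 E u"
    using m u Hs_L2[OF wE] by (simp only: wm_simps(3)[symmetric, of w] L.diff_left) (simp add: wm_simps)
  then have 2: "ip ee E u = ip1 u u + ip w E u" using dec_ip(1)[OF d m(2)] by simp
  have "w p * (a \<bullet> u p) = w p * (a \<bullet> cuf u p)" for a p
  proof (cases "\<bar>snd p\<bar> > h")
    case True
    then show ?thesis using ee_bounds(4) by (simp add: w_def)
  next
    case False
    then have "cu RR p = 1" using RL(4) by (intro cu_props(8)[OF RL(1)]) simp
    then show ?thesis by (simp add: cuf_def)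
  qed
  then have "ip w E u = ip w E (cuf u)" unfolding ip_def by (simp only: mult.assoc)
  also have "\<dots> = ip1 (wm w E) (cuf u)" by (simp only: wm_simps)
  also have "\<dots> <= L.nm (wm w E) * L.nm (cuf u)" using L.CS_abs[OF wm_L2[OF m(2) wt] cuf_L2[OF u]] by simp
  also have "\<dots> <= (\<tau> * L.nm E) * L.nm (cuf u)"
  proof (rule mult_right_mono[OF _ L.nm_nonneg[OF cuf_L2[OF u]]])
    show "L.nm (wm w E) <= \<tau> * L.nm E"
    proof (rule nm_weight_le[OF m(2) wt _ _ wm_L2[OF m(2) wt]])
      show "\<bar>w p\<bar> <= \<tau>" for p using ee_bounds(1,2)[of p] by (simp add: w_def)
    qed (simp add: wm_def)
  qed
  finally show ?thesis using 1 2 by simp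
qed

text \<open>Real Fourier functionals of the truncated field. The value 0 off the basis directions
  keeps the functionals uniformly bounded over all indices, as the removal of functionals
  demands.\<close>

definition xf :: "field => mode \<times> (complex^3) => real" where
  "xf u j = (if snd j \<in> Basis then ip1 (cuf u) (bas LR (fst j) (snd j)) else 0)"

lemma bas_L2: "bas LR m b \<in> L2"
  by (rule LL_L2[OF bas_LL])

lemma xf_linear: "u \<in> L2 ==> u' \<in> L2 ==> xf (u + u') = xf u + xf u'" "u \<in> L2 ==> xf (r *\<^sub>R u) = r *\<^sub>R xf u" "xf 0 = 0"
proof -
  have c: "cuf (u + u') = cuf u + cuf u'" "cuf (r *\<^sub>R u) = r *\<^sub>R cuf u" "cuf 0 = 0" for u u' r
    by (auto simp: cuf_def fun_eq_iff scaleR_add_right)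
  show "u \<in> L2 ==> u' \<in> L2 ==> xf (u + u') = xf u + xf u'" "u \<in> L2 ==> xf (r *\<^sub>R u) = r *\<^sub>R xf u" "xf 0 = 0"
    by (auto simp: fun_eq_iff xf_def c cuf_L2 bas_L2 L.bilin)
qed

lemma xf_bound: assumes u: "u \<in> L2" shows "\<bar>xf u j\<bar> <= sqrt (vol LR) * L.nm u"
proof (cases "snd j \<in> Basis")
  case True
  have "L.nm (bas LR (fst j) (snd j)) = sqrt (vol LR)"
    using True by (simp add: L.nm_def ip_bas_bas[OF RL(3)])
  then have "\<bar>xf u j\<bar> <= L.nm (cuf u) * sqrt (vol LR)"
    using L.CS_abs[OF cuf_L2[OF u] bas_L2, of "fst j" "snd j"] True by (simp add: xf_def)
  also have "\<dots> <= L.nm u * sqrt (vol LR)" using cuf_nm[OF u] vol_pos[OF RL(3)] by (intro mult_right_mono) auto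
  finally show ?thesis by (simp add: mult.commute)
next
  case False
  then show ?thesis using u vol_pos[OF RL(3)] by (simp add: xf_def)
qed

lemma xf_cf: assumes u: "u \<in> L2" shows "norm (cf LR m (cuf u)) <= (\<Sum>b\<in>Basis. \<bar>xf u (m, b)\<bar>)"
proof -
  have "cf LR m (cuf u) \<bullet> b = ip1 (cuf u) (bas LR m b)" for b
    using ip_bas[OF cu_LL(1)[OF u RL(1,2)], of m b] by (simp add: cuf_def)
  then show ?thesis using norm_le_l1[of "cf LR m (cuf u)"] by (simp add: xf_def)
qed

text \<open>The Rellich estimate with the curl expressed through the operator: (g, g) = (M E, E) =
  (P, E) + z (E, E), where P = (M - z) E. The free parameter \<open>K\<close> makes the non-compact
  part as small as desired.\<close>

lemma cuf_rellich:
  assumes M: "MO E g F" and d: "dec E u" and K: "K > 0"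
  shows "L.nm (cuf u) <= (1 / sqrt (vol LR)) * (\<Sum>j\<in>{m. norm (kv LR m) <= K} \<times> Basis. \<bar>xf u j\<bar>)
    + (1 + \<bar>z\<bar> + 2 * (ztM / RR)) / K * (W.nm (F - cs (of_real z) E) + W.nm E)"
proof -
  note m = MOD[OF M]
  have u: "u \<in> L2" by (rule dec_L2[OF d])
  have uH: "u \<in> Hs1" using d by (simp add: dec_def)
  define P where "P = F - cs (of_real z) E"
  have PL: "P \<in> L2" using m by (simp add: P_def)
  define B where "B = W.nm P"
  define e where "e = W.nm E"
  define k where "k = ztM / RR"
  define J where "J = {m. norm (kv LR m) <= K}"
  define V where "V = vol LR"
  define S where "S = (\<Sum>j\<in>J \<times> Basis. \<bar>xf u j\<bar>)"
  have k0: "0 <= k" using ztM_nonneg RL(1) by (simp add: k_def)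
  have Be: "0 <= B" "0 <= e" using PL m by (simp_all add: B_def e_def)
  have V0: "V > 0" unfolding V_def by (rule vol_pos[OF RL(3)])
  have J: "finite J" unfolding J_def by (rule finite_modes[OF RL(3)])
  have S0: "0 <= S" unfolding S_def by (intro sum_nonneg) simp
  have ue: "L.nm u <= e" using dec_ip(2)[OF d m(2)] L_le_W(2)[OF m(2)] by (simp add: e_def)
  \<comment> \<open>A crude square root of B e + |z| e^2; linearity in B and e is all that matters
    later.\<close>
  have ge: "L.nm g <= B + (1 + \<bar>z\<bar>) * e"
  proof (rule power2_le_imp_le)
    have "ip1 g g = ip ee F E" using MO_weak[OF M m(2,3,5)] by simp
    also have "F = P + z *\<^sub>R E" by (simp add: P_def cs_simps)
    also have "ip ee (P + z *\<^sub>R E) E = ip ee P E + z * e\<^sup>2" using PL m by (simp add: W.bilin W.nm_sq e_def)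
    also have "\<dots> <= B * e + \<bar>z\<bar> * e\<^sup>2" using W.CS_abs[OF PL m(2)] by (intro add_mono mult_right_mono) (auto simp: B_def e_def)
    also have "\<dots> <= (B + (1 + \<bar>z\<bar>) * e)\<^sup>2"
    proof -
      have "(B + (1 + \<bar>z\<bar>) * e)\<^sup>2 - (B * e + \<bar>z\<bar> * e\<^sup>2) = B\<^sup>2 + B * e + 2 * (\<bar>z\<bar> * (B * e)) + e\<^sup>2 + \<bar>z\<bar> * e\<^sup>2 + \<bar>z\<bar>\<^sup>2 * e\<^sup>2"
        by (simp add: power2_eq_square algebra_simps)
      moreover have "0 <= B\<^sup>2 + B * e + 2 * (\<bar>z\<bar> * (B * e)) + e\<^sup>2 + \<bar>z\<bar> * e\<^sup>2 + \<bar>z\<bar>\<^sup>2 * e\<^sup>2"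
        using Be by (intro add_nonneg_nonneg mult_nonneg_nonneg) auto
      ultimately show ?thesis by linarith
    qed
    finally show "(L.nm g)\<^sup>2 <= (B + (1 + \<bar>z\<bar>) * e)\<^sup>2" by (simp add: L.nm_sq m)
    show "0 <= B + (1 + \<bar>z\<bar>) * e" using Be by simp
  qed
  define N where "N = (1 + \<bar>z\<bar> + 2 * k) * (B + e)"
  have N0: "0 <= N" using Be k0 by (simp add: N_def)
  have gu: "(L.nm g + k * L.nm u)\<^sup>2 + (k * L.nm u)\<^sup>2 <= N\<^sup>2"
  proof -
    have a: "0 <= k * L.nm u" "0 <= L.nm g" "k * L.nm u <= k * e" using k0 u m ue by (auto intro: mult_left_mono)
    have "x\<^sup>2 + y\<^sup>2 <= (x + y)\<^sup>2" if "0 <= x" "0 <= y" for x y :: real using that by (simp add: power2_sum)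
    then have "(L.nm g + k * L.nm u)\<^sup>2 + (k * L.nm u)\<^sup>2 <= (L.nm g + k * L.nm u + k * L.nm u)\<^sup>2"
      using a(1,2) add_nonneg_nonneg by blast
    also have "\<dots> <= N\<^sup>2"
    proof (rule power_mono)
      have "N = (B + (1 + \<bar>z\<bar>) * e + 2 * (k * e)) + (\<bar>z\<bar> * B + 2 * (k * B))" by (simp add: N_def algebra_simps)
      moreover have "0 <= \<bar>z\<bar> * B + 2 * (k * B)" using Be k0 by simp
      ultimately show "L.nm g + k * L.nm u + k * L.nm u <= N" using ge a(3) by linarith
    qed (use a in simp)
    finally show ?thesis .
  qed
  have cS: "(\<Sum>m\<in>J. (norm (cf LR m (cuf u)))\<^sup>2) <= S\<^sup>2"
  proof -
    have "(\<Sum>m\<in>J. (norm (cf LR m (cuf u)))\<^sup>2) <= (\<Sum>m\<in>J. norm (cf LR m (cuf u)))\<^sup>2"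
      by (rule sqrt_le_D, fold L2_set_def, rule L2_set_le_sum) simp
    also have "\<dots> <= S\<^sup>2"
    proof (rule power_mono)
      have "(\<Sum>m\<in>J. norm (cf LR m (cuf u))) <= (\<Sum>m\<in>J. \<Sum>b\<in>Basis. \<bar>xf u (m, b)\<bar>)" by (rule sum_mono[OF xf_cf[OF u]])
      then show "(\<Sum>m\<in>J. norm (cf LR m (cuf u))) <= S" unfolding S_def sum.cartesian_product by (simp add: split_beta')
    qed (simp add: sum_nonneg)
    finally show ?thesis .
  qed
  have "V * (L.nm (cuf u))\<^sup>2 <= (\<Sum>m\<in>J. (norm (cf LR m (cuf u)))\<^sup>2) + V * ((L.nm g + k * L.nm u)\<^sup>2 + (k * L.nm u)\<^sup>2) / K\<^sup>2"
    using rellich[OF uH m(3) dec_curl[OF d m(2,3,5)] RL(1,2) K] unfolding L.nm_sq[OF cuf_L2[OF u]]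
    by (simp add: V_def J_def k_def cuf_def)
  also have "\<dots> <= S\<^sup>2 + V * N\<^sup>2 / K\<^sup>2"
    using cS gu V0 by (intro add_mono divide_right_mono mult_left_mono) auto
  finally have "(L.nm (cuf u))\<^sup>2 <= S\<^sup>2 / V + N\<^sup>2 / K\<^sup>2" using V0 by (simp add: field_simps)
  also have "\<dots> = (S / sqrt V)\<^sup>2 + (N / K)\<^sup>2" using V0 by (simp add: power_divide)
  also have "\<dots> <= (S / sqrt V + N / K)\<^sup>2"
    using S0 N0 K V0 by (simp add: power2_sum)
  finally have "L.nm (cuf u) <= S / sqrt V + N / K"
    by (rule power2_le_imp_le) (use S0 N0 K V0 in simp)
  then show ?thesis by (simp add: S_def N_def J_def V_def k_def B_def e_def P_def)
qed

text \<open>The lower bound for the curl and \<open>dec_energy\<close> leave the gap \<delta> =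
  |\<alpha>|^2 - z in front of the squared norm of E, against a term in the truncated
  \<open>u\<close>. For large \<open>K\<close> half of the gap absorbs the Rellich
  remainder.\<close>

lemma below_basic:
  assumes z: "z < (norm \<alpha>)\<^sup>2"
  shows "\<exists>C J. finite J & (\<forall>E g F u. MO E g F & dec E u -->
    W.nm E <= C * (W.nm (F - cs (of_real z) E) + (\<Sum>j\<in>J. \<bar>xf u j\<bar>)))"
proof -
  define A where "A = (norm \<alpha>)\<^sup>2"
  define \<delta> where "\<delta> = A - z"
  have A0: "0 <= A" and \<delta>: "\<delta> > 0" using z by (auto simp: A_def \<delta>_def)
  define N where "N = 1 + \<bar>z\<bar> + 2 * (ztM / RR)"
  have N0: "N > 0" using ztM_nonneg RL(1) by (simp add: N_def add_pos_nonneg)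
  \<comment> \<open>Chosen so that A \<tau> N / K is at most \<delta> / 2; the added 1 keeps
    \<open>K\<close> positive when A = 0.\<close>
  define K where "K = 2 * (A * \<tau>) * N / \<delta> + 1"
  have K0: "K > 0" using A0 tau N0 \<delta> by (simp add: K_def add_nonneg_pos)
  have AK: "A * \<tau> * (N / K) <= \<delta> / 2"
  proof -
    have "2 * (A * \<tau>) * N <= \<delta> * K" using \<delta> by (simp add: K_def field_simps)
    then show ?thesis using K0 by (simp add: field_simps)
  qed
  define J where "J = {m. norm (kv LR m) <= K} \<times> (Basis :: (complex^3) set)"
  have J: "finite J" unfolding J_def by (intro finite_cartesian_product finite_modes[OF RL(3)] finite_Basis)
  define V where "V = 1 / sqrt (vol LR)"
  have V0: "0 <= V" using vol_pos[OF RL(3)] by (simp add: V_def)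
  define C where "C = 2 / \<delta> * (1 + A * \<tau> * V + \<delta> / 2)"
  have "W.nm E <= C * (W.nm (F - cs (of_real z) E) + (\<Sum>j\<in>J. \<bar>xf u j\<bar>))" if M: "MO E g F" and d: "dec E u" for E g F u
  proof -
    note m = MOD[OF M]
    have u: "u \<in> L2" by (rule dec_L2[OF d])
    define P where "P = F - cs (of_real z) E"
    have PL: "P \<in> L2" using m by (simp add: P_def)
    define S where "S = (\<Sum>j\<in>J. \<bar>xf u j\<bar>)"
    have S0: "0 <= S" unfolding S_def by (intro sum_nonneg) simp
    define e where "e = W.nm E"
    define B where "B = W.nm P"
    define v where "v = L.nm (cuf u)"
    have Be: "0 <= B" "0 <= e" "0 <= v" using PL m cuf_L2[OF u] by (simp_all add: B_def e_def v_def)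
    have en: "e\<^sup>2 <= ip1 u u + \<tau> * (e * v)"
    proof -
      have "\<tau> * (L.nm E * L.nm (cuf u)) <= \<tau> * (e * v)"
        unfolding e_def v_def
        by (rule mult_left_mono[OF mult_right_mono[OF L_le_W(2)[OF m(2)] L.nm_nonneg[OF cuf_L2[OF u]]] less_imp_le[OF tau]])
      then show ?thesis using dec_energy[OF M d] by (simp add: e_def W.nm_sq m)
    qed
    have "A * ip1 u u <= ip1 g g"
      unfolding A_def by (rule curl_lower_bound[OF _ m(3) dec_curl[OF d m(2,3,5)]]) (use d in \<open>simp add: dec_def\<close>)
    also have "\<dots> = ip ee F E" using MO_weak[OF M m(2,3,5)] by simp
    also have "F = P + z *\<^sub>R E" by (simp add: P_def cs_simps)
    also have "ip ee (P + z *\<^sub>R E) E = ip ee P E + z * e\<^sup>2" using PL m by (simp add: W.bilin W.nm_sq e_def)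
    also have "\<dots> <= B * e + z * e\<^sup>2" using W.CS_abs[OF PL m(2)] by (simp add: B_def e_def)
    finally have 1: "A * ip1 u u <= B * e + z * e\<^sup>2" .
    have "A * e\<^sup>2 <= A * ip1 u u + A * (\<tau> * (e * v))"
      using mult_left_mono[OF en A0] by (simp add: distrib_left)
    then have "\<delta> * e\<^sup>2 <= B * e + A * (\<tau> * (e * v))" using 1 by (simp add: \<delta>_def left_diff_distrib)
    then have "e * (\<delta> * e) <= e * (B + A * \<tau> * v)" by (simp add: power2_eq_square algebra_simps)
    then have "\<delta> * e <= B + A * \<tau> * v"
      using Be A0 tau by (cases "e = 0") (auto simp: mult_le_cancel_left)
    also have "A * \<tau> * v <= A * \<tau> * (V * S + N / K * (B + e))"
      using cuf_rellich[OF M d K0, of z] A0 tau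
      by (intro mult_left_mono) (simp_all add: v_def V_def S_def J_def N_def B_def e_def P_def)
    also have "\<dots> = A * \<tau> * V * S + A * \<tau> * (N / K) * (B + e)" by (simp add: algebra_simps)
    also have "A * \<tau> * (N / K) * (B + e) <= \<delta> / 2 * (B + e)" using AK Be by (intro mult_right_mono) auto
    finally have "\<delta> * e <= B + (A * \<tau> * V * S + \<delta> / 2 * (B + e))" by simp
    moreover have "\<delta> * e = \<delta> / 2 * e + \<delta> / 2 * e" by simp
    ultimately have "\<delta> / 2 * e <= B + \<delta> / 2 * B + A * \<tau> * V * S" unfolding distrib_left by linarith
    also have "\<dots> <= (1 + A * \<tau> * V + \<delta> / 2) * (B + S)"
    proof -
      have "(1 + A * \<tau> * V + \<delta> / 2) * (B + S) = B + \<delta> / 2 * B + A * \<tau> * V * S + (S + \<delta> / 2 * S + A * \<tau> * V * B)"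
        by (simp add: algebra_simps)
      moreover have "0 <= S + \<delta> / 2 * S + A * \<tau> * V * B" using S0 \<delta> A0 tau V0 Be by simp
      ultimately show ?thesis by linarith
    qed
    finally have "e <= C * (B + S)" using \<delta> by (simp add: C_def field_simps)
    then show ?thesis by (simp add: e_def B_def S_def P_def)
  qed
  then show ?thesis using J by blast
qed

text \<open>Triples of a field, its image under M - z and its low-frequency functionals, on the
  orthogonal complement of \<open>N\<close>. The set \<open>N\<close> is empty for the eigenvalue
  criterion and the eigenspace for isolation.\<close>

definition GG :: "complex => field set => (field \<times> field \<times> (mode \<times> (complex^3) => real)) set" where
  "GG z N = {(E, F - cs z E, xf u) | E g F u. MO E g F & dec E u & (\<forall>s\<in>N. ip ee E s = 0)}"

lemma GG_I: "MO E g F ==> dec E u ==> \<forall>s\<in>N. ip ee E s = 0 ==> (E, F - cs z E, xf u) \<in> GG z N"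
  unfolding GG_def by blast

lemma GG_E:
  assumes "t \<in> GG z N"
  obtains E g F u where "MO E g F" "dec E u" "\<forall>s\<in>N. ip ee E s = 0" "t = (E, F - cs z E, xf u)"
  using assms unfolding GG_def by blast

lemma GG_subspace:
  assumes N: "N \<subseteq> L2"
  shows "subspace (GG z N)"
proof (rule subspaceI)
  have "\<forall>s\<in>N. ip ee 0 s = 0" using N by auto
  from GG_I[OF MO_zero dec_linear(1) this] show "0 \<in> GG z N" by (simp add: cs_simps xf_linear zero_prod_def)
  fix x y assume "x \<in> GG z N" "y \<in> GG z N"
  then obtain E g F u E' g' F' u' where M: "MO E g F" "dec E u" "\<forall>s\<in>N. ip ee E s = 0" "x = (E, F - cs z E, xf u)"
    "MO E' g' F'" "dec E' u'" "\<forall>s\<in>N. ip ee E' s = 0" "y = (E', F' - cs z E', xf u')" by (elim GG_E)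
  note m = MOD[OF M(1)] MOD[OF M(5)]
  have o: "\<forall>s\<in>N. ip ee (E + E') s = 0"
  proof
    fix s assume s: "s \<in> N"
    then have "s \<in> L2" using N by blast
    then show "ip ee (E + E') s = 0" using M(3,7) s m by (simp add: W.add_left)
  qed
  have "x + y = (E + E', (F + F') - cs z (E + E'), xf (u + u'))"
    using xf_linear(1)[OF dec_L2[OF M(2)] dec_L2[OF M(6)]] by (simp add: M(4,8) cs_simps)
  then show "x + y \<in> GG z N" using GG_I[OF MO_add[OF M(1,5)] dec_linear(2)[OF M(2) m(2) M(6) m(8)] o] by simp
next
  fix r x assume "x \<in> GG z N"
  then obtain E g F u where M: "MO E g F" "dec E u" "\<forall>s\<in>N. ip ee E s = 0" "x = (E, F - cs z E, xf u)" by (elim GG_E)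
  note m = MOD[OF M(1)]
  have o: "\<forall>s\<in>N. ip ee (r *\<^sub>R E) s = 0"
  proof
    fix s assume s: "s \<in> N"
    then have "s \<in> L2" using N by blast
    then show "ip ee (r *\<^sub>R E) s = 0" using M(3) s m by (simp add: W.scale_left)
  qed
  have "r *\<^sub>R x = (r *\<^sub>R E, r *\<^sub>R F - cs z (r *\<^sub>R E), xf (r *\<^sub>R u))"
    using xf_linear(2)[OF dec_L2[OF M(2)]] by (simp add: M(4) cs_scaleR scaleR_diff_right)
  then show "r *\<^sub>R x \<in> GG z N" using GG_I[OF MO_scaleR[OF M(1)] dec_linear(3)[OF M(2) m(2)] o] by simp
qed

text \<open>All functionals are removed from \<open>below_basic\<close>. The limits that could
  obstruct this lie in the kernel of M - z and are orthogonal to \<open>N\<close>, so they are null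
  by the injectivity hypothesis.\<close>

lemma below_estimate:
  assumes z: "z < (norm \<alpha>)\<^sup>2" and N: "N \<subseteq> L2"
    and inj: "!!E g F. MO E g F ==> \<forall>s\<in>N. ip ee E s = 0 ==> W.nm (F - cs (of_real z) E) = 0 ==> W.nm E = 0"
  shows "\<exists>c. \<forall>E g F. MO E g F & (\<forall>s\<in>N. ip ee E s = 0) --> W.nm E <= c * W.nm (F - cs (of_real z) E)"
proof -
  obtain C J where CJ: "finite J" "!!E g F u. MO E g F ==> dec E u ==>
    W.nm E <= C * (W.nm (F - cs (of_real z) E) + (\<Sum>j\<in>J. \<bar>xf u j\<bar>))"
    using below_basic[OF z] by blast
  have "\<exists>c. \<forall>u v x. (u, v, x) \<in> GG (of_real z) N --> W.nm u <= c * W.nm v"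
  proof (rule W.finite_codim_estimate[where B="sqrt (vol LR)" and C=C and J=J, OF complete_gw[OF ee_gw] GG_subspace[OF N] _ _ _ CJ(1)])
    show "E \<in> L2 & P \<in> L2" if "(E, P, x) \<in> GG (of_real z) N" for E P x
      using that by (elim GG_E) (use MOD in auto)
    show "\<bar>x j\<bar> <= sqrt (vol LR) * W.nm E" if t: "(E, P, x) \<in> GG (of_real z) N" for E P x j
    proof -
      obtain g F u where M: "MO E g F" "dec E u" "x = xf u" using t by (elim GG_E) auto
      have "L.nm u <= W.nm E" using dec_ip(2)[OF M(2) MOD(2)[OF M(1)]] L_le_W(2)[OF MOD(2)[OF M(1)]] by linarith
      then have "sqrt (vol LR) * L.nm u <= sqrt (vol LR) * W.nm E" using vol_pos[OF RL(3)] by (intro mult_left_mono) auto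
      then show ?thesis using xf_bound[OF dec_L2[OF M(2)], of j] unfolding M(3) by linarith
    qed
    show "W.nm E <= C * (W.nm P + (\<Sum>j\<in>J. \<bar>x j\<bar>))" if t: "(E, P, x) \<in> GG (of_real z) N" for E P x
    proof -
      obtain g F u where M: "MO E g F" "dec E u" "x = xf u" "P = F - cs (of_real z) E" using t by (elim GG_E) auto
      show ?thesis unfolding M(3,4) by (rule CJ(2)[OF M(1,2)])
    qed
    fix X E
    assume X: "\<forall>n. X n \<in> GG (of_real z) N" and E: "E \<in> L2"
      and l1: "(\<lambda>n. W.nm (fst (X n) - E)) ~~> 0" and l2: "(\<lambda>n. W.nm (fst (snd (X n)))) ~~> 0"
    have "\<forall>n. \<exists>g F. MO (fst (X n)) g F & (\<forall>s\<in>N. ip ee (fst (X n)) s = 0) & fst (snd (X n)) = F - cs (of_real z) (fst (X n))"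
    proof
      fix n
      show "\<exists>g F. MO (fst (X n)) g F & (\<forall>s\<in>N. ip ee (fst (X n)) s = 0) & fst (snd (X n)) = F - cs (of_real z) (fst (X n))"
        using X[rule_format, of n] by (elim GG_E) auto
    qed
    then obtain g F where M: "!!n. MO (fst (X n)) (g n) (F n)" "!!n. \<forall>s\<in>N. ip ee (fst (X n)) s = 0"
      "!!n. fst (snd (X n)) = F n - cs (of_real z) (fst (X n))" by metis
    note m = MOD[OF M(1)]
    have "(\<lambda>n. W.nm (F n - cs (of_real z) E)) ~~> 0"
    proof (rule Lim_null_comparison)
      have "W.nm (F n - cs (of_real z) E) <= W.nm (fst (snd (X n))) + norm (complex_of_real z) * W.nm (fst (X n) - E)" for n
      proof -
        have e: "F n - cs (of_real z) E = fst (snd (X n)) + cs (of_real z) (fst (X n) - E)" by (simp add: M(3) cs_simps)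
        have "fst (snd (X n)) \<in> L2" using m by (simp add: M(3))
        then show ?thesis unfolding e using W.triangle[of "fst (snd (X n))" "cs (of_real z) (fst (X n) - E)"] W_nm_cs[of "fst (X n) - E" "of_real z"] m E
          by (simp del: norm_of_real)
      qed
      then show "\<forall>\<^sub>F n in sequentially. norm (W.nm (F n - cs (of_real z) E)) <= W.nm (fst (snd (X n))) + norm (complex_of_real z) * W.nm (fst (X n) - E)"
        using m E by simp
      show "(\<lambda>n. W.nm (fst (snd (X n))) + norm (complex_of_real z) * W.nm (fst (X n) - E)) ~~> 0"
        using tendsto_add[OF l2 tendsto_mult_left[OF l1, of "norm (complex_of_real z)"]] by simp
    qed
    \<comment> \<open>The images under M - z tend to 0, so closedness of M places the limit in the
      domain with M E = z E.\<close>
    then obtain g' where M': "MO E g' (cs (of_real z) E)" using MO_closed[OF M(1) E cs_L2[OF E] l1] by blast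
    have "\<forall>s\<in>N. ip ee E s = 0"
    proof
      fix s assume s: "s \<in> N"
      then have "s \<in> L2" using N by blast
      from W.lim_ip[OF m(2) E this l1] show "ip ee E s = 0" using M(2) s by (simp add: LIMSEQ_const_iff)
    qed
    moreover have "W.nm (cs (of_real z) E - cs (of_real z) E) = 0" by (simp add: W.nm_def)
    ultimately show "W.nm E = 0" by (rule inj[OF M'])
  qed
  then obtain c where c: "!!u v x. (u, v, x) \<in> GG (of_real z) N ==> W.nm u <= c * W.nm v" by blast
  have "W.nm E <= c * W.nm (F - cs (of_real z) E)" if M: "MO E g F" "\<forall>s\<in>N. ip ee E s = 0" for E g F
  proof -
    obtain u where "dec E u" using dec_ex[OF MOD(2)[OF M(1)]] by blast
    from c[OF GG_I[OF M(1) this M(2)]] show ?thesis .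
  qed
  then show ?thesis by blast
qed

end

section \<open>Discrete eigenvalues below the threshold\<close>

context mx
begin

lemma null_simps: "(\<lambda>_. 0) = (0 :: field)" "(\<lambda>p. z *s E p) = cs z E"
  by (auto simp: fun_eq_iff cs_def)

lemma eigen_iff: "Eigen z \<longleftrightarrow> (\<exists>E g F. MO E g F & W.nm E ~= 0 & W.nm (F - cs z E) = 0)"
proof -
  have "aeq E 0 \<longleftrightarrow> W.nm E = 0" "aeq F (cs z E) \<longleftrightarrow> W.nm (F - cs z E) = 0" if "MO E g F" for E g F
    using aeq_W[OF MOD(2)[OF that] W.mem(4)] aeq_W[OF MOD(4)[OF that] cs_L2[OF MOD(2)[OF that]], of z] by simp_all
  then show ?thesis unfolding is_eigenvalue_def MM_iff null_simps by blast
qed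

lemma spec_iff: "z \<in> Spec \<longleftrightarrow> z \<notin> Resolv"
  by (simp add: spec_def)

text \<open>Without an eigenvalue the estimate holds on the whole domain; as z is real, it serves
  for z and its conjugate at once and puts z into the resolvent set.\<close>

lemma below_eigen:
  assumes z: "z < (norm \<alpha>)\<^sup>2" and s: "of_real z \<in> Spec"
  shows "Eigen (of_real z)"
proof (rule ccontr)
  assume n: "~ ?thesis"
  have "\<exists>c. \<forall>E g F. MO E g F & (\<forall>s\<in>{}. ip ee E s = 0) --> W.nm E <= c * W.nm (F - cs (of_real z) E)"
    by (rule below_estimate[OF z]) (use n in \<open>auto simp: eigen_iff\<close>)
  then obtain c where "!!E g F. MO E g F ==> W.nm E <= c * W.nm (F - cs (of_real z) E)" by blast
  then have "complex_of_real z \<in> Resolv" by (intro resolvent_criterion[of c]) simp_all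
  then show False using s spec_iff by blast
qed

text \<open>With more eigenvectors than functionals, some nontrivial real combination has all
  functionals 0; the basic estimate then makes it null.\<close>

lemma below_finite_mult:
  assumes z: "z < (norm \<alpha>)\<^sup>2"
  shows "finite_mult a1 a2 \<alpha> \<tau> D (of_real z)"
proof -
  obtain C J where CJ: "finite J" "!!E g F u. MO E g F ==> dec E u ==>
    W.nm E <= C * (W.nm (F - cs (of_real z) E) + (\<Sum>j\<in>J. \<bar>xf u j\<bar>))"
    using below_basic[OF z] by blast
  \<comment> \<open>The indices up to \<open>N\<close> number \<open>card J + 1\<close>, one more
    than the functionals.\<close>
  define N where "N = card J"
  have "\<exists>c::nat => complex. (\<exists>k\<le>N. c k ~= 0) & aeq (\<lambda>p. \<Sum>k\<le>N. c k *s Es k p) (\<lambda>_. 0)"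
    if ev: "\<forall>k\<le>N. Mop (Es k) (Fs k) & aeq (Fs k) (\<lambda>p. of_real z *s Es k p)" for Es Fs
  proof -
    have "\<forall>k\<in>{..N}. \<exists>g u. MO (Es k) g (Fs k) & dec (Es k) u" using ev dec_ex MOD(2) unfolding MM_iff by blast
    then obtain g u where M: "!!k. k \<in> {..N} ==> MO (Es k) (g k) (Fs k)" "!!k. k \<in> {..N} ==> dec (Es k) (u k)" by metis
    note m = MOD[OF M(1)]
    have z0: "W.nm (Fs k - cs (of_real z) (Es k)) = 0" if k: "k \<in> {..N}" for k
    proof -
      have "aeq (Fs k) (cs (of_real z) (Es k))" using ev k unfolding null_simps by simp
      then show ?thesis using aeq_W[OF m(4)[OF k] cs_L2[OF m(2)[OF k]]] by blast
    qed
    define t where "t k = (Es k, Fs k - cs (of_real z) (Es k), xf (u k))" for k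
    have t: "t k \<in> GG (of_real z) {}" if "k \<in> {..N}" for k unfolding t_def using M that by (intro GG_I) auto
    obtain c where c: "\<exists>k\<in>{..N}. c k ~= 0" "\<forall>j\<in>J. (\<Sum>k\<in>{..N}. c k * xf (u k) j) = (0::real)"
      using dependent_functionals[OF CJ(1) finite_atMost, of N "\<lambda>k. xf (u k)"] by (auto simp: N_def)
    define T where "T = (\<Sum>k\<in>{..N}. c k *\<^sub>R t k)"
    have sub: "subspace (GG (of_real z) {})" by (rule GG_subspace) simp
    have "T \<in> GG (of_real z) {}" unfolding T_def by (intro subspace_sum[OF sub] subspace_scale[OF sub] t)
    then obtain E g' F u' where T: "MO E g' F" "dec E u'" "T = (E, F - cs (of_real z) E, xf u')" by (elim GG_E) auto
    have fT: "E = (\<Sum>k\<in>{..N}. c k *\<^sub>R Es k)"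
      using arg_cong[OF T(3), of fst] unfolding T_def fst_sum by (simp add: t_def)
    have pT: "F - cs (of_real z) E = (\<Sum>k\<in>{..N}. c k *\<^sub>R (Fs k - cs (of_real z) (Es k)))"
      using arg_cong[OF T(3), of "\<lambda>x. fst (snd x)"] unfolding T_def fst_sum snd_sum by (simp add: t_def)
    have xT: "xf u' = (\<Sum>k\<in>{..N}. c k *\<^sub>R xf (u k))"
      using arg_cong[OF T(3), of "\<lambda>x. snd (snd x)"] unfolding T_def snd_sum by (simp add: t_def)
    have "xf u' j = 0" if "j \<in> J" for j unfolding xT using c(2) that by simp
    moreover have "W.nm (F - cs (of_real z) E) = 0"
    proof -
      have PL: "Fs k - cs (of_real z) (Es k) \<in> L2" if "k \<in> {..N}" for k using m(2,4)[OF that] by simp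
      define S where "S = (\<Sum>k\<in>{..N}. c k *\<^sub>R (Fs k - cs (of_real z) (Es k)))"
      have SL: "S \<in> L2" unfolding S_def by (rule W.mem_sum) (use PL in blast)
      have "ip ee (c k *\<^sub>R (Fs k - cs (of_real z) (Es k))) S = 0" if k: "k \<in> {..N}" for k
      proof -
        have "ip ee (Fs k - cs (of_real z) (Es k)) (Fs k - cs (of_real z) (Es k)) = 0"
          using z0[OF k] W.nm_sq[OF PL[OF k]] by simp
        from W.zero_nm_imp[OF PL[OF k] SL this] show ?thesis using W.scale_left[OF PL[OF k] SL] by simp
      qed
      then have "(\<Sum>k\<in>{..N}. ip ee (c k *\<^sub>R (Fs k - cs (of_real z) (Es k))) S) = 0" by (intro sum.neutral) blast
      moreover have "ip ee (\<Sum>k\<in>{..N}. c k *\<^sub>R (Fs k - cs (of_real z) (Es k))) S = (\<Sum>k\<in>{..N}. ip ee (c k *\<^sub>R (Fs k - cs (of_real z) (Es k))) S)"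
        by (rule W.sum_left[OF finite_atMost _ SL]) (use PL in blast)
      ultimately have "ip ee S S = 0" unfolding S_def[symmetric] by simp
      then show ?thesis unfolding pT S_def[symmetric] by (simp add: W.nm_def)
    qed
    ultimately have "W.nm E <= 0" using CJ(2)[OF T(1,2)] by simp
    then have "W.nm E = 0" using W.nm_nonneg[OF MOD(2)[OF T(1)]] by (rule antisym)
    then have "aeq E 0" using aeq_W[OF MOD(2)[OF T(1)] W.mem(4)] by simp
    moreover have "E = (\<lambda>p. \<Sum>k\<le>N. complex_of_real (c k) *s Es k p)"
      unfolding fT by (auto simp: fun_eq_iff vec_eq_iff scaleR_conv_of_real[where 'a=complex])
    ultimately have "aeq (\<lambda>p. \<Sum>k\<le>N. complex_of_real (c k) *s Es k p) (\<lambda>_. 0)" unfolding null_simps by simp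
    moreover have "\<exists>k\<le>N. complex_of_real (c k) ~= 0" using c(1) by auto
    ultimately show ?thesis by (intro exI[of _ "\<lambda>k. complex_of_real (c k)"]) blast
  qed
  then show ?thesis unfolding finite_mult_def by blast
qed

text \<open>Eigenvectors for distinct real eigenvalues are orthogonal, so one for a nearby r lies in
  the complement of the eigenspace at z. There M - z is bounded below with constant
  \<open>c\<close>, which excludes values of r too close to z.\<close>

lemma below_isolated:
  assumes z: "z < (norm \<alpha>)\<^sup>2"
  shows "\<exists>e>0. \<forall>w\<in>ball (of_real z) e. w \<in> Spec --> w = of_real z"
proof -
  define N where "N = {E. \<exists>g F. MO E g F & W.nm (F - cs (of_real z) E) = 0}"
  have NL: "N \<subseteq> L2" using MOD(2) by (auto simp: N_def)
  have "\<exists>c. \<forall>E g F. MO E g F & (\<forall>s\<in>N. ip ee E s = 0) --> W.nm E <= c * W.nm (F - cs (of_real z) E)"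
  proof (rule below_estimate[OF z NL])
    fix E g F assume a: "MO E g F" "\<forall>s\<in>N. ip ee E s = 0" "W.nm (F - cs (of_real z) E) = 0"
    then have "E \<in> N" unfolding N_def by blast
    then show "W.nm E = 0" using a(2) by (simp add: W.nm_def)
  qed
  then obtain c where c: "!!E g F. MO E g F ==> \<forall>s\<in>N. ip ee E s = 0 ==> W.nm E <= c * W.nm (F - cs (of_real z) E)" by blast
  \<comment> \<open>The first term makes |c| |r - z| < 1; the second keeps r below the threshold,
    where spectral points are eigenvalues.\<close>
  define e where "e = min (1 / (\<bar>c\<bar> + 1)) ((norm \<alpha>)\<^sup>2 - z)"
  have e: "e > 0" using z by (simp add: e_def)
  have "w = of_real z" if w: "w \<in> ball (of_real z) e" "w \<in> Spec" for w
  proof (rule ccontr)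
    assume ne: "w ~= of_real z"
    have "Im w = 0" using nonreal_resolvent[of w] w(2) spec_iff by blast
    then obtain r where r: "w = of_real r" using complex_is_Real_iff Reals_cases by metis
    have d: "\<bar>r - z\<bar> < e" using w(1) by (simp add: r dist_norm norm_minus_commute flip: of_real_diff)
    then have rz: "r < (norm \<alpha>)\<^sup>2" "r ~= z" using ne r by (auto simp: e_def)
    obtain E g F where M: "MO E g F" "W.nm E ~= 0" "W.nm (F - cs (of_real r) E) = 0"
      using below_eigen[OF rz(1)] w(2) unfolding r eigen_iff by blast
    note m = MOD[OF M(1)]
    have P: "F - cs (of_real r) E \<in> L2" "ip ee (F - cs (of_real r) E) (F - cs (of_real r) E) = 0"
      using m M(3) W.nm_sq[of "F - cs (of_real r) E"] by simp_all
    have "ip ee E s = 0" if s: "s \<in> N" for s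
    proof -
      obtain g' F' where M': "MO s g' F'" "W.nm (F' - cs (of_real z) s) = 0" using s unfolding N_def by blast
      note m' = MOD[OF M'(1)]
      have P': "F' - cs (of_real z) s \<in> L2" "ip ee (F' - cs (of_real z) s) (F' - cs (of_real z) s) = 0"
        using m' M'(2) W.nm_sq[of "F' - cs (of_real z) s"] by simp_all
      have 1: "ip ee F s = r * ip ee E s" using W.zero_nm_imp[OF P(1) m'(2) P(2)] m m' by (simp add: W.bilin cs_simps)
      have 2: "ip ee F' E = z * ip ee s E" using W.zero_nm_imp[OF P'(1) m(2) P'(2)] m m' by (simp add: W.bilin cs_simps)
      have 3: "ip ee F s = ip ee F' E" using MO_sym[OF M(1) M'(1)] W.sym[of E F'] m m' by simp
      have "ip ee s E = ip ee E s" using W.sym[of E s] m m' by simp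
      then have "(r - z) * ip ee E s = 0" using 1 2 3 unfolding left_diff_distrib by (metis diff_self)
      then show ?thesis using rz(2) by simp
    qed
    then have "W.nm E <= c * W.nm (F - cs (of_real z) E)" using c[OF M(1)] by blast
    also have "\<dots> <= \<bar>c\<bar> * (\<bar>r - z\<bar> * W.nm E)"
    proof -
      have split: "F - cs (of_real z) E = (F - cs (of_real r) E) + (r - z) *\<^sub>R E" by (simp add: cs_simps scaleR_diff_left)
      have 1: "W.nm (F - cs (of_real z) E) <= \<bar>r - z\<bar> * W.nm E"
        unfolding split using W.triangle[OF P(1), of "(r - z) *\<^sub>R E"] W.nm_scale[OF m(2), of "r - z"] M(3) m by simp
      have "0 <= W.nm (F - cs (of_real z) E)" by (rule W.nm_nonneg) (use m in simp)
      then have "c * W.nm (F - cs (of_real z) E) <= \<bar>c\<bar> * W.nm (F - cs (of_real z) E)" by (intro mult_right_mono) auto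
      also have "\<dots> <= \<bar>c\<bar> * (\<bar>r - z\<bar> * W.nm E)" using 1 by (intro mult_left_mono) auto
      finally show ?thesis .
    qed
    also have "\<dots> = (\<bar>c\<bar> * \<bar>r - z\<bar>) * W.nm E" by simp
    also have "\<dots> < 1 * W.nm E"
    proof (rule mult_strict_right_mono)
      have "\<bar>c\<bar> * \<bar>r - z\<bar> <= (\<bar>c\<bar> + 1) * \<bar>r - z\<bar>" by (intro mult_right_mono) auto
      also have "\<dots> < (\<bar>c\<bar> + 1) * (1 / (\<bar>c\<bar> + 1))" using d by (intro mult_strict_left_mono) (auto simp: e_def)
      also have "\<dots> = 1" using abs_ge_zero[of c] by (simp add: add_nonneg_eq_0_iff)
      finally show "\<bar>c\<bar> * \<bar>r - z\<bar> < 1" .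
      show "0 < W.nm E" using M(2) W.nm_nonneg[OF m(2)] by linarith
    qed
    finally show False by simp
  qed
  then show ?thesis using e by blast
qed

lemma below_disc:
  assumes z: "z < (norm \<alpha>)\<^sup>2" and s: "of_real z \<in> Spec"
  shows "of_real z \<in> Disc"
proof -
  obtain e where e: "e > 0" "!!w. w \<in> ball (of_real z) e ==> w \<in> Spec ==> w = of_real z"
    using below_isolated[OF z] by blast
  have "ball (of_real z) e \<inter> Spec = {of_real z}"
  proof
    show "{complex_of_real z} \<subseteq> ball (of_real z) e \<inter> Spec" using s e(1) by simp
  qed (use e(2) in blast)
  then show ?thesis unfolding disc_spec_def using s e(1) below_eigen[OF z s] below_finite_mult[OF z] by blast
qed

text \<open>A point r at or above the threshold is not isolated, since r + e/2 is again in the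
  spectrum for every e > 0. Below the threshold every spectral point is discrete, and off the real
  line there is none.\<close>

lemma disc_below_spec:
  assumes up: "!!r. (norm \<alpha>)\<^sup>2 <= r ==> of_real r \<in> Spec"
  shows "Ess = complex_of_real ` {(norm \<alpha>)\<^sup>2..}"
proof
  show "Ess \<subseteq> complex_of_real ` {(norm \<alpha>)\<^sup>2..}"
  proof
    fix w assume w: "w \<in> Ess"
    then have ws: "w \<in> Spec" "w \<notin> Disc" by (auto simp: ess_spec_def)
    have "Im w = 0" using nonreal_resolvent[of w] ws(1) spec_iff by blast
    then obtain r where r: "w = of_real r" using complex_is_Real_iff Reals_cases by metis
    have "~ r < (norm \<alpha>)\<^sup>2" using below_disc ws r by blast
    then show "w \<in> complex_of_real ` {(norm \<alpha>)\<^sup>2..}" using r by auto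
  qed
  show "complex_of_real ` {(norm \<alpha>)\<^sup>2..} \<subseteq> Ess"
  proof
    fix w assume "w \<in> complex_of_real ` {(norm \<alpha>)\<^sup>2..}"
    then obtain r where r: "w = of_real r" "(norm \<alpha>)\<^sup>2 <= r" by auto
    have "w \<notin> Disc"
    proof
      assume "w \<in> Disc"
      then obtain e where e: "e > 0" "ball w e \<inter> Spec = {w}" unfolding disc_spec_def by blast
      have "complex_of_real (r + e / 2) \<in> Spec" using up[of "r + e / 2"] r(2) e(1) by simp
      moreover have "complex_of_real (r + e / 2) \<in> ball w e"
      proof -
        have "dist w (complex_of_real (r + e / 2)) = \<bar>r - (r + e / 2)\<bar>"
          unfolding r(1) dist_norm of_real_diff[symmetric] norm_of_real ..
        then show ?thesis using e(1) by simp
      qed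
      ultimately have "complex_of_real (r + e / 2) = w" using e(2) by blast
      then have "r + e / 2 = r" unfolding r(1) of_real_eq_iff .
      then show False using e(1) by simp
    qed
    then show "w \<in> Ess" using up[OF r(2)] r(1) by (simp add: ess_spec_def)
  qed
qed

end

section \<open>Modulated plane waves\<close>

lemma crs_crs:
  "crs k (crs k c) = dot3 k c *s k - dot3 k k *s c" "crs ez (crs k c) + crs k (crs ez c) = c $ 3 *s k + dot3 k c *s ez - (2 * k $ 3) *s c"
  "crs ez (crs ez c) = c $ 3 *s ez - c"
  by (simp_all add: vec3_eq dot3_def sum_3 algebra_simps)

definition adm :: "(real => real) => bool" where
  "adm T \<longleftrightarrow> sm1 T & (\<exists>R. \<forall>t. \<bar>t\<bar> > R --> T t = 0)"

lemma admD:
  assumes "adm T"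
  shows "\<exists>R M. sm1 T & (\<forall>t. \<bar>t\<bar> > R --> T t = 0) & (\<forall>t. \<bar>T t\<bar> <= M) & 0 <= M"
proof -
  obtain R where R: "sm1 T" "!!t. \<bar>t\<bar> > R ==> T t = 0" using assms unfolding adm_def by blast
  obtain M where M: "!!t. \<bar>T t\<bar> <= M" using sm1_bounded[OF R] by blast
  have "0 <= M" using M[of 0] by linarith
  with R M show ?thesis by blast
qed

context qp
begin

definition kk :: "real => pt" where "kk \<xi> = (\<alpha>, \<xi>)"
definition kc :: "real => complex^3" where "kc \<xi> = vector [of_real (\<alpha> $ 1), of_real (\<alpha> $ 2), of_real \<xi>]"
definition SS :: "real => (real => real) => pt => complex" where "SS \<xi> T p = of_real (T (snd p)) * cis (kk \<xi> \<bullet> p)"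
definition wv :: "real => (real => real) => complex^3 => field" where "wv \<xi> T c = (\<lambda>p. SS \<xi> T p *s c)"

lemma kc_simps [simp]: "kc \<xi> $ 1 = of_real (\<alpha> $ 1)" "kc \<xi> $ 2 = of_real (\<alpha> $ 2)" "kc \<xi> $ 3 = of_real \<xi>"
  by (simp_all add: kc_def)

lemma kc_kk: "kc \<xi> $ j = of_real (kk \<xi> \<bullet> dir j)"
  using exhaust_3[of j] by (auto simp: kk_def inner_prod_def inner_axis)

lemma SS_shift: "SS \<xi> T (p + gm k) = ph k * SS \<xi> T p"
  by (simp add: SS_def kk_def inner_prod_def inner_add_right ph_def cis_mult gm_def algebra_simps)

lemma SS_cont: assumes "adm T" shows "continuous_on UNIV (SS \<xi> T)"
proof -
  obtain R M where R: "sm1 T" "!!t. \<bar>t\<bar> > R ==> T t = 0" "!!t. \<bar>T t\<bar> <= M" "0 <= M" using admD[OF assms] by blast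
  have "continuous_on UNIV (\<lambda>p::pt. T (snd p))"
    by (rule continuous_on_compose2[OF sm1_cont[OF R(1)]]) (auto intro!: continuous_intros)
  then show ?thesis unfolding SS_def[abs_def] cis_conv_exp by (intro continuous_intros)
qed

lemma wv_props:
  assumes "adm T"
  shows "wv \<xi> T c \<in> L2" "norm (wv \<xi> T c p) = \<bar>T (snd p)\<bar> * norm c"
proof -
  show n: "norm (wv \<xi> T c p) = \<bar>T (snd p)\<bar> * norm c" for p by (simp add: wv_def SS_def norm_vsmult norm_mult)
  obtain R M where R: "sm1 T" "!!t. \<bar>t\<bar> > R ==> T t = 0" "!!t. \<bar>T t\<bar> <= M" "0 <= M" using admD[OF assms] by blast
  have m: "wv \<xi> T c \<in> Lmeas" unfolding wv_def
    by (rule meas_vsmult[OF cont_lebesgue[OF SS_cont[OF assms]] borel_measurable_const])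
  show "wv \<xi> T c \<in> L2"
  proof (rule L2I[OF m])
    show "wv \<xi> T c (p + gm k) = ph k *s wv \<xi> T c p" for p k by (simp add: wv_def SS_shift vector_smult_assoc)
    have "Lint (\<lambda>p. indicator Y p *\<^sub>R (norm (wv \<xi> T c p))\<^sup>2)"
    proof (rule cell_integrable[where M="(M * norm c)\<^sup>2" and R=R])
      show "(\<lambda>p. (norm (wv \<xi> T c p))\<^sup>2) \<in> Lmeas" using m by measurable
      show "norm ((norm (wv \<xi> T c p))\<^sup>2) <= (M * norm c)\<^sup>2" for p
        using R(3)[of "snd p"] by (simp add: n mult_right_mono power_mono del: power_mult_distrib)
      show "\<bar>snd p\<bar> <= R" if "(norm (wv \<xi> T c p))\<^sup>2 ~= 0" for p
      proof (rule ccontr)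
        assume "~ ?thesis"
        then have "T (snd p) = 0" using R(2) by simp
        then show False using that by (simp add: n)
      qed
    qed
    then show "Lint (\<lambda>p. indicator Y p * (norm (wv \<xi> T c p))\<^sup>2)" by simp
  qed
qed

text \<open>The wave is bounded but has no bounded support horizontally. Integration by parts still
  applies because the test function alone supplies the bounded support.\<close>

lemma real_wave_ibp:
  assumes T: "adm T" "adm T'" "!!t. (T has_real_derivative T' t) (at t)"
    and u: "sm1 u" "!!t. (u has_real_derivative u' t) (at t)" "!!t. \<bar>u t\<bar> <= 1" "!!t. \<bar>u' t\<bar> <= 1"
    and t: "test_fun \<phi>"
  shows "(LI p. (T (snd p) * u (k \<bullet> p)) * pd j \<phi> p)
    = - (LI p. (T' (snd p) * snd (dir j) * u (k \<bullet> p) + T (snd p) * (u' (k \<bullet> p) * (k \<bullet> dir j))) * \<phi> p)"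
proof -
  obtain R1 M1 where M1: "sm1 T" "!!t. \<bar>t\<bar> > R1 ==> T t = 0" "!!t. \<bar>T t\<bar> <= M1" "0 <= M1" using admD[OF T(1)] by blast
  obtain R2 M2 where M2: "sm1 T'" "!!t. \<bar>t\<bar> > R2 ==> T' t = 0" "!!t. \<bar>T' t\<bar> <= M2" "0 <= M2" using admD[OF T(2)] by blast
  obtain M3 M4 where M34: "!!p. \<bar>\<phi> p\<bar> <= M3" "!!p. \<bar>pd j \<phi> p\<bar> <= M4" using test_bounded[OF t] test_bounded[OF test_pd[OF t]] by metis
  define f where "f p = T (snd p) * u (k \<bullet> p)" for p :: pt
  define df where "df p = T' (snd p) * snd (dir j) * u (k \<bullet> p) + T (snd p) * (u' (k \<bullet> p) * (k \<bullet> dir j))" for p :: pt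
  have T3: "smA (\<lambda>p::pt. T (snd p))" using smA_comp[OF M1(1), of "(0, 1)" 0] by (simp add: inner_prod_def)
  have uA: "smA (\<lambda>p. u (k \<bullet> p))" using smA_comp[OF u(1), of k 0] by simp
  have fA: "smA f" unfolding f_def[abs_def] by (rule smA_mult[OF T3 uA])
  have d: "g differentiable at p" if "smA g" for g p using smA_pd[OF that] by blast
  have p1: "pd j (\<lambda>p::pt. T (snd p)) p = T' (snd p) * snd (dir j)" for p
    using pd_comp[of T "T' (snd p)" "(0, 1)" p 0 j] T(3) by (simp add: inner_prod_def)
  have p2: "pd j (\<lambda>p. u (k \<bullet> p)) p = u' (k \<bullet> p) * (k \<bullet> dir j)" for p
    using pd_comp[of u "u' (k \<bullet> p)" k p 0 j] u(2) by simp
  have pf: "pd j f p = df p" for p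
    unfolding f_def[abs_def] pd_mult[OF d[OF T3] d[OF uA]] p1 p2 df_def ..
  define M where "M = max (M1 + (M2 * \<bar>snd (dir j)\<bar> + M1 * \<bar>k \<bullet> dir j\<bar>)) (max M3 M4)"
  have fs: "smooth_fun f" by (rule smA_smooth[OF fA])
  have "(LI p. df p * \<phi> p) = - (LI p. f p * pd j \<phi> p)"
  proof (rule integration_by_parts[where M=M and e="dir j"])
    show "f \<in> Lmeas" by (rule cont_lebesgue[OF smooth_cont[OF fs]])
    show "df \<in> Lmeas" using cont_lebesgue[OF smooth_cont[OF smooth_pd[OF fs, of j]]] pf by (metis (no_types, lifting) ext)
    show "\<phi> \<in> Lmeas" "pd j \<phi> \<in> Lmeas" by (intro test_meas t test_pd)+
    show "\<bar>f p\<bar> <= M" for p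
    proof -
      have "\<bar>f p\<bar> <= M1 * 1" unfolding f_def abs_mult by (intro mult_mono M1 u) auto
      moreover have "0 <= M2 * \<bar>snd (dir j)\<bar> + M1 * \<bar>k \<bullet> dir j\<bar>" using M1 M2 by simp
      ultimately show ?thesis unfolding M_def by linarith
    qed
    show "\<bar>df p\<bar> <= M" for p
    proof -
      have "\<bar>T' (snd p) * snd (dir j) * u (k \<bullet> p)\<bar> <= M2 * \<bar>snd (dir j)\<bar> * 1" unfolding abs_mult by (intro mult_mono M2 u) (use M2 in auto)
      moreover have "\<bar>T (snd p) * (u' (k \<bullet> p) * (k \<bullet> dir j))\<bar> <= M1 * (1 * \<bar>k \<bullet> dir j\<bar>)" unfolding abs_mult by (intro mult_mono M1 u) auto
      ultimately show ?thesis using M1(4) unfolding M_def df_def by linarith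
    qed
    show "\<bar>\<phi> p\<bar> <= M" "\<bar>pd j \<phi> p\<bar> <= M" for p using M34[of p] by (auto simp: M_def)
    show "bounded {p. \<phi> p ~= 0}" using t by (simp add: test_fun_def)
    show "((\<lambda>t. f (p + t *\<^sub>R dir j)) has_real_derivative df p) (at 0)" for p using smooth_along[OF fs, of p j] unfolding pf .
    show "((\<lambda>t. \<phi> (p + t *\<^sub>R dir j)) has_real_derivative pd j \<phi> p) (at 0)" for p
      using smooth_along[of \<phi> p j] t by (simp add: test_fun_def)
  qed
  then show ?thesis by (simp add: f_def df_def)
qed

lemma SS_test_integrable:
  assumes "adm T" "test_fun \<phi>"
  shows "Lint (\<lambda>p. SS \<xi> T p * of_real (\<phi> p))"
proof -
  obtain R M where M: "sm1 T" "!!t. \<bar>t\<bar> > R ==> T t = 0" "!!t. \<bar>T t\<bar> <= M" "0 <= M" using admD[OF assms(1)] by blast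
  obtain M' where M': "!!p. \<bar>\<phi> p\<bar> <= M'" using test_bounded[OF assms(2)] by blast
  show ?thesis
  proof (rule integrable_bounded_support[where M="M * M'"])
    have "(\<lambda>p. complex_of_real (\<phi> p)) \<in> Lmeas" using test_meas[OF assms(2)] by simp
    then show "(\<lambda>p. SS \<xi> T p * of_real (\<phi> p)) \<in> Lmeas"
      by (rule borel_measurable_times[OF cont_lebesgue[OF SS_cont[OF assms(1)]]])
    show "norm (SS \<xi> T p * of_real (\<phi> p)) <= M * M'" for p
      unfolding SS_def norm_mult norm_of_real norm_cis mult_1_right using M M' by (intro mult_mono) auto
    show "bounded {p. SS \<xi> T p * of_real (\<phi> p) ~= 0}"
      using assms(2) unfolding test_fun_def by (auto elim!: bounded_subset)
  qed
qed

lemma SS_ibp: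
  assumes T: "adm T" "adm T'" "!!t. (T has_real_derivative T' t) (at t)" and t: "test_fun \<phi>"
  shows "(LI p. SS \<xi> T p * of_real (pd j \<phi> p))
    = - (LI p. (\<i> * kc \<xi> $ j * SS \<xi> T p + of_real (snd (dir j)) * SS \<xi> T' p) * of_real (\<phi> p))" (is "?l = - ?r")
proof -
  have i1: "Lint (\<lambda>p. SS \<xi> T p * of_real (pd j \<phi> p))" by (rule SS_test_integrable[OF T(1) test_pd[OF t]])
  have "Lint (\<lambda>p. \<i> * kc \<xi> $ j * (SS \<xi> T p * of_real (\<phi> p)) + of_real (snd (dir j)) * (SS \<xi> T' p * of_real (\<phi> p)))"
    by (intro Lint_add integrable_mult_right SS_test_integrable T t)
  then have i2: "Lint (\<lambda>p. (\<i> * kc \<xi> $ j * SS \<xi> T p + of_real (snd (dir j)) * SS \<xi> T' p) * of_real (\<phi> p))"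
    by (simp add: distrib_right mult.assoc)
  have cosd: "(cos has_real_derivative - sin t) (at t)" for t :: real by (rule DERIV_cos)
  have sind: "(sin has_real_derivative cos t) (at t)" for t :: real by (rule DERIV_sin)
  have "Re ?l = (LI p. (T (snd p) * cos (kk \<xi> \<bullet> p)) * pd j \<phi> p)"
    unfolding integral_bounded_linear[OF bounded_linear_Re i1, symmetric] by (simp add: SS_def)
  also have "\<dots> = - (LI p. (T' (snd p) * snd (dir j) * cos (kk \<xi> \<bullet> p) + T (snd p) * (- sin (kk \<xi> \<bullet> p) * (kk \<xi> \<bullet> dir j))) * \<phi> p)"
    by (rule real_wave_ibp[OF T sm1_cos cosd _ _ t]) auto
  also have "(LI p. (T' (snd p) * snd (dir j) * cos (kk \<xi> \<bullet> p) + T (snd p) * (- sin (kk \<xi> \<bullet> p) * (kk \<xi> \<bullet> dir j))) * \<phi> p) = Re ?r"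
    unfolding integral_bounded_linear[OF bounded_linear_Re i2, symmetric]
    by (rule int_cong) (simp_all add: SS_def kc_kk algebra_simps)
  finally have re: "Re ?l = Re (- ?r)" by simp
  have "Im ?l = (LI p. (T (snd p) * sin (kk \<xi> \<bullet> p)) * pd j \<phi> p)"
    unfolding integral_bounded_linear[OF bounded_linear_Im i1, symmetric] by (simp add: SS_def)
  also have "\<dots> = - (LI p. (T' (snd p) * snd (dir j) * sin (kk \<xi> \<bullet> p) + T (snd p) * (cos (kk \<xi> \<bullet> p) * (kk \<xi> \<bullet> dir j))) * \<phi> p)"
    by (rule real_wave_ibp[OF T sm1_sin sind _ _ t]) auto
  also have "(LI p. (T' (snd p) * snd (dir j) * sin (kk \<xi> \<bullet> p) + T (snd p) * (cos (kk \<xi> \<bullet> p) * (kk \<xi> \<bullet> dir j))) * \<phi> p) = Im ?r"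
    unfolding integral_bounded_linear[OF bounded_linear_Im i2, symmetric]
    by (rule int_cong) (simp_all add: SS_def kc_kk algebra_simps)
  finally show ?thesis using re by (simp add: complex_eq_iff)
qed

lemma dir_ez: "of_real (snd (dir j)) = ez $ j"
  using exhaust_3[of j] by auto

lemma wave_curl:
  assumes T: "adm T" "adm T'" "!!t. (T has_real_derivative T' t) (at t)"
  shows "is_curl (wv \<xi> T c) (wv \<xi> T (\<i> *s crs (kc \<xi>) c) + wv \<xi> T' (crs ez c))"
  unfolding is_curl_def
proof (intro allI impI)
  fix \<phi> :: "pt => real" and i :: 3 assume t: "test_fun \<phi>"
  define I0 where "I0 = (LI p. SS \<xi> T p * of_real (\<phi> p))"
  define I1 where "I1 = (LI p. SS \<xi> T' p * of_real (\<phi> p))"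
  note int = SS_test_integrable[OF T(1) t, of \<xi>] SS_test_integrable[OF T(2) t, of \<xi>]
  have B: "(LI p. SS \<xi> T p * of_real (pd j \<phi> p)) = - (\<i> * kc \<xi> $ j * I0 + ez $ j * I1)" for j
  proof -
    have "(LI p. (\<i> * kc \<xi> $ j * SS \<xi> T p + of_real (snd (dir j)) * SS \<xi> T' p) * of_real (\<phi> p))
      = (LI p. \<i> * kc \<xi> $ j * (SS \<xi> T p * of_real (\<phi> p)) + ez $ j * (SS \<xi> T' p * of_real (\<phi> p)))"
      by (rule int_cong) (simp_all add: dir_ez algebra_simps)
    also have "\<dots> = \<i> * kc \<xi> $ j * I0 + ez $ j * I1"
      unfolding I0_def I1_def using int by (subst int_add) auto
    finally show ?thesis unfolding SS_ibp[OF T t] by simp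
  qed
  have "(LI p. (wv \<xi> T (\<i> *s crs (kc \<xi>) c) + wv \<xi> T' (crs ez c)) p $ i * complex_of_real (\<phi> p))
    = (LI p. (\<i> * crs (kc \<xi>) c $ i) * (SS \<xi> T p * of_real (\<phi> p)) + crs ez c $ i * (SS \<xi> T' p * of_real (\<phi> p)))"
    by (rule int_cong) (simp_all add: wv_def algebra_simps)
  also have "\<dots> = (\<i> * crs (kc \<xi>) c $ i) * I0 + crs ez c $ i * I1"
    unfolding I0_def I1_def using int by (subst int_add) auto
  also have "\<dots> = c $ nxt i * (- (\<i> * kc \<xi> $ nxt (nxt i) * I0 + ez $ nxt (nxt i) * I1)) - c $ nxt (nxt i) * (- (\<i> * kc \<xi> $ nxt i * I0 + ez $ nxt i * I1))"
    by (simp add: crs_def algebra_simps)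
  also have "\<dots> = (LI p. c $ nxt i * (SS \<xi> T p * of_real (pd (nxt (nxt i)) \<phi> p)) - c $ nxt (nxt i) * (SS \<xi> T p * of_real (pd (nxt i) \<phi> p)))"
    unfolding B[symmetric] using SS_test_integrable[OF T(1) test_pd[OF t], of \<xi>] by (subst int_diff) auto
  also have "\<dots> = (LI p. wv \<xi> T c p $ nxt i * complex_of_real (pd (nxt (nxt i)) \<phi> p) - wv \<xi> T c p $ nxt (nxt i) * complex_of_real (pd (nxt i) \<phi> p))"
    by (rule int_cong) (simp_all add: wv_def algebra_simps)
  finally show "(LI p. (wv \<xi> T (\<i> *s crs (kc \<xi>) c) + wv \<xi> T' (crs ez c)) p $ i * complex_of_real (\<phi> p))
    = (LI p. wv \<xi> T c p $ nxt i * complex_of_real (pd (nxt (nxt i)) \<phi> p) - wv \<xi> T c p $ nxt (nxt i) * complex_of_real (pd (nxt i) \<phi> p))" .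
qed

text \<open>The divergence of the wave consists of T (k . c) and T' times the vertical component of
  c; a polarization that is horizontal and orthogonal to the wave vector makes both vanish.\<close>

lemma wave_div:
  assumes T: "adm T" "adm T'" "!!t. (T has_real_derivative T' t) (at t)" and c: "dot3 (kc \<xi>) c = 0" "c $ 3 = 0"
  shows "wv \<xi> T c \<in> Hs1"
proof -
  have "(LI p. (\<Sum>i\<in>UNIV. wv \<xi> T c p $ i * complex_of_real (pd i \<phi> p))) = 0" if t: "test_fun \<phi>" for \<phi>
  proof -
    have i: "Lint (\<lambda>p. c $ j * (SS \<xi> T p * of_real (pd j \<phi> p)))" for j
      by (intro integrable_mult_right SS_test_integrable T test_pd t)
    have "(LI p. (\<Sum>i\<in>UNIV. wv \<xi> T c p $ i * complex_of_real (pd i \<phi> p)))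
      = (LI p. (\<Sum>j\<in>UNIV. c $ j * (SS \<xi> T p * of_real (pd j \<phi> p))))"
      by (rule int_cong) (simp_all add: wv_def mult_ac)
    also have "\<dots> = (\<Sum>j\<in>UNIV. LI p. c $ j * (SS \<xi> T p * of_real (pd j \<phi> p)))"
      by (rule int_sum[OF i])
    also have "\<dots> = - (\<Sum>j\<in>UNIV. LI p. c $ j * ((\<i> * kc \<xi> $ j * SS \<xi> T p + ez $ j * SS \<xi> T' p) * of_real (\<phi> p)))"
      by (simp add: SS_ibp[OF T t] dir_ez sum_negf)
    also have "(\<Sum>j\<in>UNIV. LI p. c $ j * ((\<i> * kc \<xi> $ j * SS \<xi> T p + ez $ j * SS \<xi> T' p) * of_real (\<phi> p)))
      = (LI p. (\<Sum>j\<in>UNIV. c $ j * ((\<i> * kc \<xi> $ j * SS \<xi> T p + ez $ j * SS \<xi> T' p) * of_real (\<phi> p))))"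
    proof (rule int_sum[symmetric])
      fix j :: 3
      have "Lint (\<lambda>p. c $ j * \<i> * kc \<xi> $ j * (SS \<xi> T p * of_real (\<phi> p)) + c $ j * ez $ j * (SS \<xi> T' p * of_real (\<phi> p)))"
        by (intro Lint_add integrable_mult_right SS_test_integrable T t)
      then show "Lint (\<lambda>p. c $ j * ((\<i> * kc \<xi> $ j * SS \<xi> T p + ez $ j * SS \<xi> T' p) * of_real (\<phi> p)))"
        by (simp add: algebra_simps)
    qed
    also have "\<dots> = (LI p. (\<i> * dot3 (kc \<xi>) c * SS \<xi> T p + c $ 3 * SS \<xi> T' p) * of_real (\<phi> p))"
      by (rule int_cong) (simp_all add: sum_3 dot3_def algebra_simps)
    finally show ?thesis using c by simp
  qed
  then show ?thesis using wv_props(1)[OF T(1)] by (simp add: Hs_def div_free_def)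
qed

text \<open>For such polarizations the double curl acts as the negative Laplacian on the profile:
  (|k|^2 T - 2 i \<xi> T' - T'') times the plane wave. The last two terms are small for slowly
  varying profiles.\<close>

lemma wave_curl_curl:
  assumes T: "adm T" "adm T'" "adm T''" "!!t. (T has_real_derivative T' t) (at t)" "!!t. (T' has_real_derivative T'' t) (at t)"
    and c: "dot3 (kc \<xi>) c = 0" "c $ 3 = 0"
  defines "g \<equiv> wv \<xi> T (\<i> *s crs (kc \<xi>) c) + wv \<xi> T' (crs ez c)"
  shows "g \<in> L2" "is_curl (wv \<xi> T c) g"
    "is_curl g (((norm \<alpha>)\<^sup>2 + \<xi>\<^sup>2) *\<^sub>R wv \<xi> T c - wv \<xi> T' ((2 * \<i> * of_real \<xi>) *s c) - wv \<xi> T'' c)"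
proof -
  show "g \<in> L2" unfolding g_def by (intro L.mem wv_props T)
  show "is_curl (wv \<xi> T c) g" unfolding g_def by (rule wave_curl[OF T(1,2,4)])
  have "is_curl g ((wv \<xi> T (\<i> *s crs (kc \<xi>) (\<i> *s crs (kc \<xi>) c)) + wv \<xi> T' (crs ez (\<i> *s crs (kc \<xi>) c)))
     + (wv \<xi> T' (\<i> *s crs (kc \<xi>) (crs ez c)) + wv \<xi> T'' (crs ez (crs ez c))))"
    unfolding g_def by (rule curl_add) (intro L.mem wv_props T wave_curl)+
  moreover have "(wv \<xi> T (\<i> *s crs (kc \<xi>) (\<i> *s crs (kc \<xi>) c)) + wv \<xi> T' (crs ez (\<i> *s crs (kc \<xi>) c)))
     + (wv \<xi> T' (\<i> *s crs (kc \<xi>) (crs ez c)) + wv \<xi> T'' (crs ez (crs ez c)))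
    = ((norm \<alpha>)\<^sup>2 + \<xi>\<^sup>2) *\<^sub>R wv \<xi> T c - wv \<xi> T' ((2 * \<i> * of_real \<xi>) *s c) - wv \<xi> T'' c"
  proof
    fix p
    have a: "(norm \<alpha>)\<^sup>2 = (\<alpha> $ 1)\<^sup>2 + (\<alpha> $ 2)\<^sup>2"
      unfolding power2_norm_eq_inner by (simp add: inner_vec_def sum_2 power2_eq_square)
    have k: "dot3 (kc \<xi>) (kc \<xi>) = of_real ((norm \<alpha>)\<^sup>2 + \<xi>\<^sup>2)"
      unfolding a by (simp add: dot3_def sum_3 power2_eq_square)
    have 1: "\<i> *s crs (kc \<xi>) (\<i> *s crs (kc \<xi>) c) = of_real ((norm \<alpha>)\<^sup>2 + \<xi>\<^sup>2) *s c"
      unfolding crs_scale crs_crs(1) c k by (simp add: vec_eq_iff)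
    have 2: "crs ez (\<i> *s crs (kc \<xi>) c) + \<i> *s crs (kc \<xi>) (crs ez c) = - ((2 * \<i> * of_real \<xi>) *s c)"
    proof -
      have "crs ez (\<i> *s crs (kc \<xi>) c) + \<i> *s crs (kc \<xi>) (crs ez c) = \<i> *s (crs ez (crs (kc \<xi>) c) + crs (kc \<xi>) (crs ez c))"
        unfolding crs_scale by (simp add: vec_eq_iff algebra_simps)
      then show ?thesis unfolding crs_crs(2) c by (simp add: vec_eq_iff)
    qed
    have 3: "crs ez (crs ez c) = - c" unfolding crs_crs(3) c by (simp add: vec_eq_iff)
    have "wv \<xi> T' (crs ez (\<i> *s crs (kc \<xi>) c)) p + wv \<xi> T' (\<i> *s crs (kc \<xi>) (crs ez c)) p
      = SS \<xi> T' p *s (crs ez (\<i> *s crs (kc \<xi>) c) + \<i> *s crs (kc \<xi>) (crs ez c))"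
      by (simp add: wv_def vec_eq_iff algebra_simps)
    also have "\<dots> = - wv \<xi> T' ((2 * \<i> * of_real \<xi>) *s c) p" unfolding 2 by (simp add: wv_def vec_eq_iff)
    finally have h: "wv \<xi> T' (\<i> *s crs (kc \<xi>) (crs ez c)) p = - wv \<xi> T' ((2 * \<i> * of_real \<xi>) *s c) p - wv \<xi> T' (crs ez (\<i> *s crs (kc \<xi>) c)) p"
      by (metis add_diff_cancel_left')
    have "wv \<xi> T (of_real ((norm \<alpha>)\<^sup>2 + \<xi>\<^sup>2) *s c) p = ((norm \<alpha>)\<^sup>2 + \<xi>\<^sup>2) *\<^sub>R wv \<xi> T c p" "wv \<xi> T'' (- c) p = - wv \<xi> T'' c p"
      by (simp_all add: wv_def vec_eq_iff scaleR_conv_of_real[where 'a=complex] algebra_simps)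
    then show "((wv \<xi> T (\<i> *s crs (kc \<xi>) (\<i> *s crs (kc \<xi>) c)) + wv \<xi> T' (crs ez (\<i> *s crs (kc \<xi>) c)))
     + (wv \<xi> T' (\<i> *s crs (kc \<xi>) (crs ez c)) + wv \<xi> T'' (crs ez (crs ez c)))) p
    = (((norm \<alpha>)\<^sup>2 + \<xi>\<^sup>2) *\<^sub>R wv \<xi> T c - wv \<xi> T' ((2 * \<i> * of_real \<xi>) *s c) - wv \<xi> T'' c) p"
      unfolding 1 3 plus_fun_apply minus_apply scaleR_fun_apply h by simp
  qed
  ultimately show "is_curl g (((norm \<alpha>)\<^sup>2 + \<xi>\<^sup>2) *\<^sub>R wv \<xi> T c - wv \<xi> T' ((2 * \<i> * of_real \<xi>) *s c) - wv \<xi> T'' c)" by simp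
qed

text \<open>A horizontal polarization orthogonal to \<alpha>, hence to the wave vector for every
  vertical frequency. For \<alpha> = 0 any nonzero horizontal vector would serve.\<close>

definition cc :: "complex^3" where
  "cc = (if \<alpha> = 0 then vector [1, 0, 0] else vector [- of_real (\<alpha> $ 2), of_real (\<alpha> $ 1), 0])"

lemma cc_props: "dot3 (kc \<xi>) cc = 0" "cc $ 3 = 0" "norm cc > 0"
proof -
  show "dot3 (kc \<xi>) cc = 0" "cc $ 3 = 0" by (simp_all add: cc_def dot3_def sum_3)
  have "cc ~= 0" by (auto simp: cc_def vec_eq_iff forall_3 forall_2)
  then show "norm cc > 0" by simp
qed

section \<open>Norms of modulated waves\<close>

definition sls :: "real => real => pt => real" where "sls L s p = indicator {-L..<L} (snd p - s)"

lemma sls_int: "Lint (\<lambda>p. indicator Y p * sls L s p)" "(LI p. indicator Y p * sls L s p) = vol L"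
proof -
  have i: "Lint (\<lambda>p. indicator Y p * sl L p)"
    using cell_integrable[OF sl_meas[of L], of 1 "\<bar>L\<bar>"] by (force simp: sl_def indicator_def split: if_splits)
  have Yv: "indicator Y (p + (0, r)) = (indicator Y p :: real)" for p r by (simp add: indicator_def Y_iff)
  have e: "indicator Y p * sls L s p = indicator Y (p + (0, - s)) * sl L (p + (0, - s))" for p
    unfolding Yv by (simp add: sls_def sl_def)
  show "Lint (\<lambda>p. indicator Y p * sls L s p)"
    unfolding e using integrable_shift[OF i, of "(0, - s)"] .
  show "(LI p. indicator Y p * sls L s p) = vol L"
    unfolding e vol_def using integral_shift[OF borel_measurable_integrable[OF i], of "(0, - s)"] .
qed

text \<open>The slab of half-height 2 L is the disjoint union of two vertical translates of the slab
  of half-height L.\<close>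

lemma vol_double: assumes "L > 0" shows "vol (2 * L) = 2 * vol L"
proof -
  have "sl (2 * L) p = sls L (- L) p + sls L L p" for p using assms by (auto simp: sl_def sls_def indicator_def)
  then have "vol (2 * L) = (LI p. indicator Y p * sls L (- L) p + indicator Y p * sls L L p)"
    unfolding vol_def by (simp add: distrib_left)
  also have "\<dots> = vol L + vol L" by (simp add: int_add[OF sls_int(1) sls_int(1)] sls_int(2))
  finally show ?thesis by simp
qed

text \<open>Comparison with multiples of slab indicators replaces the evaluation of any integral of
  a profile.\<close>

lemma slab_bounds:
  assumes f: "f \<in> L2"
  shows "(!!p. norm (f p) <= B * sls L s p) ==> ip1 f f <= B\<^sup>2 * vol L"
    "(!!p. B * sls L s p <= norm (f p)) ==> 0 <= B ==> B\<^sup>2 * vol L <= ip1 f f"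
proof -
  have n: "indicator Y p * 1 * (f p \<bullet> f p) = indicator Y p * (norm (f p))\<^sup>2" for p by (simp add: power2_norm_eq_inner)
  have s: "(B * sls L s p)\<^sup>2 = B\<^sup>2 * sls L s p" for p by (simp add: sls_def indicator_def)
  have v: "B\<^sup>2 * vol L = (LI p. indicator Y p * (B * sls L s p)\<^sup>2)"
    unfolding s using sls_int(2)[of L s] by (simp add: mult.left_commute[of _ "B\<^sup>2"])
  have i1: "Lint (\<lambda>p. indicator Y p * (norm (f p))\<^sup>2)" by (rule L2D(3)[OF f])
  have i2: "Lint (\<lambda>p. indicator Y p * (B * sls L s p)\<^sup>2)"
    unfolding s mult.left_commute[of _ "B\<^sup>2"] by (intro integrable_mult_right sls_int)
  show "ip1 f f <= B\<^sup>2 * vol L" if "!!p. norm (f p) <= B * sls L s p"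
    unfolding ip_def n v by (rule integral_mono[OF i1 i2]) (use that in \<open>auto intro!: mult_left_mono power_mono\<close>)
  show "B\<^sup>2 * vol L <= ip1 f f" if "!!p. B * sls L s p <= norm (f p)" "0 <= B"
    unfolding ip_def n v
  proof (rule integral_mono[OF i2 i1])
    fix p :: pt
    have "0 <= B * sls L s p" using that(2) by (simp add: sls_def)
    then show "indicator Y p * (B * sls L s p)\<^sup>2 <= indicator Y p * (norm (f p))\<^sup>2"
      using that(1)[of p] by (intro mult_left_mono power_mono) auto
  qed
qed

text \<open>The cutoff of width \<open>n\<close> centred at height \<open>s\<close>;
  \<open>Z1\<close> and \<open>Z2\<close> are its derivatives, each gaining a factor 1/n.\<close>

definition "Z0 n s t = zt ((t - s) / n)"
definition "Z1 n s t = zt1 ((t - s) / n) / n"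
definition "Z2 n s t = zt2 ((t - s) / n) / n / n"

lemma Z_props:
  assumes n: "n > 0"
  shows "adm (Z0 n s)" "adm (Z1 n s)" "adm (Z2 n s)" "(Z0 n s has_real_derivative Z1 n s t) (at t)"
    "(Z1 n s has_real_derivative Z2 n s t) (at t)" "\<bar>Z0 n s t\<bar> <= 1" "\<bar>Z1 n s t\<bar> <= ztM / n" "\<bar>Z2 n s t\<bar> <= ztM / n / n"
    "\<bar>t - s\<bar> > 2 * n ==> Z0 n s t = 0 & Z1 n s t = 0 & Z2 n s t = 0" "\<bar>t - s\<bar> <= n ==> Z0 n s t = 1"
proof -
  have aff: "sm1 (\<lambda>t. f ((t - s) / n))" if "sm1 f" for f
    using sm1_affine[OF that, of "1 / n" "- s / n"] by (simp add: diff_divide_distrib)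
  have d: "((\<lambda>t. f ((t - s) / n)) has_real_derivative f' ((t - s) / n) / n) (at t)" if "!!t. (f has_real_derivative f' t) (at t)" for f f' t
  proof -
    have "((\<lambda>t. (t - s) / n) has_real_derivative 1 / n) (at t)" using n by (auto intro!: derivative_eq_intros)
    from DERIV_chain2[where f=f and g="\<lambda>t. (t - s) / n", OF that this] show ?thesis by simp
  qed
  have big: "\<bar>(t - s) / n\<bar> > 2" if "\<bar>t - s\<bar> > 2 * n" for t using that n by (simp add: pos_less_divide_eq)
  show z: "\<bar>t - s\<bar> > 2 * n ==> Z0 n s t = 0 & Z1 n s t = 0 & Z2 n s t = 0" for t
    using zt(2)[of "(t - s) / n"] zt_derivs(5,6)[OF big[of t]] big[of t] by (simp add: Z0_def Z1_def Z2_def)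
  have far: "\<exists>R. \<forall>t. \<bar>t\<bar> > R --> Z0 n s t = 0 & Z1 n s t = 0 & Z2 n s t = 0"
  proof (intro exI allI impI)
    fix t assume "\<bar>t\<bar> > 2 * n + \<bar>s\<bar>"
    then show "Z0 n s t = 0 & Z1 n s t = 0 & Z2 n s t = 0" by (intro z) linarith
  qed
  have sc: "sm1 (\<lambda>t. f t / n)" if "sm1 f" for f
    using sm1_mult[OF that sm1_const[of "1 / n"]] by simp
  show "adm (Z0 n s)" "adm (Z1 n s)" "adm (Z2 n s)"
    unfolding adm_def using far aff[OF zt(1)] sc[OF aff[OF zt_derivs(7)]] sc[OF sc[OF aff[OF zt_derivs(8)]]]
    unfolding Z0_def[abs_def] Z1_def[abs_def] Z2_def[abs_def] by blast+
  show "(Z0 n s has_real_derivative Z1 n s t) (at t)"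
    unfolding Z0_def[abs_def] Z1_def by (rule d[OF zt_derivs(1)])
  show "(Z1 n s has_real_derivative Z2 n s t) (at t)"
    unfolding Z1_def[abs_def] Z2_def by (rule DERIV_cdivide[OF d[OF zt_derivs(2)]])
  show "\<bar>Z0 n s t\<bar> <= 1" using zt(4,5) by (simp add: Z0_def)
  show "\<bar>Z1 n s t\<bar> <= ztM / n" "\<bar>Z2 n s t\<bar> <= ztM / n / n"
    using zt_derivs(3,4) n by (simp_all add: Z1_def Z2_def divide_right_mono)
  show "\<bar>t - s\<bar> <= n ==> Z0 n s t = 1" using n by (simp add: Z0_def zt(3) pos_divide_le_eq)
qed

end

section \<open>Weyl sequences and the Rayleigh quotient\<close>

context mx
begin

lemma upper_spec:
  assumes r: "(norm \<alpha>)\<^sup>2 <= r"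
  shows "of_real r \<in> Spec"
proof (rule ccontr)
  assume "~ ?thesis"
  then have "of_real r \<in> Resolv" by (simp add: spec_def)
  then obtain C where C: "!!E g F. MO E g F ==> W.nm E <= C * W.nm (F - cs (of_real r) E)"
    unfolding resolvent_set_def mem_Collect_eq Hnorm_eq sub_eq MM_iff by blast
  define \<xi> where "\<xi> = sqrt (r - (norm \<alpha>)\<^sup>2)"
  have \<xi>: "(norm \<alpha>)\<^sup>2 + \<xi>\<^sup>2 = r" "0 <= \<xi>" using r by (simp_all add: \<xi>_def)
  define K where "K = (2 * \<xi> + 1) * ztM"
  have K0: "0 <= K" using \<xi>(2) ztM_nonneg by (simp add: K_def)
  \<comment> \<open>Collects C^2, the comparison 1 + \<tau> of the two norms, the ratio 4 of the
    slab volumes for 4 n and n, and the cutoff constant. The bound would give n^2 <= q, impossible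
    for n = 1 + q.\<close>
  define q where "q = C\<^sup>2 * ((1 + \<tau>) * (4 * K\<^sup>2))"
  have q0: "0 <= q" using tau by (simp add: q_def)
  define n where "n = 1 + q"
  have n: "n >= 1" "n > 0" using q0 by (simp_all add: n_def)
  \<comment> \<open>High enough that the support, within 2 n of \<open>s\<close>, lies above the
    inclusion, where \<epsilon> = 1.\<close>
  define s where "s = \<bar>h\<bar> + 2 * n + 1"
  note Z = Z_props[OF n(2), where s=s]
  define E where "E = wv \<xi> (Z0 n s) cc"
  define P where "P = wv \<xi> (Z1 n s) ((2 * \<i> * of_real \<xi>) *s cc) + wv \<xi> (Z2 n s) cc"
  define F where "F = r *\<^sub>R E - P"
  have L: "E \<in> L2" "P \<in> L2" "F \<in> L2" unfolding F_def E_def P_def by (intro L.mem wv_props Z)+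
  obtain g where g: "g \<in> L2" "is_curl E g" "is_curl g F"
    using wave_curl_curl[OF Z(1-5) cc_props(1,2), of \<xi>] unfolding \<xi>(1) F_def P_def E_def by (simp add: algebra_simps)
  have zero: "E p = 0 & P p = 0" if "\<bar>snd p - s\<bar> > 2 * n" for p
    using Z(9)[OF that] by (simp add: E_def P_def wv_def SS_def)
  have ee1: "ee p = 1" if "~ \<bar>snd p - s\<bar> > 2 * n" for p
    using that by (intro ee_bounds(4)) (simp add: s_def abs_if split: if_splits)
  have wmE: "wm ee E = E" "wm ee F = F"
    unfolding wm_def fun_eq_iff F_def using zero ee1 by (metis (no_types, lifting) minus_apply scaleR_fun_apply scaleR_one scaleR_zero_right diff_zero)+
  have "E \<in> Hs1" unfolding E_def by (rule wave_div[OF Z(1,2,4) cc_props(1,2)])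
  then have "E \<in> Hs ee" using Hs_wm[OF L(1) ee_wt] wmE by simp
  then have M: "MO E g F" unfolding MO_def wmE using g L by blast
  have PE: "F - cs (of_real r) E = - P" by (simp add: F_def cs_simps)
  have c0: "norm cc > 0" by (rule cc_props)
  have lower: "(norm cc)\<^sup>2 * vol n <= ip1 E E"
  proof (rule slab_bounds(2)[OF L(1), of _ n s])
    show "norm cc * sls n s p <= norm (E p)" for p
    proof (cases "snd p - s \<in> {-n..<n}")
      case True
      then have "Z0 n s (snd p) = 1" by (intro Z(10)) (simp add: abs_le_iff)
      then show ?thesis unfolding E_def wv_props(2)[OF Z(1)] by (simp add: sls_def indicator_def)
    qed (simp add: sls_def)
  qed simp
  have "norm (P p) <= (K / n * norm cc) * sls (4 * n) s p" for p
  proof (cases "\<bar>snd p - s\<bar> > 2 * n")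
    case True
    then show ?thesis using zero K0 n by (simp add: sls_def)
  next
    case False
    then have "snd p - s \<in> {- (4 * n)..<4 * n}" using n unfolding atLeastLessThan_iff by linarith
    then have "sls (4 * n) s p = 1" by (simp add: sls_def)
    moreover have "norm (P p) <= ztM / n * (2 * \<xi> * norm cc) + ztM / n * norm cc"
    proof -
      have "ztM / n / n <= ztM / n / 1" using n ztM_nonneg by (intro divide_left_mono) auto
      then have z2: "\<bar>Z2 n s (snd p)\<bar> <= ztM / n" using Z(8)[of "snd p"] by simp
      have "norm (P p) <= norm (wv \<xi> (Z1 n s) ((2 * \<i> * of_real \<xi>) *s cc) p) + norm (wv \<xi> (Z2 n s) cc p)"
        unfolding P_def plus_fun_apply by (rule norm_triangle_ineq)
      also have "\<dots> = \<bar>Z1 n s (snd p)\<bar> * (2 * \<xi> * norm cc) + \<bar>Z2 n s (snd p)\<bar> * norm cc"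
        unfolding wv_props(2)[OF Z(2)] wv_props(2)[OF Z(3)] norm_vsmult using \<xi>(2) by (simp add: norm_mult)
      also have "\<dots> <= ztM / n * (2 * \<xi> * norm cc) + ztM / n * norm cc"
        using Z(7)[of "snd p"] z2 \<xi>(2) by (intro add_mono mult_right_mono) auto
      finally show ?thesis .
    qed
    moreover have "ztM / n * (2 * \<xi> * norm cc) + ztM / n * norm cc = K / n * norm cc" using n by (simp add: K_def field_simps)
    ultimately show ?thesis by simp
  qed
  then have "ip1 P P <= (K / n * norm cc)\<^sup>2 * vol (4 * n)" by (rule slab_bounds(1)[OF L(2)])
  also have "vol (4 * n) = 4 * vol n" using vol_double[of "2 * n"] vol_double[of n] n by simp
  finally have upper: "ip1 P P <= (K / n * norm cc)\<^sup>2 * (4 * vol n)" .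
  have "W.nm E <= C * W.nm P" using C[OF M] unfolding PE using W.nm_scale[OF L(2), of "-1"] by simp
  also have "\<dots> <= \<bar>C\<bar> * W.nm P" using W.nm_nonneg[OF L(2)] by (intro mult_right_mono) auto
  finally have "(W.nm E)\<^sup>2 <= (\<bar>C\<bar> * W.nm P)\<^sup>2" using W.nm_nonneg[OF L(1)] by (intro power_mono)
  then have "ip ee E E <= C\<^sup>2 * ip ee P P" by (simp add: power_mult_distrib W.nm_sq[OF L(1)] W.nm_sq[OF L(2)])
  also have "\<dots> <= C\<^sup>2 * ((1 + \<tau>) * ((K / n * norm cc)\<^sup>2 * (4 * vol n)))"
    by (intro mult_left_mono order_trans[OF W_le_L[OF L(2)]] upper) (use tau in auto)
  also have "\<dots> = q / n\<^sup>2 * ((norm cc)\<^sup>2 * vol n)" using n by (simp add: q_def power_mult_distrib power_divide)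
  finally have "1 * ((norm cc)\<^sup>2 * vol n) <= q / n\<^sup>2 * ((norm cc)\<^sup>2 * vol n)"
    using lower L_le_W(1)[OF L(1)] by linarith
  moreover have "0 < (norm cc)\<^sup>2 * vol n" using c0 vol_pos[OF n(2)] by simp
  ultimately have "1 <= q / n\<^sup>2" by (simp only: mult_le_cancel_right_pos)
  then have "n\<^sup>2 <= q" using n by (simp add: pos_le_divide_eq)
  moreover have "n * 1 <= n * n" using n by (intro mult_left_mono) auto
  ultimately show False by (simp add: n_def power2_eq_square)
qed

lemma vol_power: "vol (2 ^ k) = 2 ^ k * vol 1"
  by (induction k) (use vol_double in simp_all)

lemma D_mass: "measure lebesgue D > 0" "Lint (indicator D :: pt => real)" "(LI p. indicator D p) = measure lebesgue D"
proof -
  have "D \<subseteq> {p \<in> Y. \<bar>snd p\<bar> <= h}" using D(3) unfolding Y_def Yinf_def Yh_def by (auto simp: abs_le_iff)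
  then have b: "bounded D" by (rule bounded_subset[OF Y_slab_bounded])
  have l: "D \<in> lmeasurable" by (rule lmeasurable_open[OF b D(1)])
  then show "Lint (indicator D :: pt => real)" by (simp add: lmeasurable_iff_integrable)
  show "(LI p. indicator D p) = measure lebesgue D" by simp
  have "~ negligible D" using open_not_negligible D by blast
  then have "measure lebesgue D ~= 0" using l negligible_iff_measure by blast
  then show "measure lebesgue D > 0" using measure_nonneg[of lebesgue D] by linarith
qed

text \<open>The numerator is at most |\<alpha>|^2 a + Q / n and the weighted norm at least a +
  \<delta>, where a is the squared norm of the cut-off wave. Although a depends on n, it cancels;
  \<delta> does not depend on n, so a large n decides.\<close>

lemma rayleigh_below:
  assumes a0: "\<alpha> ~= 0"
  shows "\<exists>E g F. MO E g F & ip ee E E > 0 & ip1 g g < (norm \<alpha>)\<^sup>2 * ip ee E E"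
proof -
  define A where "A = (norm \<alpha>)\<^sup>2"
  have A: "A > 0" using a0 by (simp add: A_def)
  \<comment> \<open>The drop of 1 / \<epsilon> below 1 on the inclusion.\<close>
  define \<kappa> where "\<kappa> = 1 - 1 / (1 + \<tau>)"
  have \<kappa>: "\<kappa> > 0" using tau by (simp add: \<kappa>_def)
  define \<delta> where "\<delta> = \<kappa> * (norm cc)\<^sup>2 * measure lebesgue D"
  have \<delta>: "\<delta> > 0" using \<kappa> cc_props(3) D_mass(1) by (simp add: \<delta>_def)
  \<comment> \<open>\<open>Q / n\<close> bounds the pairing of the cutoff error with the wave: the
    slab contributes 4 n times \<open>vol 1\<close>, the second derivative of the cutoff ztM /
    n^2.\<close>
  define Q where "Q = 4 * ztM * (norm cc)\<^sup>2 * vol 1"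
  \<comment> \<open>A power of two, because volumes of slabs are compared through doubling.\<close>
  obtain k :: nat where k: "Q / (A * \<delta>) + \<bar>h\<bar> < 2 ^ k" using real_arch_pow[of 2] by auto
  define n :: real where "n = 2 ^ k"
  have n: "n > 0" by (simp add: n_def)
  have Q0: "0 <= Q / (A * \<delta>)" using ztM_nonneg vol_pos[of 1] A \<delta> by (simp add: Q_def)
  have hn: "\<bar>h\<bar> <= n" and Qn: "Q / (A * \<delta>) < n" using k Q0 by (simp_all add: n_def)
  note Z = Z_props[OF n, where s=0]
  define E0 where "E0 = wv 0 (Z0 n 0) cc"
  define P where "P = wv 0 (Z2 n 0) cc"
  define F0 where "F0 = A *\<^sub>R E0 - P"
  have L: "E0 \<in> L2" "P \<in> L2" "F0 \<in> L2" unfolding F0_def E0_def P_def by (intro L.mem wv_props Z)+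
  obtain g where g: "g \<in> L2" "is_curl E0 g" "is_curl g F0"
  proof -
    have "wv 0 (Z1 n 0) ((2 * \<i> * of_real 0) *s cc) = 0" by (simp add: wv_def fun_eq_iff)
    then show ?thesis using that wave_curl_curl[OF Z(1-5) cc_props(1,2), of 0] unfolding F0_def P_def E0_def A_def by simp
  qed
  have E0H: "E0 \<in> Hs1" unfolding E0_def by (rule wave_div[OF Z(1,2,4) cc_props(1,2)])
  define a where "a = ip1 E0 E0"
  have a0: "0 <= a" using L.nonneg[OF L(1)] by (simp add: a_def)
  have out: "sls (4 * n) 0 p = 1 \<or> Z0 n 0 (snd p) = 0 & Z2 n 0 (snd p) = 0" for p
  proof (cases "2 * n < \<bar>snd p\<bar>")
    case True
    then show ?thesis using Z(9)[of "snd p"] by simp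
  next
    case False
    then have "snd p - 0 \<in> {- (4 * n)..<4 * n}" using n unfolding atLeastLessThan_iff by linarith
    then show ?thesis by (simp add: sls_def)
  qed
  have v4: "vol (4 * n) = 4 * (n * vol 1)"
    using vol_double[of "2 * n"] vol_double[of n] n vol_power[of k] by (simp add: n_def)
  have nE: "L.nm E0 <= sqrt (4 * (n * vol 1)) * norm cc"
  proof -
    have "norm (E0 p) <= norm cc * sls (4 * n) 0 p" for p
      unfolding E0_def wv_props(2)[OF Z(1)] using out[of p] Z(6)[of "snd p"] by (auto simp: mult_left_le_one_le sls_def)
    then have "ip1 E0 E0 <= (norm cc)\<^sup>2 * vol (4 * n)" by (rule slab_bounds(1)[OF L(1)])
    then have "L.nm E0 <= sqrt ((norm cc)\<^sup>2 * vol (4 * n))" unfolding L.nm_def by (rule real_sqrt_le_mono)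
    then show ?thesis unfolding v4 by (simp add: real_sqrt_mult mult_ac)
  qed
  have nP: "L.nm P <= sqrt (4 * (n * vol 1)) * (ztM / n / n * norm cc)"
  proof -
    have "norm (P p) <= (ztM / n / n * norm cc) * sls (4 * n) 0 p" for p
    proof (rule disjE[OF out[of p]])
      assume "sls (4 * n) 0 p = 1"
      then show ?thesis
        unfolding P_def wv_props(2)[OF Z(3)] using mult_right_mono[OF Z(8) norm_ge_zero, of "snd p" cc] by (simp only: mult_1_right)
    next
      assume "Z0 n 0 (snd p) = 0 & Z2 n 0 (snd p) = 0"
      then show ?thesis unfolding P_def wv_props(2)[OF Z(3)] using ztM_nonneg n by (simp add: sls_def)
    qed
    then have "ip1 P P <= (ztM / n / n * norm cc)\<^sup>2 * vol (4 * n)" by (rule slab_bounds(1)[OF L(2)])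
    then have "L.nm P <= sqrt ((ztM / n / n * norm cc)\<^sup>2 * vol (4 * n))" unfolding L.nm_def by (rule real_sqrt_le_mono)
    also have "\<dots> = \<bar>ztM / n / n * norm cc\<bar> * sqrt (4 * (n * vol 1))" unfolding v4 real_sqrt_mult by simp
    also have "\<bar>ztM / n / n * norm cc\<bar> = ztM / n / n * norm cc" using ztM_nonneg n by simp
    finally show ?thesis by (simp only: mult.commute)
  qed
  have gg: "ip1 g g <= A * a + Q / n"
  proof -
    have "ip1 g g = ip1 F0 E0" using curl_symmetric[OF g(1) L(3,1) g(1) g(3,2)] by simp
    also have "\<dots> = A * a - ip1 P E0" using L by (simp add: F0_def L.bilin a_def)
    also have "\<dots> <= A * a + L.nm P * L.nm E0" using L.CS_abs[OF L(2,1)] by linarith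
    also have "L.nm P * L.nm E0 <= (sqrt (4 * (n * vol 1)) * (ztM / n / n * norm cc)) * (sqrt (4 * (n * vol 1)) * norm cc)"
      using nE nP L.nm_nonneg[OF L(1)] ztM_nonneg n vol_pos[of 1] by (intro mult_mono) auto
    also have "\<dots> = (sqrt (4 * (n * vol 1)))\<^sup>2 * (ztM / n / n * (norm cc)\<^sup>2)" by (simp only: power2_eq_square mult_ac)
    also have "(sqrt (4 * (n * vol 1)))\<^sup>2 = 4 * (n * vol 1)" using n vol_pos[of 1] by simp
    also have "4 * (n * vol 1) * (ztM / n / n * (norm cc)\<^sup>2) = Q / n" using n by (simp add: Q_def field_simps)
    finally show ?thesis by simp
  qed
  obtain E where E: "E \<in> Hs ee" "\<forall>s\<in>Hs ee. ip ee (E0 - E) s = 0" using Hs_projection[OF ee_gw L(1)] by blast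
  have EL: "E \<in> L2" using E(1) by (rule Hs_L2)
  have "is_curl (E0 - E) 0" by (rule orth_ee_curl_free) (use E L EL in auto)
  from curl_diff[OF L(1) g(1) _ _ g(2) this] have Eg: "is_curl E g" using L EL g by simp
  \<comment> \<open>Dividing by \<open>ee\<close> makes \<epsilon> F the double curl, so the
    projected field lies in the operator domain.\<close>
  define F where "F = wm (\<lambda>p. 1 / ee p) F0"
  have FL: "F \<in> L2" unfolding F_def by (rule wm_L2[OF L(3) inv_ee_wt])
  have "wm ee F = F0" by (simp add: wm_def F_def)
  then have M: "MO E g F" unfolding MO_def using E Eg g FL by simp
  define w where "w p = 1 / ee p" for p
  have wwt: "wt w" unfolding w_def by (rule inv_ee_wt)
  \<comment> \<open>The wave divided by \<epsilon> belongs to \<open>Hs ee\<close>, and its weighted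
    pairing with the wave is the unweighted squared norm \<open>a\<close>. Since \<open>E\<close> is
    the projection of \<open>E0\<close>, the pairing of \<open>E\<close> with \<open>v\<close> is
    \<open>a\<close> as well.\<close>
  define v where "v = wm w E0"
  have vL: "v \<in> L2" unfolding v_def by (rule wm_L2[OF L(1) wwt])
  have wv: "wm ee v = E0" by (simp add: wm_def v_def w_def)
  then have vH: "v \<in> Hs ee" using Hs_wm[OF vL ee_wt] E0H by simp
  have "ip ee v E0 = a" using wm_simps(3)[of ee v E0] unfolding wv a_def by simp
  then have "ip ee E0 v = a" using W.sym[OF vL L(1)] by simp
  then have Ev: "ip ee E v = a" using bspec[OF E(2) vH] W.diff_left[OF L(1) EL vL] by linarith
  have vv: "ip ee v v = ip w E0 E0"
  proof -
    have "ip ee v v = ip1 E0 v" using wm_simps(3)[of ee v v] unfolding wv by simp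
    also have "\<dots> = ip1 v E0" by (rule L.sym[OF L(1) vL])
    finally show ?thesis unfolding v_def by (simp only: wm_simps)
  qed
  have "0 <= ip ee (E - v) (E - v)" by (rule W.nonneg) (use EL vL in simp)
  \<comment> \<open>Expanding the squared distance of E and v bounds the norm of the projection from
    below without computing the projection.\<close>
  then have "2 * a - ip w E0 E0 <= ip ee E E"
    using Ev vv W.sym[OF vL EL] EL vL by (simp add: W.bilin)
  moreover have "\<delta> <= a - ip w E0 E0"
  proof -
    have i: "Lint (\<lambda>p. indicator Y p * 1 * (E0 p \<bullet> E0 p))" "Lint (\<lambda>p. indicator Y p * w p * (E0 p \<bullet> E0 p))"
      by (rule ip_integrable[OF L(1,1) wt_const], rule ip_integrable[OF L(1,1) wwt])
    have "\<delta> = (LI p. \<kappa> * (norm cc)\<^sup>2 * indicator D p)" by (simp add: \<delta>_def)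
    also have "\<dots> <= (LI p. indicator Y p * 1 * (E0 p \<bullet> E0 p) - indicator Y p * w p * (E0 p \<bullet> E0 p))"
    proof (rule integral_mono[OF integrable_mult_right[OF D_mass(2)] Lint_diff[OF i]])
      fix p
      have w1: "w p <= 1" using ee_bounds(1)[of p] by (simp add: w_def)
      have e: "indicator Y p * 1 * (E0 p \<bullet> E0 p) - indicator Y p * w p * (E0 p \<bullet> E0 p) = indicator Y p * ((1 - w p) * (norm (E0 p))\<^sup>2)"
        by (simp add: power2_norm_eq_inner algebra_simps)
      show "\<kappa> * (norm cc)\<^sup>2 * indicator D p <= indicator Y p * 1 * (E0 p \<bullet> E0 p) - indicator Y p * w p * (E0 p \<bullet> E0 p)"
      proof (cases "p \<in> D")
        case True
        have pY: "p \<in> Yh a1 a2 h" using True D(3) by blast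
        then have "p \<in> Y" "\<bar>snd p\<bar> <= h" by (auto simp: Y_def Yinf_def Yh_def abs_le_iff)
        then have "Z0 n 0 (snd p) = 1" using hn by (intro Z(10)) simp
        then have "norm (E0 p) = norm cc" unfolding E0_def wv_props(2)[OF Z(1)] by simp
        then show ?thesis unfolding e using True \<open>p \<in> Y\<close> ee_bounds(3)[OF True] by (simp add: w_def \<kappa>_def)
      next
        case False
        then show ?thesis unfolding e using w1 by simp
      qed
    qed
    also have "\<dots> = a - ip w E0 E0" unfolding a_def ip_def by (rule int_diff[OF i])
    finally show ?thesis .
  qed
  ultimately have EE: "a + \<delta> <= ip ee E E" by linarith
  have "Q < n * (A * \<delta>)" using Qn A \<delta> by (simp add: pos_divide_less_eq)
  then have "Q / n < A * \<delta>" using n by (simp add: pos_divide_less_eq mult.commute)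
  then have "ip1 g g < A * (a + \<delta>)" using gg by (simp add: distrib_left)
  also have "\<dots> <= A * ip ee E E" using EE A by (intro mult_left_mono) auto
  finally have "ip1 g g < A * ip ee E E" .
  moreover have "ip ee E E > 0" using EE a0 \<delta> by linarith
  ultimately show ?thesis using M unfolding A_def by blast
qed

section \<open>The infimum of the Rayleigh quotients\<close>

definition QS :: "real set" where
  "QS = {ip1 g g / ip ee E E | E g F. MO E g F & ip ee E E > 0}"

text \<open>The curl in a quotient need not be the witness of the operator graph; by uniqueness of
  the weak curl the two differ by a null field, and the quotients agree.\<close>

lemma mu1_eq: "mu = Inf QS"
proof -
  have "{q. \<exists>\<phi> g. dom_M \<phi> & ~ aeq \<phi> (\<lambda>_. 0) & L2q a1 a2 \<alpha> g & is_curl \<phi> g &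
      q = integral\<^sup>L lebesgue (\<lambda>p. indicator (Yinf a1 a2) p * (norm (g p))\<^sup>2) /
          integral\<^sup>L lebesgue (\<lambda>p. indicator (Yinf a1 a2) p * eps a1 a2 \<tau> D p * (norm (\<phi> p))\<^sup>2)} = QS"
    (is "?X = QS")
  proof -
    have i1: "integral\<^sup>L lebesgue (\<lambda>p. indicator (Yinf a1 a2) p * (norm (g p))\<^sup>2) = ip1 g g" for g :: field
      unfolding ip_def Y_def power2_norm_eq_inner by simp
    have i2: "integral\<^sup>L lebesgue (\<lambda>p. indicator (Yinf a1 a2) p * eps a1 a2 \<tau> D p * (norm (E p))\<^sup>2) = ip ee E E" for E :: field
      unfolding ip_def Y_def ee_def power2_norm_eq_inner ..
    have nz: "~ aeq E (\<lambda>_. 0) \<longleftrightarrow> ip ee E E > 0" if "E \<in> L2" for E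
      using aeq_W[OF that W.mem(4)] W.nonneg[OF that] unfolding null_simps by (simp add: W.nm_def less_le)
    have dom: "dom_M E \<longleftrightarrow> (\<exists>g F. MO E g F)" for E
    proof -
      have "\<exists>F. Mop E F" if d: "dom_M E"
      proof -
        obtain g u where "L2q a1 a2 \<alpha> g" "is_curl E g" "L2q a1 a2 \<alpha> u" "is_curl g u" using d unfolding domM_def by blast
        then have "Mop E (\<lambda>p. complex_of_real (1 / eps a1 a2 \<tau> D p) *s u p)"
          unfolding MM_def using d by blast
        then show ?thesis by blast
      qed
      moreover have "dom_M E" if "Mop E F" for F
        using that unfolding MM_def by (rule conjunct1)
      ultimately have "dom_M E \<longleftrightarrow> (\<exists>F. Mop E F)" by blast
      then show ?thesis unfolding MM_iff by blast
    qed
    show ?thesis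
    proof
      show "?X \<subseteq> QS"
      proof
        fix q assume "q \<in> ?X"
        then obtain E g where E: "dom_M E" "~ aeq E (\<lambda>_. 0)" "g \<in> L2" "is_curl E g" "q = ip1 g g / ip ee E E"
          unfolding i1 i2 L2_def by blast
        obtain g' F where M: "MO E g' F" using E(1) dom by blast
        note m = MOD[OF M]
        have "ip1 (g - g') (g - g') = 0" by (rule curl_unique[OF m(2) E(3) m(3) E(4) m(5)])
        then have "ip1 (g - g') g = 0" "ip1 (g - g') g' = 0"
          using L.zero_nm_imp[of "g - g'"] E(3) m by simp_all
        then have "ip1 g g = ip1 g' g'" using L.sym[of g g'] E(3) m by (simp add: L.diff_left)
        then show "q \<in> QS" unfolding QS_def using M E(2,5) nz[OF m(2)] by auto
      qed
      show "QS \<subseteq> ?X"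
      proof
        fix q assume "q \<in> QS"
        then obtain E g F where E: "MO E g F" "ip ee E E > 0" "q = ip1 g g / ip ee E E" unfolding QS_def by blast
        note m = MOD[OF E(1)]
        have "L2q a1 a2 \<alpha> g" using m(3) by (simp add: L2_def)
        moreover have "dom_M E" using E(1) dom by blast
        moreover have "~ aeq E (\<lambda>_. 0)" using nz[OF m(2)] E(2) by simp
        ultimately show "q \<in> ?X" unfolding i1 i2 using m(5) E(3) by blast
      qed
    qed
  qed
  then show ?thesis unfolding mu1_def by simp
qed

lemma QS_bdd: "bdd_below QS"
proof (rule bdd_belowI)
  fix q assume "q \<in> QS"
  then show "0 <= q" unfolding QS_def using L.nonneg MOD(3) by (auto intro!: divide_nonneg_pos)
qed

lemma mu1_le: "MO E g F ==> mu * ip ee E E <= ip1 g g"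
proof -
  assume M: "MO E g F"
  note m = MOD[OF M]
  show ?thesis
  proof (cases "ip ee E E > 0")
    case True
    then have "Inf QS <= ip1 g g / ip ee E E" by (intro cInf_lower QS_bdd) (use M in \<open>auto simp: QS_def\<close>)
    then show ?thesis using True unfolding mu1_eq by (simp add: pos_le_divide_eq)
  next
    case False
    then have "ip ee E E = 0" using W.nonneg[OF m(2)] by simp
    then show ?thesis using L.nonneg[OF m(3)] by simp
  qed
qed

text \<open>If the infimum were in the resolvent set, Cauchy--Schwarz for the nonnegative form
  \<open>(M - \<mu>)E \<cdot> E\<close> would bound that form below by a multiple of the squared norm.\<close>

lemma mu1_spec:
  assumes ne: "QS ~= {}"
  shows "of_real (mu) \<in> Spec"
proof (rule ccontr)
  define \<mu> where "\<mu> = mu"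
  define a where "a E F = ip ee (F - \<mu> *\<^sub>R E) E" for E F
  assume "~ ?thesis"
  then have "of_real \<mu> \<in> Resolv" by (simp add: spec_def \<mu>_def)
  note R = this[unfolded resolvent_set_def mem_Collect_eq Hnorm_eq sub_eq MM_iff inH_iff cs_simps]
  have surj: "\<exists>E g F. MO E g F & aeq (F - \<mu> *\<^sub>R E) f" if "f \<in> Hs ee" for f
    using conjunct1[OF R] that by blast
  obtain C where C: "!!E g F. MO E g F ==> W.nm E <= C * W.nm (F - \<mu> *\<^sub>R E)"
    using conjunct2[OF conjunct2[OF R]] by blast
  have a_eq: "a E F = ip1 g g - \<mu> * ip ee E E" if "MO E g F" for E g F
    using MO_weak[OF that MOD(2,3,5)[OF that]] MOD[OF that] by (simp add: a_def W.bilin)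
  have a0: "0 <= a E F" if "MO E g F" for E g F
    using mu1_le[OF that] by (simp add: a_eq[OF that] \<mu>_def)
  define C' where "C' = \<bar>C\<bar> + 1"
  have C': "C' > 0" by (simp add: C'_def)
  have low: "ip ee E E <= C' * a E F" if M: "MO E g F" for E g F
  proof -
    note m = MOD[OF M]
    \<comment> \<open>\<open>v\<close> solves (M - \<mu>) v = E almost everywhere, which is possible
      because \<mu> is assumed to be in the resolvent set.\<close>
    obtain v gv G where V: "MO v gv G" "aeq (G - \<mu> *\<^sub>R v) E" using surj[OF m(1)] by blast
    note mv = MOD[OF V(1)]
    define X where "X = G - \<mu> *\<^sub>R v"
    have XL: "X \<in> L2" using mv by (simp add: X_def)
    have XE0: "W.nm (X - E) = 0" using V(2) aeq_W[OF XL m(2)] by (simp add: X_def)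
    have dL: "X - E \<in> L2" using XL m by simp
    have XE: "ip ee X y = ip ee E y" if "y \<in> L2" for y
    proof -
      have "ip ee (X - E) (X - E) = 0" using XE0 W.nm_sq[OF dL] by simp
      from W.zero_nm_imp[OF dL that this] show ?thesis using W.diff_left[OF XL m(2) that] by simp
    qed
    have b: "ip ee (F - \<mu> *\<^sub>R E) v = ip ee X E"
    proof -
      have "ip ee F v = ip ee G E" using MO_sym[OF M V(1)] W.sym[OF m(2) mv(4)] by simp
      then show ?thesis using W.sym[OF m(2) mv(2)] m mv by (simp add: X_def W.bilin)
    qed
    \<comment> \<open>Cauchy--Schwarz for the form of M - \<mu> at \<open>v\<close> and
      \<open>E\<close>, by the discriminant of the form along \<open>v + t E\<close>: the mixed term
      is (E, E) by the choice of \<open>v\<close>.\<close>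
    have "(ip ee E E)\<^sup>2 <= a v G * a E F"
    proof (rule W.quad_nonneg_imp)
      fix t :: real
      have "0 <= a (v + t *\<^sub>R E) (G + t *\<^sub>R F)" by (rule a0[OF MO_add[OF V(1) MO_scaleR[OF M]]])
      also have "(G + t *\<^sub>R F) - \<mu> *\<^sub>R (v + t *\<^sub>R E) = X + t *\<^sub>R (F - \<mu> *\<^sub>R E)"
        by (simp add: X_def algebra_simps)
      then have "a (v + t *\<^sub>R E) (G + t *\<^sub>R F) = ip ee (X + t *\<^sub>R (F - \<mu> *\<^sub>R E)) (v + t *\<^sub>R E)" by (simp only: a_def)
      also have "\<dots> = ip ee X v + t * ip ee X E + (t * ip ee (F - \<mu> *\<^sub>R E) v + t * (t * ip ee (F - \<mu> *\<^sub>R E) E))"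
        using W.add_left[OF XL _ , of "t *\<^sub>R (F - \<mu> *\<^sub>R E)" "v + t *\<^sub>R E"] W.scale_left[of "F - \<mu> *\<^sub>R E" _ t] XL m mv
        by (simp add: W.add_right W.scale_right distrib_left)
      also have "\<dots> = a v G + 2 * t * ip ee E E + t\<^sup>2 * a E F"
        unfolding b XE[OF m(2)] by (simp add: a_def X_def power2_eq_square)
      finally show "0 <= a v G + 2 * t * ip ee E E + t\<^sup>2 * a E F" .
    qed (rule a0[OF M])
    \<comment> \<open>The form value of \<open>v\<close> is (E, v), and the resolvent bound controls
      \<open>v\<close> by \<open>E\<close>. One factor (E, E) can then be cancelled.\<close>
    also have "a v G <= C' * ip ee E E"
    proof -
      have nX: "W.nm X <= W.nm E" using W.triangle[OF dL m(2)] XE0 by simp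
      have "W.nm v <= C * W.nm X" using C[OF V(1)] by (simp add: X_def)
      also have "\<dots> <= C' * W.nm X" using W.nm_nonneg[OF XL] by (intro mult_right_mono) (simp_all add: C'_def)
      also have "\<dots> <= C' * W.nm E" using nX C' by (intro mult_left_mono) auto
      finally have nv: "W.nm v <= C' * W.nm E" .
      have "a v G = ip ee E v" using XE[OF mv(2)] by (simp add: a_def X_def)
      also have "\<dots> <= W.nm E * W.nm v" using W.CS_abs[OF m(2) mv(2)] by simp
      also have "\<dots> <= W.nm E * (C' * W.nm E)" by (rule mult_left_mono[OF nv W.nm_nonneg[OF m(2)]])
      also have "\<dots> = C' * ip ee E E" unfolding W.nm_sq[OF m(2), symmetric] power2_eq_square by simp
      finally show ?thesis .
    qed
    then have "a v G * a E F <= C' * ip ee E E * a E F" by (rule mult_right_mono[OF _ a0[OF M]])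
    finally have "ip ee E E * ip ee E E <= ip ee E E * (C' * a E F)" by (simp add: power2_eq_square mult_ac)
    then show ?thesis
      using W.nonneg[OF m(2)] a0[OF M] C' by (cases "ip ee E E = 0") (auto simp: mult_le_cancel_left)
  qed
  \<comment> \<open>Divided by the weighted norm, the lower bound places all quotients above \<mu>
    by the fixed amount 1 / C', although \<mu> is their infimum.\<close>
  have "\<mu> + 1 / C' <= Inf QS"
  proof (rule cInf_greatest[OF ne])
    fix q assume "q \<in> QS"
    then obtain E g F where E: "MO E g F" "ip ee E E > 0" "q = ip1 g g / ip ee E E" unfolding QS_def by blast
    have "1 / C' * ip ee E E <= ip1 g g - \<mu> * ip ee E E"
      using low[OF E(1)] C' unfolding a_eq[OF E(1)] by (simp add: pos_divide_le_eq mult.commute)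
    then have "(\<mu> + 1 / C') * ip ee E E <= ip1 g g" by (simp add: distrib_right)
    then show "\<mu> + 1 / C' <= q" unfolding E(3) using E(2) by (simp add: pos_le_divide_eq)
  qed
  then show False using C' by (simp add: \<mu>_def mu1_eq)
qed

lemma mu1_below:
  assumes "\<alpha> ~= 0"
  shows "mu < (norm \<alpha>)\<^sup>2" "of_real (mu) \<in> Disc"
proof -
  obtain E g F where E: "MO E g F" "ip ee E E > 0" "ip1 g g < (norm \<alpha>)\<^sup>2 * ip ee E E"
    using rayleigh_below[OF assms] by blast
  have Q: "ip1 g g / ip ee E E \<in> QS" unfolding QS_def using E by blast
  have "Inf QS <= ip1 g g / ip ee E E" by (rule cInf_lower[OF Q QS_bdd])
  also have "\<dots> < (norm \<alpha>)\<^sup>2" using E(2,3) by (simp add: pos_divide_less_eq)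
  finally show 1: "mu < (norm \<alpha>)\<^sup>2" unfolding mu1_eq .
  show "of_real (mu) \<in> Disc" by (rule below_disc[OF 1 mu1_spec]) (use Q in blast)
qed

end

theorem theorem2p8:
  fixes a1 a2 \<alpha> :: "real^2" and \<tau> h :: real and D :: "pt set"
  assumes "\<bar>a1 $ 1 * a2 $ 2 - a1 $ 2 * a2 $ 1\<bar> = 1"
    and "\<alpha> \<in> brillouin a1 a2"
    and "\<tau> > 0"
    and "open D" and "bounded D" and "D \<noteq> {}" and "smooth_boundary D"
    and "D \<subseteq> Yh a1 a2 h"
  shows "ess_spec a1 a2 \<alpha> \<tau> D = complex_of_real ` {(norm \<alpha>)\<^sup>2..} \<and>
    (\<alpha> \<noteq> 0 \<longrightarrow> mu1 a1 a2 \<alpha> \<tau> D < (norm \<alpha>)\<^sup>2 \<and>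
       (\<exists>r::real. r < (norm \<alpha>)\<^sup>2 \<and> complex_of_real r \<in> disc_spec a1 a2 \<alpha> \<tau> D))"
proof -
  interpret mx a1 a2 \<alpha> \<tau> h D by unfold_locales (use assms in auto)
  show ?thesis using disc_below_spec[OF upper_spec] mu1_below by blast
qed

end
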